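(* Let $G$ be a finitely generated virtually nilpotent group and $N\lhd G$ a normal subgroup of finite index which is a finitely generated torsion-free nilpotent group of nilpotency class $2$ and Hirsch length $3$. Put $Z=Z(N)$, $T=N/Z\cong\mathbb Z^2$, $P=G/N$, $F=\operatorname{Im}(P\to GL(T))$ and $k=[Z:[N,N]]$. Let $p$ be a prime with $p\nmid|P|$. Then $\zeta_{G_p}^{N_p,\lhd}(s)$ is given as follows. If $F\subset SL(T)$: (a) $F\cong C_1$: $\ \zeta_p(s)\zeta_p(s-1)\left(\dfrac{1-|k|_p^{s-2}}{1-p^{-s+2}}+|k|_p^{s-2}\zeta_p(3s-2)\right)$, which equals $\zeta_p(s)\zeta_p(s-1)\zeta_p(3s-2)$ if moreover $p\nmid k$; (b) $F\cong C_2$: $\ \zeta_p(s)\zeta_p(s-1)\left(\dfrac{1-|k|_p^{s}}{1-p^{-s}}+|k|_p^{s}\zeta_p(3s)\right)$, which equals $\zeta_p(s)\zeta_p(s-1)\zeta_p(3s)$ if $p\nmid k$; (c) $F\cong C_d$, $d\in\{3,4,6\}$: $\ \zeta_p(s)L_p(s,\chi_d)\left(\dfrac{1-|k|_p^{s}}{1-p^{-s}}+|k|_p^{s}\zeta_p(3s)\right)$, which equals $\zeta_p(s)L_p(s,\chi_d)\zeta_p(3s)$ if $p\nmid k$. If $F\not\subset SL(T)$: (d) $F\cong D_1$: $\ \zeta_p(s)^2\left(\dfrac{1-|k|_p^{s-1}}{1-p^{-s+1}}+|k|_p^{s-1}\zeta_p(3s-1)\right)$, which equals $\zeta_p(s)^2\zeta_p(3s-1)$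 if $p\nmid k$; (e) $F\cong D_2$: $\ \zeta_p(s)^2\left(\dfrac{1-|k|_p^{s}}{1-p^{-s}}+|k|_p^{s}\zeta_p(3s)\right)$, which equals $\zeta_p(s)^2\zeta_p(3s)$ if $p\nmid k$; (f) $F\cong D_d$, $d\in\{3,4,6\}$: $\ \zeta_p(2s)\left(\dfrac{1-|k|_p^{s}}{1-p^{-s}}+|k|_p^{s}\zeta_p(3s)\right)$, which equals $\zeta_p(2s)\zeta_p(3s)$ if $p\nmid k$. Therefore, if $p\nmid|P|\,[Z:[N,N]]$, then $\zeta_{G_p}^{N_p,\lhd}(s)$ satisfies the functional equation $$\zeta_{G_p}^{N_p,\lhd}(s)|_{p\to p^{-1}}=\begin{cases}(-1)^3p^{-5s+3}\,\zeta_{G_p}^{N_p,\lhd}(s)&\text{if }F\cong C_1,\\ (-1)^3p^{-5s+1}\,\zeta_{G_p}^{N_p,\lhd}(s)&\text{if }F\cong C_2\cong D_1\ (\text{whether or not }F\subset SL(T)),\\ (-1)^3\chi_d(p)p^{-5s}\,\zeta_{G_p}^{N_p,\lhd}(s)&\text{if }F\cong C_d,\ d\in\{3,4,6\},\\ (-1)^3p^{-5s}\,\zeta_{G_p}^{N_p,\lhd}(s)&\text{if }F\cong D_2,\\ p^{-5s}\,\zeta_{G_p}^{N_p,\lhd}(s)&\text{if }F\cong D_d,\ d\in\{3,4,6\}.\end{cases}$$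
   Context: For a prime $p$, $G_p$ is the completion of $G$ with respect to the family of normal subgroups $B\lhd G$ with $B\subseteq N$ and $[N:B]$ a power of $p$; $N_p$ is the closure of $N$ in $G_p$ (it is the pro-$p$ completion of $N$, and $G_p/N_p\cong G/N$). The partial zeta function is $\zeta_{G_p}^{N_p,\lhd}(s)=\sum_{B}[N_p:B]^{-s}$, the sum over normal subgroups $B\lhd G_p$ with $B\subseteq N_p$ of finite index. $P$ acts on $T$ via conjugation by $G$. $C_d$ is the cyclic group of order $d$ and $D_d$ the dihedral group of order $2d$ (so $D_1\cong C_2$, $D_2\cong C_2\times C_2$); $F$, being a finite subgroup of $GL(T)\cong GL_2(\mathbb Z)$, is of one of the listed types. $\zeta_p(s)=(1-p^{-s})^{-1}$; $|\cdot|_p$ is the $p$-adic norm with $|p|_p=p^{-1}$. For $d\in\{3,4,6\}$, $\chi_d(n)=1$ if $n\equiv1\pmod d$, $-1$ if $n\equiv-1\pmod d$, $0$ otherwise, and $L_p(s,\chi_d)=(1-\chi_d(p)p^{-s})^{-1}$. The operation $|_{p\to p^{-1}}$ means formally replacing $p$ by $p^{-1}$ and $p^{-s}$ by $p^{s}$ in the displayed rational expression in $p,p^{-s}$ (for $p\nmid|P|k$), leaving the value $\chi_d(p)=\pm1$ unchanged. *)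

theory Defs
  imports
    "HOL-Analysis.Analysis"
    "HOL-Algebra.Bij"
    "HOL-Algebra.Elementary_Groups"
    "HOL-Algebra.Generated_Groups"
    "HOL-Algebra.Product_Groups"
    "HOL-Computational_Algebra.Primes"
    "HOL-Number_Theory.Cong"
begin

section \<open>Group-theoretic notions\<close>

definition finitely_generated :: "('a, 'm) monoid_scheme \<Rightarrow> bool" where
  "finitely_generated G \<longleftrightarrow> (\<exists>S. finite S \<and> S \<subseteq> carrier G \<and> generate G S = carrier G)"

definition torsion_free :: "('a, 'm) monoid_scheme \<Rightarrow> bool" where
  "torsion_free G \<longleftrightarrow> (\<forall>x\<in>carrier G. \<forall>n::nat. n > 0 \<longrightarrow> x [^]\<^bsub>G\<^esub> n = \<one>\<^bsub>G\<^esub> \<longrightarrow> x = \<one>\<^bsub>G\<^esub>)"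

definition center_of :: "('a, 'm) monoid_scheme \<Rightarrow> 'a set" where
  "center_of G = {z \<in> carrier G. \<forall>x\<in>carrier G. z \<otimes>\<^bsub>G\<^esub> x = x \<otimes>\<^bsub>G\<^esub> z}"

text \<open>Indices are shifted by one from the usual \<open>\<gamma>\<^sub>1 = G\<close>, so that nilpotency class \<open>c\<close> means
  that \<open>c\<close> is the first index at which the series is trivial.\<close>

primrec lower_central :: "('a, 'm) monoid_scheme \<Rightarrow> nat \<Rightarrow> 'a set" where
  "lower_central G 0 = carrier G"
| "lower_central G (Suc i) =
     generate G (\<Union>x\<in>lower_central G i. \<Union>y\<in>carrier G.
       {x \<otimes>\<^bsub>G\<^esub> y \<otimes>\<^bsub>G\<^esub> inv\<^bsub>G\<^esub> x \<otimes>\<^bsub>G\<^esub> inv\<^bsub>G\<^esub> y})"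

definition nilpotent_group :: "('a, 'm) monoid_scheme \<Rightarrow> bool" where
  "nilpotent_group G \<longleftrightarrow> (\<exists>c. lower_central G c = {\<one>\<^bsub>G\<^esub>})"

definition has_nilpotency_class :: "('a, 'm) monoid_scheme \<Rightarrow> nat \<Rightarrow> bool" where
  "has_nilpotency_class G c \<longleftrightarrow>
     lower_central G c = {\<one>\<^bsub>G\<^esub>} \<and> (\<forall>i<c. lower_central G i \<noteq> {\<one>\<^bsub>G\<^esub>})"

definition virtually_nilpotent :: "('a, 'm) monoid_scheme \<Rightarrow> bool" where
  "virtually_nilpotent G \<longleftrightarrow>
     (\<exists>H. subgroup H G \<and> finite (rcosets\<^bsub>G\<^esub> H) \<and> nilpotent_group (G\<lparr>carrier := H\<rparr>))"

text \<open>The Hirsch length of a polycyclic group is the number of infinite factors in a subnormal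
  series with cyclic factors; it does not depend on the series.\<close>

definition has_hirsch_length :: "('a, 'm) monoid_scheme \<Rightarrow> nat \<Rightarrow> bool" where
  "has_hirsch_length G h \<longleftrightarrow>
     (\<exists>(n::nat) H. H 0 = {\<one>\<^bsub>G\<^esub>} \<and> H n = carrier G \<and>
        (\<forall>i<n. H i \<lhd> (G\<lparr>carrier := H (Suc i)\<rparr>) \<and>
               cyclic_group ((G\<lparr>carrier := H (Suc i)\<rparr>) Mod H i)) \<and>
        card {i. i < n \<and> infinite (carrier ((G\<lparr>carrier := H (Suc i)\<rparr>) Mod H i))} = h)"

text \<open>The dihedral group of order \<open>2d\<close>: \<open>(i, e)\<close> stands for \<open>\<rho>\<^sup>i \<sigma>\<^sup>e\<close> with \<open>\<rho>\<close> of order \<open>d\<close>,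
  \<open>\<sigma>\<close> of order 2 and \<open>\<sigma> \<rho> \<sigma> = \<rho>\<^sup>-\<^sup>1\<close>.\<close>

definition dihedral_group :: "nat \<Rightarrow> (int \<times> bool) monoid" where
  "dihedral_group d =
     \<lparr>carrier = {0..<int d} \<times> UNIV,
      monoid.mult = (\<lambda>(i, e) (j, f). ((if e then i - j else i + j) mod int d, e \<noteq> f)),
      one = (0, False)\<rparr>"


section \<open>The action of \<open>G/N\<close> on \<open>N/Z(N)\<close>\<close>

definition quot_by_center :: "('a, 'm) monoid_scheme \<Rightarrow> 'a set \<Rightarrow> 'a set monoid" where
  "quot_by_center G N = (G\<lparr>carrier := N\<rparr>) Mod center_of (G\<lparr>carrier := N\<rparr>)"

text \<open>The class \<open>C = gN\<close> sends \<open>xZ\<close> to \<open>gxg\<^sup>-\<^sup>1Z\<close>. When \<open>N/Z\<close> is abelian, \<open>N\<close> acts trivially on it, so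
  that every representative \<open>g \<in> C\<close> contributes the same coset to the union.\<close>

definition conj_action :: "('a, 'm) monoid_scheme \<Rightarrow> 'a set \<Rightarrow> 'a set \<Rightarrow> 'a set \<Rightarrow> 'a set" where
  "conj_action G N C =
     (\<lambda>X\<in>carrier (quot_by_center G N). \<Union>g\<in>C. \<Union>x\<in>X. {g \<otimes>\<^bsub>G\<^esub> x \<otimes>\<^bsub>G\<^esub> inv\<^bsub>G\<^esub> g})"

definition action_image :: "('a, 'm) monoid_scheme \<Rightarrow> 'a set \<Rightarrow> ('a set \<Rightarrow> 'a set) set" where
  "action_image G N = conj_action G N ` carrier (G Mod N)"

definition is_Z_basis :: "('a, 'm) monoid_scheme \<Rightarrow> 'a \<Rightarrow> 'a \<Rightarrow> bool" where
  "is_Z_basis T e1 e2 \<longleftrightarrow> e1 \<in> carrier T \<and> e2 \<in> carrier T \<and>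
     (\<forall>x\<in>carrier T. \<exists>!ab::int \<times> int. x = e1 [^]\<^bsub>T\<^esub> fst ab \<otimes>\<^bsub>T\<^esub> e2 [^]\<^bsub>T\<^esub> snd ab)"

text \<open>Automorphisms of determinant 1 of a group \<open>T\<close> free abelian of rank 2; the
  determinant does not depend on the basis used to compute it.\<close>

definition SL_of :: "('a, 'm) monoid_scheme \<Rightarrow> ('a \<Rightarrow> 'a) set" where
  "SL_of T = {\<phi> \<in> carrier (AutoGroup T). \<exists>e1 e2. \<exists>a b c d :: int. is_Z_basis T e1 e2 \<and>
     \<phi> e1 = e1 [^]\<^bsub>T\<^esub> a \<otimes>\<^bsub>T\<^esub> e2 [^]\<^bsub>T\<^esub> b \<and>
     \<phi> e2 = e1 [^]\<^bsub>T\<^esub> c \<otimes>\<^bsub>T\<^esub> e2 [^]\<^bsub>T\<^esub> d \<and>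
     a * d - b * c = 1}"


section \<open>Completions\<close>

definition completion_family :: "('a, 'm) monoid_scheme \<Rightarrow> 'a set \<Rightarrow> nat \<Rightarrow> 'a set set" where
  "completion_family G N p =
     {B. B \<lhd> G \<and> B \<subseteq> N \<and> (\<exists>m. card (rcosets\<^bsub>G\<lparr>carrier := N\<rparr>\<^esub> B) = p ^ m)}"

text \<open>The inverse limit of the quotients \<open>G/B\<close>. For \<open>B \<subseteq> C\<close> the transition map sends a coset of \<open>B\<close>
  to the unique coset of \<open>C\<close> containing it.\<close>

definition rel_completion ::
    "('a, 'm) monoid_scheme \<Rightarrow> 'a set \<Rightarrow> nat \<Rightarrow> ('a set \<Rightarrow> 'a set) monoid" where
  "rel_completion G N p =
     (product_group (completion_family G N p) (\<lambda>B. G Mod B))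
       \<lparr>carrier := {x \<in> (\<Pi>\<^sub>E B\<in>completion_family G N p. carrier (G Mod B)).
          \<forall>B\<in>completion_family G N p. \<forall>C\<in>completion_family G N p. B \<subseteq> C \<longrightarrow> x B \<subseteq> x C}\<rparr>"

definition completion_topology ::
    "('a, 'm) monoid_scheme \<Rightarrow> 'a set \<Rightarrow> nat \<Rightarrow> ('a set \<Rightarrow> 'a set) topology" where
  "completion_topology G N p =
     subtopology
       (product_topology (\<lambda>B. discrete_topology (carrier (G Mod B))) (completion_family G N p))
       (carrier (rel_completion G N p))"

definition completion_map ::
    "('a, 'm) monoid_scheme \<Rightarrow> 'a set \<Rightarrow> nat \<Rightarrow> 'a \<Rightarrow> 'a set \<Rightarrow> 'a set" where
  "completion_map G N p g = (\<lambda>B\<in>completion_family G N p. B #>\<^bsub>G\<^esub> g)"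

definition completion_closure ::
    "('a, 'm) monoid_scheme \<Rightarrow> 'a set \<Rightarrow> nat \<Rightarrow> ('a set \<Rightarrow> 'a set) set" where
  "completion_closure G N p =
     (completion_topology G N p) closure_of (completion_map G N p ` N)"


section \<open>Partial zeta functions\<close>

definition partial_zeta_domain :: "('a, 'm) monoid_scheme \<Rightarrow> 'a set \<Rightarrow> 'a set set" where
  "partial_zeta_domain H M =
     {B. B \<lhd> H \<and> B \<subseteq> M \<and> finite (rcosets\<^bsub>H\<lparr>carrier := M\<rparr>\<^esub> B)}"

definition partial_zeta_term :: "('a, 'm) monoid_scheme \<Rightarrow> 'a set \<Rightarrow> complex \<Rightarrow> 'a set \<Rightarrow> complex" where
  "partial_zeta_term H M s B = of_nat (card (rcosets\<^bsub>H\<lparr>carrier := M\<rparr>\<^esub> B)) powr (- s)"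

definition partial_zeta_converges :: "('a, 'm) monoid_scheme \<Rightarrow> 'a set \<Rightarrow> complex \<Rightarrow> bool" where
  "partial_zeta_converges H M s \<longleftrightarrow> partial_zeta_term H M s summable_on partial_zeta_domain H M"

definition partial_zeta :: "('a, 'm) monoid_scheme \<Rightarrow> 'a set \<Rightarrow> complex \<Rightarrow> complex" where
  "partial_zeta H M s = infsum (partial_zeta_term H M s) (partial_zeta_domain H M)"


section \<open>Local factors\<close>

text \<open>The prime is replaced by an arbitrary positive real \<open>q\<close>, so that the substitution \<open>p \<mapsto> p\<^sup>-\<^sup>1\<close>,
  \<open>p\<^sup>-\<^sup>s \<mapsto> p\<^sup>s\<close> in an expression \<open>E\<close> built from these factors amounts to passing from
  \<open>E p s\<close> to \<open>E (1/p) s\<close>: indeed \<open>(1/p)\<^sup>-\<^sup>s\<^sup>+\<^sup>b = (p\<^sup>-\<^sup>1)\<^sup>b p\<^sup>s\<close>. The value \<open>c\<close> of the character is a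
  separate argument, as the substitution leaves it unchanged.\<close>

definition zeta_loc :: "real \<Rightarrow> complex \<Rightarrow> complex" where
  "zeta_loc q s = inverse (1 - of_real q powr (- s))"

definition L_loc :: "complex \<Rightarrow> real \<Rightarrow> complex \<Rightarrow> complex" where
  "L_loc c q s = inverse (1 - c * of_real q powr (- s))"

definition chi :: "nat \<Rightarrow> nat \<Rightarrow> complex" where
  "chi d n = (if [int n = 1] (mod int d) then 1
              else if [int n = - 1] (mod int d) then - 1 else 0)"

definition padic_norm :: "nat \<Rightarrow> nat \<Rightarrow> real" where
  "padic_norm p n = (if n = 0 then 0 else inverse (real p ^ multiplicity p n))"

definition center_factor :: "nat \<Rightarrow> nat \<Rightarrow> complex \<Rightarrow> complex \<Rightarrow> complex" where
  "center_factor p k a s =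
     (1 - of_real (padic_norm p k) powr (s - a)) / (1 - of_nat p powr (- s + a))
     + of_real (padic_norm p k) powr (s - a) * zeta_loc (real p) (3 * s - a)"

text \<open>The expression \<open>E\<close> represents \<open>f\<close> on the half-plane \<open>Re s > \<sigma>\<close>, and the substitution
  \<open>p \<mapsto> p\<^sup>-\<^sup>1\<close> in \<open>E\<close> multiplies \<open>f\<close> by \<open>c\<close>; the last conjunct is the same identity for
  the meromorphic continuation of \<open>f\<close> provided by \<open>E\<close>.\<close>

definition local_functional_equation ::
    "nat \<Rightarrow> (complex \<Rightarrow> complex) \<Rightarrow> real \<Rightarrow> (real \<Rightarrow> complex \<Rightarrow> complex) \<Rightarrow> (complex \<Rightarrow> complex) \<Rightarrow> bool"
  where
  "local_functional_equation p f \<sigma> E c \<longleftrightarrow>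
     (\<forall>s. Re s > \<sigma> \<longrightarrow> f s = E (real p) s \<and> E (1 / real p) s = c s * f s) \<and>
     (\<forall>s. E (1 / real p) s = c s * E (real p) s)"

end

theory Submission
  imports Defs "HOL-Number_Theory.Residue_Primitive_Roots"
begin

text \<open>In suitable coordinates, \<open>N\<close> is a Heisenberg group with parameter \<open>\<kappa>\<close>, where
  \<open>\<bar>\<kappa>\<bar> = [Z : [N, N]]\<close>, and \<open>G\<close> acts on the plane \<open>N/Z\<close> by integral matrices and on \<open>Z\<close> by their
  determinants. The open normal subgroups of the completion inside \<open>N\<^sub>p\<close> correspond to the normal
  subgroups \<open>B\<close> of \<open>G\<close> of \<open>p\<close>-power index in \<open>N\<close>, and every normal subgroup of finite index is
  open. Such a \<open>B\<close> is described by its image \<open>L\<close> in the plane, an invariant lattice \<open>p ^ e L'\<close> with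
  \<open>L'\<close> of index \<open>p ^ a\<close> and cyclic quotient, by the exponent \<open>b\<close> with \<open>B \<inter> Z = Z ^ (p ^ b)\<close>, and by
  a function \<open>L \<rightarrow> \<int>/p\<^sup>b\<close> of which \<open>B\<close> is the graph. Closedness under commutators forces
  \<open>b \<le> v\<^sub>p(\<kappa>) + e\<close>. As \<open>p\<close> does not divide \<open>|G/N|\<close>, an equivariant function exists by averaging, so
  that these functions form a torsor under the homomorphisms \<open>L \<rightarrow> \<int>/p\<^sup>b\<close> equivariant for the
  determinant; their number is \<open>p ^ (r b)\<close> with \<open>r = 2, 1, 0\<close> depending on the type of the action.
  The invariant lattices with cyclic quotient correspond to eigenvectors modulo \<open>p ^ a\<close>, and by
  Hensel lifting their number is governed by the splitting of the characteristic polynomial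
  modulo \<open>p\<close>. Summing geometric series over \<open>e\<close>, \<open>a\<close>, \<open>b\<close> gives the local factors.\<close>

section \<open>Lattices in the plane\<close>

text \<open>The obstacle is the term \<open>\<kappa> * v n * u m\<close> in the multiplication of
  \<open>N\<close>: the central coordinate is not additive. The bound on \<open>b\<close> is exactly
  what removes it, because commutators of \<open>B\<close> with \<open>N\<close> force
  \<open>q ^ b\<close> to divide \<kappa> times every coordinate of a point of \<open>L\<close>.
  Over such an \<open>L\<close> the coordinate is additive modulo \<open>q ^ b\<close>, and counting
  subgroups becomes linear algebra.

  The shape of the local factors comes from the index \<open>p ^ (2 * e + a + b)\<close>. With
  \<open>X = p powr - s\<close>, exponents \<open>b\<close> below the valuation of \<kappa> occur
  for every \<open>e\<close> and give a finite geometric sum in \<open>p ^ r * X\<close>. Beyond it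
  each step in \<open>b\<close> costs a step in \<open>e\<close>, that is, a factor
  \<open>p ^ r * X ^ 3\<close>; this is the origin of the argument \<open>3 * s - r\<close>. The
  factor \<open>1 / (1 - X ^ 2)\<close> from the free \<open>e\<close> merges with the series
  counting lattices with cyclic quotient: two eigenlines give \<open>(1 + X) / (1 - X)\<close>,
  hence the square of a zeta factor, while no eigenline leaves \<open>zeta_loc p (2 * s)\<close>.
  Writing the finite sum as a quotient divides by \<open>1 - p powr (r - s)\<close>, so for
  \<open>r > 0\<close> the zeros of this denominator are set aside.\<close>

definition sm :: "int \<Rightarrow> int \<times> int \<Rightarrow> int \<times> int" where
  "sm i x = (i * fst x, i * snd x)"

definition wedge :: "int \<times> int \<Rightarrow> int \<times> int \<Rightarrow> int" where
  "wedge x y = fst x * snd y - snd x * fst y"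

definition primitive :: "int \<Rightarrow> int \<times> int \<Rightarrow> bool" where
  "primitive q w \<longleftrightarrow> \<not> (q dvd fst w \<and> q dvd snd w)"

text \<open>For \<open>q\<close> prime and \<open>w\<close> primitive, this is \<open>q ^ e\<close> times a lattice with cyclic quotient of
  order \<open>q ^ a\<close>; every lattice of \<open>q\<close>-power index has this form.\<close>

definition lat :: "int \<Rightarrow> nat \<Rightarrow> nat \<Rightarrow> int \<times> int \<Rightarrow> (int \<times> int) set" where
  "lat q e a w = {sm (q ^ e) x |x. q ^ a dvd wedge w x}"

definition add_subgroup :: "(int \<times> int) set \<Rightarrow> bool" where
  "add_subgroup L \<longleftrightarrow> 0 \<in> L \<and> (\<forall>x\<in>L. \<forall>y\<in>L. x - y \<in> L)"

lemma sm_simps [simp]: "fst (sm i x) = i * fst x" "snd (sm i x) = i * snd x"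
  by (auto simp: sm_def)

lemma wedge_simps [simp]:
  "wedge w (sm i x) = i * wedge w x" "wedge (sm i x) w = i * wedge x w"
  "wedge w (x + y) = wedge w x + wedge w y" "wedge w (x - y) = wedge w x - wedge w y"
  "wedge (x + y) w = wedge x w + wedge y w" "wedge (x - y) w = wedge x w - wedge y w"
  "wedge w 0 = 0" "wedge w w = 0"
  by (auto simp: wedge_def algebra_simps)

lemma wedge_anticommute: "wedge x y = - wedge y x"
  by (simp add: wedge_def)

lemma add_subgroup_add: "add_subgroup L \<Longrightarrow> x \<in> L \<Longrightarrow> y \<in> L \<Longrightarrow> x + y \<in> L"
  unfolding add_subgroup_def by (metis diff_0 diff_minus_eq_add)

lemma add_subgroup_sm:
  assumes "add_subgroup L" "x \<in> L" shows "sm i x \<in> L"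
proof -
  have nat: "sm (int n) x \<in> L" for n
  proof (induction n)
    case 0 then show ?case using assms by (simp add: add_subgroup_def sm_def zero_prod_def)
  next
    case (Suc n)
    have "sm (int (Suc n)) x = sm (int n) x + x" by (simp add: sm_def prod_eq_iff algebra_simps)
    then show ?case using add_subgroup_add[OF assms(1) Suc assms(2)] by simp
  qed
  show ?thesis
  proof (cases "i \<ge> 0")
    case True then show ?thesis using nat[of "nat i"] by simp
  next
    case False
    have "sm i x = 0 - sm (int (nat (- i))) x" using False by (simp add: sm_def prod_eq_iff)
    then show ?thesis using nat[of "nat (- i)"] assms(1) unfolding add_subgroup_def by metis
  qed
qed

text \<open>A coordinate of \<open>w\<close> not divisible by \<open>q\<close> is a unit modulo
  \<open>q ^ a\<close>; its inverse gives the coefficient \<open>i\<close>, and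
  \<open>wedge w x\<close> measures the error in the other coordinate.\<close>

lemma primitive_span:
  fixes q :: int
  assumes q: "prime q" and w: "primitive q w" and d: "q ^ a dvd wedge w x"
  obtains i y where "x = sm i w + sm (q ^ a) y"
proof -
  have "\<exists>i. q ^ a dvd fst x - i * fst w \<and> q ^ a dvd snd x - i * snd w"
  proof (cases "q dvd fst w")
    case False
    then have "coprime (q ^ a) (fst w)" using q by (simp add: prime_imp_coprime)
    then obtain s t where st: "s * q ^ a + t * fst w = 1"
      using bezout_int[of "q ^ a" "fst w"] by (auto simp: coprime_iff_gcd_eq_1)
    have "fst x - (t * fst x) * fst w = fst x * s * q ^ a"
      using arg_cong[OF st, of "\<lambda>r. fst x * r"] by (simp add: algebra_simps)
    moreover have "snd x - (t * fst x) * snd w = snd x * s * q ^ a + t * wedge w x"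
      using arg_cong[OF st, of "\<lambda>r. snd x * r"] by (simp add: wedge_def algebra_simps)
    ultimately show ?thesis using d by (intro exI[of _ "t * fst x"]) auto
  next
    case True
    then have "\<not> q dvd snd w" using w by (simp add: primitive_def)
    then have "coprime (q ^ a) (snd w)" using q by (simp add: prime_imp_coprime)
    then obtain s t where st: "s * q ^ a + t * snd w = 1"
      using bezout_int[of "q ^ a" "snd w"] by (auto simp: coprime_iff_gcd_eq_1)
    have "snd x - (t * snd x) * snd w = snd x * s * q ^ a"
      using arg_cong[OF st, of "\<lambda>r. snd x * r"] by (simp add: algebra_simps)
    moreover have "fst x - (t * snd x) * fst w = fst x * s * q ^ a - t * wedge w x"
      using arg_cong[OF st, of "\<lambda>r. fst x * r"] by (simp add: wedge_def algebra_simps)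
    ultimately show ?thesis using d by (intro exI[of _ "t * snd x"]) auto
  qed
  then obtain i y1 y2 where "fst x - i * fst w = q ^ a * y1" "snd x - i * snd w = q ^ a * y2"
    by (auto elim!: dvdE)
  then have "x = sm i w + sm (q ^ a) (y1, y2)" by (auto simp: prod_eq_iff sm_def algebra_simps)
  then show thesis by (rule that)
qed

lemma lat_iff: "q \<noteq> 0 \<Longrightarrow> sm (q ^ e) x \<in> lat q e a w \<longleftrightarrow> q ^ a dvd wedge w x"
  by (auto simp: lat_def sm_def)

text \<open>Modulo \<open>q ^ a\<close> the vector \<open>x\<close> is a multiple of
  \<open>w\<close>, so vanishing of \<open>wedge w y\<close> passes to \<open>wedge x y\<close>. A
  lattice therefore depends only on the point that \<open>w\<close> defines on the projective line
  modulo \<open>q ^ a\<close>.\<close>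

lemma wedge_trans:
  fixes q :: int
  assumes q: "prime q" and w: "primitive q w" and "q ^ a dvd wedge w x" "q ^ a dvd wedge w y"
  shows "q ^ a dvd wedge x y"
proof -
  obtain i x' where x: "x = sm i w + sm (q ^ a) x'" using primitive_span[OF q w assms(3)] .
  show ?thesis unfolding x using assms(4) by simp
qed

lemma lat_eqI:
  fixes q :: int
  assumes "prime q" "primitive q w" "primitive q w'" "q ^ a dvd wedge w w'"
  shows "lat q e a w = lat q e a w'"
proof -
  have "q ^ a dvd wedge w' w" using assms(4) by (subst wedge_anticommute) simp
  then have "q ^ a dvd wedge w x \<longleftrightarrow> q ^ a dvd wedge w' x" for x
    using wedge_trans[OF assms(1,2,4)] wedge_trans[OF assms(1,3), of a w x] by blast
  then show ?thesis by (simp add: lat_def)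
qed

lemma lat_add_subgroup: "add_subgroup (lat q e a w)"
  unfolding add_subgroup_def
proof (intro conjI ballI)
  have "0 = sm (q ^ e) 0" by (simp add: sm_def zero_prod_def)
  then show "0 \<in> lat q e a w" unfolding lat_def using dvd_0_right wedge_simps(7) by fastforce
next
  fix x y assume "x \<in> lat q e a w" "y \<in> lat q e a w"
  then obtain x' y' where "x = sm (q ^ e) x'" "y = sm (q ^ e) y'"
    "q ^ a dvd wedge w x'" "q ^ a dvd wedge w y'" by (auto simp: lat_def)
  moreover have "sm (q ^ e) x' - sm (q ^ e) y' = sm (q ^ e) (x' - y')"
    by (simp add: sm_def prod_eq_iff algebra_simps)
  ultimately show "x - y \<in> lat q e a w" unfolding lat_def
    by (auto intro!: exI[of _ "x' - y'"] simp del: split_paired_Ex)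
qed

text \<open>All parameters are read off from test vectors: \<open>q ^ e\<close> times the primitive
  \<open>w\<close> shows the power dividing the whole lattice, \<open>q ^ a\<close> times the unit
  vectors bounds the other exponent, and \<open>w\<close> itself compares the directions.\<close>

lemma lat_inj:
  fixes q :: int
  assumes q: "prime q" and w: "primitive q w" "primitive q w'"
    and eq: "lat q e a w = lat q e' a' w'"
  shows "e = e'" "a = a'" "q ^ a dvd wedge w w'"
proof -
  have q0: "q \<noteq> 0" "\<not> is_unit q" using q by auto
  have le: "e \<le> e'" if w: "primitive q w'" and eq: "lat q e a w = lat q e' a' w'" for e e' a a' w w'
  proof (rule ccontr)
    assume "\<not> e \<le> e'"
    then obtain f where f: "e = e' + Suc f" by (metis add_Suc_right less_imp_Suc_add not_le)
    have "sm (q ^ e') w' \<in> lat q e a w" unfolding eq using q0 by (simp add: lat_iff)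
    then obtain x where x: "sm (q ^ e') w' = sm (q ^ e) x" by (auto simp: lat_def)
    then have "q ^ e' * fst w' = q ^ e * fst x" "q ^ e' * snd w' = q ^ e * snd x"
      by (auto simp: sm_def)
    then have "fst w' = q * (q ^ f * fst x)" "snd w' = q * (q ^ f * snd x)" using q0
      by (auto simp: f power_add)
    then show False using w unfolding primitive_def by (metis dvd_triv_left)
  qed
  show e: "e = e'" using le[OF w(2) eq] le[OF w(1) eq[symmetric]] by simp
  have iff: "q ^ a dvd wedge w x \<longleftrightarrow> q ^ a' dvd wedge w' x" for x
    using lat_iff[OF q0(1), of e x a w] lat_iff[OF q0(1), of e x a' w'] eq e by simp
  have le: "a' \<le> a" if w: "primitive q w'" and iff: "\<And>x. q ^ a dvd wedge w x \<longleftrightarrow> q ^ a' dvd wedge w' x"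
    for a a' w w'
  proof -
    have "q ^ a dvd wedge w (q ^ a, 0)" "q ^ a dvd wedge w (0, q ^ a)" by (auto simp: wedge_def)
    then have *: "q ^ a' dvd q ^ a * snd w'" "q ^ a' dvd q ^ a * fst w'"
      unfolding iff by (auto simp: wedge_def mult.commute)
    show ?thesis
    proof (rule ccontr)
      assume "\<not> a' \<le> a"
      then obtain f where f: "a' = a + Suc f" by (metis add_Suc_right less_imp_Suc_add not_le)
      have "q ^ a * q dvd q ^ a'" by (simp add: f power_add)
      then have "q ^ a * q dvd q ^ a * snd w'" "q ^ a * q dvd q ^ a * fst w'"
        using * dvd_trans by blast+
      then have "q dvd snd w'" "q dvd fst w'" using q0 by (simp_all del: mult.commute)
      then show False using w by (simp add: primitive_def)
    qed
  qed
  show "a = a'" using le[OF w(2) iff] le[OF w(1) iff[symmetric]] by simp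
  then have "q ^ a dvd wedge w' w" using iff[of w] by simp
  then show "q ^ a dvd wedge w w'" by (subst wedge_anticommute) simp
qed

text \<open>The exponent \<open>e\<close> is the largest with \<open>q ^ e\<close> dividing all of
  \<open>L\<close>, so the rescaled lattice \<open>M\<close> contains a primitive \<open>w\<close>;
  \<open>a\<close> is the least exponent for which \<open>M\<close> contains \<open>q ^ a\<close>
  times the plane.\<close>

lemma sublattice_classification:
  fixes q :: int
  assumes q: "prime q" and L: "add_subgroup L" and n: "(q ^ n, 0) \<in> L" "(0, q ^ n) \<in> L"
  obtains e a w where "primitive q w" "L = lat q e a w"
proof -
  have q0: "q \<noteq> 0" "\<not> is_unit q" using q by auto
  have q2: "q \<ge> 2" using q by (simp add: prime_ge_2_int)
  define P where "P = (\<lambda>e. \<forall>x\<in>L. q ^ e dvd fst x \<and> q ^ e dvd snd x)"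
  have P0: "P 0" by (simp add: P_def)
  have Pn: "e \<le> n" if "P e" for e
  proof -
    have "q ^ e dvd q ^ n" using n(1) that by (force simp: P_def)
    then show ?thesis using q0 by (simp add: dvd_power_iff)
  qed
  obtain e where e: "P e" "\<And>f. P f \<Longrightarrow> f \<le> e"
    using GreatestI_nat[of P 0 n] Greatest_le_nat[of P _ n] P0 Pn by blast
  define M where "M = {x. sm (q ^ e) x \<in> L}"
  have M: "add_subgroup M"
  proof -
    have "sm (q ^ e) 0 = 0" "sm (q ^ e) (x - y) = sm (q ^ e) x - sm (q ^ e) y" for x y
      by (auto simp: sm_def prod_eq_iff algebra_simps)
    then show ?thesis using L by (simp add: M_def add_subgroup_def)
  qed
  have LM: "L = sm (q ^ e) ` M"
  proof
    show "L \<subseteq> sm (q ^ e) ` M"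
    proof
      fix x assume x: "x \<in> L"
      then obtain y1 y2 where y: "fst x = q ^ e * y1" "snd x = q ^ e * y2"
        using e(1) unfolding P_def by (meson dvdE)
      then have "x = sm (q ^ e) (y1, y2)" by (simp add: sm_def prod_eq_iff)
      then show "x \<in> sm (q ^ e) ` M" using x by (auto simp: M_def)
    qed
  qed (auto simp: M_def)
  have "\<exists>w\<in>M. primitive q w"
  proof (rule ccontr)
    assume "\<not> (\<exists>w\<in>M. primitive q w)"
    then have "P (Suc e)" unfolding P_def LM by (auto simp: primitive_def mult_ac)
    then show False using e(2) by fastforce
  qed
  then obtain w where w: "w \<in> M" "primitive q w" by blast
  define A where "A = (\<lambda>a. (q ^ a, 0) \<in> M \<and> (0, q ^ a) \<in> M)"
  have "A n"
    using add_subgroup_sm[OF L n(1), of "q ^ e"] add_subgroup_sm[OF L n(2), of "q ^ e"]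
    by (simp add: A_def M_def sm_def mult.commute)
  define a where "a = (LEAST a. A a)"
  have a: "A a" "\<And>b. A b \<Longrightarrow> a \<le> b" using LeastI[of A, OF \<open>A n\<close>] Least_le[of A] by (auto simp: a_def)
  have qa: "sm (q ^ a) y \<in> M" for y
  proof -
    have "sm (q ^ a) y = sm (fst y) (q ^ a, 0) + sm (snd y) (0, q ^ a)"
      by (simp add: sm_def prod_eq_iff mult.commute)
    then show ?thesis using add_subgroup_add[OF M] add_subgroup_sm[OF M] a(1) by (simp add: A_def)
  qed
  have "M = {x. q ^ a dvd wedge w x}"
  proof (intro subset_antisym subsetI CollectI)
    fix z assume "z \<in> M"
    then obtain x y where z: "z = (x, y)" and xy: "(x, y) \<in> M" by (cases z) auto
    \<comment> \<open>Cramer's rule: \<open>w\<close> and \<open>z\<close> combine to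
      \<open>d\<close> times each unit vector. The gcd of \<open>d\<close> and \<open>q ^ a\<close>
      is a power of \<open>q\<close> that again satisfies \<open>A\<close>, and minimality of
      \<open>a\<close> makes it equal to \<open>q ^ a\<close>.\<close>
    define d where "d = wedge w (x, y)"
    have d1: "(d, 0) \<in> M"
    proof -
      have "(d, 0) = sm y w - sm (snd w) (x, y)" by (simp add: d_def wedge_def sm_def prod_eq_iff)
      then show ?thesis using M add_subgroup_sm[OF M] xy w(1) by (simp add: add_subgroup_def)
    qed
    have d2: "(0, d) \<in> M"
    proof -
      have "(0, d) = sm (fst w) (x, y) - sm x w" by (simp add: d_def wedge_def sm_def prod_eq_iff)
      then show ?thesis using M add_subgroup_sm[OF M] xy w(1) by (simp add: add_subgroup_def)
    qed
    have "gcd d (q ^ a) dvd q ^ a" by simp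
    then obtain j where j: "j \<le> a" "gcd d (q ^ a) = q ^ j"
      using divides_primepow[OF q, of "gcd d (q ^ a)" a] by auto
    obtain s t where st: "s * d + t * q ^ a = q ^ j" using bezout_int j(2) by metis
    have "(q ^ j, 0) = sm s (d, 0) + sm t (q ^ a, 0)" "(0, q ^ j) = sm s (0, d) + sm t (0, q ^ a)"
      using st by (auto simp: sm_def)
    then have "A j" using add_subgroup_add[OF M] add_subgroup_sm[OF M] d1 d2 a(1) by (simp add: A_def)
    then have "j = a" using a(2) j(1) by fastforce
    then show "q ^ a dvd wedge w z" using j(2) by (metis d_def z gcd_dvd1)
  next
    fix x assume "x \<in> {x. q ^ a dvd wedge w x}" then have "q ^ a dvd wedge w x" by simp
    then obtain i z where "x = sm i w + sm (q ^ a) z" using primitive_span[OF q w(2)] by metis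
    then show "x \<in> M" using add_subgroup_add[OF M] add_subgroup_sm[OF M] qa w(1) by simp
  qed
  then have "L = lat q e a w" unfolding LM lat_def by blast
  then show thesis using that w(2) by blast
qed

section \<open>Integral two-by-two matrices\<close>

type_synonym mat2 = "int \<times> int \<times> int \<times> int"

definition mv :: "mat2 \<Rightarrow> int \<times> int \<Rightarrow> int \<times> int" where
  "mv A x = (case A of (a, b, c, d) \<Rightarrow> (a * fst x + b * snd x, c * fst x + d * snd x))"

definition mm :: "mat2 \<Rightarrow> mat2 \<Rightarrow> mat2" where
  "mm A B = (case A of (a, b, c, d) \<Rightarrow> case B of (a', b', c', d') \<Rightarrow>
     (a * a' + b * c', a * b' + b * d', c * a' + d * c', c * b' + d * d'))"

text \<open>The polynomial \<open>i + j * A\<close> in the matrix. By Cayley-Hamilton every power of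
  \<open>A\<close> has this form, and an eigenline of \<open>A\<close> is one of
  \<open>lin i j A\<close>.\<close>

definition lin :: "int \<Rightarrow> int \<Rightarrow> mat2 \<Rightarrow> mat2" where
  "lin i j A = (case A of (a, b, c, d) \<Rightarrow> (i + j * a, j * b, j * c, i + j * d))"

definition det2 :: "mat2 \<Rightarrow> int" where
  "det2 A = (case A of (a, b, c, d) \<Rightarrow> a * d - b * c)"

definition tr2 :: "mat2 \<Rightarrow> int" where
  "tr2 A = (case A of (a, b, c, d) \<Rightarrow> a + d)"

abbreviation id2 :: mat2 where "id2 \<equiv> (1, 0, 0, 1)"

abbreviation neg2 :: mat2 where "neg2 \<equiv> (- 1, 0, 0, - 1)"

lemma mv_mm: "mv (mm A B) x = mv A (mv B x)"
  by (cases A; cases B) (simp add: mv_def mm_def algebra_simps)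

lemma mv_linear: "mv A (x + y) = mv A x + mv A y" "mv A (x - y) = mv A x - mv A y"
  "mv A (sm i x) = sm i (mv A x)" "mv A 0 = 0"
  by (cases A; cases x; cases y; simp add: mv_def sm_def zero_prod_def algebra_simps)+

lemma mv_id2 [simp]: "mv id2 x = x"
  by (simp add: mv_def)

lemma mv_neg2 [simp]: "mv neg2 x = - x"
  by (simp add: mv_def prod_eq_iff)

lemma mm_id2 [simp]: "mm id2 A = A" "mm A id2 = A"
  by (cases A; simp add: mm_def)+

lemma mm_assoc: "mm (mm A B) C = mm A (mm B C)"
  by (cases A; cases B; cases C) (simp add: mm_def algebra_simps)

lemma det2_mm: "det2 (mm A B) = det2 A * det2 B"
  by (cases A; cases B) (simp add: mm_def det2_def algebra_simps)

lemma det2_id2 [simp]: "det2 id2 = 1"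
  by (simp add: det2_def)

lemma wedge_mv: "wedge (mv A x) (mv A y) = det2 A * wedge x y"
  by (cases A) (simp add: mv_def wedge_def det2_def algebra_simps)

lemma mv_lin: "mv (lin i j A) x = sm i x + sm j (mv A x)"
  by (cases A; cases x) (simp add: mv_def lin_def sm_def algebra_simps)

lemma cayley_hamilton: "mm A A = lin (- det2 A) (tr2 A) A"
  by (cases A) (simp add: mm_def lin_def det2_def tr2_def algebra_simps)

lemma cayley_hamilton_mv: "mv A (mv A x) = sm (tr2 A) (mv A x) - sm (det2 A) x"
proof -
  have "mv A (mv A x) = mv (lin (- det2 A) (tr2 A) A) x" by (metis mv_mm cayley_hamilton)
  then show ?thesis by (simp add: mv_lin prod_eq_iff)
qed

lemma mv_inject: "(\<And>x. mv A x = mv B x) \<Longrightarrow> A = B"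
proof -
  assume *: "\<And>x. mv A x = mv B x"
  show ?thesis using *[of "(1, 0)"] *[of "(0, 1)"] by (cases A; cases B) (simp add: mv_def)
qed

definition inv_lats :: "int \<Rightarrow> mat2 set \<Rightarrow> nat \<Rightarrow> nat \<Rightarrow> (int \<times> int) set set" where
  "inv_lats q S e a =
     {lat q e a w |w. primitive q w \<and> (\<forall>A\<in>S. q ^ a dvd wedge w (mv A w))}"

text \<open>Up to the factor \<open>q ^ e\<close> the lattice consists of the multiples of
  \<open>w\<close> modulo \<open>q ^ a\<close>. Invariance has to be tested on \<open>w\<close>
  only, where it says that \<open>w\<close> is an eigenvector modulo \<open>q ^ a\<close>.\<close>

lemma lat_invariant_iff:
  fixes q :: int
  assumes q: "prime q" and w: "primitive q w"
  shows "(\<forall>x\<in>lat q e a w. mv A x \<in> lat q e a w) \<longleftrightarrow> q ^ a dvd wedge w (mv A w)" (is "?L \<longleftrightarrow> ?R")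
proof
  have q0: "q \<noteq> 0" using q by auto
  {
    assume ?L
    moreover have "sm (q ^ e) w \<in> lat q e a w" using q0 by (simp add: lat_iff)
    ultimately have "sm (q ^ e) (mv A w) \<in> lat q e a w" by (metis mv_linear(3))
    then show ?R using q0 by (simp add: lat_iff)
  }
  {
    assume R: ?R
    show ?L
    proof
      fix x assume "x \<in> lat q e a w"
      then obtain y where y: "x = sm (q ^ e) y" "q ^ a dvd wedge w y" by (auto simp: lat_def)
      obtain i z where z: "y = sm i w + sm (q ^ a) z" using primitive_span[OF q w y(2)] .
      have "q ^ a dvd wedge w (mv A y)" using R by (simp add: z mv_linear)
      then show "mv A x \<in> lat q e a w" using q0 by (simp add: y(1) mv_linear lat_iff)
    qed
  }
qed

lemma card_inv_lats_0: "prime (q::int) \<Longrightarrow> card (inv_lats q S e 0) = 1"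
proof -
  assume q: "prime q"
  then have p: "primitive q (1, 0)" by (auto simp: primitive_def)
  have "lat q e 0 w = lat q e 0 (1, 0)" if "primitive q w" for w
    using lat_eqI[OF q that p] by simp
  moreover have "lat q e 0 (1, 0) \<in> inv_lats q S e 0"
    unfolding inv_lats_def mem_Collect_eq using p by (metis one_dvd power_0)
  ultimately have "inv_lats q S e 0 = {lat q e 0 (1, 0)}"
    unfolding inv_lats_def by blast
  then show ?thesis by simp
qed

lemma inv_lats_empty:
  fixes q :: int
  assumes "\<And>w. primitive q w \<Longrightarrow> \<exists>A\<in>S. \<not> q dvd wedge w (mv A w)" "a > 0"
  shows "inv_lats q S e a = {}"
proof (rule ccontr)
  assume "inv_lats q S e a \<noteq> {}"
  then obtain w where w: "primitive q w" "\<forall>A\<in>S. q ^ a dvd wedge w (mv A w)"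
    unfolding inv_lats_def by auto
  obtain A where "A \<in> S" "\<not> q dvd wedge w (mv A w)" using assms(1)[OF w(1)] by blast
  moreover have "q dvd q ^ a" using assms(2) by (simp add: dvd_power)
  ultimately show False using w(2) dvd_trans by blast
qed

text \<open>When every line is invariant, the count is that of the points of the projective line
  modulo \<open>p ^ a\<close>. They are represented by \<open>(1, c)\<close> and
  \<open>(q * c, 1)\<close>; in the second chart only \<open>c\<close> modulo
  \<open>q ^ (a - 1)\<close> matters.\<close>

lemma card_inv_lats_scalar:
  assumes p: "prime p" and S: "\<And>A w. A \<in> S \<Longrightarrow> wedge w (mv A w) = 0" and a: "a > 0"
  shows "card (inv_lats (int p) S e a) = p ^ a + p ^ (a - 1)"
proof -
  define q where "q = int p"
  have q: "prime q" using p by (simp add: q_def)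
  have q2: "q \<ge> 2" using q by (simp add: prime_ge_2_int)
  obtain b where b: "a = Suc b" using a gr0_implies_Suc by blast
  define f where "f = (\<lambda>c. lat q e a (1, c))"
  define g where "g = (\<lambda>c. lat q e a (q * c, 1))"
  have prim: "primitive q (1, c)" "primitive q (c, 1)" for c using q by (auto simp: primitive_def)
  have mod_eq: "c = c'" if "0 \<le> c" "c < q ^ n" "0 \<le> c'" "c' < q ^ n" "q ^ n dvd c' - c" for c c' n
    using that by (metis mod_eq_dvd_iff mod_pos_pos_trivial)
  have injf: "inj_on f {0..<q ^ a}"
  proof (rule inj_onI)
    fix c c' assume c: "c \<in> {0..<q ^ a}" "c' \<in> {0..<q ^ a}" "f c = f c'"
    then have "q ^ a dvd c' - c"
      using lat_inj(3)[OF q prim(1) prim(1), of e a c e a c'] by (simp add: f_def wedge_def)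
    then show "c = c'" using c mod_eq by auto
  qed
  have injg: "inj_on g {0..<q ^ b}"
  proof (rule inj_onI)
    fix c c' assume c: "c \<in> {0..<q ^ b}" "c' \<in> {0..<q ^ b}" "g c = g c'"
    then have "q ^ a dvd q * c' - q * c"
      using lat_inj(3)[OF q prim(2) prim(2), of e a "q * c'" e a "q * c"] by (simp add: g_def wedge_def)
    then have "q * q ^ b dvd q * (c' - c)" by (simp add: b algebra_simps)
    then have "q ^ b dvd c' - c" using q2 by simp
    then show "c = c'" using c mod_eq by auto
  qed
  have disj: "f ` {0..<q ^ a} \<inter> g ` {0..<q ^ b} = {}"
  proof (rule ccontr)
    assume "f ` {0..<q ^ a} \<inter> g ` {0..<q ^ b} \<noteq> {}"
    then obtain c c' where "f c = g c'" by blast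
    then have "q ^ a dvd 1 - c * (q * c')"
      using lat_inj(3)[OF q prim(1) prim(2), of e a c e a "q * c'"] by (simp add: f_def g_def wedge_def)
    then have "q dvd 1 - q * (c * c')" by (simp add: b dvd_mult_left mult_ac)
    then have "q dvd 1" by (metis dvd_add_times_triv_left_iff diff_add_cancel dvd_triv_left dvd_diff_right_iff dvd_diff_commute)
    then show False using q2 by (simp add: zdvd1_eq)
  qed
  have "inv_lats q S e a = f ` {0..<q ^ a} \<union> g ` {0..<q ^ b}"
  proof
    show "inv_lats q S e a \<subseteq> f ` {0..<q ^ a} \<union> g ` {0..<q ^ b}"
    proof
      fix X assume "X \<in> inv_lats q S e a"
      then obtain w where w: "primitive q w" and X: "X = lat q e a w" by (auto simp: inv_lats_def)
      have "coprime (fst w) (q ^ a) \<or> coprime (snd w) (q ^ a)"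
        using w q unfolding primitive_def by (metis coprime_commute coprime_power_left_iff prime_imp_coprime)
      then consider "coprime (fst w) (q ^ a)" | "q dvd fst w" "coprime (snd w) (q ^ a)"
        using q by (metis coprime_commute coprime_power_left_iff prime_imp_coprime)
      then show "X \<in> f ` {0..<q ^ a} \<union> g ` {0..<q ^ b}"
      proof cases
        case 1
        then obtain j where j: "[fst w * j = 1] (mod q ^ a)" using cong_solve_coprime_int by blast
        define c where "c = (j * snd w) mod q ^ a"
        have "[wedge w (1, c) = fst w * j * snd w - snd w] (mod q ^ a)"
        proof -
          have "[fst w * c = fst w * (j * snd w)] (mod q ^ a)"
            unfolding c_def by (intro cong_mult cong_refl) simp
          from cong_diff[OF this cong_refl[of "snd w"]] show ?thesis by (simp add: wedge_def mult_ac)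
        qed
        moreover have "[fst w * j * snd w - snd w = 1 * snd w - snd w] (mod q ^ a)"
          using j by (intro cong_diff cong_mult cong_refl)
        ultimately have "[wedge w (1, c) = 0] (mod q ^ a)" by (metis cong_trans diff_self mult_1)
        then have "q ^ a dvd wedge w (1, c)" by (simp add: cong_0_iff)
        then have "X = f c" unfolding X f_def by (rule lat_eqI[OF q w prim(1)])
        then show ?thesis using q2 by (auto simp: c_def)
      next
        case 2
        then obtain j where j: "[snd w * j = 1] (mod q ^ a)" using cong_solve_coprime_int by blast
        obtain w1 where w1: "fst w = q * w1" using 2 by blast
        define c where "c = (j * w1) mod q ^ b"
        have "q ^ b dvd snd w * c - w1"
        proof -
          have "[snd w * c = snd w * j * w1] (mod q ^ b)"
            unfolding c_def by (simp add: cong_def mod_simps mult_ac)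
          moreover have "[snd w * j * w1 = 1 * w1] (mod q ^ b)"
          proof (intro cong_mult cong_refl)
            have "q ^ b dvd q ^ a" by (simp add: b)
            then show "[snd w * j = 1] (mod q ^ b)" using j cong_dvd_modulus by blast
          qed
          ultimately show ?thesis by (metis cong_iff_dvd_diff cong_trans mult_1)
        qed
        then have "q * q ^ b dvd q * (snd w * c - w1)" by simp
        moreover have "wedge w (q * c, 1) = - (q * (snd w * c - w1))" by (simp add: wedge_def w1 algebra_simps)
        ultimately have "q ^ a dvd wedge w (q * c, 1)" by (simp add: b)
        then have "X = g c" unfolding X g_def by (rule lat_eqI[OF q w prim(2)])
        then show ?thesis using q2 by (auto simp: c_def)
      qed
    qed
    show "f ` {0..<q ^ a} \<union> g ` {0..<q ^ b} \<subseteq> inv_lats q S e a"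
      unfolding inv_lats_def f_def g_def using prim S by fastforce
  qed
  then have "card (inv_lats q S e a) = card (f ` {0..<q ^ a}) + card (g ` {0..<q ^ b})"
    using disj by (simp add: card_Un_disjoint)
  then show ?thesis using injf injg by (simp add: card_image q_def b nat_power_eq nat_mult_distrib)
qed

lemma primitive_dvd:
  fixes q :: int
  assumes q: "prime q" and w: "primitive q w" and "q ^ a dvd f * fst w" "q ^ a dvd f * snd w"
  shows "q ^ a dvd f"
proof -
  have "coprime (q ^ a) (fst w) \<or> coprime (q ^ a) (snd w)"
    using w q unfolding primitive_def by (metis coprime_power_left_iff prime_imp_coprime)
  then show ?thesis using assms(3,4) by (metis coprime_dvd_mult_left_iff)
qed

section \<open>Eigenvectors modulo prime powers\<close>

definition eigen :: "int \<Rightarrow> nat \<Rightarrow> mat2 \<Rightarrow> int \<Rightarrow> int \<times> int \<Rightarrow> bool" where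
  "eigen q a A r w \<longleftrightarrow> q ^ a dvd fst (mv A w) - r * fst w \<and> q ^ a dvd snd (mv A w) - r * snd w"

lemma eigen_wedge: "eigen q a A r w \<Longrightarrow> q ^ a dvd wedge w (mv A w)"
proof -
  assume "eigen q a A r w"
  then have "q ^ a dvd fst w * (snd (mv A w) - r * snd w) - snd w * (fst (mv A w) - r * fst w)"
    unfolding eigen_def by (metis dvd_diff dvd_mult)
  then show ?thesis by (simp add: wedge_def algebra_simps)
qed

lemma wedge_eigen:
  fixes q :: int
  assumes "prime q" "primitive q w" "q ^ a dvd wedge w (mv A w)"
  obtains r where "eigen q a A r w"
proof -
  obtain i y where "mv A w = sm i w + sm (q ^ a) y" using primitive_span[OF assms] .
  then have "eigen q a A i w" by (simp add: eigen_def)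
  then show thesis by (rule that)
qed

text \<open>Multiplying the congruence for \<open>A - r\<close> by the adjugate matrix turns it into
  \<open>det (A - r)\<close> times \<open>w\<close>, and a primitive vector can be
  cancelled.\<close>

lemma eigen_root:
  fixes q :: int
  assumes q: "prime q" and w: "primitive q w" and e: "eigen q a A r w"
  shows "q ^ a dvd r ^ 2 - tr2 A * r + det2 A"
proof -
  obtain A1 A2 A3 A4 where A: "A = (A1, A2, A3, A4)" by (cases A)
  obtain x y where xy: "w = (x, y)" by (cases w)
  have d: "q ^ a dvd A1 * x + A2 * y - r * x" "q ^ a dvd A3 * x + A4 * y - r * y"
    using e unfolding eigen_def mv_def A xy by auto
  have eq: "(r ^ 2 - tr2 A * r + det2 A) * x
      = (A4 - r) * (A1 * x + A2 * y - r * x) - A2 * (A3 * x + A4 * y - r * y)"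
    "(r ^ 2 - tr2 A * r + det2 A) * y
      = (A1 - r) * (A3 * x + A4 * y - r * y) - A3 * (A1 * x + A2 * y - r * x)"
    unfolding A tr2_def det2_def by (simp_all add: power2_eq_square algebra_simps)
  have "q ^ a dvd (r ^ 2 - tr2 A * r + det2 A) * x" "q ^ a dvd (r ^ 2 - tr2 A * r + det2 A) * y"
    using dvd_diff[OF dvd_mult[OF d(1), of "A4 - r"] dvd_mult[OF d(2), of A2]]
      dvd_diff[OF dvd_mult[OF d(2), of "A1 - r"] dvd_mult[OF d(1), of A3]] unfolding eq by blast+
  then show ?thesis using primitive_dvd[OF q w] unfolding xy fst_conv snd_conv by blast
qed

text \<open>Up to sign, the candidates are the columns of the adjugate of \<open>A - r\<close>,
  which are eigenvectors because \<open>r\<close> is a root. If neither is primitive,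
  \<open>A\<close> is scalar modulo \<open>q\<close> and its discriminant vanishes there.\<close>

lemma eigen_exists:
  fixes q :: int
  assumes q: "prime q" and disc: "\<not> q dvd (tr2 A)\<^sup>2 - 4 * det2 A"
    and r: "q ^ a dvd r ^ 2 - tr2 A * r + det2 A" and a: "a > 0"
  obtains w where "primitive q w" "eigen q a A r w"
proof -
  obtain A1 A2 A3 A4 where A: "A = (A1, A2, A3, A4)" by (cases A)
  have r': "q ^ a dvd r ^ 2 - (A1 + A4) * r + (A1 * A4 - A2 * A3)"
    using r unfolding A tr2_def det2_def by simp
  have "eigen q a A r (r - A4, A3)"
  proof -
    have "A1 * (r - A4) + A2 * A3 - r * (r - A4) = - (r ^ 2 - (A1 + A4) * r + (A1 * A4 - A2 * A3))"
      by (simp add: power2_eq_square algebra_simps)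
    then have "q ^ a dvd A1 * (r - A4) + A2 * A3 - r * (r - A4)" using r' by (simp only: dvd_minus_iff)
    moreover have "A3 * (r - A4) + A4 * A3 - r * A3 = 0" by (simp add: algebra_simps)
    ultimately show ?thesis unfolding eigen_def mv_def A by simp
  qed
  moreover have "eigen q a A r (A2, r - A1)"
  proof -
    have "A3 * A2 + A4 * (r - A1) - r * (r - A1) = - (r ^ 2 - (A1 + A4) * r + (A1 * A4 - A2 * A3))"
      by (simp add: power2_eq_square algebra_simps)
    then have "q ^ a dvd A3 * A2 + A4 * (r - A1) - r * (r - A1)" using r' by (simp only: dvd_minus_iff)
    moreover have "A1 * A2 + A2 * (r - A1) - r * A2 = 0" by (simp add: algebra_simps)
    ultimately show ?thesis unfolding eigen_def mv_def A by simp
  qed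
  moreover have "primitive q (r - A4, A3) \<or> primitive q (A2, r - A1)"
  proof (rule ccontr)
    assume "\<not> ?thesis"
    then have "q dvd r - A4" "q dvd A3" "q dvd A2" "q dvd r - A1" by (auto simp: primitive_def)
    then have "q dvd ((r - A4) - (r - A1)) * (A1 - A4) + 4 * A2 * A3"
      by (meson dvd_add dvd_diff dvd_mult dvd_mult2)
    moreover have "((r - A4) - (r - A1)) * (A1 - A4) + 4 * A2 * A3 = (tr2 A)\<^sup>2 - 4 * det2 A"
      by (simp add: A tr2_def det2_def power2_eq_square algebra_simps)
    ultimately show False using disc by simp
  qed
  ultimately show thesis using that by blast
qed

text \<open>Every entry of \<open>A - r\<close> annihilates \<open>wedge w w'\<close> modulo
  \<open>q ^ a\<close>. As the discriminant is a unit, \<open>A\<close> is not scalar modulo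
  \<open>q\<close>, so one of these entries is a unit.\<close>

lemma eigen_unique:
  fixes q :: int
  assumes q: "prime q" and disc: "\<not> q dvd (tr2 A)\<^sup>2 - 4 * det2 A"
    and e: "eigen q a A r w" "eigen q a A r w'"
  shows "q ^ a dvd wedge w w'"
proof -
  obtain A1 A2 A3 A4 where A: "A = (A1, A2, A3, A4)" by (cases A)
  obtain x y where xy: "w = (x, y)" by (cases w)
  obtain x' y' where xy': "w' = (x', y')" by (cases w')
  have d: "q ^ a dvd A1 * x + A2 * y - r * x" "q ^ a dvd A3 * x + A4 * y - r * y"
    "q ^ a dvd A1 * x' + A2 * y' - r * x'" "q ^ a dvd A3 * x' + A4 * y' - r * y'"
    using e unfolding eigen_def mv_def A xy xy' by auto
  have "wedge w w' * (A1 - r) = y' * (A1 * x + A2 * y - r * x) - y * (A1 * x' + A2 * y' - r * x')"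
    "wedge w w' * A2 = x * (A1 * x' + A2 * y' - r * x') - x' * (A1 * x + A2 * y - r * x)"
    "wedge w w' * A3 = y' * (A3 * x + A4 * y - r * y) - y * (A3 * x' + A4 * y' - r * y')"
    "wedge w w' * (A4 - r) = x * (A3 * x' + A4 * y' - r * y') - x' * (A3 * x + A4 * y - r * y)"
    unfolding xy xy' wedge_def by (simp_all add: algebra_simps)
  then have d: "q ^ a dvd wedge w w' * (A1 - r)" "q ^ a dvd wedge w w' * A2"
     "q ^ a dvd wedge w w' * A3" "q ^ a dvd wedge w w' * (A4 - r)"
    using d by (metis dvd_diff dvd_mult)+
  have "\<not> (q dvd A1 - r \<and> q dvd A2 \<and> q dvd A3 \<and> q dvd A4 - r)"
  proof
    assume "q dvd A1 - r \<and> q dvd A2 \<and> q dvd A3 \<and> q dvd A4 - r"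
    then have "q dvd ((A1 - r) - (A4 - r)) * (A1 - A4) + 4 * A2 * A3"
      by (meson dvd_add dvd_diff dvd_mult dvd_mult2)
    moreover have "((A1 - r) - (A4 - r)) * (A1 - A4) + 4 * A2 * A3 = (tr2 A)\<^sup>2 - 4 * det2 A"
      by (simp add: A tr2_def det2_def power2_eq_square algebra_simps)
    ultimately show False using disc by simp
  qed
  then have "coprime (q ^ a) (A1 - r) \<or> coprime (q ^ a) A2 \<or> coprime (q ^ a) A3 \<or> coprime (q ^ a) (A4 - r)"
    using q by (metis coprime_power_left_iff prime_imp_coprime)
  then show ?thesis using d by (metis coprime_dvd_mult_left_iff)
qed

text \<open>The second root is \<open>s = t - r\<close>, and \<open>(r - s) ^ 2\<close> is congruent
  to the discriminant, so the roots differ modulo \<open>q\<close>. An eigenvalue \<open>m\<close>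
  satisfies \<open>(m - r) * (m - s) = 0\<close> modulo \<open>q ^ a\<close> with at most one factor
  divisible by \<open>q\<close>, hence is one of the two. The other matrices are polynomials in
  \<open>A\<close> and impose nothing new.\<close>

lemma card_inv_lats_split:
  fixes q :: int
  assumes q: "prime q" and disc: "\<not> q dvd (tr2 A)\<^sup>2 - 4 * det2 A"
    and r: "q ^ a dvd r ^ 2 - tr2 A * r + det2 A" and a: "a > 0"
    and A: "A \<in> S" and S: "\<And>B. B \<in> S \<Longrightarrow> \<exists>i j. B = lin i j A"
  shows "card (inv_lats q S e a) = 2"
proof -
  define t where "t = tr2 A"
  define s where "s = t - r"
  have s: "q ^ a dvd s ^ 2 - tr2 A * s + det2 A"
  proof -
    have "s ^ 2 - tr2 A * s + det2 A = r ^ 2 - tr2 A * r + det2 A"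
      by (simp add: s_def t_def power2_eq_square algebra_simps)
    then show ?thesis using r by simp
  qed
  have qa: "q dvd q ^ a" using a by (simp add: dvd_power)
  have rs: "\<not> q dvd r - s"
  proof
    assume "q dvd r - s"
    then have "q dvd (r - s) ^ 2 - 4 * (r ^ 2 - tr2 A * r + det2 A)"
      using r qa by (meson dvd_diff dvd_mult dvd_power dvd_trans zero_less_numeral dvd_power_le)
    moreover have "(r - s) ^ 2 - 4 * (r ^ 2 - tr2 A * r + det2 A) = (tr2 A)\<^sup>2 - 4 * det2 A"
      by (simp add: s_def t_def power2_eq_square algebra_simps)
    ultimately show False using disc by metis
  qed
  obtain w where w: "primitive q w" "eigen q a A r w" using eigen_exists[OF q disc r a] .
  obtain w' where w': "primitive q w'" "eigen q a A s w'" using eigen_exists[OF q disc s a] .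
  have S': "\<forall>B\<in>S. q ^ a dvd wedge x (mv B x)" if "q ^ a dvd wedge x (mv A x)" for x
    using S that by (metis dvd_mult mv_lin wedge_simps(1,3,8) add_0 mult_zero_right)
  have "inv_lats q S e a = {lat q e a w, lat q e a w'}"
  proof
    show "{lat q e a w, lat q e a w'} \<subseteq> inv_lats q S e a"
      using w w' S'[OF eigen_wedge] unfolding inv_lats_def by blast
    show "inv_lats q S e a \<subseteq> {lat q e a w, lat q e a w'}"
    proof
      fix X assume "X \<in> inv_lats q S e a"
      then obtain x where x: "primitive q x" "q ^ a dvd wedge x (mv A x)" and X: "X = lat q e a x"
        using A by (auto simp: inv_lats_def)
      obtain m where m: "eigen q a A m x" using wedge_eigen[OF q x] .
      have "(m - r) * (m - s) = (m ^ 2 - tr2 A * m + det2 A) - (r ^ 2 - tr2 A * r + det2 A)"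
        by (simp add: s_def t_def power2_eq_square algebra_simps)
      then have d: "q ^ a dvd (m - r) * (m - s)" using eigen_root[OF q x(1) m] r by (metis dvd_diff)
      have "\<not> (q dvd m - r \<and> q dvd m - s)"
      proof
        assume "q dvd m - r \<and> q dvd m - s"
        then have "q dvd (m - s) - (m - r)" by (metis dvd_diff)
        then show False using rs by simp
      qed
      then have "coprime (q ^ a) (m - r) \<or> coprime (q ^ a) (m - s)"
        using q by (metis coprime_power_left_iff prime_imp_coprime)
      then have "q ^ a dvd m - s \<or> q ^ a dvd m - r"
        using d by (metis coprime_dvd_mult_left_iff coprime_dvd_mult_right_iff)
      moreover have "eigen q a A l x" if l: "q ^ a dvd m - l" for l
      proof -
        have "q ^ a dvd (fst (mv A x) - m * fst x) + (m - l) * fst x"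
          "q ^ a dvd (snd (mv A x) - m * snd x) + (m - l) * snd x"
          using m l by (simp_all add: eigen_def)
        then show ?thesis by (simp add: eigen_def algebra_simps)
      qed
      ultimately have "eigen q a A r x \<or> eigen q a A s x" by blast
      then show "X \<in> {lat q e a w, lat q e a w'}"
        using eigen_unique[OF q disc] w w' lat_eqI[OF q x(1)] unfolding X by blast
    qed
  qed
  moreover have "lat q e a w \<noteq> lat q e a w'"
  proof
    assume "lat q e a w = lat q e a w'"
    then have "q ^ a dvd wedge w w'" using lat_inj(3)[OF q w(1) w'(1)] by simp
    then obtain i y where "w' = sm i w + sm (q ^ a) y" using primitive_span[OF q w(1)] by metis
    then have i: "w' = sm i w + sm (q ^ a) y" .
    have "q ^ a dvd fst (mv A w') - r * fst w' \<and> q ^ a dvd snd (mv A w') - r * snd w'"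
    proof -
      have "fst (mv A w') - r * fst w' = i * (fst (mv A w) - r * fst w) + q ^ a * (fst (mv A y) - r * fst y)"
        "snd (mv A w') - r * snd w' = i * (snd (mv A w) - r * snd w) + q ^ a * (snd (mv A y) - r * snd y)"
        by (simp_all add: i mv_linear algebra_simps)
      then show ?thesis using w(2) by (simp add: eigen_def)
    qed
    then have "q ^ a dvd (fst (mv A w') - s * fst w') - (fst (mv A w') - r * fst w')"
       "q ^ a dvd (snd (mv A w') - s * snd w') - (snd (mv A w') - r * snd w')"
      using w'(2) unfolding eigen_def by (meson dvd_diff)+
    then have "q ^ a dvd (r - s) * fst w'" "q ^ a dvd (r - s) * snd w'" by (simp_all add: algebra_simps)
    then have "q ^ a dvd r - s" by (rule primitive_dvd[OF q w'(1)])
    then show False using rs qa dvd_trans by blast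
  qed
  ultimately show ?thesis by simp
qed

text \<open>The derivative \<open>2 * s - t\<close> is a unit at every root modulo \<open>q\<close>,
  since its square is the discriminant plus four times the value of the polynomial.\<close>

lemma hensel_quadratic:
  fixes q :: int
  assumes q: "prime q" and disc: "\<not> q dvd t\<^sup>2 - 4 * d" and r: "q dvd r ^ 2 - t * r + d"
  shows "\<exists>s. q ^ Suc n dvd s ^ 2 - t * s + d"
proof (induction n)
  case 0 then show ?case using r by auto
next
  case (Suc n)
  then obtain s m where m: "s ^ 2 - t * s + d = q ^ Suc n * m" by (auto elim!: dvdE)
  have "\<not> q dvd 2 * s - t"
  proof
    assume "q dvd 2 * s - t"
    then have "q dvd (2 * s - t) * (2 * s - t) - 4 * (s ^ 2 - t * s + d)" unfolding m by simp
    moreover have "(2 * s - t) * (2 * s - t) - 4 * (s ^ 2 - t * s + d) = t\<^sup>2 - 4 * d"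
      by (simp add: power2_eq_square algebra_simps)
    ultimately show False using disc by metis
  qed
  then have "coprime (2 * s - t) q" using q by (metis coprime_commute prime_imp_coprime)
  then obtain j where j: "[(2 * s - t) * j = 1] (mod q)" using cong_solve_coprime_int by blast
  then obtain l where l: "(2 * s - t) * j = 1 + q * l"
    by (metis cong_iff_lin cong_sym)
  \<comment> \<open>Newton step: \<open>j\<close> inverts the derivative modulo \<open>q\<close>,
    and \<open>q ^ Suc n * m\<close> is the current value.\<close>
  define s' where "s' = s - q ^ Suc n * (m * j)"
  have "s' ^ 2 - t * s' + d = q ^ Suc (Suc n) * (q ^ n * (m * j)^2 - m * l)"
  proof -
    have "s' ^ 2 - t * s' + d = (s ^ 2 - t * s + d) - q ^ Suc n * m * ((2 * s - t) * j) + (q ^ Suc n * (m * j))^2"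
      unfolding s'_def by (simp add: power2_eq_square algebra_simps)
    also have "\<dots> = q ^ Suc n * m - q ^ Suc n * m * (1 + q * l) + (q ^ Suc n * (m * j))^2"
      unfolding m l ..
    also have "\<dots> = q ^ Suc (Suc n) * (q ^ n * (m * j)^2 - m * l)"
      by (simp add: power2_eq_square algebra_simps)
    finally show ?thesis .
  qed
  then show ?case by (metis dvd_triv_left)
qed

section \<open>Finite-order matrices and the quadratic characters\<close>

fun mpow :: "mat2 \<Rightarrow> nat \<Rightarrow> mat2" where
  "mpow A 0 = id2"
| "mpow A (Suc n) = mm A (mpow A n)"

lemma mpow_add: "mpow A (m + n) = mm (mpow A m) (mpow A n)"
  by (induction m) (auto simp: mm_assoc)

lemma mpow_mult: "mpow A (m * n) = mpow (mpow A m) n"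
  by (induction n) (auto simp: mpow_add)

lemma mpow_one: "mpow id2 n = id2"
  by (induction n) auto

lemma mm_lin: "mm A (lin i j A) = lin (- j * det2 A) (i + j * tr2 A) A"
  by (cases A) (simp add: mm_def lin_def det2_def tr2_def algebra_simps)

lemma lin_const: "lin i 0 A = (i, 0, 0, i)"
  by (cases A) (simp add: lin_def)

lemma mpow_lin: "\<exists>i j. mpow A n = lin i j A"
proof (induction n)
  case 0
  show ?case by (intro exI[of _ 1] exI[of _ 0]) (auto simp: lin_def split: prod.splits)
next
  case (Suc n)
  then obtain i j where ij: "mpow A n = lin i j A" by blast
  then show ?case using mm_lin[of A i j] by auto
qed

lemma det2_mpow: "det2 (mpow A n) = det2 A ^ n"
  by (induction n) (auto simp: det2_mm)

lemma order_dvd: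
  assumes d: "mpow A d = id2" "\<And>i. 0 < i \<Longrightarrow> i < d \<Longrightarrow> mpow A i \<noteq> id2" "d > 0"
    and n: "mpow A n = id2"
  shows "d dvd n"
proof -
  have "mpow A n = mm (mpow A (d * (n div d))) (mpow A (n mod d))"
    by (metis mpow_add mult_div_mod_eq)
  then have "mpow A (n mod d) = id2" using d(1) n by (simp add: mpow_mult mpow_one)
  then show ?thesis using d(2)[of "n mod d"] d(3) by (metis mod_greater_zero_iff_not_dvd mod_less_divisor)
qed

text \<open>Adding the determinant equation to the first entry of \<open>mm A A = id2\<close> gives
  \<open>a * (a + d) = 2\<close>, so the trace is nonzero. The off-diagonal entries of the square
  are multiples of the trace, which forces \<open>A\<close> to be diagonal.\<close>

lemma involution_SL:
  assumes "mm A A = id2" "det2 A = 1" "A \<noteq> id2" shows "A = neg2"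
proof -
  obtain a b c d where A: "A = (a, b, c, d)" by (cases A)
  have e: "a * a + b * c = 1" "a * b + b * d = 0" "c * a + d * c = 0" "c * b + d * d = 1" "a * d - b * c = 1"
    using assms by (auto simp: A mm_def det2_def)
  have "a * (a + d) = 2" using e(1,5) by (simp add: algebra_simps)
  then have ad: "a + d \<noteq> 0" by auto
  have "b * (a + d) = 0" "c * (a + d) = 0" using e(2,3) by (simp_all add: algebra_simps)
  then have bc: "b = 0" "c = 0" using ad by auto
  then have "a * a = 1" "a * d = 1" using e by auto
  then have "a = 1 \<and> d = 1 \<or> a = - 1 \<and> d = - 1" by (metis mult_minus1 mult_1 square_eq_1_iff minus_equation_iff)
  then show ?thesis using assms(3) A bc by auto
qed

lemma det_minus1_square:
  assumes "mm A A = id2" "det2 A = - 1" shows "tr2 A = 0"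
proof -
  obtain a b c d where A: "A = (a, b, c, d)" by (cases A)
  have e: "a * a + b * c = 1" "a * b + b * d = 0" "c * a + d * c = 0" "c * b + d * d = 1" "a * d - b * c = - 1"
    using assms by (auto simp: A mm_def det2_def)
  have "a * (a + d) = 0" "d * (a + d) = 0" using e by (simp_all add: algebra_simps)
  then have "(a + d) * (a + d) = 0" by (simp add: algebra_simps)
  then show ?thesis by (simp add: A tr2_def)
qed

lemma mpow_2: "mpow A 2 = mm A A" and mpow_3: "mpow A 3 = mm A (mm A A)"
  by (simp_all add: numeral_eq_Suc)

text \<open>By Cayley-Hamilton the cube is \<open>(t * t - 1) * A - t\<close>. If \<open>t\<close>
  is not -1, this makes \<open>A\<close> scalar, and the only integral scalar with cube 1 is the
  identity.\<close>

lemma order3_trace: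
  assumes "mpow A 3 = id2" "A \<noteq> id2" shows "det2 A = 1" "tr2 A = - 1"
proof -
  have "det2 A * (det2 A * det2 A) = 1"
    using det2_mpow[of A 3] assms(1) by (simp add: power3_eq_cube mult.assoc)
  then show d: "det2 A = 1" by (auto simp: zmult_eq_1_iff)
  obtain a b c e where A: "A = (a, b, c, e)" by (cases A)
  define t where "t = tr2 A"
  have "mpow A 3 = mm A (lin (- 1) t A)"
    using cayley_hamilton[of A] d by (simp add: mpow_3 t_def)
  also have "\<dots> = lin (- t) (t * t - 1) A"
    using d by (simp add: mm_lin t_def algebra_simps)
  finally have "lin (- t) (t * t - 1) A = id2" using assms(1) by simp
  then have e: "(t * t - 1) * a = t + 1" "(t * t - 1) * b = 0" "(t * t - 1) * c = 0" "(t * t - 1) * e = t + 1"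
    by (auto simp: A lin_def)
  show "tr2 A = - 1"
  proof (rule ccontr)
    assume "tr2 A \<noteq> - 1"
    then have t: "t + 1 \<noteq> 0" by (simp add: t_def)
    then have t2: "t * t - 1 \<noteq> 0" using e(1) by auto
    then have bc: "b = 0" "c = 0" using e by auto
    have ae: "a = e" using e(1,4) t2 by (metis mult_cancel_left)
    have "(t + 1) * ((t - 1) * a) = (t + 1) * 1" using e(1) by (simp add: algebra_simps)
    then have "(t - 1) * a = 1" using t by (metis mult_cancel_left)
    then have "a = 1 \<or> a = - 1 \<and> t = 0" by (auto simp: zmult_eq_1_iff)
    moreover have "t = 2 * a" by (simp add: t_def A tr2_def ae)
    ultimately have "a = 1" by auto
    then show False using assms(2) A bc ae by simp
  qed
qed

text \<open>For order 4 the square of \<open>A\<close>, and for order 6 its cube, is an involution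
  of determinant 1, hence -1. In order 6 the square has order 3, so
  \<open>tr2 A * tr2 A - 2 * det2 A = - 1\<close>; this excludes determinant -1, and trace -1 would
  make the cube trivial. The last two claims provide the powers that later annihilate
  \<open>Psi\<close>.\<close>

lemma finite_order_trace:
  assumes d: "d \<in> {3, 4, 6}" and A: "mpow A d = id2" "\<And>i. 0 < i \<Longrightarrow> i < d \<Longrightarrow> mpow A i \<noteq> id2"
  shows "det2 A = 1" "tr2 A = (if d = 3 then - 1 else if d = 4 then 0 else 1)"
    "d \<in> {4, 6} \<Longrightarrow> \<exists>n. mpow A n = neg2" "d \<in> {3, 6} \<Longrightarrow> \<exists>n. mpow A n \<noteq> id2 \<and> mpow (mpow A n) 3 = id2"
proof -
  have sq: "mpow A (2 * n) = mm (mpow A n) (mpow A n)" for n by (metis mpow_add mult_2)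
  have trsq: "tr2 (mm A A) = tr2 A * tr2 A - 2 * det2 A"
    by (cases A) (simp add: mm_def tr2_def det2_def algebra_simps)
  have "det2 A ^ d = 1" using det2_mpow[of A d] A(1) by simp
  moreover have "d > 0" using d by auto
  ultimately have "det2 A dvd 1" by (metis dvd_power)
  then have det: "det2 A = 1 \<or> det2 A = - 1" by auto
  consider "d = 3" | "d = 4" | "d = 6" using d by auto
  then have "det2 A = 1 \<and> tr2 A = (if d = 3 then - 1 else if d = 4 then 0 else 1) \<and>
     (d \<in> {4, 6} \<longrightarrow> (\<exists>n. mpow A n = neg2)) \<and>
     (d \<in> {3, 6} \<longrightarrow> (\<exists>n. mpow A n \<noteq> id2 \<and> mpow (mpow A n) 3 = id2))"
  proof cases
    case 1
    then show ?thesis using order3_trace[of A] A(1) A(2)[of 1] by (auto intro!: exI[of _ 1])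
  next
    case 2
    have "mm (mpow A 2) (mpow A 2) = id2" using A(1) sq[of 2] 2 by simp
    moreover have "det2 (mpow A 2) = 1" using det by (auto simp: det2_mpow)
    moreover have "mpow A 2 \<noteq> id2" using A(2)[of 2] 2 by simp
    ultimately have neg: "mpow A 2 = neg2" by (rule involution_SL)
    then have AA: "lin (- det2 A) (tr2 A) A = neg2" by (simp add: mpow_2 cayley_hamilton)
    have "tr2 A = 0 \<and> det2 A = 1"
    proof -
      obtain a b c e where Ae: "A = (a, b, c, e)" by (cases A)
      define t where "t = a + e"
      have eqs: "t * a = det2 A - 1" "t * b = 0" "t * c = 0" "t * e = det2 A - 1"
        using AA by (auto simp: lin_def Ae tr2_def t_def)
      show ?thesis
      proof (cases "t = 0")
        case True then show ?thesis using eqs by (simp add: Ae tr2_def t_def)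
      next
        case False
        then have bc: "b = 0" "c = 0" using eqs by auto
        have ae: "a = e" using eqs False by (metis mult_cancel_left)
        then have "det2 A = a * a" by (simp add: det2_def Ae bc)
        moreover have "t = 2 * a" by (simp add: t_def ae)
        ultimately have "a * a = - 1" using eqs(1) by simp
        then show ?thesis by (metis not_square_less_zero zero_less_one neg_less_0_iff_less)
      qed
    qed
    then show ?thesis using 2 neg by auto
  next
    case 3
    have "mm (mpow A 3) (mpow A 3) = id2" using A(1) sq[of 3] 3 by simp
    have o3: "mpow (mpow A 2) 3 = id2" "mpow A 2 \<noteq> id2"
      using A(1) mpow_mult[of A 2 3] A(2)[of 2] 3 by auto
    from order3_trace[OF this] have "tr2 A * tr2 A - 2 * det2 A = - 1" by (simp add: mpow_2 trsq)
    then have det1: "det2 A = 1"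
      using det not_square_less_zero[of "tr2 A"] by auto
    have neg: "mpow A 3 = neg2"
      using involution_SL[of "mpow A 3"] \<open>mm (mpow A 3) (mpow A 3) = id2\<close> det1 A(2)[of 3] 3
      by (simp add: det2_mpow)
    have "tr2 A * tr2 A = 1" using \<open>tr2 A * tr2 A - 2 * det2 A = - 1\<close> det1 by simp
    then have "tr2 A = 1 \<or> tr2 A = - 1" by (auto simp: zmult_eq_1_iff)
    moreover have "tr2 A \<noteq> - 1"
    proof
      assume t: "tr2 A = - 1"
      have "mpow A 3 = mm A (lin (- 1) (- 1) A)" using cayley_hamilton[of A] det1 t by (simp add: mpow_3)
      also have "\<dots> = id2" using det1 t by (simp add: mm_lin lin_const)
      finally show False using neg by simp
    qed
    ultimately show ?thesis using 3 det1 neg o3 by auto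
  qed
  then show "det2 A = 1" "tr2 A = (if d = 3 then - 1 else if d = 4 then 0 else 1)"
    "d \<in> {4, 6} \<Longrightarrow> \<exists>n. mpow A n = neg2" "d \<in> {3, 6} \<Longrightarrow> \<exists>n. mpow A n \<noteq> id2 \<and> mpow (mpow A n) 3 = id2"
    by blast+
qed

text \<open>The sum of the two primitive \<open>d\<close>-th roots of unity, so that
  \<open>r ^ 2 - cyc_tr d * r + 1\<close> is the \<open>d\<close>-th cyclotomic polynomial.\<close>

definition cyc_tr :: "nat \<Rightarrow> int" where
  "cyc_tr d = (if d = 3 then - 1 else if d = 4 then 0 else 1)"

text \<open>For these three moduli the only units are 1 and -1, which a finite check
  confirms.\<close>

lemma chi_cases:
  assumes "prime p" "d \<in> {3, 4, 6}" "coprime p d"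
  shows "[int p = 1] (mod int d) \<and> chi d p = 1 \<or> [int p = - 1] (mod int d) \<and> chi d p = - 1"
proof -
  have "[int p = 1] (mod int d) \<or> [int p = - 1] (mod int d)"
  proof -
    have *: "p mod d < d" using assms(2) by auto
    have c: "coprime (p mod d) d" using assms(3) by (metis coprime_mod_left_iff assms(2) empty_iff insert_iff zero_neq_numeral)
    have "p mod d = 1 \<or> p mod d = d - 1"
    proof -
      have A: "\<forall>r\<in>{0..<3::nat}. coprime r 3 \<longrightarrow> r = 1 \<or> r = 3 - 1"
        "\<forall>r\<in>{0..<4::nat}. coprime r 4 \<longrightarrow> r = 1 \<or> r = 4 - 1"
        "\<forall>r\<in>{0..<6::nat}. coprime r 6 \<longrightarrow> r = 1 \<or> r = 6 - 1"
        by (code_simp)+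
      have "p mod d \<in> {0..<d}" using * by simp
      then show ?thesis using assms(2) c A[THEN bspec, of "p mod d"] by (elim insertE emptyE) simp_all
    qed
    then show ?thesis
    proof
      assume "p mod d = 1"
      then have "int p mod int d = 1" by (metis of_nat_mod of_nat_1)
      then show ?thesis using assms(2) by (auto simp: cong_def)
    next
      assume "p mod d = d - 1"
      then have "(p + 1) mod d = 0" using assms(2) by (metis Suc_eq_plus1 Suc_pred' mod_Suc bot_nat_0.not_eq_extremum empty_iff insert_iff zero_neq_numeral)
      then have "d dvd p + 1" by auto
      then have "int d dvd int p - (- 1)" by (metis diff_minus_eq_add of_nat_1 of_nat_add of_nat_dvd_iff)
      then show ?thesis by (simp add: cong_iff_dvd_diff)
    qed
  qed
  moreover have "\<not> [- 1 = 1] (mod int d)" using assms(2) by (auto simp: cong_def)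
  ultimately show ?thesis unfolding chi_def by (metis cong_sym cong_trans)
qed

lemma cyclotomic_factor:
  fixes r :: int
  assumes "d \<in> {3, 4, 6}"
  shows "r ^ 2 - cyc_tr d * r + 1 dvd r ^ d - 1"
proof -
  have "r ^ 3 - 1 = (r ^ 2 + r + 1) * (r - 1)" "r ^ 4 - 1 = (r ^ 2 + 1) * (r ^ 2 - 1)"
    "r ^ 6 - 1 = (r ^ 2 - r + 1) * ((r + 1) * (r ^ 3 - 1))"
    by (simp_all add: algebra_simps power_numeral_reduce)
  then show ?thesis using assms by (auto simp: cyc_tr_def)
qed

text \<open>The discriminants are -3, -4 and -3, each a divisor of the corresponding
  \<open>d\<close>.\<close>

lemma disc_unit:
  assumes "prime p" "d \<in> {3, 4, 6}" "coprime p d"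
  shows "\<not> int p dvd (cyc_tr d)\<^sup>2 - 4"
proof
  assume "int p dvd (cyc_tr d)\<^sup>2 - 4"
  moreover have "(cyc_tr d)\<^sup>2 - 4 dvd int d" using assms(2) by (auto simp: cyc_tr_def)
  ultimately have "p dvd d" using dvd_trans by (metis of_nat_dvd_iff)
  then show False using assms by (metis coprime_absorb_left not_prime_unit)
qed

text \<open>If \<open>p\<close> is 1 modulo \<open>d\<close>, an element of order \<open>d\<close>
  modulo \<open>p\<close> is a root. If \<open>p\<close> is -1, a root satisfies both
  \<open>r ^ (p + 1) = 1\<close> and \<open>r ^ p = r\<close> modulo \<open>p\<close>, hence
  \<open>r * r = 1\<close>, and then \<open>p\<close> would divide the discriminant.\<close>

lemma cyclotomic_root_iff:
  assumes p: "prime p" and d: "d \<in> {3, 4, 6}" and c: "coprime p d"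
  shows "(\<exists>r. int p dvd r ^ 2 - cyc_tr d * r + 1) \<longleftrightarrow> chi d p = 1"
proof
  assume chi: "chi d p = 1"
  then have "[int p = 1] (mod int d)" using chi_cases[OF p d c] by auto
  then have "[p = 1] (mod d)" by (metis cong_int_iff of_nat_1)
  moreover have p1: "p > 1" using p prime_gt_1_nat by blast
  ultimately have "d dvd p - 1" by (metis cong_altdef_nat less_imp_le)
  then obtain m where m: "p - 1 = d * m" by blast
  obtain g where g: "residue_primroot p g" using prime_primitive_root_exists[OF p1 p] by blast
  then have og: "ord p g = p - 1" "coprime p g" using p by (auto simp: residue_primroot_def totient_prime)
  \<comment> \<open>The power of a primitive root with exponent \<open>(p - 1) / d\<close> has order
    exactly \<open>d\<close>.\<close>
  define r where "r = g ^ m"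
  have m0: "m > 0" using m p1 by (intro gr0I) auto
  have rd: "[r ^ i = 1] (mod p) \<longleftrightarrow> d dvd i" for i
  proof -
    have "[r ^ i = 1] (mod p) \<longleftrightarrow> d * m dvd m * i"
      unfolding r_def by (metis m og(1) ord_divides power_mult)
    then show ?thesis using m0 by (simp add: mult.commute[of d])
  qed
  have cop: "(int p dvd int r ^ i - 1) \<longleftrightarrow> d dvd i" for i
    using rd[of i] by (metis cong_iff_dvd_diff cong_int_iff of_nat_1 of_nat_power)
  have pr: "prime (int p)" using p by simp
  have "int p dvd int r ^ d - 1" using cop[of d] by simp
  moreover have "int r ^ 3 - 1 = (int r ^ 2 + int r + 1) * (int r ^ 1 - 1)" "int r ^ 4 - 1 = (int r ^ 2 + 1) * (int r ^ 2 - 1)"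
    "int r ^ 6 - 1 = (int r ^ 2 - int r + 1) * ((int r + 1) * (int r ^ 3 - 1))"
    "int r ^ 2 - 1 = (int r + 1) * (int r - 1)"
    by (simp_all add: algebra_simps power_numeral_reduce)
  \<comment> \<open>The other factors of \<open>r ^ d - 1\<close> divide some
    \<open>r ^ i - 1\<close> with \<open>i < d\<close>, and the order of \<open>r\<close> keeps
    \<open>p\<close> from dividing those.\<close>
  moreover have "\<not> d dvd 1" "d = 4 \<Longrightarrow> \<not> d dvd 2" "d = 6 \<Longrightarrow> \<not> d dvd 2 \<and> \<not> d dvd 3" using d by auto
  ultimately have "int p dvd int r ^ 2 - cyc_tr d * int r + 1"
    using d cop[of 1] cop[of 2] cop[of 3] pr unfolding cyc_tr_def
    by (auto simp: prime_dvd_mult_iff)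
  then show "\<exists>r. int p dvd r ^ 2 - cyc_tr d * r + 1" by blast
next
  assume "\<exists>r. int p dvd r ^ 2 - cyc_tr d * r + 1"
  then obtain r where r: "int p dvd r ^ 2 - cyc_tr d * r + 1" by blast
  show "chi d p = 1"
  proof (rule ccontr)
    assume "chi d p \<noteq> 1"
    then have "[int p = - 1] (mod int d)" using chi_cases[OF p d c] by auto
    then have "int d dvd int (p + 1)" by (simp add: cong_iff_dvd_diff add.commute)
    then obtain m where m: "p + 1 = d * m" unfolding of_nat_dvd_iff by blast
    have "int p dvd r ^ d - 1" using r cyclotomic_factor[OF d] dvd_trans by blast
    then have "[r ^ d = 1] (mod int p)" by (simp add: cong_iff_dvd_diff)
    then have "[(r ^ d) ^ m = 1 ^ m] (mod int p)" by (rule cong_pow)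
    then have r1: "[r ^ (p + 1) = 1] (mod int p)" by (simp only: m power_mult power_one)
    have "[r ^ p = r] (mod int p)"
    proof -
      define a where "a = nat (r mod int p)"
      have p0: "p > 0" using p prime_gt_0_nat by blast
      then have a: "[r = int a] (mod int p)" by (simp add: a_def cong_def)
      have "[a ^ p = a] (mod p)"
      proof (cases "p dvd a")
        case True
        then have "p dvd a ^ p" using p0 by (meson dvd_power dvd_trans)
        then show ?thesis using True by (metis cong_0_iff cong_sym cong_trans)
      next
        case False
        then have "[a ^ (p - 1) * a = 1 * a] (mod p)"
          using fermat_theorem[OF p] by (intro cong_mult cong_refl) auto
        then show ?thesis using p0 by (metis mult_1 power_minus_mult)
      qed
      then have "[int a ^ p = int a] (mod int p)" by (metis cong_int_iff of_nat_power)
      moreover have "[r ^ p = int a ^ p] (mod int p)" using a by (rule cong_pow)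
      ultimately show ?thesis using a by (metis cong_sym cong_trans)
    qed
    then have "[r ^ p * r = r * r] (mod int p)" by (intro cong_mult cong_refl)
    then have "[r * r = 1] (mod int p)" using r1 by (metis Suc_eq_plus1 cong_sym cong_trans power_Suc2)
    then have r2: "int p dvd r * r - 1" by (simp add: cong_iff_dvd_diff)
    define t where "t = cyc_tr d"
    \<comment> \<open>Given \<open>r * r = 1\<close>, the polynomial reduces to
      \<open>2 - t * r\<close>; multiplying by its conjugate \<open>t * r + 2\<close> leaves
      \<open>4 - t ^ 2\<close>.\<close>
    have "int p dvd (t * r + 2) * (r ^ 2 - t * r + 1 - (r * r - 1)) + t * t * (r * r - 1)"
      using dvd_add[OF dvd_mult[OF dvd_diff[OF r r2]] dvd_mult[OF r2]] unfolding t_def .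
    moreover have "(t * r + 2) * (r ^ 2 - t * r + 1 - (r * r - 1)) + t * t * (r * r - 1) = - (t\<^sup>2 - 4)"
      by (simp add: power2_eq_square algebra_simps)
    ultimately have "int p dvd t\<^sup>2 - 4" by (metis dvd_minus_iff)
    then show False using disc_unit[OF p d c] by (simp add: t_def)
  qed
qed

text \<open>On a common eigenline with eigenvalues \<open>r\<close> and \<open>s\<close>, the
  relation \<open>R Q R = Q\<close> gives \<open>s * (r * r - 1) = 0\<close> modulo
  \<open>q\<close>, and \<open>s\<close> is a unit because \<open>Q\<close> is an involution. So
  \<open>r * r = 1\<close>, which the discriminant of \<open>R\<close> forbids.\<close>

lemma dihedral_no_eigenvector:
  fixes q :: int
  assumes q: "prime q" and R: "det2 R = 1" "\<not> q dvd (tr2 R)\<^sup>2 - 4"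
    and rel: "mm R (mm Q R) = Q" "mm Q Q = id2"
    and w: "primitive q w" "q dvd wedge w (mv R w)" "q dvd wedge w (mv Q w)"
  shows False
proof -
  obtain r where r: "eigen q 1 R r w" using wedge_eigen[OF q w(1), of 1 R] w(2) by auto
  obtain s where s: "eigen q 1 Q s w" using wedge_eigen[OF q w(1), of 1 Q] w(3) by auto
  have eig: "eigen q 1 (mm A B) (a * b) w" if A: "eigen q 1 A a w" and B: "eigen q 1 B b w" for A B a b
  proof -
    obtain x y where "fst (mv B w) - b * fst w = q * x" "snd (mv B w) - b * snd w = q * y"
      using B unfolding eigen_def by (auto elim!: dvdE)
    then have "mv B w = sm b w + sm q (x, y)" by (simp add: prod_eq_iff)
    then have e: "mv (mm A B) w = sm b (mv A w) + sm q (mv A (x, y))" by (simp add: mv_mm mv_linear)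
    have "q dvd b * (fst (mv A w) - a * fst w) + q * fst (mv A (x, y))"
      "q dvd b * (snd (mv A w) - a * snd w) + q * snd (mv A (x, y))"
      using A unfolding eigen_def by auto
    then show ?thesis unfolding eigen_def e by (simp add: algebra_simps)
  qed
  have uniq: "q dvd a - b" if A: "eigen q 1 A a w" "eigen q 1 A b w" for A a b
  proof -
    have "q dvd (fst (mv A w) - b * fst w) - (fst (mv A w) - a * fst w)"
      "q dvd (snd (mv A w) - b * snd w) - (snd (mv A w) - a * snd w)"
      using A unfolding eigen_def power_one_right by (blast intro: dvd_diff)+
    then have "q ^ 1 dvd (a - b) * fst w" "q ^ 1 dvd (a - b) * snd w" by (simp_all add: algebra_simps)
    from primitive_dvd[OF q w(1) this] show ?thesis by simp
  qed
  have "eigen q 1 Q (r * (s * r)) w" using eig[OF r eig[OF s r]] rel(1) by simp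
  from uniq[OF this s] have 1: "q dvd s * (r * r - 1)" by (simp add: algebra_simps)
  have "eigen q 1 id2 (s * s) w" using eig[OF s s] rel(2) by simp
  moreover have "eigen q 1 id2 1 w" by (simp add: eigen_def)
  ultimately have "q dvd s * s - 1" by (rule uniq)
  then have "\<not> q dvd s" using q by (metis dvd_diff_right_iff dvd_mult2 not_prime_unit)
  then have r2: "q dvd r * r - 1" using 1 q by (simp add: prime_dvd_mult_iff)
  have r': "q dvd r ^ 2 - tr2 R * r + 1" using eigen_root[OF q w(1) r] R(1) by simp
  define t where "t = tr2 R"
  have "q dvd (t * r + 2) * (r ^ 2 - t * r + 1 - (r * r - 1)) + t * t * (r * r - 1)"
    using dvd_add[OF dvd_mult[OF dvd_diff[OF r' r2]] dvd_mult[OF r2]] unfolding t_def .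
  moreover have "(t * r + 2) * (r ^ 2 - t * r + 1 - (r * r - 1)) + t * t * (r * r - 1) = - (t\<^sup>2 - 4)"
    by (simp add: power2_eq_square algebra_simps)
  ultimately have "q dvd t\<^sup>2 - 4" by (metis dvd_minus_iff)
  then show False using R(2) by (simp add: t_def)
qed

section \<open>Extensions of a Heisenberg group\<close>

lemma int_additive_linear:
  fixes f :: "int \<Rightarrow> int"
  assumes add: "\<And>x y. f (x + y) = f x + f y"
  shows "f n = n * f 1"
proof -
  have 0: "f 0 = 0" using add[of 0 0] by simp
  have nat: "f (int n) = int n * f 1" for n
    by (induction n) (auto simp: 0 add algebra_simps)
  have "f (- x) = - f x" for x using add[of x "- x"] 0 by simp
  then show ?thesis using nat[of "nat n"] nat[of "nat (- n)"] by (cases "n \<ge> 0") (metis int_nat_eq, simp)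
qed

text \<open>The coordinates are those of a normal form \<open>x^u y^v z^c\<close> with
  \<open>z\<close> central and the commutator of \<open>y\<close> and \<open>x\<close> equal to the
  \<kappa>-th power of \<open>z\<close>; moving a power of \<open>y\<close> past a power of
  \<open>x\<close> produces the cocycle in \<open>c_mult\<close>. The sign of \<kappa> is left
  open.\<close>

locale heis_ext = group G for G (structure) +
  fixes N :: "'a set" and u v c :: "'a \<Rightarrow> int" and \<kappa> :: int
  assumes normal_N: "N \<lhd> G"
    and finite_index: "finite (rcosets N)"
    and coord_inj: "\<lbrakk>n \<in> N; m \<in> N; u n = u m; v n = v m; c n = c m\<rbrakk> \<Longrightarrow> n = m"
    and coord_surj: "\<exists>n\<in>N. u n = i \<and> v n = j \<and> c n = l"
    and u_mult: "\<lbrakk>n \<in> N; m \<in> N\<rbrakk> \<Longrightarrow> u (n \<otimes> m) = u n + u m"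
    and v_mult: "\<lbrakk>n \<in> N; m \<in> N\<rbrakk> \<Longrightarrow> v (n \<otimes> m) = v n + v m"
    and c_mult: "\<lbrakk>n \<in> N; m \<in> N\<rbrakk> \<Longrightarrow> c (n \<otimes> m) = c n + c m + \<kappa> * v n * u m"
    and kappa_nonzero: "\<kappa> \<noteq> 0"
begin

abbreviation GN where "GN \<equiv> G\<lparr>carrier := N\<rparr>"

lemma subgroup_N: "subgroup N G" using normal_N by (rule normal_imp_subgroup)

lemma N_carrier [simp]: "n \<in> N \<Longrightarrow> n \<in> carrier G"
  using subgroup_N subgroup.mem_carrier by metis

lemma N_closed [simp]: "\<one> \<in> N" "n \<in> N \<Longrightarrow> m \<in> N \<Longrightarrow> n \<otimes> m \<in> N" "n \<in> N \<Longrightarrow> inv n \<in> N"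
  using subgroup_N by (auto simp: subgroup.one_closed subgroup.m_closed subgroup.m_inv_closed)

definition el :: "int \<Rightarrow> int \<Rightarrow> int \<Rightarrow> 'a" where
  "el i j l = (SOME n. n \<in> N \<and> u n = i \<and> v n = j \<and> c n = l)"

lemma el: "el i j l \<in> N" "u (el i j l) = i" "v (el i j l) = j" "c (el i j l) = l"
proof -
  have "\<exists>n. n \<in> N \<and> u n = i \<and> v n = j \<and> c n = l" using coord_surj by blast
  from someI_ex[OF this] show "el i j l \<in> N" "u (el i j l) = i" "v (el i j l) = j" "c (el i j l) = l"
    unfolding el_def by auto
qed

declare el [simp]

lemma el_coords: "n \<in> N \<Longrightarrow> el (u n) (v n) (c n) = n"
  by (rule coord_inj) auto

lemma one_coords [simp]: "u \<one> = 0" "v \<one> = 0" "c \<one> = 0"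
proof -
  show u: "u \<one> = 0" using u_mult[of \<one> \<one>] by simp
  show v: "v \<one> = 0" using v_mult[of \<one> \<one>] by simp
  show "c \<one> = 0" using c_mult[of \<one> \<one>] u by simp
qed

lemma inv_coords:
  assumes "n \<in> N" shows "u (inv n) = - u n" "v (inv n) = - v n" "c (inv n) = - c n + \<kappa> * v n * u n"
proof -
  show u: "u (inv n) = - u n" using u_mult[of n "inv n"] assms by simp
  show v: "v (inv n) = - v n" using v_mult[of n "inv n"] assms by simp
  show "c (inv n) = - c n + \<kappa> * v n * u n" using c_mult[of n "inv n"] u assms by simp
qed

definition uv :: "'a \<Rightarrow> int \<times> int" where "uv n = (u n, v n)"

lemma uv_mult [simp]: "n \<in> N \<Longrightarrow> m \<in> N \<Longrightarrow> uv (n \<otimes> m) = uv n + uv m"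
  by (simp add: uv_def u_mult v_mult)

lemma uv_one [simp]: "uv \<one> = 0" by (simp add: uv_def zero_prod_def)

lemma uv_inv [simp]: "n \<in> N \<Longrightarrow> uv (inv n) = - uv n" by (simp add: uv_def inv_coords)

lemma uv_el [simp]: "uv (el i j l) = (i, j)" by (simp add: uv_def)

lemma fst_snd_uv [simp]: "fst (uv n) = u n" "snd (uv n) = v n" by (auto simp: uv_def)

lemma uv_eq_iff: "uv n = uv m \<longleftrightarrow> u n = u m \<and> v n = v m" by (auto simp: uv_def)

lemma el0_mult: "el 0 0 (i + j) = el 0 0 i \<otimes> el 0 0 j"
  by (rule coord_inj) (auto simp: u_mult v_mult c_mult)

lemma el0_coords_mult:
  "n \<in> N \<Longrightarrow> u (el 0 0 l \<otimes> n) = u n" "n \<in> N \<Longrightarrow> v (el 0 0 l \<otimes> n) = v n"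
  "n \<in> N \<Longrightarrow> c (el 0 0 l \<otimes> n) = l + c n" "n \<in> N \<Longrightarrow> uv (el 0 0 l \<otimes> n) = uv n"
  by (auto simp: u_mult v_mult c_mult uv_def)

lemma same_uv:
  assumes "n \<in> N" "m \<in> N" "uv n = uv m" shows "n = el 0 0 (c n - c m) \<otimes> m"
  using assms by (intro coord_inj) (auto simp: u_mult v_mult c_mult uv_eq_iff)

lemma same_uv_inv:
  assumes "n \<in> N" "m \<in> N" "uv n = uv m" shows "n \<otimes> inv m = el 0 0 (c n - c m)"
  using same_uv[OF assms] assms by (metis N_carrier el(1) inv_solve_right')

lemma el0_central:
  assumes "n \<in> N" shows "el 0 0 l \<otimes> n = n \<otimes> el 0 0 l"
  using assms by (intro coord_inj) (auto simp: u_mult v_mult c_mult)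

lemma central_iff:
  assumes n: "n \<in> N" shows "(\<forall>m\<in>N. n \<otimes> m = m \<otimes> n) \<longleftrightarrow> uv n = 0"
proof
  assume L: "\<forall>m\<in>N. n \<otimes> m = m \<otimes> n"
  have "c (n \<otimes> el 1 0 0) = c (el 1 0 0 \<otimes> n)" "c (n \<otimes> el 0 1 0) = c (el 0 1 0 \<otimes> n)"
    using L by auto
  then show "uv n = 0" using n kappa_nonzero by (auto simp: c_mult uv_def zero_prod_def)
next
  assume "uv n = 0"
  then have "n = el 0 0 (c n)" using n by (intro coord_inj) (auto simp: uv_def zero_prod_def)
  then show "\<forall>m\<in>N. n \<otimes> m = m \<otimes> n" using el0_central by metis
qed

definition cj :: "'a \<Rightarrow> 'a \<Rightarrow> 'a" where "cj g n = g \<otimes> n \<otimes> inv g"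

lemma cj_N [simp]: "g \<in> carrier G \<Longrightarrow> n \<in> N \<Longrightarrow> cj g n \<in> N"
  unfolding cj_def using normal_N normal.inv_op_closed2 by metis

lemma cj_mult: "g \<in> carrier G \<Longrightarrow> n \<in> carrier G \<Longrightarrow> m \<in> carrier G \<Longrightarrow> cj g (n \<otimes> m) = cj g n \<otimes> cj g m"
  unfolding cj_def by (simp add: m_assoc inv_solve_left)

lemma cj_comp: "g \<in> carrier G \<Longrightarrow> h \<in> carrier G \<Longrightarrow> n \<in> carrier G \<Longrightarrow> cj (g \<otimes> h) n = cj g (cj h n)"
  unfolding cj_def by (simp add: m_assoc inv_mult_group)

lemma cj_one: "n \<in> carrier G \<Longrightarrow> cj \<one> n = n"
  unfolding cj_def by simp

text \<open>Conjugation is an automorphism of \<open>N\<close> and preserves its centre, which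
  \<open>central_iff\<close> describes by \<open>uv n = 0\<close>.\<close>

lemma uv_cj_el0 [simp]: "g \<in> carrier G \<Longrightarrow> uv (cj g (el 0 0 l)) = 0"
proof -
  assume g: "g \<in> carrier G"
  have "cj g (el 0 0 l) \<otimes> m = m \<otimes> cj g (el 0 0 l)" if m: "m \<in> N" for m
  proof -
    have eq: "m = cj g (cj (inv g) m)" using g m by (simp add: cj_comp[symmetric] cj_one)
    have "cj g (el 0 0 l) \<otimes> cj g (cj (inv g) m) = cj g (el 0 0 l \<otimes> cj (inv g) m)"
      using g m by (simp add: cj_mult)
    also have "\<dots> = cj g (cj (inv g) m \<otimes> el 0 0 l)" using g m by (simp add: el0_central)
    also have "\<dots> = cj g (cj (inv g) m) \<otimes> cj g (el 0 0 l)" using g m by (simp add: cj_mult)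
    finally show ?thesis using eq by simp
  qed
  then show ?thesis using central_iff[of "cj g (el 0 0 l)"] g by (metis cj_N el(1))
qed

lemma uv_hom_linear:
  fixes h :: "'a \<Rightarrow> int"
  assumes h: "\<And>n m. n \<in> N \<Longrightarrow> m \<in> N \<Longrightarrow> h (n \<otimes> m) = h n + h m" and z: "\<And>l. h (el 0 0 l) = 0"
    and n: "n \<in> N"
  shows "h n = u n * h (el 1 0 0) + v n * h (el 0 1 0)"
proof -
  have eq: "h n = h m" if "n \<in> N" "m \<in> N" "uv n = uv m" for n m
  proof -
    have "h (el 0 0 (c n - c m) \<otimes> m) = h m" using h[OF el(1) that(2)] z by simp
    then show ?thesis using same_uv[OF that] by simp
  qed
  have "h (el (i + j) 0 0) = h (el i 0 0) + h (el j 0 0)" for i j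
    using h[of "el i 0 0" "el j 0 0"] eq[of "el i 0 0 \<otimes> el j 0 0" "el (i + j) 0 0"] by simp
  then have 1: "h (el i 0 0) = i * h (el 1 0 0)" for i by (rule int_additive_linear)
  have "h (el 0 (i + j) 0) = h (el 0 i 0) + h (el 0 j 0)" for i j
    using h[of "el 0 i 0" "el 0 j 0"] eq[of "el 0 i 0 \<otimes> el 0 j 0" "el 0 (i + j) 0"] by simp
  then have 2: "h (el 0 i 0) = i * h (el 0 1 0)" for i by (rule int_additive_linear)
  have "h n = h (el (u n) 0 0 \<otimes> el 0 (v n) 0)" using n by (intro eq) (auto simp: uv_def u_mult v_mult)
  then show ?thesis using h[of "el (u n) 0 0" "el 0 (v n) 0"] 1[of "u n"] 2[of "v n"] by simp
qed

text \<open>The columns are the images of the two basis vectors. The central coordinates of these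
  images are dropped here and return in the condition of \<open>graph_fun\<close>.\<close>

definition Mat :: "'a \<Rightarrow> mat2" where
  "Mat g = (u (cj g (el 1 0 0)), u (cj g (el 0 1 0)), v (cj g (el 1 0 0)), v (cj g (el 0 1 0)))"

lemma uv_cj: assumes g: "g \<in> carrier G" and n: "n \<in> N" shows "uv (cj g n) = mv (Mat g) (uv n)"
proof -
  have "u (cj g (el 0 0 l)) = 0" "v (cj g (el 0 0 l)) = 0" for l
    using uv_cj_el0[OF g, of l] by (auto simp: uv_def zero_prod_def)
  moreover have "u (cj g (n \<otimes> m)) = u (cj g n) + u (cj g m)" "v (cj g (n \<otimes> m)) = v (cj g n) + v (cj g m)"
    if "n \<in> N" "m \<in> N" for n m using that g by (auto simp: cj_mult u_mult v_mult)
  ultimately have "u (cj g n) = u n * u (cj g (el 1 0 0)) + v n * u (cj g (el 0 1 0))"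
    "v (cj g n) = u n * v (cj g (el 1 0 0)) + v n * v (cj g (el 0 1 0))"
    using uv_hom_linear[of "\<lambda>n. u (cj g n)", OF _ _ n] uv_hom_linear[of "\<lambda>n. v (cj g n)", OF _ _ n]
    by blast+
  then show ?thesis by (simp add: uv_def mv_def Mat_def mult.commute)
qed

lemma c_commutator:
  assumes "n \<in> N" "m \<in> N"
  shows "n \<otimes> m \<otimes> inv n \<otimes> inv m = el 0 0 (\<kappa> * (v n * u m - v m * u n))"
  using assms by (intro coord_inj) (auto simp: u_mult v_mult c_mult inv_coords algebra_simps)

text \<open>A commutator in \<open>N\<close> is central, with coordinate \<kappa> times the
  determinant of the two images in the plane. Conjugating the commutator of the basis elements
  multiplies this determinant by \<open>det2 (Mat g)\<close>, and \<kappa> cancels.\<close>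

lemma cj_el0: assumes g: "g \<in> carrier G" shows "cj g (el 0 0 l) = el 0 0 (det2 (Mat g) * l)"
proof -
  define f where "f = (\<lambda>l. c (cj g (el 0 0 l)))"
  have 0: "cj g (el 0 0 l) = el 0 0 (f l)" for l
    using uv_cj_el0[OF g, of l] g unfolding f_def
    by (intro coord_inj) (auto simp: uv_def zero_prod_def)
  have "f (i + j) = f i + f j" for i j
  proof -
    have "u (cj g (el 0 0 j)) = 0" using uv_cj_el0[OF g, of j] by (simp add: uv_def zero_prod_def)
    then show ?thesis using g by (simp add: f_def el0_mult cj_mult c_mult)
  qed
  then have lin: "f i = i * f 1" for i by (rule int_additive_linear)
  define X Y where "X = el 1 0 0" and "Y = el 0 1 0"
  have XY: "X \<in> N" "Y \<in> N" by (auto simp: X_def Y_def)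
  have inv: "cj g (inv n) = inv (cj g n)" if "n \<in> N" for n
    using that g by (simp add: cj_def inv_mult_group m_assoc)
  have "cj g (Y \<otimes> X \<otimes> inv Y \<otimes> inv X) = cj g Y \<otimes> cj g X \<otimes> inv (cj g Y) \<otimes> inv (cj g X)"
    using XY g by (simp add: cj_mult inv)
  then have "cj g (el 0 0 \<kappa>) = el 0 0 (\<kappa> * (v (cj g Y) * u (cj g X) - v (cj g X) * u (cj g Y)))"
    using XY g c_commutator[of Y X] c_commutator[of "cj g Y" "cj g X"] by (simp add: X_def Y_def)
  then have "f \<kappa> = \<kappa> * (v (cj g Y) * u (cj g X) - v (cj g X) * u (cj g Y))"
    using 0[of \<kappa>] by (metis el(4))
  then have "\<kappa> * f 1 = \<kappa> * det2 (Mat g)"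
    using lin[of \<kappa>] by (simp add: det2_def Mat_def X_def Y_def algebra_simps)
  then have "f 1 = det2 (Mat g)" using kappa_nonzero by simp
  then show ?thesis using 0[of l] lin[of l] by (simp add: mult.commute)
qed

lemma Mat_mult: "g \<in> carrier G \<Longrightarrow> h \<in> carrier G \<Longrightarrow> Mat (g \<otimes> h) = mm (Mat g) (Mat h)"
proof (rule mv_inject)
  fix x assume gh: "g \<in> carrier G" "h \<in> carrier G"
  obtain i j where x: "x = uv (el i j 0)" by (cases x) auto
  show "mv (Mat (g \<otimes> h)) x = mv (mm (Mat g) (Mat h)) x"
    unfolding x using gh by (simp add: uv_cj[symmetric] cj_comp mv_mm del: uv_el)
qed

lemma Mat_N: assumes "n \<in> N" shows "Mat n = id2"
proof (rule mv_inject)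
  fix x :: "int \<times> int"
  obtain i j where x: "x = uv (el i j 0)" by (cases x) auto
  have "uv (cj n (el i j 0)) = uv (el i j 0)" using assms by (simp add: cj_def)
  then show "mv (Mat n) x = mv id2 x" unfolding x using assms by (simp add: uv_cj del: uv_el)
qed

lemma Mat_one [simp]: "Mat \<one> = id2" by (rule Mat_N) simp

lemma Mat_inv: "g \<in> carrier G \<Longrightarrow> mm (Mat g) (Mat (inv g)) = id2" "g \<in> carrier G \<Longrightarrow> mm (Mat (inv g)) (Mat g) = id2"
  by (simp_all add: Mat_mult[symmetric])

lemma det_Mat: "g \<in> carrier G \<Longrightarrow> det2 (Mat g) = 1 \<or> det2 (Mat g) = - 1"
  "g \<in> carrier G \<Longrightarrow> det2 (Mat g) * det2 (Mat (inv g)) = 1"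
proof -
  assume g: "g \<in> carrier G"
  show e: "det2 (Mat g) * det2 (Mat (inv g)) = 1"
    using Mat_inv(1)[OF g] by (metis det2_mm det2_id2)
  then show "det2 (Mat g) = 1 \<or> det2 (Mat g) = - 1" by (auto simp: zmult_eq_1_iff)
qed

lemma Mat_pow: "g \<in> carrier G \<Longrightarrow> Mat (g [^] (n::nat)) = mpow (Mat g) n"
proof (induction n)
  case (Suc n)
  then have "g [^] Suc n = g \<otimes> g [^] n" by (metis nat_pow_Suc2)
  then show ?case using Suc by (simp add: Mat_mult)
qed simp

lemma c_cj_mult:
  assumes "g \<in> carrier G" "n \<in> N" shows "c (cj g (el 0 0 l \<otimes> n)) = det2 (Mat g) * l + c (cj g n)"
  using assms by (simp add: cj_mult cj_el0 el0_coords_mult)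

text \<open>\<open>Mat\<close> is trivial on \<open>N\<close>, so the order of the quotient kills
  every matrix. Through this the hypothesis on \<open>p\<close> reaches the orders of the
  matrices.\<close>

lemma order_Mat_dvd:
  assumes "g \<in> carrier G" shows "mpow (Mat g) (order (G Mod N)) = id2"
proof -
  have grp: "group (G Mod N)" using normal_N by (rule normal.factorgroup_is_group)
  have "N #> g \<in> carrier (G Mod N)" using assms by (auto simp: carrier_FactGroup)
  then have "(N #> g) [^]\<^bsub>G Mod N\<^esub> order (G Mod N) = N"
    using group.pow_order_eq_1[OF grp] by simp
  then have "N #> (g [^] order (G Mod N)) = N"
    using normal.FactGroup_pow[OF normal_N assms] by metis
  then have "g [^] order (G Mod N) \<in> N"
    using assms coset_join1[OF _ nat_pow_closed subgroup_N] by blast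
  then show ?thesis using Mat_pow[OF assms] Mat_N by metis
qed

end

section \<open>Bases of lattices and equivariant homomorphisms\<close>

lemma lat_basis:
  fixes q :: int
  assumes q: "prime q" and w: "primitive q w"
  obtains x y \<alpha> \<beta> where "x \<in> lat q e a w" "y \<in> lat q e a w" "wedge x y \<noteq> 0"
    "\<And>z. z \<in> lat q e a w \<Longrightarrow> z = sm (\<alpha> z) x + sm (\<beta> z) y"
    "\<And>i j. \<alpha> (sm i x + sm j y) = i" "\<And>i j. \<beta> (sm i x + sm j y) = j"
proof -
  have q0: "q \<noteq> 0" using q by auto
  have "coprime (fst w) (q ^ a) \<or> coprime (snd w) (q ^ a)"
    using w q unfolding primitive_def by (metis coprime_commute coprime_power_left_iff prime_imp_coprime)
  then show thesis
  proof
    assume "coprime (fst w) (q ^ a)"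
    then obtain j where j: "[fst w * j = 1] (mod q ^ a)" using cong_solve_coprime_int by blast
    \<comment> \<open>Scaling by the inverse \<open>j\<close> normalises the direction to
      \<open>(1, c)\<close>. The lattice then has the triangular basis \<open>(1, c)\<close>,
      \<open>(0, q ^ a)\<close> up to \<open>q ^ e\<close>, whose coordinate functions are explicit
      divisions.\<close>
    define c where "c = j * snd w"
    have "q ^ a dvd (fst w * j - 1) * snd w" using j by (simp add: cong_iff_dvd_diff)
    then have "q ^ a dvd wedge w (1, c)" by (simp add: wedge_def c_def algebra_simps)
    moreover have "primitive q (1, c)" using q by (auto simp: primitive_def)
    ultimately have L: "lat q e a w = lat q e a (1, c)" using lat_eqI[OF q w] by blast
    define x y where "x = sm (q ^ e) (1, c)" and "y = sm (q ^ e) (0, q ^ a)"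
    show thesis
    proof (rule that[of x y "\<lambda>z. fst z div q ^ e" "\<lambda>z. (snd z div q ^ e - c * (fst z div q ^ e)) div q ^ a"])
      show "x \<in> lat q e a w" "y \<in> lat q e a w" unfolding L x_def y_def using q0
        by (simp_all add: lat_iff wedge_def)
      show "wedge x y \<noteq> 0" using q0 by (simp add: x_def y_def wedge_def)
      fix i j
      have "fst (sm i x + sm j y) = q ^ e * i" "snd (sm i x + sm j y) = q ^ e * (i * c + q ^ a * j)"
        by (simp_all add: x_def y_def algebra_simps)
      then show "fst (sm i x + sm j y) div q ^ e = i"
        "(snd (sm i x + sm j y) div q ^ e - c * (fst (sm i x + sm j y) div q ^ e)) div q ^ a = j"
        using q0 by simp_all
    next
      fix z assume "z \<in> lat q e a w"
      then obtain z' where z: "z = sm (q ^ e) z'" "q ^ a dvd wedge (1, c) z'"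
        unfolding L unfolding lat_def by blast
      then obtain t where "snd z' - c * fst z' = q ^ a * t" by (auto simp: wedge_def elim!: dvdE)
      then have t: "snd z' = c * fst z' + q ^ a * t" by simp
      show "z = sm (fst z div q ^ e) x + sm ((snd z div q ^ e - c * (fst z div q ^ e)) div q ^ a) y"
        using q0 unfolding z x_def y_def by (simp add: t prod_eq_iff algebra_simps)
    qed
  next
    assume "coprime (snd w) (q ^ a)"
    then obtain j where j: "[snd w * j = 1] (mod q ^ a)" using cong_solve_coprime_int by blast
    define c where "c = j * fst w"
    have "q ^ a dvd (snd w * j - 1) * fst w" using j by (simp add: cong_iff_dvd_diff)
    then have "q ^ a dvd - wedge w (c, 1)" by (simp add: wedge_def c_def algebra_simps)
    then have "q ^ a dvd wedge w (c, 1)" by (simp only: dvd_minus_iff)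
    moreover have "primitive q (c, 1)" using q by (auto simp: primitive_def)
    ultimately have L: "lat q e a w = lat q e a (c, 1)" using lat_eqI[OF q w] by blast
    define x y where "x = sm (q ^ e) (c, 1)" and "y = sm (q ^ e) (q ^ a, 0)"
    show thesis
    proof (rule that[of x y "\<lambda>z. snd z div q ^ e" "\<lambda>z. (fst z div q ^ e - c * (snd z div q ^ e)) div q ^ a"])
      show "x \<in> lat q e a w" "y \<in> lat q e a w" unfolding L x_def y_def using q0
        by (simp_all add: lat_iff wedge_def)
      show "wedge x y \<noteq> 0" using q0 by (simp add: x_def y_def wedge_def)
      fix i j
      have "snd (sm i x + sm j y) = q ^ e * i" "fst (sm i x + sm j y) = q ^ e * (i * c + q ^ a * j)"
        by (simp_all add: x_def y_def algebra_simps)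
      then show "snd (sm i x + sm j y) div q ^ e = i"
        "(fst (sm i x + sm j y) div q ^ e - c * (snd (sm i x + sm j y) div q ^ e)) div q ^ a = j"
        using q0 by simp_all
    next
      fix z assume "z \<in> lat q e a w"
      then obtain z' where z: "z = sm (q ^ e) z'" "q ^ a dvd wedge (c, 1) z'"
        unfolding L unfolding lat_def by blast
      then have "q ^ a dvd fst z' - c * snd z'" by (simp add: wedge_def dvd_diff_commute)
      then obtain t where "fst z' - c * snd z' = q ^ a * t" by blast
      then have t: "fst z' = c * snd z' + q ^ a * t" by simp
      show "z = sm (snd z div q ^ e) x + sm ((fst z div q ^ e - c * (snd z div q ^ e)) div q ^ a) y"
        using q0 unfolding z x_def y_def by (simp add: t prod_eq_iff algebra_simps)
    qed
  qed
qed

definition add_mod :: "int \<Rightarrow> (int \<times> int) set \<Rightarrow> (int \<times> int \<Rightarrow> int) \<Rightarrow> bool" where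
  "add_mod m L \<psi> \<longleftrightarrow> (\<forall>x\<in>L. \<forall>y\<in>L. [\<psi> (x + y) = \<psi> x + \<psi> y] (mod m))"

lemma add_mod_minus:
  assumes L: "add_subgroup L" and \<psi>: "add_mod m L \<psi>"
  shows "[\<psi> 0 = 0] (mod m)" "x \<in> L \<Longrightarrow> [\<psi> (- x) = - \<psi> x] (mod m)"
proof -
  have "0 \<in> L" using L by (simp add: add_subgroup_def)
  then have "[\<psi> (0 + 0) = \<psi> 0 + \<psi> 0] (mod m)" using \<psi> unfolding add_mod_def by blast
  then have "m dvd \<psi> (0 + 0) - (\<psi> 0 + \<psi> 0)" by (simp only: cong_iff_dvd_diff)
  then show z: "[\<psi> 0 = 0] (mod m)" by (simp add: cong_0_iff)
  assume x: "x \<in> L"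
  then have "- x \<in> L" using L \<open>0 \<in> L\<close> by (metis add_subgroup_def diff_0)
  then have "[\<psi> (x + - x) = \<psi> x + \<psi> (- x)] (mod m)" using \<psi> x unfolding add_mod_def by blast
  then have "[\<psi> x + \<psi> (- x) = 0] (mod m)" using z by (metis add.right_inverse cong_sym cong_trans)
  then show "[\<psi> (- x) = - \<psi> x] (mod m)" by (simp add: cong_iff_dvd_diff add.commute)
qed

lemma add_mod_sm:
  assumes L: "add_subgroup L" and \<psi>: "add_mod m L \<psi>" and x: "x \<in> L"
  shows "[\<psi> (sm i x) = i * \<psi> x] (mod m)"
proof -
  have nat: "[\<psi> (sm (int n) x) = int n * \<psi> x] (mod m)" for n
  proof (induction n)
    case 0
    have "sm 0 x = 0" by (simp add: sm_def zero_prod_def)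
    then show ?case using add_mod_minus(1)[OF L \<psi>] by simp
  next
    case (Suc n)
    have "sm (int (Suc n)) x = sm (int n) x + x" by (simp add: sm_def prod_eq_iff algebra_simps)
    then have "[\<psi> (sm (int (Suc n)) x) = \<psi> (sm (int n) x) + \<psi> x] (mod m)"
      using \<psi> add_subgroup_sm[OF L x] x unfolding add_mod_def by metis
    also have "[\<psi> (sm (int n) x) + \<psi> x = int n * \<psi> x + \<psi> x] (mod m)"
      using Suc by (intro cong_add cong_refl)
    finally show ?case by (simp add: algebra_simps)
  qed
  show ?thesis
  proof (cases "i \<ge> 0")
    case True then show ?thesis using nat[of "nat i"] by simp
  next
    case False
    define n where "n = nat (- i)"
    have i: "i = - int n" using False by (simp add: n_def)
    have "sm i x = - sm (int n) x" by (simp add: i sm_def prod_eq_iff)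
    then have "[\<psi> (sm i x) = - \<psi> (sm (int n) x)] (mod m)"
      using add_mod_minus(2)[OF L \<psi> add_subgroup_sm[OF L x]] by simp
    also have "[- \<psi> (sm (int n) x) = - (int n * \<psi> x)] (mod m)"
      using nat[of n] by (simp add: cong_minus_minus_iff)
    finally show ?thesis by (simp add: i)
  qed
qed

text \<open>Homomorphisms from \<open>L\<close> to \<open>\<int>/m\<close> that are equivariant for the determinant twist, each
  represented by its values in \<open>{0..<m}\<close>.\<close>

definition Psi :: "int \<Rightarrow> mat2 set \<Rightarrow> (int \<times> int) set \<Rightarrow> (int \<times> int \<Rightarrow> int) set" where
  "Psi m S L = {\<psi> \<in> L \<rightarrow>\<^sub>E {0..<m}. add_mod m L \<psi> \<and>
     (\<forall>A\<in>S. \<forall>x\<in>L. [\<psi> (mv A x) = det2 A * \<psi> x] (mod m))}"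

text \<open>A unit multiple of every value vanishes modulo \<open>m\<close>, so only the zero
  function remains; applied with \<open>k\<close> equal to 2 and 3.\<close>

lemma card_Psi_trivial:
  assumes m: "m > 0" and L: "add_subgroup L" and inv: "\<And>A x. A \<in> S \<Longrightarrow> x \<in> L \<Longrightarrow> mv A x \<in> L"
    and k: "coprime k m" "\<And>\<psi> x. \<psi> \<in> Psi m S L \<Longrightarrow> x \<in> L \<Longrightarrow> [k * \<psi> x = 0] (mod m)"
  shows "card (Psi m S L) = 1"
proof -
  have "Psi m S L = {\<lambda>x\<in>L. 0}"
  proof (intro subset_antisym subsetI)
    fix \<psi> assume \<psi>: "\<psi> \<in> Psi m S L"
    have "\<psi> x = 0" if x: "x \<in> L" for x
    proof -
      have "m dvd k * \<psi> x" using k(2)[OF \<psi> x] by (simp add: cong_0_iff)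
      then have "m dvd \<psi> x" using k(1) by (metis coprime_commute coprime_dvd_mult_right_iff)
      moreover have "\<psi> x \<in> {0..<m}" using \<psi> x by (auto simp: Psi_def)
      ultimately show ?thesis using zdvd_not_zless[of "\<psi> x" m] by force
    qed
    moreover have "\<psi> \<in> extensional L" using \<psi> by (auto simp: Psi_def PiE_def)
    ultimately have "\<psi> = (\<lambda>x\<in>L. 0)" by (intro extensionalityI[of _ L]) auto
    then show "\<psi> \<in> {\<lambda>x\<in>L. 0}" by simp
  next
    fix \<psi> assume "\<psi> \<in> {\<lambda>x\<in>L. (0::int)}"
    then show "\<psi> \<in> Psi m S L"
      using m add_subgroup_add[OF L] inv by (auto simp: Psi_def add_mod_def)
  qed
  then show ?thesis by simp
qed

text \<open>The matrix -1 has determinant 1 in the plane, so an equivariant homomorphism is both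
  even and odd.\<close>

lemma card_Psi_neg:
  assumes m: "m > 0" "coprime 2 m" and L: "add_subgroup L" and inv: "\<And>A x. A \<in> S \<Longrightarrow> x \<in> L \<Longrightarrow> mv A x \<in> L"
    and S: "neg2 \<in> S"
  shows "card (Psi m S L) = 1"
proof (rule card_Psi_trivial[OF m(1) L inv m(2)])
  fix \<psi> x assume \<psi>: "\<psi> \<in> Psi m S L" and x: "x \<in> L"
  have "[\<psi> (mv neg2 x) = det2 neg2 * \<psi> x] (mod m)" using \<psi> S x unfolding Psi_def by blast
  then have 1: "[\<psi> (- x) = \<psi> x] (mod m)" by (simp add: det2_def)
  have "add_mod m L \<psi>" using \<psi> by (simp add: Psi_def)
  from add_mod_minus(2)[OF L this x] 1 have "[\<psi> x = - \<psi> x] (mod m)" by (metis cong_sym cong_trans)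
  then have "m dvd \<psi> x - (- \<psi> x)" by (simp only: cong_iff_dvd_diff)
  then show "[2 * \<psi> x = 0] (mod m)" by (simp add: cong_0_iff)
qed

text \<open>Here \<open>x\<close>, \<open>A x\<close> and \<open>A (A x)\<close> add up to 0 while
  \<psi> takes the same value on all three.\<close>

lemma card_Psi_order3:
  assumes m: "m > 0" "coprime 3 m" and L: "add_subgroup L" and inv: "\<And>A x. A \<in> S \<Longrightarrow> x \<in> L \<Longrightarrow> mv A x \<in> L"
    and S: "A \<in> S" "det2 A = 1" "tr2 A = - 1"
  shows "card (Psi m S L) = 1"
proof (rule card_Psi_trivial[OF m(1) L inv m(2)])
  fix \<psi> x assume \<psi>: "\<psi> \<in> Psi m S L" and x: "x \<in> L"
  have eq: "[\<psi> (mv A y) = \<psi> y] (mod m)" if "y \<in> L" for y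
    using \<psi> S that unfolding Psi_def by force
  have Ax: "mv A x \<in> L" "mv A (mv A x) \<in> L" using inv S(1) x by auto
  have am: "add_mod m L \<psi>" using \<psi> by (simp add: Psi_def)
  have "mv A (mv A x) = - (mv A x + x)"
    using cayley_hamilton_mv[of A x] S by (simp add: sm_def prod_eq_iff)
  then have "[\<psi> (mv A (mv A x)) = - \<psi> (mv A x + x)] (mod m)"
    using add_mod_minus(2)[OF L am add_subgroup_add[OF L Ax(1) x]] by simp
  also have "[- \<psi> (mv A x + x) = - (\<psi> (mv A x) + \<psi> x)] (mod m)"
    using am Ax x unfolding add_mod_def cong_minus_minus_iff by blast
  also have "[- (\<psi> (mv A x) + \<psi> x) = - (\<psi> x + \<psi> x)] (mod m)"
    unfolding cong_minus_minus_iff using eq[OF x] by (intro cong_add cong_refl)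
  finally have "[\<psi> (mv A (mv A x)) = - (\<psi> x + \<psi> x)] (mod m)" .
  moreover have "[\<psi> (mv A (mv A x)) = \<psi> x] (mod m)" using eq[OF Ax(1)] eq[OF x] cong_trans by blast
  ultimately have "[\<psi> x = - (\<psi> x + \<psi> x)] (mod m)" by (metis cong_sym cong_trans)
  then have "m dvd \<psi> x - (- (\<psi> x + \<psi> x))" by (simp only: cong_iff_dvd_diff)
  then show "[3 * \<psi> x = 0] (mod m)" by (simp add: cong_0_iff)
qed

text \<open>A homomorphism is given by its values \<open>i\<close>, \<open>j\<close> on the basis,
  and equivariance is linear, so it suffices to impose it there. Counting becomes a count of
  solutions of linear congruences.\<close>

lemma Psi_basis:
  fixes q :: int
  assumes q: "prime q" and w: "primitive q w" and m: "m > 0"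
    and inv: "\<And>A x. A \<in> S \<Longrightarrow> x \<in> lat q e a w \<Longrightarrow> mv A x \<in> lat q e a w"
    and basis: "x \<in> lat q e a w" "y \<in> lat q e a w"
    "\<And>z. z \<in> lat q e a w \<Longrightarrow> z = sm (\<alpha> z) x + sm (\<beta> z) y"
    "\<And>i j. \<alpha> (sm i x + sm j y) = i" "\<And>i j. \<beta> (sm i x + sm j y) = j"
  shows "card (Psi m S (lat q e a w)) = card {(i, j). i \<in> {0..<m} \<and> j \<in> {0..<m} \<and>
    (\<forall>A\<in>S. [i * \<alpha> (mv A x) + j * \<beta> (mv A x) = det2 A * i] (mod m) \<and>
           [i * \<alpha> (mv A y) + j * \<beta> (mv A y) = det2 A * j] (mod m))}" (is "_ = card ?I")
proof -
  define L where "L = lat q e a w"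
  have L: "add_subgroup L" unfolding L_def by (rule lat_add_subgroup)
  note basis = basis[folded L_def] and inv = inv[folded L_def]
  have val: "[\<psi> z = \<psi> x * \<alpha> z + \<psi> y * \<beta> z] (mod m)" if "add_mod m L \<psi>" "z \<in> L" for \<psi> z
  proof -
    have "[\<psi> (sm (\<alpha> z) x + sm (\<beta> z) y) = \<psi> (sm (\<alpha> z) x) + \<psi> (sm (\<beta> z) y)] (mod m)"
      using that basis(1,2) add_subgroup_sm[OF L] unfolding add_mod_def by blast
    also have "[\<psi> (sm (\<alpha> z) x) + \<psi> (sm (\<beta> z) y) = \<alpha> z * \<psi> x + \<beta> z * \<psi> y] (mod m)"
      using that basis(1,2) by (intro cong_add add_mod_sm[OF L])
    finally show ?thesis using basis(3)[OF that(2)] by (simp add: mult.commute)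
  qed
  define f where "f = (\<lambda>(i, j). \<lambda>z\<in>L. (i * \<alpha> z + j * \<beta> z) mod m)"
  have xy: "\<alpha> x = 1" "\<beta> x = 0" "\<alpha> y = 0" "\<beta> y = 1"
  proof -
    have "sm 1 x + sm 0 y = x" "sm 0 x + sm 1 y = y" by (auto simp: sm_def zero_prod_def prod_eq_iff)
    then show "\<alpha> x = 1" "\<beta> x = 0" "\<alpha> y = 0" "\<beta> y = 1" using basis(4,5) by metis+
  qed
  have ab_add: "\<alpha> (z + z') = \<alpha> z + \<alpha> z'" "\<beta> (z + z') = \<beta> z + \<beta> z'" if "z \<in> L" "z' \<in> L" for z z'
  proof -
    have "z + z' = sm (\<alpha> z + \<alpha> z') x + sm (\<beta> z + \<beta> z') y"
    proof -
      have "z + z' = (sm (\<alpha> z) x + sm (\<beta> z) y) + (sm (\<alpha> z') x + sm (\<beta> z') y)"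
        using basis(3)[OF that(1)] basis(3)[OF that(2)] by simp
      then show ?thesis by (simp add: sm_def prod_eq_iff algebra_simps)
    qed
    then show "\<alpha> (z + z') = \<alpha> z + \<alpha> z'" "\<beta> (z + z') = \<beta> z + \<beta> z'" using basis(4,5) by metis+
  qed
  have "bij_betw f ?I (Psi m S L)"
  proof (rule bij_betw_imageI)
    show "inj_on f ?I"
    proof (rule inj_onI, clarify)
      fix i j i' j' assume r: "i \<in> {0..<m}" "j \<in> {0..<m}" "i' \<in> {0..<m}" "j' \<in> {0..<m}" and f: "f (i, j) = f (i', j')"
      show "i = i' \<and> j = j'"
        using fun_cong[OF f, of x] fun_cong[OF f, of y] basis(1,2) r by (simp add: f_def xy)
    qed
    show "f ` ?I = Psi m S L"
    proof (intro subset_antisym subsetI)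
      fix \<psi> assume "\<psi> \<in> f ` ?I"
      then obtain i j where ij: "i \<in> {0..<m}" "j \<in> {0..<m}" and \<psi>: "\<psi> = f (i, j)"
        and A: "\<And>A. A \<in> S \<Longrightarrow> [i * \<alpha> (mv A x) + j * \<beta> (mv A x) = det2 A * i] (mod m) \<and>
           [i * \<alpha> (mv A y) + j * \<beta> (mv A y) = det2 A * j] (mod m)" by auto
      have fz: "[\<psi> z = i * \<alpha> z + j * \<beta> z] (mod m)" if "z \<in> L" for z using that by (simp add: \<psi> f_def)
      have am: "add_mod m L \<psi>" unfolding add_mod_def
      proof (intro ballI)
        fix z z' assume z: "z \<in> L" "z' \<in> L"
        have "[\<psi> (z + z') = i * \<alpha> (z + z') + j * \<beta> (z + z')] (mod m)"
          using fz add_subgroup_add[OF L z] by blast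
        also have "i * \<alpha> (z + z') + j * \<beta> (z + z') = (i * \<alpha> z + j * \<beta> z) + (i * \<alpha> z' + j * \<beta> z')"
          using ab_add[OF z] by (simp add: algebra_simps)
        also have "[\<dots> = \<psi> z + \<psi> z'] (mod m)" using fz z by (intro cong_add cong_sym[OF fz])
        finally show "[\<psi> (z + z') = \<psi> z + \<psi> z'] (mod m)" .
      qed
      have "[\<psi> (mv A z) = det2 A * \<psi> z] (mod m)" if "A \<in> S" and z: "z \<in> L" for A z
      proof -
        have Axy: "mv A x \<in> L" "mv A y \<in> L" using inv that(1) basis by auto
        have "mv A z = sm (\<alpha> z) (mv A x) + sm (\<beta> z) (mv A y)"
          using basis(3)[OF z] by (metis mv_linear(1,3))
        then have "[\<psi> (mv A z) = \<psi> (sm (\<alpha> z) (mv A x)) + \<psi> (sm (\<beta> z) (mv A y))] (mod m)"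
          using am Axy add_subgroup_sm[OF L] unfolding add_mod_def by metis
        also have "[\<psi> (sm (\<alpha> z) (mv A x)) + \<psi> (sm (\<beta> z) (mv A y)) = \<alpha> z * (det2 A * i) + \<beta> z * (det2 A * j)] (mod m)"
        proof (intro cong_add)
          show "[\<psi> (sm (\<alpha> z) (mv A x)) = \<alpha> z * (det2 A * i)] (mod m)"
            using cong_trans[OF add_mod_sm[OF L am Axy(1)] cong_mult[OF cong_refl cong_trans[OF fz[OF Axy(1)] conjunct1[OF A[OF that(1)]]]]] .
          show "[\<psi> (sm (\<beta> z) (mv A y)) = \<beta> z * (det2 A * j)] (mod m)"
            using cong_trans[OF add_mod_sm[OF L am Axy(2)] cong_mult[OF cong_refl cong_trans[OF fz[OF Axy(2)] conjunct2[OF A[OF that(1)]]]]] .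
        qed
        also have "\<alpha> z * (det2 A * i) + \<beta> z * (det2 A * j) = det2 A * (i * \<alpha> z + j * \<beta> z)"
          by (simp add: algebra_simps)
        also have "[\<dots> = det2 A * \<psi> z] (mod m)" using fz[OF z] by (intro cong_mult cong_refl cong_sym[OF fz[OF z]])
        finally show ?thesis .
      qed
      moreover have "\<psi> \<in> L \<rightarrow>\<^sub>E {0..<m}" using m by (auto simp: \<psi> f_def)
      ultimately show "\<psi> \<in> Psi m S L" using am by (auto simp: Psi_def)
    next
      fix \<psi> assume \<psi>: "\<psi> \<in> Psi m S L"
      then have am: "add_mod m L \<psi>" and r: "\<And>z. z \<in> L \<Longrightarrow> \<psi> z \<in> {0..<m}" and ext: "\<psi> \<in> extensional L"
        and eq: "\<And>A z. A \<in> S \<Longrightarrow> z \<in> L \<Longrightarrow> [\<psi> (mv A z) = det2 A * \<psi> z] (mod m)"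
        by (auto simp: Psi_def PiE_def)
      have "\<psi> = f (\<psi> x, \<psi> y)"
      proof (rule extensionalityI[OF ext])
        show "f (\<psi> x, \<psi> y) \<in> extensional L" by (simp add: f_def)
        fix z assume z: "z \<in> L"
        show "\<psi> z = f (\<psi> x, \<psi> y) z" using val[OF am z] r[OF z] z by (simp add: f_def cong_def)
      qed
      moreover have "(\<psi> x, \<psi> y) \<in> ?I"
        using r basis(1,2) eq cong_trans[OF cong_sym[OF val[OF am inv]]] by auto
      ultimately show "\<psi> \<in> f ` ?I" by blast
    qed
  qed
  then show ?thesis by (simp add: bij_betw_same_card L_def)
qed

lemma card_Psi_id:
  assumes p: "prime p" and w: "primitive (int p) w"
  shows "card (Psi (int p ^ b) {id2} (lat (int p) e a w)) = p ^ (2 * b)"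
proof -
  have q: "prime (int p)" and m: "int p ^ b > 0" using p by (auto simp: prime_gt_0_nat)
  obtain x y \<alpha> \<beta> where B: "x \<in> lat (int p) e a w" "y \<in> lat (int p) e a w" "wedge x y \<noteq> 0"
    "\<And>z. z \<in> lat (int p) e a w \<Longrightarrow> z = sm (\<alpha> z) x + sm (\<beta> z) y"
    "\<And>i j. \<alpha> (sm i x + sm j y) = i" "\<And>i j. \<beta> (sm i x + sm j y) = j"
    using lat_basis[OF q w] by blast
  have "sm 1 x + sm 0 y = x" "sm 0 x + sm 1 y = y" by (auto simp: sm_def zero_prod_def prod_eq_iff)
  then have xy: "\<alpha> x = 1" "\<beta> x = 0" "\<alpha> y = 0" "\<beta> y = 1" using B(5,6) by metis+
  have "{(i, j). i \<in> {0..<int p ^ b} \<and> j \<in> {0..<int p ^ b}} = {0..<int p ^ b} \<times> {0..<int p ^ b}" by auto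
  then have "card (Psi (int p ^ b) {id2} (lat (int p) e a w)) = card ({0..<int p ^ b} \<times> {0..<int p ^ b})"
    by (subst Psi_basis[OF q w m _ B(1,2,4-6)]) (auto simp: xy)
  then show ?thesis by (simp add: card_cartesian_product nat_power_eq power_mult[symmetric] power2_eq_square[symmetric] mult.commute)
qed

text \<open>The two congruences for \<open>(i, j)\<close> are dependent, because 1 and -1 are the
  eigenvalues of \<open>R\<close>. Since \<open>p\<close> is odd, one of \<open>1 + s\<close> and
  \<open>1 - s\<close> is a unit, so one unknown is a function of the other and the second
  congruence follows.\<close>

lemma card_Psi_reflection:
  assumes p: "prime p" "p \<noteq> 2" and w: "primitive (int p) w" and R: "det2 R = - 1" "tr2 R = 0"
    and inv: "\<And>x. x \<in> lat (int p) e a w \<Longrightarrow> mv R x \<in> lat (int p) e a w"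
  shows "card (Psi (int p ^ b) {id2, R} (lat (int p) e a w)) = p ^ b"
proof -
  define m where "m = int p ^ b"
  have q: "prime (int p)" and m: "m > 0" using p by (auto simp: prime_gt_0_nat m_def)
  obtain x y \<alpha> \<beta> where B: "x \<in> lat (int p) e a w" "y \<in> lat (int p) e a w" "wedge x y \<noteq> 0"
    "\<And>z. z \<in> lat (int p) e a w \<Longrightarrow> z = sm (\<alpha> z) x + sm (\<beta> z) y"
    "\<And>i j. \<alpha> (sm i x + sm j y) = i" "\<And>i j. \<beta> (sm i x + sm j y) = j"
    using lat_basis[OF q w] by blast
  have "sm 1 x + sm 0 y = x" "sm 0 x + sm 1 y = y" by (auto simp: sm_def zero_prod_def prod_eq_iff)
  then have xy: "\<alpha> x = 1" "\<beta> x = 0" "\<alpha> y = 0" "\<beta> y = 1" using B(5,6) by metis+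
  define s t s' t' where st: "s = \<alpha> (mv R x)" "t = \<beta> (mv R x)" "s' = \<alpha> (mv R y)" "t' = \<beta> (mv R y)"
  have Rx: "mv R x = sm s x + sm t y" "mv R y = sm s' x + sm t' y" using B inv st by auto
  \<comment> \<open>Trace and determinant of \<open>R\<close> are transferred to the basis through
    the determinant form, which is nonzero on \<open>x\<close>, \<open>y\<close>. The result is
    \<open>t' = - s\<close> and \<open>s * s + t * s' = 1\<close>.\<close>
  have "wedge (mv R x) y + wedge x (mv R y) = tr2 R * wedge x y"
    by (cases R) (simp add: mv_def wedge_def tr2_def algebra_simps)
  then have "(s + t') * wedge x y = 0" using R unfolding Rx by (simp add: algebra_simps)
  then have t': "t' = - s" using B(3) by simp
  have "wedge (mv R x) (mv R y) = - wedge x y" using R by (simp add: wedge_mv)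
  then have "(s * t' - t * s') * wedge x y = - 1 * wedge x y"
    unfolding Rx by (simp add: algebra_simps wedge_anticommute[of y x])
  then have "s * t' - t * s' = - 1" using B(3) by (metis mult_cancel_right)
  then have d: "s * s + t * s' = 1" by (simp add: t')
  define I where "I = {(i, j). i \<in> {0..<m} \<and> j \<in> {0..<m} \<and>
     [i * (1 + s) + j * t = 0] (mod m) \<and> [i * s' + j * (1 - s) = 0] (mod m)}"
  have cardPsi: "card (Psi m {id2, R} (lat (int p) e a w)) = card I"
    unfolding I_def
    by (subst Psi_basis[OF q w m _ B(1,2,4-6)])
      (use inv R in \<open>auto simp: xy st[symmetric] t' cong_iff_dvd_diff cong_0_iff algebra_simps intro!: arg_cong[of _ _ card]\<close>)
  have "\<not> (int p dvd 1 + s \<and> int p dvd 1 - s)"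
  proof
    assume "int p dvd 1 + s \<and> int p dvd 1 - s"
    then have "int p dvd (1 + s) + (1 - s)" by (metis dvd_add)
    then have "p dvd 2" by (metis add_diff_cancel_left' add_uminus_conv_diff diff_add_cancel int_dvd_int_iff of_nat_numeral one_add_one add.commute add.left_commute)
    then show False using p by (metis primes_dvd_imp_eq two_is_prime_nat)
  qed
  then have "coprime (1 + s) m \<or> coprime (1 - s) m"
    using q unfolding m_def by (metis coprime_commute coprime_power_left_iff prime_imp_coprime)
  then have "card I = nat m"
  proof
    assume cop: "coprime (1 + s) m"
    then obtain r where r: "[(1 + s) * r = 1] (mod m)" using cong_solve_coprime_int by blast
    have "I = (\<lambda>j. ((- (j * t * r)) mod m, j)) ` {0..<m}"
    proof (intro subset_antisym subsetI)
      fix z assume "z \<in> I"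
      then obtain i j where z: "z = (i, j)" "i \<in> {0..<m}" "j \<in> {0..<m}" and e: "[i * (1 + s) + j * t = 0] (mod m)"
        by (auto simp: I_def)
      have "m dvd (i * (1 + s) + j * t) * r - i * ((1 + s) * r - 1)"
        using e r by (auto simp: cong_iff_dvd_diff cong_0_iff)
      moreover have "(i * (1 + s) + j * t) * r - i * ((1 + s) * r - 1) = i - (- (j * t * r))"
        by (simp add: algebra_simps)
      ultimately have "[i = - (j * t * r)] (mod m)" by (simp only: cong_iff_dvd_diff)
      then have "i = (- (j * t * r)) mod m" using z(2) by (simp add: cong_def)
      then show "z \<in> (\<lambda>j. ((- (j * t * r)) mod m, j)) ` {0..<m}" using z by blast
    next
      fix z assume "z \<in> (\<lambda>j. ((- (j * t * r)) mod m, j)) ` {0..<m}"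
      then obtain j where j: "j \<in> {0..<m}" and z: "z = ((- (j * t * r)) mod m, j)" by blast
      define i where "i = (- (j * t * r)) mod m"
      have i: "[i = - (j * t * r)] (mod m)" by (simp add: i_def)
      have "[i * (1 + s) = - (j * t * r) * (1 + s)] (mod m)" using i by (intro cong_mult cong_refl)
      also have "- (j * t * r) * (1 + s) = - (j * t) * ((1 + s) * r)" by (simp add: algebra_simps)
      also have "[\<dots> = - (j * t) * 1] (mod m)" using r by (intro cong_mult cong_refl)
      finally have "[i * (1 + s) + j * t = - (j * t) * 1 + j * t] (mod m)" by (intro cong_add cong_refl)
      then have 1: "[i * (1 + s) + j * t = 0] (mod m)" by simp
      \<comment> \<open>By \<open>s * s + t * s' = 1\<close> the second expression times the unit
        \<open>1 + s\<close> is a multiple of the first.\<close>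
      have "(1 + s) * (i * s' + j * (1 - s)) = s' * (i * (1 + s) + j * t) + j * (1 - (s * s + t * s'))"
        by (simp add: algebra_simps)
      then have "(1 + s) * (i * s' + j * (1 - s)) = s' * (i * (1 + s) + j * t)" using d by simp
      then have "m dvd (1 + s) * (i * s' + j * (1 - s))" using 1 by (simp add: cong_0_iff)
      then have "m dvd i * s' + j * (1 - s)" using cop by (metis coprime_commute coprime_dvd_mult_right_iff)
      then show "z \<in> I" using 1 j m unfolding z I_def i_def[symmetric] by (auto simp: i_def cong_0_iff)
    qed
    then show ?thesis by (simp add: card_image inj_on_def)
  next
    assume cop: "coprime (1 - s) m"
    then obtain r where r: "[(1 - s) * r = 1] (mod m)" using cong_solve_coprime_int by blast
    have "I = (\<lambda>i. (i, (- (i * s' * r)) mod m)) ` {0..<m}"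
    proof (intro subset_antisym subsetI)
      fix z assume "z \<in> I"
      then obtain i j where z: "z = (i, j)" "i \<in> {0..<m}" "j \<in> {0..<m}" and e: "[i * s' + j * (1 - s) = 0] (mod m)"
        by (auto simp: I_def)
      have "m dvd (i * s' + j * (1 - s)) * r - j * ((1 - s) * r - 1)"
        using e r by (auto simp: cong_iff_dvd_diff cong_0_iff)
      moreover have "(i * s' + j * (1 - s)) * r - j * ((1 - s) * r - 1) = j - (- (i * s' * r))"
        by (simp add: algebra_simps)
      ultimately have "[j = - (i * s' * r)] (mod m)" by (simp only: cong_iff_dvd_diff)
      then have "j = (- (i * s' * r)) mod m" using z(3) by (simp add: cong_def)
      then show "z \<in> (\<lambda>i. (i, (- (i * s' * r)) mod m)) ` {0..<m}" using z by blast
    next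
      fix z assume "z \<in> (\<lambda>i. (i, (- (i * s' * r)) mod m)) ` {0..<m}"
      then obtain i where j: "i \<in> {0..<m}" and z: "z = (i, (- (i * s' * r)) mod m)" by blast
      define j where "j = (- (i * s' * r)) mod m"
      have i: "[j = - (i * s' * r)] (mod m)" by (simp add: j_def)
      have "[j * (1 - s) = - (i * s' * r) * (1 - s)] (mod m)" using i by (intro cong_mult cong_refl)
      also have "- (i * s' * r) * (1 - s) = - (i * s') * ((1 - s) * r)" by (simp add: algebra_simps)
      also have "[\<dots> = - (i * s') * 1] (mod m)" using r by (intro cong_mult cong_refl)
      finally have "[i * s' + j * (1 - s) = i * s' + - (i * s') * 1] (mod m)" by (intro cong_add cong_refl)
      then have 1: "[i * s' + j * (1 - s) = 0] (mod m)" by simp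
      have "(1 - s) * (i * (1 + s) + j * t) = t * (i * s' + j * (1 - s)) + i * (1 - (s * s + t * s'))"
        by (simp add: algebra_simps)
      then have "(1 - s) * (i * (1 + s) + j * t) = t * (i * s' + j * (1 - s))" using d by simp
      then have "m dvd (1 - s) * (i * (1 + s) + j * t)" using 1 by (simp add: cong_0_iff)
      then have "m dvd i * (1 + s) + j * t" using cop by (metis coprime_commute coprime_dvd_mult_right_iff)
      then show "z \<in> I" using 1 j m unfolding z I_def j_def[symmetric] by (auto simp: j_def cong_0_iff)
    qed
    then show ?thesis by (simp add: card_image inj_on_def)
  qed
  then show ?thesis using cardPsi by (simp add: m_def nat_power_eq)
qed

section \<open>Normal subgroups over a fixed lattice\<close>

locale heis_ext_p = heis_ext +
  fixes p :: nat
  assumes prime_p: "prime p" and p_index: "\<not> p dvd order (G Mod N)"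
begin

abbreviation q :: int where "q \<equiv> int p"

abbreviation mats :: "mat2 set" where "mats \<equiv> Mat ` carrier G"

lemma prime_q: "prime q" using prime_p by simp

lemma q_pos [simp]: "q ^ b > 0" using prime_p by (simp add: prime_gt_0_nat)

definition Fib :: "(int \<times> int) set \<Rightarrow> nat \<Rightarrow> 'a set set" where
  "Fib L b = {B. B \<lhd> G \<and> B \<subseteq> N \<and> uv ` B = L \<and> (\<forall>l. el 0 0 l \<in> B \<longleftrightarrow> q ^ b dvd l)}"

text \<open>The last condition expresses that commutators of the subgroup with all of
  \<open>N\<close> stay inside it: their central coordinates are \<kappa> times coordinates of
  points of \<open>L\<close>.\<close>

definition admissible :: "(int \<times> int) set \<Rightarrow> nat \<Rightarrow> bool" where
  "admissible L b \<longleftrightarrow> add_subgroup L \<and> (\<forall>A\<in>mats. \<forall>x\<in>L. mv A x \<in> L) \<and>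
     (\<forall>x\<in>L. q ^ b dvd \<kappa> * fst x \<and> q ^ b dvd \<kappa> * snd x)"

lemma admissible_Fib:
  assumes B: "B \<in> Fib L b" shows "admissible L b"
proof -
  have nB: "B \<lhd> G" and BN: "B \<subseteq> N" and L: "uv ` B = L" and z: "\<And>l. el 0 0 l \<in> B \<longleftrightarrow> q ^ b dvd l"
    using B by (auto simp: Fib_def)
  have sB: "subgroup B G" using nB by (rule normal_imp_subgroup)
  have inv: "\<forall>A\<in>mats. \<forall>x\<in>L. mv A x \<in> L"
  proof (intro ballI)
    fix A x assume "A \<in> mats" "x \<in> L"
    then obtain g n where g: "g \<in> carrier G" "A = Mat g" and n: "n \<in> B" "x = uv n" using L by blast
    have "cj g n \<in> B" unfolding cj_def using normal.inv_op_closed2[OF nB g(1) n(1)] .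
    moreover have "uv (cj g n) = mv A x" using g n BN uv_cj by blast
    ultimately show "mv A x \<in> L" using L by (metis imageI)
  qed
  have add: "add_subgroup L" unfolding add_subgroup_def
  proof (intro conjI ballI)
    show "0 \<in> L" using L subgroup.one_closed[OF sB] uv_one by (metis imageI)
    fix x y assume "x \<in> L" "y \<in> L"
    then obtain n m where nm: "n \<in> B" "m \<in> B" "x = uv n" "y = uv m" using L by blast
    then have "n \<otimes> inv m \<in> B" using sB by (simp add: subgroup.m_closed subgroup.m_inv_closed)
    moreover have "uv (n \<otimes> inv m) = x - y"
    proof -
      have "n \<in> N" "m \<in> N" using nm BN by auto
      then show ?thesis by (simp add: nm)
    qed
    ultimately show "x - y \<in> L" using L by (metis imageI)
  qed
  have div: "\<forall>x\<in>L. q ^ b dvd \<kappa> * fst x \<and> q ^ b dvd \<kappa> * snd x"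
  proof
    fix x assume "x \<in> L"
    then obtain n where n: "n \<in> B" "x = uv n" using L by blast
    have nN: "n \<in> N" using n BN by blast
    have com: "n \<otimes> m \<otimes> inv n \<otimes> inv m \<in> B" if "m \<in> N" for m
    proof -
      have "m \<otimes> inv n \<otimes> inv m \<in> B"
        using normal.inv_op_closed2[OF nB, of m "inv n"] n that subgroup.m_inv_closed[OF sB] by simp
      then have "n \<otimes> (m \<otimes> inv n \<otimes> inv m) \<in> B" using n sB by (simp add: subgroup.m_closed)
      then show ?thesis using that nN by (simp add: m_assoc)
    qed
    have "el 0 0 (\<kappa> * v n) \<in> B" using com[of "el 1 0 0"] c_commutator[OF nN, of "el 1 0 0"] by simp
    moreover have "el 0 0 (- (\<kappa> * u n)) \<in> B" using com[of "el 0 1 0"] c_commutator[OF nN, of "el 0 1 0"] by simp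
    ultimately show "q ^ b dvd \<kappa> * fst x \<and> q ^ b dvd \<kappa> * snd x" using z by (simp add: n uv_def)
  qed
  show ?thesis using add inv div by (simp add: admissible_def)
qed

text \<open>A member of \<open>Fib L b\<close> is the graph modulo \<open>q ^ b\<close> of a function on \<open>L\<close>; the conditions on
  this function express closedness under products and under conjugation.\<close>

definition graph_fun :: "(int \<times> int) set \<Rightarrow> nat \<Rightarrow> (int \<times> int \<Rightarrow> int) \<Rightarrow> bool" where
  "graph_fun L b d \<longleftrightarrow> add_mod (q ^ b) L d \<and>
     (\<forall>g\<in>carrier G. \<forall>n\<in>N. uv n \<in> L \<longrightarrow>
        [c (cj g n) = det2 (Mat g) * (c n - d (uv n)) + d (mv (Mat g) (uv n))] (mod q ^ b))"

definition graph_of :: "(int \<times> int) set \<Rightarrow> nat \<Rightarrow> (int \<times> int \<Rightarrow> int) \<Rightarrow> 'a set" where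
  "graph_of L b d = {n \<in> N. uv n \<in> L \<and> [c n = d (uv n)] (mod q ^ b)}"

text \<open>The cocycle \<open>\<kappa> * v n * u m\<close> vanishes modulo \<open>q ^ b\<close> as
  soon as the first factor lies over \<open>L\<close>.\<close>

lemma c_mult_admissible:
  assumes "admissible L b" "n \<in> N" "m \<in> N" "uv n \<in> L"
  shows "[c (n \<otimes> m) = c n + c m] (mod q ^ b)"
proof -
  have "q ^ b dvd \<kappa> * v n" using assms by (auto simp: admissible_def uv_def)
  then have "q ^ b dvd \<kappa> * v n * u m" by simp
  then show ?thesis using assms by (simp add: c_mult cong_iff_dvd_diff)
qed

text \<open>Elements of \<open>N\<close> over the same point differ by a central element, so above
  that point \<open>B\<close> is a single residue class of the central coordinate. A section of
  \<open>B\<close> over \<open>L\<close> supplies representatives of these classes.\<close>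

lemma Fib_graph:
  assumes B: "B \<in> Fib L b"
  obtains d where "graph_fun L b d" "B = graph_of L b d"
proof -
  have nB: "B \<lhd> G" and BN: "B \<subseteq> N" and L: "uv ` B = L" and z: "\<And>l. el 0 0 l \<in> B \<longleftrightarrow> q ^ b dvd l"
    using B by (auto simp: Fib_def)
  have adm: "admissible L b" using B by (rule admissible_Fib)
  have sB: "subgroup B G" using nB by (rule normal_imp_subgroup)
  define s where "s = (\<lambda>x. SOME n. n \<in> B \<and> uv n = x)"
  have s: "s x \<in> B" "uv (s x) = x" "s x \<in> N" if "x \<in> L" for x
  proof -
    have "\<exists>n. n \<in> B \<and> uv n = x" using that L by blast
    from someI_ex[OF this] show "s x \<in> B" "uv (s x) = x" "s x \<in> N" using BN by (auto simp: s_def)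
  qed
  define d where "d = (\<lambda>x. c (s x))"
  have mem: "n \<in> B \<longleftrightarrow> [c n = c m] (mod q ^ b)" if "n \<in> N" "m \<in> B" "uv n = uv m" for n m
  proof -
    have m: "m \<in> N" using that BN by blast
    have "n \<in> B \<longleftrightarrow> n \<otimes> inv m \<in> B"
    proof
      show "n \<in> B \<Longrightarrow> n \<otimes> inv m \<in> B" using that sB by (simp add: subgroup.m_closed subgroup.m_inv_closed)
      assume "n \<otimes> inv m \<in> B"
      then have "n \<otimes> inv m \<otimes> m \<in> B" using that sB by (simp add: subgroup.m_closed)
      then show "n \<in> B" using that m by (simp add: m_assoc)
    qed
    then show ?thesis using same_uv_inv[OF that(1) m that(3)] z by (simp add: cong_iff_dvd_diff)
  qed
  have eq: "B = graph_of L b d"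
  proof (intro subset_antisym subsetI)
    fix n assume n: "n \<in> B"
    then have "n \<in> N" "uv n \<in> L" using BN L by auto
    then show "n \<in> graph_of L b d" using mem[of n "s (uv n)"] s[of "uv n"] n by (simp add: graph_of_def d_def)
  next
    fix n assume "n \<in> graph_of L b d"
    then show "n \<in> B" using mem[of n "s (uv n)"] s[of "uv n"] by (simp add: graph_of_def d_def)
  qed
  have addL: "add_subgroup L" using adm by (simp add: admissible_def)
  have "add_mod (q ^ b) L d" unfolding add_mod_def
  proof (intro ballI)
    fix x y assume xy: "x \<in> L" "y \<in> L"
    have xyL: "x + y \<in> L" using add_subgroup_add[OF addL xy] .
    have "s x \<otimes> s y \<in> B" using s xy sB by (simp add: subgroup.m_closed)
    then have "[c (s x \<otimes> s y) = d (x + y)] (mod q ^ b)"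
      using mem[of "s x \<otimes> s y" "s (x + y)"] s xy xyL by (simp add: d_def)
    moreover have "[c (s x \<otimes> s y) = d x + d y] (mod q ^ b)"
      using c_mult_admissible[OF adm] s xy by (simp add: d_def)
    ultimately show "[d (x + y) = d x + d y] (mod q ^ b)" by (metis cong_sym cong_trans)
  qed
  moreover have "[c (cj g n) = det2 (Mat g) * (c n - d (uv n)) + d (mv (Mat g) (uv n))] (mod q ^ b)"
    if g: "g \<in> carrier G" and n: "n \<in> N" "uv n \<in> L" for g n
  proof -
    have m: "s (uv n) \<in> N" "s (uv n) \<in> B" "uv (s (uv n)) = uv n" using s n by auto
    have gL: "mv (Mat g) (uv n) \<in> L" using adm g n by (auto simp: admissible_def)
    have "cj g (s (uv n)) \<in> B" unfolding cj_def using normal.inv_op_closed2[OF nB g m(2)] .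
    then have "[c (cj g (s (uv n))) = d (mv (Mat g) (uv n))] (mod q ^ b)"
      using mem[of "cj g (s (uv n))" "s (mv (Mat g) (uv n))"] s[OF gL] g m by (simp add: d_def uv_cj)
    moreover have "c (cj g n) = det2 (Mat g) * (c n - d (uv n)) + c (cj g (s (uv n)))"
      using c_cj_mult[OF g m(1), of "c n - c (s (uv n))"] same_uv[OF n(1) m(1) m(3)[symmetric]]
      by (simp add: d_def)
    ultimately show ?thesis by (simp add: cong_add_lcancel)
  qed
  ultimately have "graph_fun L b d" by (simp add: graph_fun_def)
  then show thesis using eq by (rule that)
qed

lemma graph_of_mem_Fib:
  assumes adm: "admissible L b" and d: "graph_fun L b d"
  shows "graph_of L b d \<in> Fib L b"
proof -
  define B where "B = graph_of L b d"
  have L: "add_subgroup L" using adm by (simp add: admissible_def)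
  have add: "add_mod (q ^ b) L d" using d by (simp add: graph_fun_def)
  have d0: "[d 0 = 0] (mod q ^ b)" using add_mod_minus(1)[OF L add] .
  have L0: "0 \<in> L" using L by (simp add: add_subgroup_def)
  have BN: "B \<subseteq> N" by (auto simp: B_def graph_of_def)
  have mult: "n \<otimes> m \<in> B" if "n \<in> B" "m \<in> B" for n m
  proof -
    have nm: "n \<in> N" "m \<in> N" "uv n \<in> L" "uv m \<in> L" "[c n = d (uv n)] (mod q ^ b)" "[c m = d (uv m)] (mod q ^ b)"
      using that by (auto simp: B_def graph_of_def)
    have "[c (n \<otimes> m) = c n + c m] (mod q ^ b)" using c_mult_admissible[OF adm nm(1-3)] .
    also have "[c n + c m = d (uv n) + d (uv m)] (mod q ^ b)" using nm by (intro cong_add)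
    also have "[d (uv n) + d (uv m) = d (uv n + uv m)] (mod q ^ b)"
      using add nm unfolding add_mod_def by (blast intro: cong_sym)
    finally show ?thesis using nm add_subgroup_add[OF L nm(3,4)] by (simp add: B_def graph_of_def)
  qed
  have conj: "cj g n \<in> B" if g: "g \<in> carrier G" and "n \<in> B" for g n
  proof -
    have n: "n \<in> N" "uv n \<in> L" "[c n = d (uv n)] (mod q ^ b)" using that by (auto simp: B_def graph_of_def)
    have "[c (cj g n) = det2 (Mat g) * (c n - d (uv n)) + d (mv (Mat g) (uv n))] (mod q ^ b)"
      using d g n by (auto simp: graph_fun_def)
    also have "[det2 (Mat g) * (c n - d (uv n)) + d (mv (Mat g) (uv n)) = d (mv (Mat g) (uv n))] (mod q ^ b)"
      using n(3) by (simp add: cong_iff_dvd_diff)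
    finally show ?thesis using adm g n by (auto simp: B_def graph_of_def uv_cj admissible_def)
  qed
  have inv: "inv n \<in> B" if "n \<in> B" for n
  proof -
    have n: "n \<in> N" "uv n \<in> L" "[c n = d (uv n)] (mod q ^ b)" using that by (auto simp: B_def graph_of_def)
    have mL: "- uv n \<in> L" using L L0 n by (metis add_subgroup_def diff_0)
    have "[c (n \<otimes> inv n) = c n + c (inv n)] (mod q ^ b)" using c_mult_admissible[OF adm n(1) _ n(2), of "inv n"] n by simp
    then have "[c (inv n) = - c n] (mod q ^ b)" using n by (simp add: cong_iff_dvd_diff) (metis add.commute dvd_minus_iff minus_add_distrib add_uminus_conv_diff diff_minus_eq_add)
    also have "[- c n = - d (uv n)] (mod q ^ b)" using n by (simp add: cong_minus_minus_iff)
    also have "[- d (uv n) = d (- uv n)] (mod q ^ b)" using add_mod_minus(2)[OF L add n(2)] by (rule cong_sym)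
    finally show ?thesis using n mL by (simp add: B_def graph_of_def)
  qed
  have "\<one> \<in> B" using L0 d0 by (simp add: B_def graph_of_def cong_sym)
  then have sB: "subgroup B G" using BN mult inv by (intro subgroupI) auto
  have "B \<lhd> G" using sB conj unfolding normal_inv_iff cj_def by blast
  moreover have "uv ` B = L"
  proof (intro subset_antisym subsetI)
    fix x assume "x \<in> L"
    then have "el (fst x) (snd x) (d x) \<in> B" by (simp add: B_def graph_of_def)
    moreover have "uv (el (fst x) (snd x) (d x)) = x" by simp
    ultimately show "x \<in> uv ` B" by (metis imageI)
  qed (auto simp: B_def graph_of_def)
  moreover have "el 0 0 l \<in> B \<longleftrightarrow> q ^ b dvd l" for l
  proof -
    have "[l = d 0] (mod q ^ b) \<longleftrightarrow> [l = 0] (mod q ^ b)" using d0 by (metis cong_sym cong_trans)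
    then show ?thesis using L0 by (simp add: B_def graph_of_def cong_0_iff zero_prod_def)
  qed
  ultimately show ?thesis using BN by (simp add: Fib_def B_def)
qed

lemma graph_of_eq_iff:
  "graph_of L b d = graph_of L b d' \<longleftrightarrow> (\<forall>x\<in>L. [d x = d' x] (mod q ^ b))"
proof
  assume eq: "graph_of L b d = graph_of L b d'"
  show "\<forall>x\<in>L. [d x = d' x] (mod q ^ b)"
  proof
    fix x assume "x \<in> L"
    then have "el (fst x) (snd x) (d x) \<in> graph_of L b d" by (simp add: graph_of_def)
    then show "[d x = d' x] (mod q ^ b)" unfolding eq by (simp add: graph_of_def)
  qed
next
  assume "\<forall>x\<in>L. [d x = d' x] (mod q ^ b)"
  then show "graph_of L b d = graph_of L b d'" unfolding graph_of_def by (metis (no_types, lifting) cong_sym cong_trans)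
qed

text \<open>The coordinate \<open>c (cj g n)\<close> enters the condition of
  \<open>graph_fun\<close> as an inhomogeneous term. It cancels in a difference and leaves the
  linear equivariance of \<open>Psi\<close>.\<close>

lemma graph_fun_diff:
  assumes adm: "admissible L b" and d: "graph_fun L b d" "graph_fun L b d'"
  shows "(\<lambda>x\<in>L. (d' x - d x) mod q ^ b) \<in> Psi (q ^ b) mats L"
proof -
  define \<psi> where "\<psi> = (\<lambda>x\<in>L. (d' x - d x) mod q ^ b)"
  have psi: "[\<psi> x = d' x - d x] (mod q ^ b)" if "x \<in> L" for x using that by (simp add: \<psi>_def)
  have L: "add_subgroup L" using adm by (simp add: admissible_def)
  have "add_mod (q ^ b) L \<psi>" unfolding add_mod_def
  proof (intro ballI)
    fix x y assume xy: "x \<in> L" "y \<in> L"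
    have "[\<psi> (x + y) = d' (x + y) - d (x + y)] (mod q ^ b)" using psi add_subgroup_add[OF L xy] .
    also have "[d' (x + y) - d (x + y) = (d' x + d' y) - (d x + d y)] (mod q ^ b)"
      using d xy by (intro cong_diff) (auto simp: graph_fun_def add_mod_def)
    also have "(d' x + d' y) - (d x + d y) = (d' x - d x) + (d' y - d y)" by simp
    also have "[\<dots> = \<psi> x + \<psi> y] (mod q ^ b)" using xy by (intro cong_add cong_sym[OF psi])
    finally show "[\<psi> (x + y) = \<psi> x + \<psi> y] (mod q ^ b)" .
  qed
  moreover have "[\<psi> (mv A x) = det2 A * \<psi> x] (mod q ^ b)" if A: "A \<in> mats" and x: "x \<in> L" for A x
  proof -
    obtain g where g: "g \<in> carrier G" "A = Mat g" using A by blast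
    define n where "n = el (fst x) (snd x) 0"
    have n: "n \<in> N" "uv n = x" by (auto simp: n_def)
    have "[c (cj g n) = det2 A * (c n - d x) + d (mv A x)] (mod q ^ b)"
      "[c (cj g n) = det2 A * (c n - d' x) + d' (mv A x)] (mod q ^ b)"
      using d g n x by (auto simp: graph_fun_def)
    then have "[det2 A * (c n - d' x) + d' (mv A x) = det2 A * (c n - d x) + d (mv A x)] (mod q ^ b)"
      by (metis cong_sym cong_trans)
    then have "[d' (mv A x) - d (mv A x) = det2 A * (d' x - d x)] (mod q ^ b)"
      by (simp add: cong_iff_dvd_diff algebra_simps)
    moreover have "mv A x \<in> L" using adm A x by (auto simp: admissible_def)
    ultimately show ?thesis
      using psi x cong_trans[OF psi cong_trans[OF _ cong_mult[OF cong_refl cong_sym[OF psi[OF x]]]]] by blast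
  qed
  moreover have "z mod q ^ b \<in> {0..<q ^ b}" for z
    using q_pos[of b] by (meson atLeastLessThan_iff pos_mod_bound pos_mod_sign)
  then have "\<psi> \<in> L \<rightarrow>\<^sub>E {0..<q ^ b}" by (simp add: \<psi>_def PiE_iff)
  ultimately show ?thesis unfolding Psi_def \<psi>_def by blast
qed

lemma graph_fun_add:
  assumes adm: "admissible L b" and d: "graph_fun L b d" and \<psi>: "\<psi> \<in> Psi (q ^ b) mats L"
  shows "graph_fun L b (\<lambda>x. d x + \<psi> x)"
  unfolding graph_fun_def
proof (intro conjI ballI impI)
  show "add_mod (q ^ b) L (\<lambda>x. d x + \<psi> x)" unfolding add_mod_def
  proof (intro ballI)
    fix x y assume xy: "x \<in> L" "y \<in> L"
    have "[d (x + y) + \<psi> (x + y) = (d x + d y) + (\<psi> x + \<psi> y)] (mod q ^ b)"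
      using d \<psi> xy by (intro cong_add) (auto simp: graph_fun_def add_mod_def Psi_def)
    then show "[d (x + y) + \<psi> (x + y) = d x + \<psi> x + (d y + \<psi> y)] (mod q ^ b)" by (simp add: algebra_simps)
  qed
  fix g n assume g: "g \<in> carrier G" and n: "n \<in> N" "uv n \<in> L"
  have 1: "[c (cj g n) = det2 (Mat g) * (c n - d (uv n)) + d (mv (Mat g) (uv n))] (mod q ^ b)"
    using d g n by (auto simp: graph_fun_def)
  have 2: "[\<psi> (mv (Mat g) (uv n)) = det2 (Mat g) * \<psi> (uv n)] (mod q ^ b)"
    using \<psi> g n by (auto simp: Psi_def)
  have "[c (cj g n) + \<psi> (mv (Mat g) (uv n)) = det2 (Mat g) * (c n - d (uv n)) + d (mv (Mat g) (uv n)) + det2 (Mat g) * \<psi> (uv n)] (mod q ^ b)"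
    using 1 2 by (rule cong_add)
  then show "[c (cj g n) = det2 (Mat g) * (c n - (d (uv n) + \<psi> (uv n))) + (d (mv (Mat g) (uv n)) + \<psi> (mv (Mat g) (uv n)))] (mod q ^ b)"
    using cong_diff[OF 1 2] cong_diff[OF _ cong_refl] 2
    by (simp add: cong_iff_dvd_diff algebra_simps)
qed

lemma card_Fib:
  assumes adm: "admissible L b" and d: "graph_fun L b d"
  shows "card (Fib L b) = card (Psi (q ^ b) mats L)"
proof -
  have "bij_betw (\<lambda>\<psi>. graph_of L b (\<lambda>x. d x + \<psi> x)) (Psi (q ^ b) mats L) (Fib L b)"
  proof (rule bij_betw_imageI)
    show "inj_on (\<lambda>\<psi>. graph_of L b (\<lambda>x. d x + \<psi> x)) (Psi (q ^ b) mats L)"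
    proof (rule inj_onI)
      fix \<psi> \<psi>' assume psi: "\<psi> \<in> Psi (q ^ b) mats L" "\<psi>' \<in> Psi (q ^ b) mats L"
        and "graph_of L b (\<lambda>x. d x + \<psi> x) = graph_of L b (\<lambda>x. d x + \<psi>' x)"
      then have "\<forall>x\<in>L. [\<psi> x = \<psi>' x] (mod q ^ b)" unfolding graph_of_eq_iff by (simp add: cong_add_lcancel)
      moreover have "\<psi> x \<in> {0..<q ^ b}" "\<psi>' x \<in> {0..<q ^ b}" if "x \<in> L" for x
        using psi that by (auto simp: Psi_def PiE_iff)
      ultimately have "\<psi> x = \<psi>' x" if "x \<in> L" for x using that by (fastforce simp: cong_def)
      moreover have "\<psi> \<in> extensional L" "\<psi>' \<in> extensional L" using psi by (auto simp: Psi_def PiE_def)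
      ultimately show "\<psi> = \<psi>'" by (metis extensionalityI)
    qed
    show "(\<lambda>\<psi>. graph_of L b (\<lambda>x. d x + \<psi> x)) ` Psi (q ^ b) mats L = Fib L b"
    proof (intro subset_antisym subsetI)
      fix B assume "B \<in> (\<lambda>\<psi>. graph_of L b (\<lambda>x. d x + \<psi> x)) ` Psi (q ^ b) mats L"
      then show "B \<in> Fib L b" using graph_of_mem_Fib[OF adm graph_fun_add[OF adm d]] by blast
    next
      fix B assume "B \<in> Fib L b"
      then obtain d' where d': "graph_fun L b d'" "B = graph_of L b d'" by (rule Fib_graph)
      define \<psi> where "\<psi> = (\<lambda>x\<in>L. (d' x - d x) mod q ^ b)"
      have "B = graph_of L b (\<lambda>x. d x + \<psi> x)"
        unfolding d' graph_of_eq_iff by (auto simp: \<psi>_def cong_def mod_simps)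
      then show "B \<in> (\<lambda>\<psi>. graph_of L b (\<lambda>x. d x + \<psi> x)) ` Psi (q ^ b) mats L"
        using graph_fun_diff[OF adm d d'(1)] unfolding \<psi>_def by blast
    qed
  qed
  then show ?thesis by (simp add: bij_betw_same_card)
qed

lemma card_rcosets_N: "order (G Mod N) = card (rcosets N)"
  by (simp add: order_def FactGroup_def)

text \<open>Summing transported central coordinates over the cosets gives a function
  \<open>C\<close> that, modulo \<open>q ^ b\<close>, is additive over \<open>L\<close>,
  equivariant, and shifts by \<open>P * l\<close> under central translation by \<open>l\<close>. As
  \<open>P\<close> is invertible modulo \<open>q ^ b\<close>, the zeros of \<open>C\<close> over
  \<open>L\<close> form the required graph.\<close>

lemma graph_fun_exists:
  assumes adm: "admissible L b"
  shows "\<exists>d. graph_fun L b d"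
proof -
  define m where "m = q ^ b"
  have L: "add_subgroup L" and Linv: "\<And>g x. g \<in> carrier G \<Longrightarrow> x \<in> L \<Longrightarrow> mv (Mat g) x \<in> L"
    using adm by (auto simp: admissible_def)
  define rep where "rep = (\<lambda>X. SOME g. g \<in> carrier G \<and> N #> g = X)"
  have rep: "rep X \<in> carrier G" "N #> rep X = X" if "X \<in> rcosets N" for X
  proof -
    have "\<exists>g. g \<in> carrier G \<and> N #> g = X" using that by (auto simp: RCOSETS_def)
    from someI_ex[OF this] show "rep X \<in> carrier G" "N #> rep X = X" by (auto simp: rep_def)
  qed
  \<comment> \<open>Transport of the central coordinate along \<open>g\<close>. The twist by the
    determinant makes a central translation by \<open>l\<close> change the value by \<open>l\<close>
    itself.\<close>
  define t where "t = (\<lambda>g n. det2 (Mat g) * c (cj (inv g) n))"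
  define C where "C = (\<lambda>n. \<Sum>X\<in>rcosets N. t (rep X) n)"
  define P where "P = int (card (rcosets N))"
  have copP: "coprime P m"
    using p_index prime_p unfolding P_def m_def card_rcosets_N
    by (simp add: coprime_commute prime_imp_coprime)
  then obtain P' where P': "[P * P' = 1] (mod m)" using cong_solve_coprime_int by blast
  have cm: "[c (n \<otimes> k) = c n + c k] (mod m)" if "n \<in> N" "k \<in> N" "uv n \<in> L" for n k
    using c_mult_admissible[OF adm that] by (simp add: m_def)
  have uvL: "uv (cj g n) \<in> L" if "g \<in> carrier G" "n \<in> N" "uv n \<in> L" for g n
    using that Linv by (simp add: uv_cj)
  have t_add: "[t g (n \<otimes> k) = t g n + t g k] (mod m)"
    if "g \<in> carrier G" "n \<in> N" "k \<in> N" "uv n \<in> L" for g n k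
  proof -
    have "[det2 (Mat g) * c (cj (inv g) n \<otimes> cj (inv g) k) = det2 (Mat g) * (c (cj (inv g) n) + c (cj (inv g) k))] (mod m)"
      using cm[of "cj (inv g) n" "cj (inv g) k"] that uvL by (intro cong_mult cong_refl) auto
    then show ?thesis using that by (simp add: t_def cj_mult algebra_simps)
  qed
  have C_add: "[C (n \<otimes> k) = C n + C k] (mod m)" if "n \<in> N" "k \<in> N" "uv n \<in> L" for n k
  proof -
    have "[C (n \<otimes> k) = (\<Sum>X\<in>rcosets N. t (rep X) n + t (rep X) k)] (mod m)"
      unfolding C_def using rep t_add that by (intro cong_sum) auto
    then show ?thesis by (simp add: C_def sum.distrib)
  qed
  have t_el0: "t g (el 0 0 l \<otimes> n) = l + t g n" if "g \<in> carrier G" "n \<in> N" for g n l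
  proof -
    have "det2 (Mat g) * det2 (Mat (inv g)) = 1" using det_Mat(2)[OF that(1)] .
    then have "det2 (Mat g) * (det2 (Mat (inv g)) * l) = l" by (metis mult.assoc mult_1)
    then show ?thesis using that by (simp add: t_def c_cj_mult distrib_left)
  qed
  have C_el0: "C (el 0 0 l \<otimes> n) = P * l + C n" if "n \<in> N" for n l
  proof -
    have "C (el 0 0 l \<otimes> n) = (\<Sum>X\<in>rcosets N. l + t (rep X) n)"
      unfolding C_def using rep t_el0 that by (intro sum.cong) auto
    then show ?thesis by (simp add: C_def P_def sum.distrib)
  qed
  \<comment> \<open>Changing the representative by an element of \<open>N\<close> alters the central
    coordinate by that of a commutator, which is \<kappa> times a combination of coordinates of a
    point of \<open>L\<close> and so vanishes modulo \<open>m\<close>.\<close>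
  have t_N: "[t (k \<otimes> g) n = t g n] (mod m)"
    if g: "g \<in> carrier G" and k: "k \<in> N" and n: "n \<in> N" "uv n \<in> L" for g k n
  proof -
    define n' where "n' = cj (inv k) n"
    have n': "n' \<in> N" "uv n' = uv n" using k n by (auto simp: n'_def uv_cj Mat_N)
    have "n' \<otimes> inv n = el 0 0 (c n' - c n)" using same_uv_inv n' n by simp
    moreover have "n' \<otimes> inv n = inv k \<otimes> n \<otimes> inv (inv k) \<otimes> inv n" by (simp add: n'_def cj_def)
    moreover have "\<dots> = el 0 0 (\<kappa> * (v (inv k) * u n - v n * u (inv k)))"
      using c_commutator[of "inv k" n] k n by simp
    ultimately have "c n' - c n = \<kappa> * (v (inv k) * u n - v n * u (inv k))" by (metis el(4))
    moreover have "m dvd \<kappa> * u n" "m dvd \<kappa> * v n" using adm n by (auto simp: admissible_def uv_def m_def)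
    then have "m dvd v (inv k) * (\<kappa> * u n) - u (inv k) * (\<kappa> * v n)" by simp
    moreover have "v (inv k) * (\<kappa> * u n) - u (inv k) * (\<kappa> * v n) = \<kappa> * (v (inv k) * u n - v n * u (inv k))"
      by (simp add: algebra_simps)
    ultimately have d: "m dvd c n' - c n" by simp
    have "t (k \<otimes> g) n = det2 (Mat g) * c (cj (inv g) n')"
      using g k n by (simp add: t_def n'_def Mat_mult Mat_N inv_mult_group cj_comp)
    also have "\<dots> = t g (el 0 0 (c n' - c n) \<otimes> n)" using same_uv[OF n'(1) n(1) n'(2)] by (simp add: t_def)
    also have "\<dots> = (c n' - c n) + t g n" using t_el0[OF g n(1)] .
    finally show ?thesis using d by (simp add: cong_iff_dvd_diff)
  qed
  have t_coset: "[t g n = t (rep (N #> g)) n] (mod m)" if "g \<in> carrier G" "n \<in> N" "uv n \<in> L" for g n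
  proof -
    have X: "N #> g \<in> rcosets N" using that subgroup.subset[OF subgroup_N] by (simp add: rcosetsI)
    have "rep (N #> g) \<in> N #> g" using rep[OF X] subgroup_N rcos_self by metis
    then obtain k where "k \<in> N" "rep (N #> g) = k \<otimes> g" by (auto simp: r_coset_def)
    then show ?thesis using t_N[OF that(1) _ that(2,3)] by (simp add: cong_sym)
  qed
  have C_cj: "[C (cj h n) = det2 (Mat h) * C n] (mod m)" if h: "h \<in> carrier G" and n: "n \<in> N" "uv n \<in> L" for h n
  proof -
    \<comment> \<open>Left multiplication by \<open>inv h\<close> permutes the cosets of the normal
      subgroup \<open>N\<close>, so the sum is only rearranged, up to the factor
      \<open>det2 (Mat h)\<close>.\<close>
    define \<pi> where "\<pi> = (\<lambda>X. N #> (inv h \<otimes> rep X))"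
    have \<pi>: "\<pi> X \<in> rcosets N" if "X \<in> rcosets N" for X
      unfolding \<pi>_def using that rep h subgroup.subset[OF subgroup_N] by (simp add: rcosetsI)
    have inj: "inj_on \<pi> (rcosets N)"
    proof (rule inj_onI)
      fix X Y assume XY: "X \<in> rcosets N" "Y \<in> rcosets N" "\<pi> X = \<pi> Y"
      then have "inv h \<otimes> rep X \<in> N #> (inv h \<otimes> rep Y)"
        unfolding \<pi>_def using repr_independenceD[OF subgroup_N, of "inv h \<otimes> rep X" "inv h \<otimes> rep Y"] rep h by simp
      then obtain k where k: "k \<in> N" "inv h \<otimes> rep X = k \<otimes> (inv h \<otimes> rep Y)" by (auto simp: r_coset_def)
      have "rep X = h \<otimes> (inv h \<otimes> rep X)" using rep[OF XY(1)] h by (simp add: m_assoc[symmetric])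
      also have "\<dots> = cj h k \<otimes> rep Y" unfolding k(2) using rep[OF XY(2)] h k by (simp add: cj_def m_assoc)
      finally have "rep X \<in> N #> rep Y" using k h by (auto simp: r_coset_def)
      then show "X = Y" using rep XY repr_independence[OF _ _ subgroup_N] by metis
    qed
    have img: "\<pi> ` (rcosets N) = rcosets N"
      using inj \<pi> by (intro endo_inj_surj[OF finite_index]) auto
    have "C (cj h n) = (\<Sum>X\<in>rcosets N. det2 (Mat h) * t (inv h \<otimes> rep X) n)"
      unfolding C_def
    proof (intro sum.cong refl)
      fix X assume X: "X \<in> rcosets N"
      have "det2 (Mat (rep X)) = det2 (Mat h) * det2 (Mat (inv h \<otimes> rep X))"
        using rep[OF X] h det_Mat(2)[OF h] by (simp add: Mat_mult det2_mm mult.assoc[symmetric])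
      moreover have "cj (inv (rep X)) (cj h n) = cj (inv (inv h \<otimes> rep X)) n"
        using rep[OF X] h n by (simp add: cj_comp[symmetric] inv_mult_group)
      ultimately show "t (rep X) (cj h n) = det2 (Mat h) * t (inv h \<otimes> rep X) n" by (simp add: t_def)
    qed
    also have "[\<dots> = (\<Sum>X\<in>rcosets N. det2 (Mat h) * t (rep (\<pi> X)) n)] (mod m)"
      unfolding \<pi>_def using rep h n by (intro cong_sum cong_mult cong_refl t_coset) auto
    also have "(\<Sum>X\<in>rcosets N. det2 (Mat h) * t (rep (\<pi> X)) n) = det2 (Mat h) * (\<Sum>X\<in>rcosets N. t (rep (\<pi> X)) n)"
      by (simp add: sum_distrib_left)
    also have "(\<Sum>X\<in>rcosets N. t (rep (\<pi> X)) n) = (\<Sum>Y\<in>\<pi> ` (rcosets N). t (rep Y) n)"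
      using inj by (simp add: sum.reindex)
    also have "\<dots> = C n" by (simp add: img C_def)
    finally show ?thesis .
  qed
  \<comment> \<open>Solved from \<open>C n = P * (c n - d (uv n))\<close> at the lift with central
    coordinate 0; \<open>P'\<close> is the inverse of \<open>P\<close> modulo
    \<open>m\<close>.\<close>
  define d where "d = (\<lambda>x. - P' * C (el (fst x) (snd x) 0))"
  have Cn: "[C n = P * (c n - d (uv n))] (mod m)" if n: "n \<in> N" for n
  proof -
    define n0 where "n0 = el (u n) (v n) 0"
    have "n = el 0 0 (c n) \<otimes> n0" using same_uv[of n n0] n by (simp add: n0_def uv_def)
    then have "C n = P * c n + C n0" using C_el0[of n0 "c n"] by (simp add: n0_def)
    moreover have "[(P * P') * C n0 = 1 * C n0] (mod m)" using P' by (intro cong_mult cong_refl)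
    then have "[P * c n + C n0 = P * c n + (P * P') * C n0] (mod m)"
      by (simp add: cong_add_lcancel cong_sym)
    ultimately show ?thesis by (simp add: d_def n0_def algebra_simps)
  qed
  have cancelP: "[x = y] (mod m)" if "[P * x = P * y] (mod m)" for x y
    using that copP by (metis cong_mult_lcancel coprime_commute)
  have "add_mod m L d" unfolding add_mod_def
  proof (intro ballI)
    fix x y assume xy: "x \<in> L" "y \<in> L"
    define n k where "n = el (fst x) (snd x) 0" and "k = el (fst y) (snd y) 0"
    have nk: "n \<in> N" "k \<in> N" "uv n = x" "uv k = y" "c n = 0" "c k = 0" by (auto simp: n_def k_def)
    have "[P * (c (n \<otimes> k) - d (x + y)) = P * (c n - d x) + P * (c k - d y)] (mod m)"
      using cong_trans[OF cong_sym[OF Cn[of "n \<otimes> k"]] cong_trans[OF C_add[OF nk(1,2)] cong_add[OF Cn[OF nk(1)] Cn[OF nk(2)]]]] nk xy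
      by simp
    then have "[P * (c (n \<otimes> k) - d (x + y)) = P * (- d x - d y)] (mod m)" by (simp add: nk algebra_simps)
    then have 1: "[c (n \<otimes> k) - d (x + y) = - d x - d y] (mod m)" by (rule cancelP)
    have 2: "[c (n \<otimes> k) = 0] (mod m)" using cm[OF nk(1,2)] xy nk by simp
    from cong_diff[OF 2 1] show "[d (x + y) = d x + d y] (mod m)" by (simp add: add.commute)
  qed
  moreover have "[c (cj g n) = det2 (Mat g) * (c n - d (uv n)) + d (mv (Mat g) (uv n))] (mod m)"
    if g: "g \<in> carrier G" and n: "n \<in> N" "uv n \<in> L" for g n
  proof -
    have "[P * (c (cj g n) - d (uv (cj g n))) = det2 (Mat g) * (P * (c n - d (uv n)))] (mod m)"
      using cong_trans[OF cong_sym[OF Cn[of "cj g n"]] cong_trans[OF C_cj[OF g n] cong_mult[OF cong_refl Cn[OF n(1)]]]] g n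
      by simp
    then have "[P * (c (cj g n) - d (uv (cj g n))) = P * (det2 (Mat g) * (c n - d (uv n)))] (mod m)"
      by (simp add: mult.left_commute)
    then have "[c (cj g n) - d (uv (cj g n)) = det2 (Mat g) * (c n - d (uv n))] (mod m)" by (rule cancelP)
    then have "[c (cj g n) - d (uv (cj g n)) + d (uv (cj g n)) = det2 (Mat g) * (c n - d (uv n)) + d (uv (cj g n))] (mod m)"
      by (intro cong_add cong_refl)
    then show ?thesis using g n by (simp add: uv_cj)
  qed
  ultimately show ?thesis unfolding graph_fun_def m_def by blast
qed

lemma card_Fib_admissible: "admissible L b \<Longrightarrow> card (Fib L b) = card (Psi (q ^ b) mats L)"
  using graph_fun_exists card_Fib by blast

lemma Fib_not_admissible: "\<not> admissible L b \<Longrightarrow> Fib L b = {}"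
  using admissible_Fib by blast

end

section \<open>Indices of the normal subgroups\<close>

lemma (in group) card_rcosets_detect:
  assumes B: "subgroup B G" and f: "\<And>n m. n \<in> carrier G \<Longrightarrow> m \<in> carrier G \<Longrightarrow> f n = f m \<longleftrightarrow> n \<otimes> inv m \<in> B"
  shows "card (rcosets B) = card (f ` carrier G)"
proof -
  define F where "F = (\<lambda>X. f (SOME n. n \<in> carrier G \<and> B #> n = X))"
  have eq: "B #> n = B #> m \<longleftrightarrow> n \<otimes> inv m \<in> B" if "n \<in> carrier G" "m \<in> carrier G" for n m
  proof
    assume "B #> n = B #> m"
    then have "n \<in> B #> m" using rcos_self[OF that(1) B] by simp
    then show "n \<otimes> inv m \<in> B" using subgroup.rcos_module[OF B group_axioms that(2,1)] by simp
  next
    assume "n \<otimes> inv m \<in> B"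
    then have "n \<in> B #> m" using subgroup.rcos_module[OF B group_axioms that(2,1)] by simp
    then show "B #> n = B #> m" using repr_independence[OF _ that(2) B] by simp
  qed
  have F: "F (B #> n) = f n" if n: "n \<in> carrier G" for n
  proof -
    have "\<exists>m. m \<in> carrier G \<and> B #> m = B #> n" using n by blast
    from someI_ex[OF this] show ?thesis using eq f n unfolding F_def by metis
  qed
  have "bij_betw F (rcosets B) (f ` carrier G)"
  proof (rule bij_betw_imageI)
    show "inj_on F (rcosets B)"
    proof (rule inj_onI)
      fix X Y assume "X \<in> rcosets B" "Y \<in> rcosets B" and F': "F X = F Y"
      then obtain n m where "n \<in> carrier G" "m \<in> carrier G" "X = B #> n" "Y = B #> m"
        by (auto simp: RCOSETS_def)
      then show "X = Y" using F' F eq f by metis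
    qed
    show "F ` (rcosets B) = f ` carrier G"
      by (force simp: RCOSETS_def F)
  qed
  then show ?thesis by (rule bij_betw_same_card)
qed

lemma diff_eq_mult_div_diff: "x mod m = y mod m \<Longrightarrow> x - y = m * (x div m - y div m)" for m :: int
  by (metis add_diff_cancel_right mult_div_mod_eq right_diff_distrib)

context heis_ext_p
begin

lemma group_GN: "group GN"
  using subgroup_N subgroup_imp_group by blast

lemma inv_GN: "n \<in> N \<Longrightarrow> inv\<^bsub>GN\<^esub> n = inv n"
  using m_inv_consistent[OF subgroup_N] by simp

lemma subgroup_GN: "subgroup B G \<Longrightarrow> B \<subseteq> N \<Longrightarrow> subgroup B GN"
  using subgroup_incl[OF _ subgroup_N] by blast

text \<open>The point modulo \<open>L\<close> contributes \<open>p ^ (2 * e + a)\<close> values and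
  the central coordinate \<open>p ^ b\<close>. The latter behaves additively over \<open>L\<close>
  only, so it is measured after dividing by a chosen representative of the class of the
  point.\<close>

lemma index_Fib:
  assumes w: "primitive q w" and B: "B \<in> Fib (lat q e a w) b"
  shows "card (rcosets\<^bsub>GN\<^esub> B) = p ^ (2 * e + a + b)"
proof -
  define L where "L = lat q e a w"
  have q0: "q \<noteq> 0" using prime_q by auto
  have BL: "B \<in> Fib L b" using B by (simp add: L_def)
  have nB: "B \<lhd> G" and BN: "B \<subseteq> N" using B by (auto simp: Fib_def)
  have sB: "subgroup B G" using nB by (rule normal_imp_subgroup)
  have adm: "admissible L b" using BL by (rule admissible_Fib)
  have L: "add_subgroup L" using adm by (simp add: admissible_def)
  obtain d where d: "graph_fun L b d" "B = graph_of L b d" using Fib_graph[OF BL] .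
  have addd: "add_mod (q ^ b) L d" using d by (simp add: graph_fun_def)
  \<comment> \<open>A complete invariant of the plane modulo \<open>L\<close>: the residues modulo
    \<open>q ^ e\<close>, and the determinant with \<open>w\<close> of the two quotients, taken
    modulo \<open>q ^ a\<close>.\<close>
  define s where "s = (\<lambda>x. (fst x mod q ^ e, snd x mod q ^ e,
     (fst w * (snd x div q ^ e) - snd w * (fst x div q ^ e)) mod q ^ a))"
  have s_eq: "s x = s y \<longleftrightarrow> x - y \<in> L" for x y
  proof
    assume "s x = s y"
    then have 1: "fst x mod q ^ e = fst y mod q ^ e" "snd x mod q ^ e = snd y mod q ^ e"
      and 2: "q ^ a dvd (fst w * (snd x div q ^ e) - snd w * (fst x div q ^ e)) - (fst w * (snd y div q ^ e) - snd w * (fst y div q ^ e))"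
      by (auto simp: s_def mod_eq_dvd_iff)
    define z where "z = (fst x div q ^ e - fst y div q ^ e, snd x div q ^ e - snd y div q ^ e)"
    have "fst x - fst y = q ^ e * fst z" "snd x - snd y = q ^ e * snd z"
      using diff_eq_mult_div_diff[OF 1(1)] diff_eq_mult_div_diff[OF 1(2)] by (simp_all add: z_def)
    then have "x - y = sm (q ^ e) z" by (simp add: prod_eq_iff)
    moreover have "q ^ a dvd wedge w z" using 2 by (simp add: wedge_def z_def algebra_simps)
    ultimately show "x - y \<in> L" unfolding L_def lat_def by blast
  next
    assume "x - y \<in> L"
    then obtain z where z: "x - y = sm (q ^ e) z" "q ^ a dvd wedge w z" unfolding L_def lat_def by blast
    then have x: "fst x = fst y + q ^ e * fst z" "snd x = snd y + q ^ e * snd z"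
      by (simp_all add: prod_eq_iff algebra_simps)
    have "q ^ a dvd (fst w * (snd x div q ^ e) - snd w * (fst x div q ^ e)) - (fst w * (snd y div q ^ e) - snd w * (fst y div q ^ e))"
      using z(2) q0 by (simp add: x wedge_def algebra_simps)
    then show "s x = s y" by (simp add: s_def x mod_eq_dvd_iff)
  qed
  have s_img: "s ` UNIV = {0..<q ^ e} \<times> {0..<q ^ e} \<times> {0..<q ^ a}"
  proof (intro subset_antisym subsetI)
    fix y assume "y \<in> s ` UNIV"
    moreover have "z mod q ^ f \<in> {0..<q ^ f}" for z f
      using q_pos[of f] by (meson atLeastLessThan_iff pos_mod_bound pos_mod_sign)
    ultimately show "y \<in> {0..<q ^ e} \<times> {0..<q ^ e} \<times> {0..<q ^ a}" unfolding s_def by blast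
  next
    fix y assume "y \<in> {0..<q ^ e} \<times> {0..<q ^ e} \<times> {0..<q ^ a}"
    then obtain i j l where y: "y = (i, j, l)" "i \<in> {0..<q ^ e}" "j \<in> {0..<q ^ e}" "l \<in> {0..<q ^ a}" by blast
    have "coprime (fst w) (q ^ a) \<or> coprime (snd w) (q ^ a)"
      using w prime_q unfolding primitive_def by (metis coprime_commute coprime_power_left_iff prime_imp_coprime)
    then have "\<exists>z. [wedge w z = l] (mod q ^ a)"
    proof
      assume "coprime (fst w) (q ^ a)"
      then obtain r where r: "[fst w * r = 1] (mod q ^ a)" using cong_solve_coprime_int by blast
      then have "[fst w * r * l = 1 * l] (mod q ^ a)" by (intro cong_mult cong_refl)
      then show ?thesis by (intro exI[of _ "(0, r * l)"]) (simp add: wedge_def mult.assoc)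
    next
      assume "coprime (snd w) (q ^ a)"
      then obtain r where r: "[snd w * r = 1] (mod q ^ a)" using cong_solve_coprime_int by blast
      then have "[snd w * r * l = 1 * l] (mod q ^ a)" by (intro cong_mult cong_refl)
      then show ?thesis by (intro exI[of _ "(- r * l, 0)"]) (simp add: wedge_def mult.assoc)
    qed
    then obtain z where z: "[wedge w z = l] (mod q ^ a)" by blast
    have "s (i + q ^ e * fst z, j + q ^ e * snd z) = y"
      using y q0 z by (simp add: s_def cong_def wedge_def)
    then show "y \<in> s ` UNIV" by blast
  qed
  define D where "D = (\<lambda>n. c n - d (uv n))"
  have uv0: "uv (el 0 0 l) = 0" for l by (simp add: zero_prod_def)
  have D: "[D (n \<otimes> k) = D n + D k] (mod q ^ b)" if "n \<in> N" "k \<in> N" "uv n \<in> L" "uv k \<in> L" for n k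
  proof -
    have "[c (n \<otimes> k) = c n + c k] (mod q ^ b)" using c_mult_admissible[OF adm that(1-3)] .
    moreover have "[d (uv n + uv k) = d (uv n) + d (uv k)] (mod q ^ b)" using addd that unfolding add_mod_def by blast
    ultimately have "[c (n \<otimes> k) - d (uv n + uv k) = (c n + c k) - (d (uv n) + d (uv k))] (mod q ^ b)"
      by (rule cong_diff)
    then show ?thesis using that by (simp add: D_def algebra_simps)
  qed
  have mem: "n \<in> B \<longleftrightarrow> uv n \<in> L \<and> [D n = 0] (mod q ^ b)" if "n \<in> N" for n
    using that by (simp add: d(2) graph_of_def D_def cong_iff_dvd_diff)
  have Dinv: "n \<otimes> inv k \<in> B \<longleftrightarrow> [D n = D k] (mod q ^ b)" if nk: "n \<in> N" "k \<in> N" "uv n \<in> L" "uv k \<in> L" for n k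
  proof -
    have L': "uv (n \<otimes> inv k) \<in> L" using nk L by (simp add: add_subgroup_def)
    have "n \<otimes> inv k \<otimes> k = n" using nk by (simp add: m_assoc)
    then have "[D n = D (n \<otimes> inv k) + D k] (mod q ^ b)" using D[of "n \<otimes> inv k" k] nk L' by simp
    then have "[D (n \<otimes> inv k) = 0] (mod q ^ b) \<longleftrightarrow> [D n = D k] (mod q ^ b)"
    proof -
      assume "[D n = D (n \<otimes> inv k) + D k] (mod q ^ b)"
      then have "q ^ b dvd (D n - D k) - D (n \<otimes> inv k)" by (simp add: cong_iff_dvd_diff algebra_simps)
      then show ?thesis
        using dvd_add_right_iff[of "q ^ b" "(D n - D k) - D (n \<otimes> inv k)" "D (n \<otimes> inv k)"]
        by (simp add: cong_iff_dvd_diff)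
    qed
    then show ?thesis using mem[of "n \<otimes> inv k"] nk L' by simp
  qed
  \<comment> \<open>One lift for each value of \<open>s\<close>; the quotient of \<open>n\<close> by
    the lift of its class lies over \<open>L\<close>, where \<open>D\<close> is additive.\<close>
  define r where "r = (\<lambda>y. let x = (SOME x. s x = y) in el (fst x) (snd x) 0)"
  have r: "r y \<in> N" "s (uv (r (s x))) = s x" for x y
  proof -
    show "r y \<in> N" by (simp add: r_def Let_def)
    have "\<exists>z. s z = s x" by blast
    from someI_ex[OF this] show "s (uv (r (s x))) = s x" by (simp add: r_def Let_def)
  qed
  define f where "f = (\<lambda>n. (s (uv n), D (n \<otimes> inv (r (s (uv n)))) mod q ^ b))"
  have M: "uv (n \<otimes> inv (r (s (uv n)))) \<in> L" if "n \<in> N" for n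
    using that r s_eq[of "uv n" "uv (r (s (uv n)))"] by simp
  have f: "f n = f k \<longleftrightarrow> n \<otimes> inv\<^bsub>GN\<^esub> k \<in> B" if nk: "n \<in> carrier GN" "k \<in> carrier GN" for n k
  proof -
    have nk: "n \<in> N" "k \<in> N" using nk by auto
    have "f n = f k \<longleftrightarrow> n \<otimes> inv k \<in> B" if eq: "s (uv n) = s (uv k)"
    proof -
      define y where "y = r (s (uv n))"
      have y: "y \<in> N" "uv (n \<otimes> inv y) \<in> L" "uv (k \<otimes> inv y) \<in> L"
        using r nk M[OF nk(1)] M[OF nk(2)] eq by (auto simp: y_def)
      have "f n = f k \<longleftrightarrow> [D (n \<otimes> inv y) = D (k \<otimes> inv y)] (mod q ^ b)"
        by (simp add: f_def eq y_def cong_def)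
      also have "\<dots> \<longleftrightarrow> (n \<otimes> inv y) \<otimes> inv (k \<otimes> inv y) \<in> B" using Dinv y nk by simp
      also have "(n \<otimes> inv y) \<otimes> inv (k \<otimes> inv y) = n \<otimes> inv k"
      proof -
        have "inv y \<otimes> (y \<otimes> inv k) = inv k" using y nk by (simp add: m_assoc[symmetric])
        then show ?thesis using y nk by (simp add: inv_mult_group m_assoc)
      qed
      finally show ?thesis .
    qed
    moreover have "s (uv n) = s (uv k)" if "n \<otimes> inv k \<in> B"
    proof -
      have "uv (n \<otimes> inv k) \<in> L" using that mem nk by simp
      then show ?thesis using s_eq nk by simp
    qed
    moreover have "s (uv n) = s (uv k)" if "f n = f k" using that by (simp add: f_def)
    ultimately show ?thesis using nk by (simp add: inv_GN) blast
  qed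
  have "f ` N = s ` UNIV \<times> {0..<q ^ b}"
  proof (intro subset_antisym subsetI)
    fix y assume "y \<in> f ` N"
    then obtain x z where "y = (s x, z mod q ^ b)" unfolding f_def by blast
    moreover have "z mod q ^ b \<in> {0..<q ^ b}"
      using q_pos[of b] by (meson atLeastLessThan_iff pos_mod_bound pos_mod_sign)
    ultimately show "y \<in> s ` UNIV \<times> {0..<q ^ b}" by blast
  next
    fix y assume "y \<in> s ` UNIV \<times> {0..<q ^ b}"
    then obtain x l where y: "y = (s x, l)" "l \<in> {0..<q ^ b}" by blast
    define t where "t = l + d 0"
    define n where "n = el 0 0 t \<otimes> r (s x)"
    have n: "n \<in> N" "uv n = uv (r (s x))" using r by (auto simp: n_def el0_coords_mult simp del: uv_mult)
    then have sn: "s (uv n) = s x" using r by simp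
    have "n \<otimes> inv (r (s x)) = el 0 0 t" using r by (simp add: n_def m_assoc)
    then have "D (n \<otimes> inv (r (s (uv n)))) = t - d 0" unfolding sn by (simp add: D_def uv0 del: uv_el)
    then have "f n = y" using y by (simp add: f_def sn t_def)
    then show "y \<in> f ` N" using n by blast
  qed
  moreover have "card (rcosets\<^bsub>GN\<^esub> B) = card (f ` carrier GN)"
    using group.card_rcosets_detect[OF group_GN subgroup_GN[OF sB BN], of f] f by simp
  ultimately have "card (rcosets\<^bsub>GN\<^esub> B) = card (({0..<q ^ e} \<times> {0..<q ^ e} \<times> {0..<q ^ a}) \<times> {0..<q ^ b})"
    by (simp add: s_img)
  also have "\<dots> = p ^ e * (p ^ e * p ^ a) * p ^ b" by (simp add: card_cartesian_product nat_power_eq)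
  also have "\<dots> = p ^ (2 * e + a + b)" by (simp add: power_add mult_2)
  finally show ?thesis .
qed

lemma multiples_of_power:
  fixes S :: "int set"
  assumes 0: "0 \<in> S" and diff: "\<And>x y. x \<in> S \<Longrightarrow> y \<in> S \<Longrightarrow> x - y \<in> S" and m: "q ^ m \<in> S"
  shows "\<exists>b. \<forall>l. l \<in> S \<longleftrightarrow> q ^ b dvd l"
proof -
  define b where "b = (LEAST b. q ^ b \<in> S)"
  have b: "q ^ b \<in> S" "\<And>i. q ^ i \<in> S \<Longrightarrow> b \<le> i"
    unfolding b_def using LeastI[of "\<lambda>b. q ^ b \<in> S", OF m] Least_le[of "\<lambda>b. q ^ b \<in> S"] by auto
  have add: "add_subgroup {x. fst x \<in> S \<and> snd x = 0}"
    using 0 diff by (auto simp: add_subgroup_def)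
  have mult: "i * x \<in> S" if "x \<in> S" for i x
    using add_subgroup_sm[OF add, of "(x, 0)" i] that by simp
  have plus: "x + y \<in> S" if "x \<in> S" "y \<in> S" for x y
    using add_subgroup_add[OF add, of "(x, 0)" "(y, 0)"] that by simp
  have "l \<in> S \<longleftrightarrow> q ^ b dvd l" for l
  proof
    assume l: "l \<in> S"
    have "gcd l (q ^ b) dvd q ^ b" by simp
    then obtain j where j: "j \<le> b" "gcd l (q ^ b) = q ^ j"
      using divides_primepow[OF prime_q, of "gcd l (q ^ b)" b] by auto
    obtain s t where st: "s * l + t * q ^ b = q ^ j" using bezout_int j(2) by metis
    then have "q ^ j \<in> S" using plus[OF mult[OF l] mult[OF b(1)]] by metis
    then have "j = b" using b(2) j(1) by fastforce
    then show "q ^ b dvd l" using j(2) by (metis gcd_dvd1)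
  next
    assume "q ^ b dvd l"
    then obtain i where "l = q ^ b * i" by blast
    then show "l \<in> S" using mult[OF b(1), of i] by (simp add: mult.commute)
  qed
  then show ?thesis by blast
qed

lemma nat_pow_N: "n \<in> N \<Longrightarrow> n [^] (k::nat) \<in> N \<and> uv (n [^] k) = sm (int k) (uv n)"
proof (induction k)
  case 0 then show ?case by (simp add: sm_def zero_prod_def)
next
  case (Suc k) then show ?case by (simp add: sm_def prod_eq_iff algebra_simps)
qed

lemma el0_pow: "el 0 0 1 [^] (k::nat) = el 0 0 (int k)"
proof (induction k)
  case 0 show ?case by (rule coord_inj) auto
next
  case (Suc k) then show ?case using el0_mult[of "int k" 1] by (simp add: add.commute)
qed

lemma Fib_classification:
  assumes nB: "B \<lhd> G" and BN: "B \<subseteq> N"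
    and m: "el 0 0 (q ^ m) \<in> B" "(q ^ k, 0) \<in> uv ` B" "(0, q ^ k) \<in> uv ` B"
  obtains e a b w where "primitive q w" "B \<in> Fib (lat q e a w) b"
proof -
  have sB: "subgroup B G" using nB by (rule normal_imp_subgroup)
  have "\<exists>b. \<forall>l. l \<in> {l. el 0 0 l \<in> B} \<longleftrightarrow> q ^ b dvd l"
  proof (rule multiples_of_power)
    have "el 0 0 0 = \<one>" by (rule coord_inj) auto
    then show "0 \<in> {l. el 0 0 l \<in> B}" using subgroup.one_closed[OF sB] by simp
    show "q ^ m \<in> {l. el 0 0 l \<in> B}" using m(1) by simp
    fix x y assume "x \<in> {l. el 0 0 l \<in> B}" "y \<in> {l. el 0 0 l \<in> B}"
    then have "el 0 0 x \<otimes> inv (el 0 0 y) \<in> B" using sB by (simp add: subgroup.m_closed subgroup.m_inv_closed)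
    then show "x - y \<in> {l. el 0 0 l \<in> B}" using same_uv_inv[of "el 0 0 x" "el 0 0 y"] by simp
  qed
  then obtain b where "\<forall>l. el 0 0 l \<in> B \<longleftrightarrow> q ^ b dvd l" by auto
  then have F: "B \<in> Fib (uv ` B) b" using nB BN by (simp add: Fib_def)
  have L: "add_subgroup (uv ` B)" using admissible_Fib[OF F] by (simp add: admissible_def)
  obtain e a w where "primitive q w" "uv ` B = lat q e a w"
    by (rule sublattice_classification[OF prime_q L m(2,3)])
  then show thesis using F that by metis
qed

section \<open>The family of normal subgroups of p-power index\<close>

definition expo :: "'a set \<Rightarrow> nat" where
  "expo B = (SOME m. card (rcosets\<^bsub>GN\<^esub> B) = p ^ m)"

lemma expo: "B \<in> completion_family G N p \<Longrightarrow> card (rcosets\<^bsub>GN\<^esub> B) = p ^ expo B"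
  unfolding expo_def completion_family_def by (auto intro: someI_ex)

lemma fam_normal:
  "B \<in> completion_family G N p \<Longrightarrow> B \<lhd> G" "B \<in> completion_family G N p \<Longrightarrow> B \<subseteq> N"
  "B \<in> completion_family G N p \<Longrightarrow> subgroup B G"
  by (auto simp: completion_family_def normal_imp_subgroup)

text \<open>Lagrange's theorem in the quotient of \<open>N\<close> by \<open>B\<close>. It provides
  the multiples of powers of \<open>q\<close> from which the classification of \<open>B\<close>
  starts.\<close>

lemma family_pow:
  assumes B: "B \<in> completion_family G N p" and n: "n \<in> N"
  shows "n [^] (p ^ expo B) \<in> B"
proof -
  have nB: "B \<lhd> G" and BN: "B \<subseteq> N" and sB: "subgroup B G" using fam_normal[OF B] by auto
  have nBN: "B \<lhd> GN" using normal_restrict_supergroup[OF subgroup_N nB BN] .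
  have grp: "group (GN Mod B)" using nBN by (rule normal.factorgroup_is_group)
  have "B #>\<^bsub>GN\<^esub> n \<in> carrier (GN Mod B)" using n by (auto simp: carrier_FactGroup)
  then have "(B #>\<^bsub>GN\<^esub> n) [^]\<^bsub>GN Mod B\<^esub> (p ^ expo B) = B"
    using group.pow_order_eq_1[OF grp] expo[OF B] by (simp add: order_def FactGroup_def)
  then have "B #> (n [^] (p ^ expo B)) = B"
    using normal.FactGroup_pow[OF nBN, of n "p ^ expo B"] n by (simp add: nat_pow_consistent[symmetric])
  then show ?thesis using coset_join1[OF _ _ sB] n by simp
qed

lemma family_classification:
  assumes B: "B \<in> completion_family G N p"
  obtains e a b w where "primitive q w" "B \<in> Fib (lat q e a w) b"
proof -
  have "sm (q ^ expo B) (uv n) \<in> uv ` B" if "n \<in> N" for n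
    using family_pow[OF B that] nat_pow_N[OF that, of "p ^ expo B"] by (metis imageI of_nat_power)
  from this[of "el 1 0 0"] this[of "el 0 1 0"]
  have L: "(q ^ expo B, 0) \<in> uv ` B" "(0, q ^ expo B) \<in> uv ` B" by (simp_all add: sm_def)
  have "el 0 0 (q ^ expo B) \<in> B" using family_pow[OF B, of "el 0 0 1"] by (simp add: el0_pow)
  obtain e a b w where "primitive q w" "B \<in> Fib (lat q e a w) b"
    by (rule Fib_classification[OF fam_normal(1,2)[OF B] \<open>el 0 0 (q ^ expo B) \<in> B\<close> L])
  then show thesis by (rule that)
qed

text \<open>The index is constant on each class, so the zeta sum becomes a sum over three exponents
  weighted by cardinalities.\<close>

definition cls :: "nat \<Rightarrow> nat \<Rightarrow> nat \<Rightarrow> 'a set set" where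
  "cls e a b = (\<Union>L\<in>inv_lats q mats e a. Fib L b)"

lemma Fib_lat_inv:
  assumes w: "primitive q w" and B: "B \<in> Fib (lat q e a w) b"
  shows "lat q e a w \<in> inv_lats q mats e a"
proof -
  have "\<forall>A\<in>mats. \<forall>x\<in>lat q e a w. mv A x \<in> lat q e a w"
    using admissible_Fib[OF B] unfolding admissible_def by (elim conjE)
  then have "\<forall>A\<in>mats. q ^ a dvd wedge w (mv A w)"
    using lat_invariant_iff[OF prime_q w, of e a] by (auto simp del: split_paired_All)
  then show ?thesis unfolding inv_lats_def using w by blast
qed

lemma family_eq: "completion_family G N p = (\<Union>(e, a, b). cls e a b)"
proof (intro subset_antisym subsetI)
  fix B assume "B \<in> completion_family G N p"
  then obtain e a b w where "primitive q w" "B \<in> Fib (lat q e a w) b" by (rule family_classification)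
  then have "B \<in> cls e a b" unfolding cls_def using Fib_lat_inv by blast
  then show "B \<in> (\<Union>(e, a, b). cls e a b)" by blast
next
  fix B assume "B \<in> (\<Union>(e, a, b). cls e a b)"
  then obtain e a b w where "primitive q w" and B: "B \<in> Fib (lat q e a w) b"
    by (auto simp: cls_def inv_lats_def)
  then have "card (rcosets\<^bsub>GN\<^esub> B) = p ^ (2 * e + a + b)" using index_Fib by blast
  then show "B \<in> completion_family G N p" using B by (auto simp: completion_family_def Fib_def)
qed

lemma cls_index: "B \<in> cls e a b \<Longrightarrow> card (rcosets\<^bsub>GN\<^esub> B) = p ^ (2 * e + a + b)"
  using index_Fib by (auto simp: cls_def inv_lats_def)

lemma cls_disjoint:
  assumes "B \<in> cls e a b" "B \<in> cls e' a' b'" shows "e = e' \<and> a = a' \<and> b = b'"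
proof -
  obtain w w' where w: "primitive q w" "B \<in> Fib (lat q e a w) b" "primitive q w'" "B \<in> Fib (lat q e' a' w') b'"
    using assms by (auto simp: cls_def inv_lats_def)
  then have eq: "lat q e a w = lat q e' a' w'" by (auto simp: Fib_def)
  have 1: "e = e'" "a = a'" using lat_inj[OF prime_q w(1,3) eq] by auto
  have "q ^ b dvd l \<longleftrightarrow> q ^ b' dvd l" for l using w by (auto simp: Fib_def)
  then have "q ^ b dvd q ^ b'" "q ^ b' dvd q ^ b" by (metis dvd_refl)+
  moreover have "q \<noteq> 0" "\<not> is_unit q" using prime_q by auto
  ultimately have "b = b'" by (simp add: dvd_power_iff)
  then show ?thesis using 1 by simp
qed

text \<open>The lattice lies in \<open>q ^ e\<close> times the plane and contains
  \<open>q ^ e\<close> times the primitive \<open>w\<close>. The commutator condition thus says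
  exactly that \<open>q ^ b\<close> divides \<open>\<kappa> * q ^ e\<close>.\<close>

lemma admissible_lat_iff:
  assumes "L \<in> inv_lats q mats e a"
  shows "admissible L b \<longleftrightarrow> b \<le> multiplicity p (nat \<bar>\<kappa>\<bar>) + e"
proof -
  obtain w where w: "primitive q w" "\<forall>A\<in>mats. q ^ a dvd wedge w (mv A w)" and L: "L = lat q e a w"
    using assms by (auto simp: inv_lats_def)
  have q0: "q \<noteq> 0" using prime_q by auto
  have inv: "\<forall>A\<in>mats. \<forall>x\<in>L. mv A x \<in> L" unfolding L using lat_invariant_iff[OF prime_q w(1)] w(2) by blast
  have "(\<forall>x\<in>L. q ^ b dvd \<kappa> * fst x \<and> q ^ b dvd \<kappa> * snd x) \<longleftrightarrow> q ^ b dvd \<kappa> * q ^ e"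
  proof
    assume *: "\<forall>x\<in>L. q ^ b dvd \<kappa> * fst x \<and> q ^ b dvd \<kappa> * snd x"
    have "sm (q ^ e) w \<in> L" unfolding L using q0 by (simp add: lat_iff)
    then have "q ^ b dvd (\<kappa> * q ^ e) * fst w" "q ^ b dvd (\<kappa> * q ^ e) * snd w" using * by (auto simp: mult.assoc)
    then show "q ^ b dvd \<kappa> * q ^ e" by (rule primitive_dvd[OF prime_q w(1)])
  next
    assume *: "q ^ b dvd \<kappa> * q ^ e"
    show "\<forall>x\<in>L. q ^ b dvd \<kappa> * fst x \<and> q ^ b dvd \<kappa> * snd x"
    proof
      fix x assume "x \<in> L"
      then obtain y where "x = sm (q ^ e) y" unfolding L lat_def by blast
      then show "q ^ b dvd \<kappa> * fst x \<and> q ^ b dvd \<kappa> * snd x" using * by (simp add: mult.assoc[symmetric])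
    qed
  qed
  also have "\<dots> \<longleftrightarrow> p ^ b dvd nat \<bar>\<kappa>\<bar> * p ^ e"
  proof -
    have "\<bar>\<kappa> * q ^ e\<bar> = int (nat \<bar>\<kappa>\<bar> * p ^ e)" by (simp add: abs_mult)
    then have "q ^ b dvd \<kappa> * q ^ e \<longleftrightarrow> int (p ^ b) dvd int (nat \<bar>\<kappa>\<bar> * p ^ e)"
      by (metis dvd_abs_iff of_nat_power)
    then show ?thesis by (simp only: of_nat_dvd_iff)
  qed
  also have "\<dots> \<longleftrightarrow> b \<le> multiplicity p (nat \<bar>\<kappa>\<bar> * p ^ e)"
    using prime_p kappa_nonzero by (intro power_dvd_iff_le_multiplicity) (auto simp: prime_gt_0_nat)
  also have "multiplicity p (nat \<bar>\<kappa>\<bar> * p ^ e) = multiplicity p (nat \<bar>\<kappa>\<bar>) + e"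
    using prime_p kappa_nonzero by (subst prime_elem_multiplicity_mult_distrib) (auto simp: prime_gt_0_nat)
  finally show ?thesis using inv L lat_add_subgroup by (simp add: admissible_def)
qed

lemma card_cls:
  assumes fin: "finite (inv_lats q mats e a)"
    and Psi: "\<And>L. L \<in> inv_lats q mats e a \<Longrightarrow> card (Psi (q ^ b) mats L) = p ^ (r * b)"
  shows "finite (cls e a b)"
    "card (cls e a b) = (if b \<le> multiplicity p (nat \<bar>\<kappa>\<bar>) + e then card (inv_lats q mats e a) * p ^ (r * b) else 0)"
proof -
  have card: "card (Fib L b) = (if b \<le> multiplicity p (nat \<bar>\<kappa>\<bar>) + e then p ^ (r * b) else 0)"
    if "L \<in> inv_lats q mats e a" for L
    using that admissible_lat_iff[OF that, of b] card_Fib_admissible Fib_not_admissible Psi by auto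
  have finF: "finite (Fib L b)" if "L \<in> inv_lats q mats e a" for L
  proof (cases "admissible L b")
    case True
    then have "card (Fib L b) > 0" using that card_Fib_admissible Psi prime_p by (simp add: prime_gt_0_nat)
    then show ?thesis using card_gt_0_iff by blast
  next
    case False then show ?thesis by (simp add: Fib_not_admissible)
  qed
  show "finite (cls e a b)" unfolding cls_def using fin finF by blast
  have "card (cls e a b) = (\<Sum>L\<in>inv_lats q mats e a. card (Fib L b))"
    unfolding cls_def by (rule card_UN_disjoint[OF fin]) (use finF in \<open>auto simp: Fib_def\<close>)
  also have "\<dots> = (if b \<le> multiplicity p (nat \<bar>\<kappa>\<bar>) + e then card (inv_lats q mats e a) * p ^ (r * b) else 0)"
    using card by simp
  finally show "card (cls e a b) = (if b \<le> multiplicity p (nat \<bar>\<kappa>\<bar>) + e then card (inv_lats q mats e a) * p ^ (r * b) else 0)" .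
qed

end

section \<open>Finite-index normal subgroups of the completion\<close>

text \<open>A normal subgroup of finite index \<open>M\<close> contains all \<open>M\<close>-th powers. Elements that are close to
  the identity are products of three \<open>M\<close>-th powers, which are constructed from coherent
  sequences of exponents; this is why such a subgroup is open.\<close>

context heis_ext_p
begin

abbreviation fam where "fam \<equiv> completion_family G N p"
abbreviation Gp where "Gp \<equiv> rel_completion G N p"
abbreviation Np where "Np \<equiv> completion_closure G N p"
abbreviation \<iota> where "\<iota> \<equiv> completion_map G N p"

lemma coset_eq_iff:
  assumes "subgroup B G" "x \<in> carrier G" "y \<in> carrier G"
  shows "B #> x = B #> y \<longleftrightarrow> x \<otimes> inv y \<in> B"
  using assms repr_independence[OF _ assms(3,1), of x] rcos_self[OF assms(2,1)]
    subgroup.rcos_module[OF assms(1) group_axioms assms(3,2)] by metis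

lemma mem_coset_eq:
  assumes "subgroup B G" "x \<in> B #> y" "y \<in> carrier G"
  shows "B #> x = B #> y" "x \<in> carrier G"
  using repr_independence[OF assms(2,3,1)] subgroup.elemrcos_carrier[OF assms(1) group_axioms assms(3,2)] by auto

text \<open>A descending sequence cofinal in the family, on which elements of the completion are
  tested. The doubled exponent for \<open>u\<close> and \<open>v\<close> serves to make it normal in
  \<open>G\<close>.\<close>

definition DD :: "nat \<Rightarrow> 'a set" where
  "DD m = {n \<in> N. q ^ (2 * m) dvd u n \<and> q ^ (2 * m) dvd v n \<and> q ^ m dvd c n}"

lemma lat_full: "q ^ e dvd fst x \<and> q ^ e dvd snd x \<longleftrightarrow> x \<in> lat q e 0 w"
proof
  assume "q ^ e dvd fst x \<and> q ^ e dvd snd x"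
  then obtain y1 y2 where "fst x = q ^ e * y1" "snd x = q ^ e * y2" by (auto elim!: dvdE)
  then have "x = sm (q ^ e) (y1, y2)" by (simp add: prod_eq_iff)
  then show "x \<in> lat q e 0 w" unfolding lat_def by auto
qed (auto simp: lat_def)

text \<open>Averaging gives a graph function for the multiples of \<open>q ^ m\<close>. Being
  additive modulo \<open>q ^ m\<close>, it vanishes on the multiples of \<open>q ^ (2 * m)\<close>,
  so over these the zero function satisfies the same conditions.\<close>

lemma DD_Fib: "DD m \<in> Fib (lat q (2 * m) 0 (1, 0)) m"
proof -
  define w :: "int \<times> int" where "w = (1, 0)"
  have w: "primitive q w" using prime_q by (auto simp: w_def primitive_def)
  have full: "lat q e 0 w \<in> inv_lats q mats e 0" for e
    unfolding inv_lats_def mem_Collect_eq using w by (intro exI[of _ w]) simp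
  define L L' where "L = lat q m 0 w" and "L' = lat q (2 * m) 0 w"
  have adm: "admissible L m" "admissible L' m"
    using admissible_lat_iff[OF full] by (auto simp: L_def L'_def)
  obtain d where d: "graph_fun L m d" using graph_fun_exists[OF adm(1)] by blast
  have add: "add_subgroup L" "add_mod (q ^ m) L d" using adm d by (auto simp: admissible_def graph_fun_def)
  have sub: "L' \<subseteq> L \<and> (\<forall>x\<in>L'. [d x = 0] (mod q ^ m))"
  proof (intro conjI subsetI ballI)
    fix x assume "x \<in> L'"
    then obtain y where y: "x = sm (q ^ (2 * m)) y" unfolding L'_def lat_def by auto
    then have x: "x = sm (q ^ m) (sm (q ^ m) y)" by (simp add: sm_def mult_2 power_add mult.assoc)
    have yL: "sm (q ^ m) y \<in> L" unfolding L_def lat_def mem_Collect_eq by (intro exI[of _ y]) simp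
    show "x \<in> L" unfolding x using add_subgroup_sm[OF add(1) yL] .
    have "[d x = q ^ m * d (sm (q ^ m) y)] (mod q ^ m)" unfolding x using add_mod_sm[OF add yL] .
    then show "[d x = 0] (mod q ^ m)" by (simp add: cong_def)
  qed
  have "graph_fun L' m (\<lambda>_. 0)" unfolding graph_fun_def
  proof (intro conjI ballI impI)
    show "add_mod (q ^ m) L' (\<lambda>_. 0)" by (simp add: add_mod_def)
    fix g n assume g: "g \<in> carrier G" and n: "n \<in> N" "uv n \<in> L'"
    have gL: "mv (Mat g) (uv n) \<in> L'" using adm(2) g n by (auto simp: admissible_def)
    have "[c (cj g n) = det2 (Mat g) * (c n - d (uv n)) + d (mv (Mat g) (uv n))] (mod q ^ m)"
      using d g n sub by (auto simp: graph_fun_def)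
    also have "[det2 (Mat g) * (c n - d (uv n)) + d (mv (Mat g) (uv n)) = det2 (Mat g) * (c n - 0) + 0] (mod q ^ m)"
      using sub n gL by (intro cong_add cong_mult cong_diff cong_refl) auto
    finally show "[c (cj g n) = det2 (Mat g) * (c n - 0) + 0] (mod q ^ m)" .
  qed
  moreover have "graph_of L' m (\<lambda>_. 0) = DD m"
  proof -
    have "uv n \<in> L' \<longleftrightarrow> q ^ (2 * m) dvd u n \<and> q ^ (2 * m) dvd v n" for n
      using lat_full[of "2 * m" "uv n" w] by (simp add: L'_def)
    then show ?thesis unfolding graph_of_def DD_def by (auto simp: cong_0_iff)
  qed
  ultimately have "DD m \<in> Fib L' m" using graph_of_mem_Fib[OF adm(2)] by metis
  then show ?thesis by (simp add: L'_def w_def)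
qed

lemma DD_fam: "DD m \<in> fam"
proof -
  have "primitive q (1, 0)" using prime_q by (auto simp: primitive_def)
  then have "DD m \<in> cls (2 * m) 0 m" unfolding cls_def using DD_Fib Fib_lat_inv by blast
  then show ?thesis unfolding family_eq by blast
qed

lemma DD_dvd: "n \<in> DD m \<Longrightarrow> q ^ m dvd u n \<and> q ^ m dvd v n \<and> q ^ m dvd c n"
proof -
  assume "n \<in> DD m"
  moreover have "q ^ m dvd q ^ (2 * m)" by (simp add: le_imp_power_dvd)
  ultimately show ?thesis unfolding DD_def using dvd_trans by blast
qed

lemma DD_mono: "m \<le> n \<Longrightarrow> DD n \<subseteq> DD m"
  unfolding DD_def by (auto elim!: dvd_trans[rotated] intro!: le_imp_power_dvd)

definition E1 :: "int \<Rightarrow> 'a" where "E1 i = el i 0 0"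

definition E2 :: "int \<Rightarrow> 'a" where "E2 i = el 0 i 0"

definition E3 :: "int \<Rightarrow> 'a" where "E3 i = el 0 0 i"

definition one_param :: "(int \<Rightarrow> 'a) \<Rightarrow> bool" where
  "one_param E \<longleftrightarrow> (\<forall>i. E i \<in> N) \<and> (\<forall>i j. E (i + j) = E i \<otimes> E j)"

lemma one_param_E: "one_param E1" "one_param E2" "one_param E3"
  unfolding one_param_def E1_def E2_def E3_def
  by (auto intro!: coord_inj simp: u_mult v_mult c_mult)

text \<open>In this order no factor with a \<open>u\<close>-coordinate follows one with a
  \<open>v\<close>-coordinate, so the cocycle contributes nothing.\<close>

lemma el_E: "el i j l = E1 i \<otimes> E2 j \<otimes> E3 l"
  unfolding E1_def E2_def E3_def by (rule coord_inj) (auto simp: u_mult v_mult c_mult)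

lemma one_param_simps:
  assumes "one_param E"
  shows "E i \<in> N" "E (i + j) = E i \<otimes> E j" "E 0 = \<one>" "E (- i) = inv (E i)" "E (i - j) = E i \<otimes> inv (E j)"
    "E (int k * i) = E i [^] k"
proof -
  show 1: "E i \<in> N" "E (i + j) = E i \<otimes> E j" for i j using assms by (auto simp: one_param_def)
  have "E 0 \<otimes> E 0 = E 0" using 1(2)[of 0 0] by simp
  then show 0: "E 0 = \<one>" using 1(1)[of 0] by (simp add: l_cancel_one)
  show 2: "E (- i) = inv (E i)" for i using 1 0 by (metis N_carrier add.left_inverse inv_equality)
  show "E (i - j) = E i \<otimes> inv (E j)" using 1(2)[of i "- j"] 2 by simp
  show "E (int k * i) = E i [^] k" for k
  proof (induction k)
    case (Suc k)
    have "int (Suc k) * i = int k * i + i" by (simp add: algebra_simps)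
    then show ?case using 1(2)[of "int k * i" i] Suc by simp
  qed (simp add: 0)
qed

text \<open>A multiple of \<open>q ^ expo B\<close> as exponent produces a
  \<open>p ^ expo B\<close>-th power, which lies in \<open>B\<close> and hence in
  \<open>C\<close>.\<close>

lemma one_param_coset:
  assumes E: "one_param E" and B: "B \<in> fam" and C: "C \<in> fam" "B \<subseteq> C" and ij: "[i = j] (mod q ^ expo B)"
  shows "C #> E i = C #> E j"
proof -
  obtain t where t: "i - j = q ^ expo B * t" using ij by (auto simp: cong_iff_dvd_diff elim!: dvdE)
  have "E (i - j) = E t [^] (p ^ expo B)" using one_param_simps(6)[OF E, of "p ^ expo B" t] by (simp add: t)
  then have "E (i - j) \<in> C" using family_pow[OF B] one_param_simps(1)[OF E] C(2) by auto
  then show ?thesis using coset_eq_iff[OF fam_normal(3)[OF C(1)]] one_param_simps[OF E] by simp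
qed

text \<open>Each of the three coordinate factors lies in \<open>B\<close>, since its exponent is 0
  modulo \<open>q ^ expo B\<close>. This is the cofinality of the sequence
  \<open>DD\<close>.\<close>

lemma DD_subset:
  assumes B: "B \<in> fam" shows "DD (expo B) \<subseteq> B"
proof
  fix n assume n: "n \<in> DD (expo B)"
  then have nN: "n \<in> N" and d: "q ^ expo B dvd u n" "q ^ expo B dvd v n" "q ^ expo B dvd c n"
    using DD_dvd[OF n] by (simp_all add: DD_def)
  have sB: "subgroup B G" using fam_normal[OF B] by auto
  have "E i \<in> B" if "one_param E" "q ^ expo B dvd i" for E i
  proof -
    have "B #> E i = B #> E 0" using that B by (intro one_param_coset) (auto simp: cong_0_iff)
    then show ?thesis using that coset_join1[OF _ _ sB, of "E i"] one_param_simps[OF that(1)]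
      subgroup.subset[OF sB] by simp
  qed
  then have "E1 (u n) \<otimes> E2 (v n) \<otimes> E3 (c n) \<in> B" using d one_param_E sB by (simp add: subgroup.m_closed)
  then show "n \<in> B" using el_coords[OF nN] by (metis el_E)
qed

section \<open>The completion as a group of compatible cosets\<close>

lemma mult_Gp: "x \<otimes>\<^bsub>Gp\<^esub> y = (\<lambda>B\<in>fam. x B <#> y B)"
  by (simp add: rel_completion_def product_group_def)

lemma one_Gp: "\<one>\<^bsub>Gp\<^esub> = (\<lambda>B\<in>fam. B)"
  by (simp add: rel_completion_def product_group_def)

lemma carrier_Gp: "carrier Gp = {x \<in> (\<Pi>\<^sub>E B\<in>fam. carrier (G Mod B)). \<forall>B\<in>fam. \<forall>C\<in>fam. B \<subseteq> C \<longrightarrow> x B \<subseteq> x C}"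
  by (simp add: rel_completion_def)

lemma group_Gp: "group Gp"
proof -
  define PG where "PG = product_group fam (\<lambda>B. G Mod B)"
  have grp: "group (G Mod B)" if "B \<in> fam" for B
    using fam_normal(1)[OF that] by (rule normal.factorgroup_is_group)
  then have PG: "group PG" by (simp add: PG_def)
  define X where "X = {x \<in> (\<Pi>\<^sub>E B\<in>fam. carrier (G Mod B)). \<forall>B\<in>fam. \<forall>C\<in>fam. B \<subseteq> C \<longrightarrow> x B \<subseteq> x C}"
  have "subgroup X PG"
  proof (rule group.subgroupI[OF PG])
    show "X \<subseteq> carrier PG" by (auto simp: X_def PG_def)
    have "(\<lambda>B\<in>fam. B) \<in> X"
      using grp group.is_monoid[THEN monoid.one_closed] by (force simp: X_def)
    then show "X \<noteq> {}" by blast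
    fix x assume x: "x \<in> X"
    have inv: "inv\<^bsub>PG\<^esub> x = (\<lambda>B\<in>fam. inv\<^bsub>G Mod B\<^esub> x B)"
      unfolding PG_def using x grp by (intro inv_product_group) (auto simp: X_def)
    have "inv\<^bsub>PG\<^esub> x \<in> (\<Pi>\<^sub>E B\<in>fam. carrier (G Mod B))"
      unfolding inv using x grp by (auto simp: X_def group.inv_closed PiE_iff)
    moreover have "inv\<^bsub>G Mod B\<^esub> x B \<subseteq> inv\<^bsub>G Mod C\<^esub> x C" if "B \<in> fam" "C \<in> fam" "B \<subseteq> C" for B C
    proof -
      have "x B \<in> carrier (G Mod B)" "x C \<in> carrier (G Mod C)" "x B \<subseteq> x C" using x that by (auto simp: X_def)
      then show ?thesis using that fam_normal by (auto simp: normal.inv_FactGroup SET_INV_def)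
    qed
    ultimately show "inv\<^bsub>PG\<^esub> x \<in> X" by (auto simp: X_def inv)
    fix y assume y: "y \<in> X"
    have "x \<otimes>\<^bsub>PG\<^esub> y = (\<lambda>B\<in>fam. x B \<otimes>\<^bsub>G Mod B\<^esub> y B)" by (simp add: PG_def)
    moreover have "x B \<otimes>\<^bsub>G Mod B\<^esub> y B \<in> carrier (G Mod B)" if "B \<in> fam" for B
      using x y that group.is_monoid[OF grp[OF that]] by (intro monoid.m_closed) (auto simp: X_def)
    moreover have "x B <#> y B \<subseteq> x C <#> y C" if "B \<in> fam" "C \<in> fam" "B \<subseteq> C" for B C
      using x y that by (intro mono_set_mult) (auto simp: X_def)
    ultimately show "x \<otimes>\<^bsub>PG\<^esub> y \<in> X" by (auto simp: X_def)
  qed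
  then have "group (PG\<lparr>carrier := X\<rparr>)" using PG by (rule subgroup.subgroup_is_group)
  then show ?thesis by (simp add: rel_completion_def PG_def X_def)
qed

lemma Gp_coset:
  assumes "x \<in> carrier Gp" "B \<in> fam"
  obtains g where "g \<in> carrier G" "x B = B #> g"
  using assms by (auto simp: carrier_Gp PiE_iff carrier_FactGroup)

lemma Gp_mono: "x \<in> carrier Gp \<Longrightarrow> B \<in> fam \<Longrightarrow> C \<in> fam \<Longrightarrow> B \<subseteq> C \<Longrightarrow> x B \<subseteq> x C"
  by (auto simp: carrier_Gp)

lemma Gp_coset_mem:
  assumes "x \<in> carrier Gp" "B \<in> fam" "g \<in> x B"
  shows "x B = B #> g" "g \<in> carrier G"
proof -
  obtain h where h: "h \<in> carrier G" "x B = B #> h" using Gp_coset[OF assms(1,2)] .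
  then show "x B = B #> g" "g \<in> carrier G"
    using mem_coset_eq[OF fam_normal(3)[OF assms(2)], of g h] assms(3) by auto
qed

lemma Gp_refine:
  assumes "x \<in> carrier Gp" "B \<in> fam" "C \<in> fam" "B \<subseteq> C" "x B = B #> g" "g \<in> carrier G"
  shows "x C = C #> g"
proof -
  have "g \<in> x B" using assms rcos_self fam_normal(3) by metis
  then show ?thesis using Gp_mono[OF assms(1-4)] Gp_coset_mem[OF assms(1,3)] by blast
qed

lemma N_fam: "N \<in> fam"
proof -
  have "rcosets\<^bsub>GN\<^esub> N = {N}"
    using coset_join2[OF _ subgroup_N] by (auto simp: RCOSETS_def) (metis N_closed(1) empty_iff)
  then have "card (rcosets\<^bsub>GN\<^esub> N) = p ^ 0" by simp
  then show ?thesis using normal_N unfolding completion_family_def by blast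
qed

lemma iota: "g \<in> carrier G \<Longrightarrow> \<iota> g \<in> carrier Gp" "B \<in> fam \<Longrightarrow> \<iota> g B = B #> g"
proof -
  show eq: "B \<in> fam \<Longrightarrow> \<iota> g B = B #> g" for B by (simp add: completion_map_def)
  assume g: "g \<in> carrier G"
  have "B #> g \<subseteq> C #> g" if "B \<subseteq> C" for B C using that by (auto simp: r_coset_def)
  then show "\<iota> g \<in> carrier Gp" using g by (auto simp: carrier_Gp completion_map_def carrier_FactGroup)
qed

lemma Gp_mult_coset:
  assumes "B \<in> fam" "x B = B #> g" "y B = B #> h" "g \<in> carrier G" "h \<in> carrier G"
  shows "(x \<otimes>\<^bsub>Gp\<^esub> y) B = B #> (g \<otimes> h)"
  using assms normal.rcos_sum[OF fam_normal(1)] by (simp add: mult_Gp)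

lemma iota_mult: "g \<in> carrier G \<Longrightarrow> h \<in> carrier G \<Longrightarrow> \<iota> (g \<otimes> h) = \<iota> g \<otimes>\<^bsub>Gp\<^esub> \<iota> h"
  unfolding mult_Gp completion_map_def
  by (rule restrict_ext) (simp add: normal.rcos_sum[OF fam_normal(1)])

lemma iota_hom: "group_hom G Gp \<iota>"
  using iota iota_mult group_Gp group_axioms by (auto simp: group_hom_def group_hom_axioms_def hom_def)

text \<open>The kernel of the projection to the quotient by \<open>C\<close>, whose identity element
  is the coset \<open>C\<close> itself.\<close>

definition hat :: "'a set \<Rightarrow> ('a set \<Rightarrow> 'a set) set" where
  "hat C = {x \<in> carrier Gp. x C = C}"

lemma proj_hom:
  assumes "B \<in> fam" shows "group_hom Gp (G Mod B) (\<lambda>x. x B)"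
proof -
  have "group (G Mod B)" using fam_normal(1)[OF assms] by (rule normal.factorgroup_is_group)
  then show ?thesis using assms group_Gp
    by (auto simp: group_hom_def group_hom_axioms_def hom_def mult_Gp carrier_Gp PiE_iff)
qed

lemma hat_normal: "C \<in> fam \<Longrightarrow> hat C \<lhd> Gp"
  using group_hom.normal_kernel[OF proj_hom] by (simp add: hat_def kernel_def)

lemma hat_iff:
  assumes "C \<in> fam" "x \<in> carrier Gp" "y \<in> carrier Gp"
  shows "x \<otimes>\<^bsub>Gp\<^esub> inv\<^bsub>Gp\<^esub> y \<in> hat C \<longleftrightarrow> x C = y C"
proof -
  interpret h: group_hom Gp "G Mod C" "\<lambda>x. x C" using proj_hom[OF assms(1)] .
  have "x \<otimes>\<^bsub>Gp\<^esub> inv\<^bsub>Gp\<^esub> y \<in> hat C \<longleftrightarrow> (x \<otimes>\<^bsub>Gp\<^esub> inv\<^bsub>Gp\<^esub> y) C = \<one>\<^bsub>G Mod C\<^esub>"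
    using assms by (simp add: hat_def)
  also have "(x \<otimes>\<^bsub>Gp\<^esub> inv\<^bsub>Gp\<^esub> y) C = x C \<otimes>\<^bsub>G Mod C\<^esub> inv\<^bsub>G Mod C\<^esub> (y C)"
    using assms h.hom_mult h.hom_inv by (metis h.G.inv_closed)
  also have "\<dots> = \<one>\<^bsub>G Mod C\<^esub> \<longleftrightarrow> x C = y C"
    using assms h.hom_closed by (metis h.H.inv_closed h.H.inv_inv h.H.inv_equality h.H.r_inv)
  finally show ?thesis .
qed

text \<open>Projection to the discrete quotient by \<open>N\<close> is continuous, so the closure
  stays in its kernel. Conversely, a basic open set restricts finitely many components, and one
  element of \<open>N\<close> matches all of them.\<close>

lemma Np_eq: "Np = hat N"
proof (intro subset_antisym subsetI)
  fix x assume "x \<in> Np"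
  then have xc: "x \<in> completion_topology G N p closure_of (\<iota> ` N)" by (simp add: completion_closure_def)
  have top: "topspace (completion_topology G N p) = carrier Gp"
    by (auto simp: completion_topology_def carrier_Gp)
  have x: "x \<in> carrier Gp" using xc top by (auto simp: in_closure_of)
  define T where "T = {y \<in> carrier Gp. y N = x N}"
  have "openin (completion_topology G N p) T"
  proof -
    have "continuous_map (product_topology (\<lambda>B. discrete_topology (carrier (G Mod B))) fam) (discrete_topology (carrier (G Mod N))) (\<lambda>y. y N)"
      using continuous_map_product_projection[OF N_fam, of "\<lambda>B. discrete_topology (carrier (G Mod B))"] by simp
    then have "openin (product_topology (\<lambda>B. discrete_topology (carrier (G Mod B))) fam)
       {y \<in> topspace (product_topology (\<lambda>B. discrete_topology (carrier (G Mod B))) fam). y N \<in> {x N}}"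
      using x N_fam by (intro openin_continuous_map_preimage[where Y = "discrete_topology (carrier (G Mod N))"])
        (auto simp: carrier_Gp PiE_iff)
    then show ?thesis unfolding completion_topology_def openin_subtopology T_def
      by (rule_tac exI, rule_tac conjI, assumption) (auto simp: carrier_Gp)
  qed
  moreover have "x \<in> T" using x by (simp add: T_def)
  ultimately obtain n where "n \<in> N" "\<iota> n \<in> T" using xc unfolding in_closure_of by blast
  then have "x N = N #> n" using iota(2)[OF N_fam] by (simp add: T_def)
  then show "x \<in> hat N" using x \<open>n \<in> N\<close> coset_join2[OF _ subgroup_N] by (simp add: hat_def)
next
  fix x assume "x \<in> hat N"
  then have x: "x \<in> carrier Gp" and xN: "x N = N" by (auto simp: hat_def)
  have top: "topspace (completion_topology G N p) = carrier Gp"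
    by (auto simp: completion_topology_def carrier_Gp)
  show "x \<in> Np" unfolding completion_closure_def in_closure_of
  proof (intro conjI allI impI)
    show "x \<in> topspace (completion_topology G N p)" using x top by simp
    fix T assume "x \<in> T \<and> openin (completion_topology G N p) T"
    then obtain T' where T': "openin (product_topology (\<lambda>B. discrete_topology (carrier (G Mod B))) fam) T'"
      "T = T' \<inter> carrier Gp" "x \<in> T'" unfolding completion_topology_def openin_subtopology by blast
    then obtain U where U: "finite {i \<in> fam. U i \<noteq> topspace (discrete_topology (carrier (G Mod i)))}"
      "x \<in> Pi\<^sub>E fam U" "Pi\<^sub>E fam U \<subseteq> T'"
      unfolding openin_product_topology_alt by meson
    \<comment> \<open>The finitely many restricted components all lie above a common
      \<open>DD m\<close>, so a representative of the component there serves for all of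
      them.\<close>
    define I where "I = {i \<in> fam. U i \<noteq> carrier (G Mod i)}"
    have "finite (expo ` I)" using U(1) by (simp add: I_def)
    then obtain m where m: "\<And>B. B \<in> I \<Longrightarrow> expo B \<le> m" by (meson finite_nat_set_iff_bounded_le imageI)
    obtain g where g: "g \<in> carrier G" "x (DD m) = DD m #> g" using Gp_coset[OF x DD_fam] .
    have "x N = N #> g" using Gp_refine[OF x DD_fam N_fam _ g(2,1)] fam_normal(2)[OF DD_fam] by simp
    then have gN: "g \<in> N" using xN coset_join1[OF _ g(1) subgroup_N] by simp
    have "\<iota> g B \<in> U B" if B: "B \<in> fam" for B
    proof (cases "B \<in> I")
      case True
      then have "DD m \<subseteq> B" using DD_subset[OF B] DD_mono[OF m] by blast
      then have "x B = B #> g" using Gp_refine[OF x DD_fam B _ g(2,1)] by simp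
      then show ?thesis using U(2) B by (auto simp: iota(2) PiE_iff)
    next
      case False
      then have "U B = carrier (G Mod B)" using B by (simp add: I_def)
      then show ?thesis using B g by (auto simp: iota(2) carrier_FactGroup)
    qed
    then have "\<iota> g \<in> Pi\<^sub>E fam U" by (auto simp: completion_map_def)
    then show "\<exists>y. y \<in> \<iota> ` N \<and> y \<in> T" using U(3) T'(2) iota(1)[OF g(1)] gN by blast
  qed
qed

lemma subgroup_Np: "subgroup Np Gp"
  unfolding Np_eq using hat_normal[OF N_fam] by (rule normal_imp_subgroup)

lemma hat_subset_Np: assumes "C \<in> fam" shows "hat C \<subseteq> Np"
proof
  fix x assume "x \<in> hat C"
  then have x: "x \<in> carrier Gp" "x C = C #> \<one>"
    using fam_normal(3)[OF assms] by (auto simp: hat_def subgroup.subset)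
  then have "x N = N #> \<one>" using Gp_refine[OF x(1) assms N_fam fam_normal(2)[OF assms] x(2)] by simp
  then show "x \<in> Np" using x subgroup.subset[OF subgroup_N] by (simp add: Np_eq hat_def)
qed

lemma Np_coset:
  assumes "x \<in> Np" "B \<in> fam" obtains n where "n \<in> N" "x B = B #> n"
proof -
  have x: "x \<in> carrier Gp" "x N = N" using assms by (auto simp: Np_eq hat_def)
  obtain g where g: "g \<in> carrier G" "x B = B #> g" using Gp_coset[OF x(1) assms(2)] .
  then have "x N = N #> g" using Gp_refine[OF x(1) assms(2) N_fam fam_normal(2)[OF assms(2)]] by simp
  then have "g \<in> N" using x coset_join1[OF _ g(1) subgroup_N] by simp
  then show thesis using that g by blast
qed

lemma iota_Np: "n \<in> N \<Longrightarrow> \<iota> n \<in> Np"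
  using iota(1)[of n] coset_join2[OF _ subgroup_N, of n] iota(2)[OF N_fam, of n] by (simp add: Np_eq hat_def)

lemma card_rcosets_hat:
  assumes C: "C \<in> fam"
  shows "card (rcosets\<^bsub>Gp\<lparr>carrier := Np\<rparr>\<^esub> (hat C)) = card (rcosets\<^bsub>GN\<^esub> C)"
proof -
  have grp: "group (Gp\<lparr>carrier := Np\<rparr>)" using subgroup_Np group_Gp by (rule subgroup.subgroup_is_group)
  have sub: "subgroup (hat C) (Gp\<lparr>carrier := Np\<rparr>)"
    using group.subgroup_incl[OF group_Gp normal_imp_subgroup[OF hat_normal[OF C]] subgroup_Np hat_subset_Np[OF C]] .
  have "card (rcosets\<^bsub>Gp\<lparr>carrier := Np\<rparr>\<^esub> (hat C)) = card ((\<lambda>x. x C) ` carrier (Gp\<lparr>carrier := Np\<rparr>))"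
  proof (rule group.card_rcosets_detect[OF grp sub])
    fix x y assume xy: "x \<in> carrier (Gp\<lparr>carrier := Np\<rparr>)" "y \<in> carrier (Gp\<lparr>carrier := Np\<rparr>)"
    then have "x \<in> carrier Gp" "y \<in> carrier Gp" using subgroup.subset[OF subgroup_Np] by auto
    moreover have "inv\<^bsub>Gp\<lparr>carrier := Np\<rparr>\<^esub> y = inv\<^bsub>Gp\<^esub> y"
      using xy group.m_inv_consistent[OF group_Gp subgroup_Np] by simp
    ultimately show "(x C = y C) = (x \<otimes>\<^bsub>Gp\<lparr>carrier := Np\<rparr>\<^esub> inv\<^bsub>Gp\<lparr>carrier := Np\<rparr>\<^esub> y \<in> hat C)"
      using hat_iff[OF C] by simp
  qed
  also have "(\<lambda>x. x C) ` carrier (Gp\<lparr>carrier := Np\<rparr>) = rcosets\<^bsub>GN\<^esub> C"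
  proof (intro subset_antisym subsetI)
    fix X assume "X \<in> (\<lambda>x. x C) ` carrier (Gp\<lparr>carrier := Np\<rparr>)"
    then obtain x where x: "x \<in> Np" "X = x C" by auto
    obtain n where "n \<in> N" "x C = C #> n" using Np_coset[OF x(1) C] .
    then show "X \<in> rcosets\<^bsub>GN\<^esub> C" unfolding x(2) RCOSETS_def by auto
  next
    fix X assume "X \<in> rcosets\<^bsub>GN\<^esub> C"
    then obtain n where n: "n \<in> N" "X = C #> n" by (auto simp: RCOSETS_def)
    then have "X = \<iota> n C" using iota(2)[OF C] by simp
    then show "X \<in> (\<lambda>x. x C) ` carrier (Gp\<lparr>carrier := Np\<rparr>)" using iota_Np[OF n(1)] by simp
  qed
  finally show ?thesis .
qed

section \<open>Powers with p-adic exponents and open subgroups\<close>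

definition coherent :: "(nat \<Rightarrow> int) \<Rightarrow> bool" where
  "coherent i \<longleftrightarrow> (\<forall>n. [i (Suc n) = i n] (mod q ^ n))"

lemma coherent_le:
  assumes "coherent i" "n \<le> m" shows "[i m = i n] (mod q ^ n)"
  using assms(2)
proof (induction m rule: dec_induct)
  case (step m)
  have "[i (Suc m) = i m] (mod q ^ m)" using assms(1) by (simp add: coherent_def)
  then have "[i (Suc m) = i m] (mod q ^ n)" using step(1) le_imp_power_dvd cong_dvd_modulus by blast
  then show ?case using step(3) cong_trans by blast
qed simp

text \<open>Division of a p-adic integer by \<open>M\<close>. The part \<open>M'\<close> is a unit;
  cancelling \<open>q ^ a\<close> loses \<open>a\<close> digits, which is why the quotient at level
  \<open>n\<close> is computed from the term with index \<open>n + a\<close>.\<close>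

lemma coherent_div:
  assumes i: "coherent i" and M: "M = p ^ a * M'" "\<not> p dvd M'" and d: "\<And>n. n \<ge> a \<Longrightarrow> q ^ a dvd i n"
  obtains i' where "coherent i'" "\<And>n. [int M * i' n = i n] (mod q ^ n)"
proof -
  have "coprime p M'" using M(2) prime_p prime_imp_coprime by blast
  then have "coprime (int M') q" by (simp add: coprime_commute)
  then have cop: "coprime (int M') (q ^ n)" for n by simp
  have "\<exists>x. [int M * x = i (n + a)] (mod q ^ (n + a))" for n
  proof -
    obtain t where t: "i (n + a) = q ^ a * t" using d[of "n + a"] by (auto elim!: dvdE)
    obtain r where "[int M' * r = 1] (mod q ^ n)" using cop cong_solve_coprime_int by blast
    then have "q ^ n dvd (int M' * r - 1) * t" by (simp add: cong_iff_dvd_diff)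
    then have "q ^ a * q ^ n dvd q ^ a * ((int M' * r - 1) * t)" by simp
    moreover have "q ^ a * ((int M' * r - 1) * t) = int M * (r * t) - i (n + a)"
      unfolding t by (simp add: M algebra_simps)
    ultimately have "q ^ (n + a) dvd int M * (r * t) - i (n + a)" by (metis add.commute power_add)
    then show ?thesis unfolding cong_iff_dvd_diff by blast
  qed
  then obtain i' where i': "\<And>n. [int M * i' n = i (n + a)] (mod q ^ (n + a))" by metis
  have "coherent i'" unfolding coherent_def
  proof
    fix n
    have "[int M * i' (Suc n) = i (Suc n + a)] (mod q ^ (n + a))"
      using i'[of "Suc n"] by (rule cong_dvd_modulus) (simp add: le_imp_power_dvd)
    moreover have "[i (Suc n + a) = i (n + a)] (mod q ^ (n + a))" using i by (simp add: coherent_def)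
    ultimately have "[int M * i' (Suc n) = int M * i' n] (mod q ^ (n + a))"
      using i'[of n] by (metis cong_sym cong_trans)
    then have "q ^ a * q ^ n dvd q ^ a * (int M' * (i' (Suc n) - i' n))"
      by (simp add: cong_iff_dvd_diff M power_add algebra_simps)
    then have "q ^ n dvd int M' * (i' (Suc n) - i' n)" using prime_p by (simp add: prime_gt_0_nat)
    then show "[i' (Suc n) = i' n] (mod q ^ n)"
      using cop by (metis cong_iff_dvd_diff coprime_commute coprime_dvd_mult_right_iff)
  qed
  moreover have "[int M * i' n = i n] (mod q ^ n)" for n
  proof -
    have "[int M * i' n = i (n + a)] (mod q ^ n)"
      using i'[of n] by (rule cong_dvd_modulus) (simp add: le_imp_power_dvd)
    then show ?thesis using coherent_le[OF i, of n "n + a"] cong_trans by fastforce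
  qed
  ultimately show thesis by (rule that)
qed

text \<open>The value of the one-parameter subgroup \<open>E\<close> at the p-adic integer given by
  the sequence; in the component at \<open>B\<close> an exponent known modulo
  \<open>q ^ expo B\<close> is precise enough.\<close>

definition pw :: "(int \<Rightarrow> 'a) \<Rightarrow> (nat \<Rightarrow> int) \<Rightarrow> 'a set \<Rightarrow> 'a set" where
  "pw E i = (\<lambda>B\<in>fam. B #> E (i (expo B)))"

lemma pw_Np:
  assumes E: "one_param E" and i: "coherent i" shows "pw E i \<in> Np"
proof -
  have EN: "E j \<in> N" for j using one_param_simps(1)[OF E] .
  have "B #> E (i (expo B)) \<subseteq> C #> E (i (expo C))" if BC: "B \<in> fam" "C \<in> fam" "B \<subseteq> C" for B C
  proof -
    have "C #> E (i (expo B)) = C #> E (i (expo C))"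
    proof (cases "expo B \<le> expo C")
      case True
      then have "[i (expo B) = i (expo C)] (mod q ^ expo B)" using coherent_le[OF i] by (blast intro: cong_sym)
      then show ?thesis using one_param_coset[OF E BC] by blast
    next
      case False
      then have "[i (expo B) = i (expo C)] (mod q ^ expo C)" using coherent_le[OF i] by simp
      then show ?thesis using one_param_coset[OF E BC(2,2)] by blast
    qed
    moreover have "B #> E (i (expo B)) \<subseteq> C #> E (i (expo B))" using BC(3) by (auto simp: r_coset_def)
    ultimately show ?thesis by simp
  qed
  then have "pw E i \<in> carrier Gp" using EN by (auto simp: carrier_Gp pw_def carrier_FactGroup)
  moreover have "pw E i N = N" using EN N_fam coset_join2[OF _ subgroup_N] by (simp add: pw_def)
  ultimately show ?thesis by (simp add: Np_eq hat_def)
qed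

lemma pw_pow:
  assumes E: "one_param E"
  shows "pw E i [^]\<^bsub>Gp\<^esub> (k::nat) = pw E (\<lambda>n. int k * i n)"
proof (induction k)
  case 0
  have "(\<lambda>B\<in>fam. B) = pw E (\<lambda>n. int 0 * i n)"
    unfolding pw_def by (rule restrict_ext) (simp add: one_param_simps(3)[OF E] fam_normal(3) subgroup.subset)
  then show ?case by (simp add: one_Gp)
next
  case (Suc k)
  have EN: "E j \<in> carrier G" for j using one_param_simps(1)[OF E] by simp
  have "pw E i [^]\<^bsub>Gp\<^esub> Suc k = (\<lambda>B\<in>fam. (B #> E (int k * i (expo B))) <#> (B #> E (i (expo B))))"
    unfolding monoid.nat_pow_Suc[OF group.is_monoid[OF group_Gp]] Suc mult_Gp by (rule restrict_ext) (simp add: pw_def)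
  also have "\<dots> = pw E (\<lambda>n. int (Suc k) * i n)"
    unfolding pw_def using EN normal.rcos_sum[OF fam_normal(1)] one_param_simps(2)[OF E, symmetric]
    by (intro restrict_ext) (simp add: algebra_simps)
  finally show ?case .
qed

lemma pw_cong:
  assumes E: "one_param E" and "\<And>n. [i n = j n] (mod q ^ n)" shows "pw E i = pw E j"
  unfolding pw_def using assms by (intro restrict_ext one_param_coset) auto

lemma normal_finite_index_open:
  assumes BB: "BB \<lhd> Gp" "BB \<subseteq> Np" and fin: "finite (rcosets\<^bsub>Gp\<lparr>carrier := Np\<rparr>\<^esub> BB)"
  shows "\<exists>m. hat (DD m) \<subseteq> BB"
proof -
  define GNp where "GNp = Gp\<lparr>carrier := Np\<rparr>"
  have nB: "BB \<lhd> GNp"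
    unfolding GNp_def using group.normal_restrict_supergroup[OF group_Gp subgroup_Np BB] .
  have grp: "group (GNp Mod BB)" using nB by (rule normal.factorgroup_is_group)
  have grpN: "group GNp" unfolding GNp_def using subgroup_Np group_Gp by (rule subgroup.subgroup_is_group)
  have sB: "subgroup BB Gp" using BB by (simp add: normal_imp_subgroup)
  define M where "M = order (GNp Mod BB)"
  have "finite (carrier (GNp Mod BB))" using fin by (simp add: FactGroup_def GNp_def)
  then have "M > 0" using monoid.order_gt_0_iff_finite[OF group.is_monoid[OF grp]] by (simp add: M_def)
  have pow: "x [^]\<^bsub>Gp\<^esub> M \<in> BB" if x: "x \<in> Np" for x
  proof -
    have xN: "x \<in> carrier GNp" using x by (simp add: GNp_def)
    then have "BB #>\<^bsub>GNp\<^esub> x \<in> carrier (GNp Mod BB)" by (auto simp: carrier_FactGroup)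
    then have "(BB #>\<^bsub>GNp\<^esub> x) [^]\<^bsub>GNp Mod BB\<^esub> M = BB"
      using group.pow_order_eq_1[OF grp] by (simp add: M_def)
    then have "BB #>\<^bsub>GNp\<^esub> (x [^]\<^bsub>GNp\<^esub> M) = BB" using normal.FactGroup_pow[OF nB xN] by simp
    then have "x [^]\<^bsub>GNp\<^esub> M \<in> BB"
      using group.coset_join1[OF grpN _ monoid.nat_pow_closed[OF group.is_monoid[OF grpN] xN] normal_imp_subgroup[OF nB]]
      by simp
    then show ?thesis using monoid.nat_pow_consistent[OF group.is_monoid[OF group_Gp]] by (simp add: GNp_def)
  qed
  have prime: "prime p" by (rule prime_p)
  define a where "a = multiplicity p M"
  obtain M' where M': "M = p ^ a * M'" "\<not> p dvd M'"
    using multiplicity_decompose'[of M p] \<open>M > 0\<close> prime unfolding a_def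
    by (metis not_prime_unit not_gr_zero)
  \<comment> \<open>The exponent \<open>a\<close> is the valuation of \<open>M\<close>: coordinates
    divisible by \<open>q ^ a\<close> can be divided by \<open>M\<close> among the p-adic
    integers.\<close>
  have "hat (DD a) \<subseteq> BB"
  proof
    fix x assume x: "x \<in> hat (DD a)"
    then have xN: "x \<in> Np" and xG: "x \<in> carrier Gp" and xa: "x (DD a) = DD a"
      using hat_subset_Np[OF DD_fam] by (auto simp: hat_def)
    have "\<exists>n. n \<in> N \<and> x (DD m) = DD m #> n" for m using Np_coset[OF xN DD_fam] by metis
    then obtain y where y: "\<And>m. y m \<in> N" "\<And>m. x (DD m) = DD m #> y m" by metis
    \<comment> \<open>Representatives at two levels agree modulo the coarser one. The cocycle term
      in the central coordinate contains the difference of the \<open>v\<close>-coordinates and is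
      absorbed.\<close>
    have diff: "q ^ m dvd u (y n) - u (y m) \<and> q ^ m dvd v (y n) - v (y m) \<and> q ^ m dvd c (y n) - c (y m)"
      if "m \<le> n" for m n
    proof -
      have "x (DD m) = DD m #> y n" using Gp_refine[OF xG DD_fam DD_fam DD_mono[OF that] y(2)] y(1) by simp
      then have "DD m #> y n = DD m #> y m" using y(2)[of m] by simp
      then have "y n \<otimes> inv (y m) \<in> DD m"
        using coset_eq_iff[OF fam_normal(3)[OF DD_fam]] y(1) by simp
      then have d: "q ^ (2 * m) dvd u (y n) - u (y m)" "q ^ (2 * m) dvd v (y n) - v (y m)"
        "q ^ m dvd c (y n) - c (y m) - \<kappa> * (v (y n) - v (y m)) * u (y m)"
        using y by (auto simp: DD_def u_mult v_mult c_mult inv_coords algebra_simps)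
      have "q ^ m dvd q ^ (2 * m)" by (simp add: le_imp_power_dvd)
      then have d': "q ^ m dvd u (y n) - u (y m)" "q ^ m dvd v (y n) - v (y m)" using d dvd_trans by blast+
      then have "q ^ m dvd (c (y n) - c (y m) - \<kappa> * (v (y n) - v (y m)) * u (y m)) + \<kappa> * (v (y n) - v (y m)) * u (y m)"
        using d(3) by (intro dvd_add dvd_mult2 dvd_mult)
      then show ?thesis using d' by simp
    qed
    have "y a \<in> DD a" using xa y coset_join1[OF _ _ fam_normal(3)[OF DD_fam]] by (metis N_carrier)
    then have da: "q ^ a dvd u (y a)" "q ^ a dvd v (y a)" "q ^ a dvd c (y a)"
      using DD_dvd by auto
    have coh: "coherent (\<lambda>n. u (y n))" "coherent (\<lambda>n. v (y n))" "coherent (\<lambda>n. c (y n))"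
      unfolding coherent_def cong_iff_dvd_diff using diff by auto
    have dn: "q ^ a dvd u (y n)" "q ^ a dvd v (y n)" "q ^ a dvd c (y n)" if "n \<ge> a" for n
      using diff[OF that] da by (metis diff_add_cancel dvd_add)+
    obtain i where i: "coherent i" "\<And>n. [int M * i n = u (y n)] (mod q ^ n)"
      using coherent_div[OF coh(1) M' dn(1)] by blast
    obtain j where j: "coherent j" "\<And>n. [int M * j n = v (y n)] (mod q ^ n)"
      using coherent_div[OF coh(2) M' dn(2)] by blast
    obtain l where l: "coherent l" "\<And>n. [int M * l n = c (y n)] (mod q ^ n)"
      using coherent_div[OF coh(3) M' dn(3)] by blast
    have B3: "pw E1 (\<lambda>n. u (y n)) \<in> BB" "pw E2 (\<lambda>n. v (y n)) \<in> BB" "pw E3 (\<lambda>n. c (y n)) \<in> BB"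
      using pow[OF pw_Np[OF one_param_E(1) i(1)]] pow[OF pw_Np[OF one_param_E(2) j(1)]]
        pow[OF pw_Np[OF one_param_E(3) l(1)]]
      unfolding pw_pow[OF one_param_E(1)] pw_pow[OF one_param_E(2)] pw_pow[OF one_param_E(3)]
        pw_cong[OF one_param_E(1) i(2)] pw_cong[OF one_param_E(2) j(2)] pw_cong[OF one_param_E(3) l(2)]
      by auto
    define z where "z = pw E1 (\<lambda>n. u (y n)) \<otimes>\<^bsub>Gp\<^esub> pw E2 (\<lambda>n. v (y n)) \<otimes>\<^bsub>Gp\<^esub> pw E3 (\<lambda>n. c (y n))"
    have zB: "z \<in> BB" unfolding z_def using B3 sB by (simp add: subgroup.m_closed)
    have "x = z"
    \<comment> \<open>Equality is checked in each component \<open>B\<close>: there \<open>z\<close>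
      has the normal form of \<open>y (expo B)\<close>, which represents \<open>x\<close> because
      \<open>DD (expo B)\<close> lies in \<open>B\<close>.\<close>
    proof (rule extensionalityI[of _ fam])
      show "x \<in> extensional fam" using xG by (auto simp: carrier_Gp PiE_def)
      show "z \<in> extensional fam" by (simp add: z_def mult_Gp)
      fix B assume B: "B \<in> fam"
      have E: "E1 k \<in> carrier G" "E2 k \<in> carrier G" "E3 k \<in> carrier G" for k
        using one_param_simps(1)[OF one_param_E(1)] one_param_simps(1)[OF one_param_E(2)] one_param_simps(1)[OF one_param_E(3)] by auto
      have "z B = B #> (E1 (u (y (expo B))) \<otimes> E2 (v (y (expo B))) \<otimes> E3 (c (y (expo B))))"
        unfolding z_def using B E by (intro Gp_mult_coset) (auto simp: pw_def)
      also have "\<dots> = B #> y (expo B)" using el_coords[OF y(1)] by (simp add: el_E)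
      also have "\<dots> = x B"
        using Gp_refine[OF xG DD_fam B DD_subset[OF B] y(2)] y(1) by simp
      finally show "x B = z B" by simp
    qed
    then show "x \<in> BB" using zB by simp
  qed
  then show ?thesis by blast
qed

text \<open>The inverse takes the preimage in \<open>G\<close>. Membership in a subgroup of
  \<open>Np\<close> that contains \<open>hat (DD m)\<close> depends only on the component at
  \<open>DD m\<close>, and for elements of \<open>Np\<close> this component is that of some
  \<open>\<iota> n\<close> with \<open>n\<close> in \<open>N\<close>.\<close>

lemma bij_hat: "bij_betw hat fam (partial_zeta_domain Gp Np)"
proof (rule bij_betw_imageI)
  have pre: "C = {n \<in> N. \<iota> n \<in> hat C}" if C: "C \<in> fam" for C
  proof -
    have "n \<in> C \<longleftrightarrow> \<iota> n \<in> hat C" if n: "n \<in> N" for n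
      using iota(1)[of n] iota(2)[OF C, of n] n coset_join1[OF _ _ fam_normal(3)[OF C], of n]
        coset_join2[OF _ fam_normal(3)[OF C], of n] unfolding hat_def by auto
    then show ?thesis using fam_normal(2)[OF C] by blast
  qed
  show "inj_on hat fam" by (rule inj_onI) (metis pre)
  show "hat ` fam = partial_zeta_domain Gp Np"
  proof (intro subset_antisym subsetI)
    fix X assume "X \<in> hat ` fam"
    then obtain C where C: "C \<in> fam" "X = hat C" by blast
    have "card (rcosets\<^bsub>Gp\<lparr>carrier := Np\<rparr>\<^esub> (hat C)) \<noteq> 0"
      using card_rcosets_hat[OF C(1)] expo[OF C(1)] prime_p by (simp add: prime_gt_0_nat)
    then have "finite (rcosets\<^bsub>Gp\<lparr>carrier := Np\<rparr>\<^esub> (hat C))" by (metis card.infinite)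
    then show "X \<in> partial_zeta_domain Gp Np"
      using C hat_normal hat_subset_Np by (simp add: partial_zeta_domain_def)
  next
    fix BB assume "BB \<in> partial_zeta_domain Gp Np"
    then have BB: "BB \<lhd> Gp" "BB \<subseteq> Np" "finite (rcosets\<^bsub>Gp\<lparr>carrier := Np\<rparr>\<^esub> BB)"
      by (auto simp: partial_zeta_domain_def)
    then obtain m where m: "hat (DD m) \<subseteq> BB" using normal_finite_index_open by blast
    have sBB: "subgroup BB Gp" using BB by (simp add: normal_imp_subgroup)
    interpret h: group_hom G Gp \<iota> by (rule iota_hom)
    define C where "C = {g \<in> carrier G. \<iota> g \<in> BB}"
    have CN: "C \<subseteq> N"
    proof
      fix g assume "g \<in> C"
      then have "\<iota> g \<in> Np" "g \<in> carrier G" using BB(2) by (auto simp: C_def)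
      then show "g \<in> N" using iota(2)[OF N_fam] coset_join1[OF _ _ subgroup_N] by (auto simp: Np_eq hat_def)
    qed
    have sC: "subgroup C G"
      by (rule subgroupI) (use sBB in \<open>auto simp: C_def subgroup.m_closed subgroup.m_inv_closed subgroup.one_closed intro!: exI[of _ \<one>]\<close>)
    have nC: "C \<lhd> G" unfolding normal_inv_iff
      using sC normal.inv_op_closed2[OF BB(1)] by (auto simp: C_def)
    have DC: "DD m \<subseteq> C"
    proof
      fix n assume n: "n \<in> DD m"
      then have "n \<in> carrier G" by (simp add: DD_def)
      moreover have "\<iota> n \<in> hat (DD m)" using n \<open>n \<in> carrier G\<close> iota iota(2)[OF DD_fam] coset_join2[OF _ fam_normal(3)[OF DD_fam]]
        by (simp add: hat_def)
      ultimately show "n \<in> C" using m by (auto simp: C_def)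
    qed
    have Cfam: "C \<in> fam"
    proof -
      have "el 0 0 (q ^ m) \<in> C" "el (q ^ (2 * m)) 0 0 \<in> C" "el 0 (q ^ (2 * m)) 0 \<in> C"
        using DC by (auto simp: DD_def)
      then have "el 0 0 (q ^ m) \<in> C" "(q ^ (2 * m), 0) \<in> uv ` C" "(0, q ^ (2 * m)) \<in> uv ` C"
        by (metis imageI uv_el)+
      then obtain e a b w where "primitive q w" "C \<in> Fib (lat q e a w) b"
        using Fib_classification[OF nC CN] by metis
      then have "C \<in> cls e a b" unfolding cls_def using Fib_lat_inv by blast
      then show ?thesis unfolding family_eq by blast
    qed
    have "BB = hat C"
    proof -
      have key: "x \<in> BB \<longleftrightarrow> n \<in> C" if x: "x \<in> Np" "x (DD m) = DD m #> n" and n: "n \<in> N" for x n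
      proof -
        have xG: "x \<in> carrier Gp" using x subgroup.subset[OF subgroup_Np] by blast
        have "x (DD m) = \<iota> n (DD m)" using x iota(2)[OF DD_fam] by simp
        then have d: "x \<otimes>\<^bsub>Gp\<^esub> inv\<^bsub>Gp\<^esub> \<iota> n \<in> BB" using hat_iff[OF DD_fam xG iota(1)] n m by auto
        have "x = x \<otimes>\<^bsub>Gp\<^esub> inv\<^bsub>Gp\<^esub> \<iota> n \<otimes>\<^bsub>Gp\<^esub> \<iota> n" using xG n by (simp add: h.H.m_assoc)
        moreover have "\<iota> n = inv\<^bsub>Gp\<^esub> (x \<otimes>\<^bsub>Gp\<^esub> inv\<^bsub>Gp\<^esub> \<iota> n) \<otimes>\<^bsub>Gp\<^esub> x"
          using xG n by (simp add: h.H.inv_mult_group h.H.m_assoc)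
        ultimately have "x \<in> BB \<longleftrightarrow> \<iota> n \<in> BB" using d sBB
          by (metis subgroup.m_closed subgroup.m_inv_closed)
        then show ?thesis using n by (simp add: C_def)
      qed
      have key2: "x \<in> hat C \<longleftrightarrow> n \<in> C" if x: "x \<in> Np" "x (DD m) = DD m #> n" and n: "n \<in> N" for x n
      proof -
        have xG: "x \<in> carrier Gp" using x subgroup.subset[OF subgroup_Np] by blast
        have "x C = C #> n" using Gp_refine[OF xG DD_fam Cfam DC x(2)] n by simp
        then show ?thesis using xG n coset_join1[OF _ _ sC] coset_join2[OF _ sC] by (auto simp: hat_def)
      qed
      show ?thesis
      proof (rule Set.set_eqI)
        fix x
        show "x \<in> BB \<longleftrightarrow> x \<in> hat C"
        proof (cases "x \<in> Np")
          case True
          obtain n where "n \<in> N" "x (DD m) = DD m #> n" using Np_coset[OF True DD_fam] .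
          then show ?thesis using key key2 True by blast
        next
          case False then show ?thesis using BB(2) hat_subset_Np[OF Cfam] by blast
        qed
      qed
    qed
    then show "BB \<in> hat ` fam" using Cfam by blast
  qed
qed

lemma zeta_family:
  "partial_zeta_converges Gp Np s \<longleftrightarrow>
     (\<lambda>B. (of_nat (card (rcosets\<^bsub>GN\<^esub> B)) powr (- s) :: complex)) summable_on fam"
  "partial_zeta Gp Np s = infsum (\<lambda>B. of_nat (card (rcosets\<^bsub>GN\<^esub> B)) powr (- s)) fam"
proof -
  have t: "partial_zeta_term Gp Np s (hat B) = of_nat (card (rcosets\<^bsub>GN\<^esub> B)) powr (- s)" if "B \<in> fam" for B
    using card_rcosets_hat[OF that] by (simp add: partial_zeta_term_def)
  show "partial_zeta Gp Np s = infsum (\<lambda>B. of_nat (card (rcosets\<^bsub>GN\<^esub> B)) powr (- s)) fam"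
    unfolding partial_zeta_def infsum_reindex_bij_betw[OF bij_hat, symmetric] using t by (rule infsum_cong)
  show "partial_zeta_converges Gp Np s \<longleftrightarrow>
     (\<lambda>B. (of_nat (card (rcosets\<^bsub>GN\<^esub> B)) powr (- s) :: complex)) summable_on fam"
    unfolding partial_zeta_converges_def summable_on_reindex_bij_betw[OF bij_hat, symmetric]
    using t by (rule summable_on_cong)
qed

end

section \<open>Coordinates on class-two groups of Hirsch length three\<close>

lemma int_subgroup_principal:
  fixes S :: "int set"
  assumes 0: "0 \<in> S" and diff: "\<And>x y. x \<in> S \<Longrightarrow> y \<in> S \<Longrightarrow> x - y \<in> S"
  obtains d where "d \<in> S" "\<And>x. x \<in> S \<longleftrightarrow> d dvd x"
proof -
  have add: "add_subgroup {x. fst x \<in> S \<and> snd x = 0}"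
    using 0 diff by (auto simp: add_subgroup_def)
  have mult: "i * x \<in> S" if "x \<in> S" for i x
    using add_subgroup_sm[OF add, of "(x, 0)" i] that by simp
  show thesis
  proof (cases "\<exists>x\<in>S. x \<noteq> 0")
    case False
    then show thesis using that[of 0] 0 by (metis dvd_0_left_iff dvd_0_right)
  next
    case True
    then obtain x where x: "x \<in> S" "x \<noteq> 0" by blast
    have "\<bar>x\<bar> \<in> S" using x mult[of x "sgn x"] by (simp add: abs_sgn mult.commute)
    moreover have "nat \<bar>x\<bar> > 0" "int (nat \<bar>x\<bar>) = \<bar>x\<bar>" using x by auto
    ultimately have ex: "\<exists>n. n > 0 \<and> int n \<in> S" by metis
    define n where "n = (LEAST n. n > 0 \<and> int n \<in> S)"
    have n: "n > 0" "int n \<in> S" "\<And>k. k > 0 \<Longrightarrow> int k \<in> S \<Longrightarrow> n \<le> k"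
      using LeastI_ex[OF ex] Least_le[of "\<lambda>n. n > 0 \<and> int n \<in> S"] by (auto simp: n_def)
    have "y \<in> S \<longleftrightarrow> int n dvd y" for y
    proof
      assume "int n dvd y"
      then show "y \<in> S" using mult[OF n(2)] by (auto simp: mult.commute elim!: dvdE)
    next
      assume y: "y \<in> S"
      have "y mod int n = y - (y div int n) * int n" by (simp add: minus_div_mult_eq_mod)
      then have r: "y mod int n \<in> S" using diff[OF y mult[OF n(2)]] by simp
      have small: "t = 0" if t: "t \<in> S" "0 \<le> t" "t < int n" for t
      proof (rule ccontr)
        assume "t \<noteq> 0"
        then have "nat t > 0" "int (nat t) = t" using t by auto
        then have "n \<le> nat t" using n(3) t(1) by metis
        then show False using t by linarith
      qed
      have "y mod int n = 0" using r n(1) by (intro small) auto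
      then show "int n dvd y" by (rule dvd_eq_mod_eq_0[THEN iffD2])
    qed
    then show thesis using that n(2) by blast
  qed
qed

text \<open>A triangular basis: \<open>d\<close> generates the second coordinates of
  \<open>L\<close>, and \<open>(a, 0)\<close> generates its intersection with the first
  axis.\<close>

lemma plane_lattice_basis:
  assumes L: "add_subgroup L" and m: "m \<noteq> 0" "(m, 0) \<in> L" "(0, m) \<in> L"
  obtains x y where "x \<in> L" "y \<in> L" "wedge x y \<noteq> 0" "\<And>z. z \<in> L \<Longrightarrow> \<exists>i j. z = sm i x + sm j y"
proof -
  have L0: "0 \<in> L" and Ld: "\<And>x y. x \<in> L \<Longrightarrow> y \<in> L \<Longrightarrow> x - y \<in> L" using L by (auto simp: add_subgroup_def)
  obtain d where d: "d \<in> snd ` L" "\<And>x. x \<in> snd ` L \<longleftrightarrow> d dvd x"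
  proof (rule int_subgroup_principal[of "snd ` L"])
    show "0 \<in> snd ` L" using L0 by force
    show "x - y \<in> snd ` L" if xy: "x \<in> snd ` L" "y \<in> snd ` L" for x y
    proof -
      obtain x' y' where "x' \<in> L" "y' \<in> L" "x = snd x'" "y = snd y'" using xy by blast
      then have "x' - y' \<in> L" "x - y = snd (x' - y')" using Ld by auto
      then show ?thesis by blast
    qed
  qed blast
  obtain a where a: "a \<in> {x. (x, 0) \<in> L}" "\<And>x. x \<in> {x. (x, 0) \<in> L} \<longleftrightarrow> a dvd x"
  proof (rule int_subgroup_principal[of "{x. (x, 0) \<in> L}"])
    show "0 \<in> {x. (x, 0) \<in> L}" using L0 by (simp add: zero_prod_def)
    show "x - y \<in> {x. (x, 0) \<in> L}" if "x \<in> {x. (x, 0) \<in> L}" "y \<in> {x. (x, 0) \<in> L}" for x y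
      using that Ld[of "(x, 0)" "(y, 0)"] by simp
  qed blast
  obtain y where y: "y \<in> L" "snd y = d" using d(1) by blast
  have "a \<noteq> 0" using a(2)[of m] m by auto
  have "d \<noteq> 0" using d(2)[of m] m by force
  show thesis
  proof (rule that[of "(a, 0)" y])
    show "(a, 0) \<in> L" "y \<in> L" using a(1) y by auto
    show "wedge (a, 0) y \<noteq> 0" using \<open>a \<noteq> 0\<close> \<open>d \<noteq> 0\<close> y by (simp add: wedge_def)
    fix z assume z: "z \<in> L"
    then obtain j where j: "snd z = d * j" using d(2) by (metis dvdE imageI)
    have "z - sm j y \<in> L" using Ld z add_subgroup_sm[OF L y(1)] by blast
    moreover have zz: "z - sm j y = (fst z - j * fst y, 0)" using j y by (simp add: prod_eq_iff)
    ultimately have "a dvd fst z - j * fst y" using a(2) by simp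
    then obtain i where "fst z - j * fst y = a * i" by blast
    then have "z = sm i (a, 0) + sm j y" using zz by (simp add: prod_eq_iff algebra_simps)
    then show "\<exists>i j. z = sm i (a, 0) + sm j y" by blast
  qed
qed

section \<open>Ranks of abelian groups\<close>

context comm_group
begin

fun lc :: "'a list \<Rightarrow> int list \<Rightarrow> 'a" where
  "lc (e # es) (a # as) = e [^] a \<otimes> lc es as"
| "lc _ _ = \<one>"

lemma lc_closed: "set es \<subseteq> carrier G \<Longrightarrow> lc es as \<in> carrier G"
  by (induction es as rule: lc.induct) auto

text \<open>\<open>A\<close> contains a free abelian subgroup of rank \<open>r\<close> that contains all \<open>m\<close>-th powers of \<open>A\<close>.\<close>

definition rank :: "'a set \<Rightarrow> nat \<Rightarrow> bool" where
  "rank A r \<longleftrightarrow> (\<exists>es m. set es \<subseteq> A \<and> A \<subseteq> carrier G \<and> length es = r \<and> m \<noteq> 0 \<and>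
     (\<forall>x\<in>A. \<exists>as. length as = r \<and> x [^] (m::int) = lc es as) \<and>
     (\<forall>as. length as = r \<longrightarrow> lc es as = \<one> \<longrightarrow> (\<forall>a\<in>set as. a = 0)))"

lemma rank_one: "rank {\<one>} 0"
  unfolding rank_def by (intro exI[of _ "[]"] exI[of _ 1]) auto

lemma rank_finite_step:
  assumes "rank A r" "A \<subseteq> B" "B \<subseteq> carrier G" "j \<noteq> 0" "\<And>x. x \<in> B \<Longrightarrow> x [^] (j::int) \<in> A"
  shows "rank B r"
proof -
  obtain es m where es: "set es \<subseteq> A" "length es = r" "m \<noteq> 0"
    "\<And>x. x \<in> A \<Longrightarrow> \<exists>as. length as = r \<and> x [^] (m::int) = lc es as"
    "\<And>as. length as = r \<Longrightarrow> lc es as = \<one> \<Longrightarrow> (\<forall>a\<in>set as. a = 0)"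
    using assms(1) unfolding rank_def by metis
  have "\<exists>as. length as = r \<and> x [^] (j * m) = lc es as" if "x \<in> B" for x
  proof -
    have "x \<in> carrier G" using assms(3) that by blast
    then show ?thesis using es(4)[OF assms(5)[OF that]] by (simp add: int_pow_pow)
  qed
  then show ?thesis unfolding rank_def using es assms by (intro exI[of _ es] exI[of _ "j * m"]) auto
qed

text \<open>The exponent \<open>j\<close> allows for a \<open>w\<close> that only generates a
  subgroup of finite index modulo \<open>A\<close>; it is absorbed into the new exponent
  \<open>j * m\<close>.\<close>

lemma rank_infinite_step:
  assumes A: "rank A r" "A \<subseteq> B" "B \<subseteq> carrier G" "subgroup A G" and w: "w \<in> B" and j: "j \<noteq> 0"
    and B: "\<And>x. x \<in> B \<Longrightarrow> \<exists>i::int. x [^] (j::int) \<otimes> inv (w [^] i) \<in> A" and ind: "\<And>a::int. w [^] a \<in> A \<Longrightarrow> a = 0"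
  shows "rank B (Suc r)"
proof -
  obtain es m where es: "set es \<subseteq> A" "length es = r" "m \<noteq> 0"
    "\<And>x. x \<in> A \<Longrightarrow> \<exists>as. length as = r \<and> x [^] (m::int) = lc es as"
    "\<And>as. length as = r \<Longrightarrow> lc es as = \<one> \<Longrightarrow> (\<forall>a\<in>set as. a = 0)"
    using A(1) unfolding rank_def by metis
  have wG: "w \<in> carrier G" using w A by blast
  have AG: "A \<subseteq> carrier G" using A by blast
  have lcA: "lc fs as \<in> A" if "set fs \<subseteq> A" for fs as
    using that A(4) by (induction fs as rule: lc.induct) (auto simp: subgroup.m_closed subgroup.one_closed subgroup_int_pow_closed)
  have span: "\<exists>as. length as = Suc r \<and> x [^] (j * m) = lc (w # es) as" if x: "x \<in> B" for x
  proof -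
    obtain i :: int where i: "x [^] j \<otimes> inv (w [^] i) \<in> A" using B[OF x] by blast
    define y where "y = x [^] j \<otimes> inv (w [^] i)"
    have xG: "x \<in> carrier G" using x A by blast
    have y: "y \<in> A" "y \<in> carrier G" using i AG by (auto simp: y_def)
    obtain as where as: "length as = r" "y [^] m = lc es as" using es(4)[OF y(1)] by blast
    have "x [^] j = w [^] i \<otimes> y" using xG wG by (simp add: y_def m_lcomm[of "w [^] i" "x [^] j"])
    then have "x [^] (j * m) = (w [^] i \<otimes> y) [^] m" using int_pow_pow[OF xG, of j m] by simp
    also have "\<dots> = (w [^] i) [^] m \<otimes> y [^] m" using wG y by (intro int_pow_mult_distrib m_comm) auto
    also have "\<dots> = lc (w # es) ((i * m) # as)" using as wG by (simp add: int_pow_pow)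
    finally show ?thesis using as by (intro exI[of _ "(i * m) # as"]) simp
  qed
  have indep: "\<forall>a\<in>set as. a = 0" if as: "length as = Suc r" "lc (w # es) as = \<one>" for as
  proof -
    obtain a bs where ab: "as = a # bs" "length bs = r" using as(1) by (metis length_Suc_conv)
    have l: "lc es bs \<in> A" using lcA[OF es(1)] .
    have "w [^] a = inv (lc es bs)" using as(2) ab l AG wG by (simp add: inv_equality[symmetric] subset_iff)
    then have "w [^] a \<in> A" using l A(4) by (simp add: subgroup.m_inv_closed)
    then have "a = 0" by (rule ind)
    then have "lc es bs = \<one>" using as(2) ab l AG by (auto simp: subset_iff)
    then show ?thesis using es(5)[OF ab(2)] ab \<open>a = 0\<close> by simp
  qed
  show ?thesis unfolding rank_def
    by (intro exI[of _ "w # es"] exI[of _ "j * m"]) (use es w A j span indep in auto)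
qed

lemma torsion_free_int:
  assumes "torsion_free G" "x \<in> carrier G" "x [^] (m::int) = \<one>" "m \<noteq> 0" shows "x = \<one>"
proof -
  have "x [^] \<bar>m\<bar> = \<one>"
    using assms(2,3) int_pow_neg[OF assms(2), of m] by (cases "m \<ge> 0") simp_all
  then have "x [^] nat \<bar>m\<bar> = \<one>" using int_pow_int[of G x "nat \<bar>m\<bar>"] by simp
  moreover have "nat \<bar>m\<bar> > 0" using assms(4) by simp
  ultimately show ?thesis using assms(1,2) unfolding torsion_free_def by blast
qed

lemma rank_0_trivial:
  assumes "rank (carrier G) 0" "torsion_free G" shows "carrier G = {\<one>}"
proof -
  obtain m where m: "m \<noteq> 0" "\<And>x. x \<in> carrier G \<Longrightarrow> x [^] (m::int) = \<one>"
    using assms(1) unfolding rank_def by auto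
  then show ?thesis using torsion_free_int[OF assms(2)] by auto
qed

text \<open>Taking \<open>m\<close>-th powers embeds the torsion-free group into the powers of
  \<open>e\<close>. The exponents that occur form a subgroup of the integers, and an element
  realising its generator \<open>d\<close> generates the group.\<close>

lemma rank_1_cyclic:
  assumes r: "rank (carrier G) 1" and tf: "torsion_free G"
  obtains x where "x \<in> carrier G" "\<And>y. y \<in> carrier G \<Longrightarrow> \<exists>!i::int. y = x [^] i"
proof -
  obtain es m where es: "set es \<subseteq> carrier G" "length es = 1" "m \<noteq> 0"
    "\<And>x. x \<in> carrier G \<Longrightarrow> \<exists>as. length as = 1 \<and> x [^] (m::int) = lc es as"
    "\<And>as. length as = 1 \<Longrightarrow> lc es as = \<one> \<Longrightarrow> (\<forall>a\<in>set as. a = 0)"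
    using r unfolding rank_def by metis
  obtain e where e: "es = [e]" using es(2) by (metis One_nat_def length_0_conv length_Suc_conv)
  have eG: "e \<in> carrier G" using es(1) e by simp
  have 1: "\<exists>a::int. x [^] m = e [^] a" if x: "x \<in> carrier G" for x
  proof -
    obtain as where "length as = 1" "x [^] m = lc es as" using es(4)[OF x] by blast
    then obtain a where "as = [a]" by (metis One_nat_def length_0_conv length_Suc_conv)
    then have "x [^] m = e [^] a" using \<open>x [^] m = lc es as\<close> e eG by simp
    then show ?thesis by blast
  qed
  have 2: "a = 0" if "e [^] a = \<one>" for a :: int using es(5)[of "[a]"] that e eG by simp
  define S :: "int set" where "S = {a. \<exists>x\<in>carrier G. x [^] m = e [^] a}"
  obtain d where d: "d \<in> S" "\<And>a. a \<in> S \<longleftrightarrow> d dvd a"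
  proof (rule int_subgroup_principal[of S])
    show "0 \<in> S" unfolding S_def by (auto intro!: bexI[of _ \<one>])
    fix a b assume "a \<in> S" "b \<in> S"
    then obtain x y where xy: "x \<in> carrier G" "y \<in> carrier G" "x [^] m = e [^] a" "y [^] m = e [^] b" by (auto simp: S_def)
    have "(x \<otimes> inv y) [^] m = x [^] m \<otimes> (inv y) [^] m" using xy by (intro int_pow_mult_distrib m_comm) auto
    also have "\<dots> = e [^] (a - b)" using xy eG by (simp add: int_pow_inv int_pow_diff)
    finally show "a - b \<in> S" using xy unfolding S_def by blast
  qed blast
  have "e [^] m = e [^] m" ..
  then have "m \<in> S" using eG unfolding S_def by blast
  then have d0: "d \<noteq> 0" using d(2) es(3) by (metis dvd_0_left)
  obtain x where x: "x \<in> carrier G" "x [^] m = e [^] d" using d(1) by (auto simp: S_def)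
  show thesis
  proof (rule that[OF x(1)])
    fix y assume y: "y \<in> carrier G"
    obtain a :: int where a: "y [^] m = e [^] a" using 1[OF y] by blast
    then have "a \<in> S" using y by (auto simp: S_def)
    then obtain i where i: "a = d * i" using d(2) by blast
    have "(y \<otimes> inv (x [^] i)) [^] m = y [^] m \<otimes> (inv (x [^] i)) [^] m"
      using x y by (intro int_pow_mult_distrib m_comm) auto
    also have "\<dots> = e [^] a \<otimes> inv ((x [^] m) [^] i)"
      using x(1) y a int_pow_pow[OF x(1), of i m] int_pow_pow[OF x(1), of m i]
      by (simp add: int_pow_inv mult.commute)
    also have "\<dots> = \<one>" using eG by (simp add: x i int_pow_pow)
    finally have "y \<otimes> inv (x [^] i) = \<one>" using torsion_free_int[OF tf _ _ es(3)] x y by simp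
    then have yi: "y = x [^] i" using x y by (metis int_pow_closed inv_closed inv_equality inv_inv)
    show "\<exists>!i::int. y = x [^] i"
    proof (rule ex1I[of _ i])
      show "y = x [^] i" by (rule yi)
      fix j :: int assume "y = x [^] j"
      then have "x [^] (i - j) = \<one>" using yi x by (simp add: int_pow_diff)
      then have "(x [^] (i - j)) [^] m = \<one>" by simp
      then have "(x [^] m) [^] (i - j) = \<one>" using x(1) by (simp add: int_pow_pow mult.commute)
      then have "e [^] (d * (i - j)) = \<one>" using eG by (simp add: x(2) int_pow_pow)
      then show "j = i" using 2 d0 by fastforce
    qed
  qed
qed

text \<open>As in rank one, \<open>m\<close>-th powers embed the group as a lattice of exponents in
  the plane. A basis of the lattice lifts to the group, and its nonzero determinant gives uniqueness
  of the coordinates.\<close>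

lemma rank_2_basis:
  assumes r: "rank (carrier G) 2" and tf: "torsion_free G"
  obtains x y where "is_Z_basis G x y"
proof -
  obtain es m where es: "set es \<subseteq> carrier G" "length es = 2" "m \<noteq> 0"
    "\<And>x. x \<in> carrier G \<Longrightarrow> \<exists>as. length as = 2 \<and> x [^] (m::int) = lc es as"
    "\<And>as. length as = 2 \<Longrightarrow> lc es as = \<one> \<Longrightarrow> (\<forall>a\<in>set as. a = 0)"
    using r unfolding rank_def by metis
  have two: "\<exists>a b. xs = [a, b]" if "length xs = 2" for xs :: "'c list"
    using that by (metis Suc_1 One_nat_def length_0_conv length_Suc_conv)
  obtain e f where e: "es = [e, f]" using es(2) two by blast
  define P where "P = (\<lambda>x::int \<times> int. e [^] fst x \<otimes> f [^] snd x)"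
  have eG: "e \<in> carrier G" "f \<in> carrier G" using es(1) e by auto
  have 1: "\<exists>a. x [^] m = P a" if x: "x \<in> carrier G" for x
  proof -
    obtain as where as: "length as = 2" "x [^] m = lc es as" using es(4)[OF x] by blast
    then obtain a b where "as = [a, b]" using two by blast
    then have "x [^] m = P (a, b)" using as e eG by (simp add: P_def)
    then show ?thesis by blast
  qed
  have 2: "a = 0" if "P a = \<one>" for a
    using es(5)[of "[fst a, snd a]"] that e eG by (simp add: P_def prod_eq_iff)
  have Pd: "P (a - b) = P a \<otimes> inv (P b)" for a b
    using eG by (simp add: P_def int_pow_diff inv_mult_group m_ac)
  have Pp: "P (a + b) = P a \<otimes> P b" for a b
    using eG by (simp add: P_def int_pow_mult m_ac)
  have Ps: "P (sm i a) = P a [^] i" for a i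
    using eG by (simp add: P_def int_pow_mult_distrib[OF m_comm] int_pow_pow mult.commute)
  have PG: "P a \<in> carrier G" for a using eG by (simp add: P_def)
  define L where "L = {a. \<exists>x\<in>carrier G. x [^] m = P a}"
  have L: "add_subgroup L" unfolding add_subgroup_def
  proof (intro conjI ballI)
    show "0 \<in> L" unfolding L_def by (auto intro!: bexI[of _ \<one>] simp: P_def)
    fix a b assume "a \<in> L" "b \<in> L"
    then obtain x y where xy: "x \<in> carrier G" "y \<in> carrier G" "x [^] m = P a" "y [^] m = P b" by (auto simp: L_def)
    have "(x \<otimes> inv y) [^] m = x [^] m \<otimes> (inv y) [^] m" using xy by (intro int_pow_mult_distrib m_comm) auto
    also have "\<dots> = P (a - b)" using xy by (simp add: int_pow_inv Pd)
    finally show "a - b \<in> L" using xy unfolding L_def by blast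
  qed
  have "e [^] m = P (m, 0)" "f [^] m = P (0, m)" using eG by (auto simp: P_def)
  then have mL: "(m, 0) \<in> L" "(0, m) \<in> L" using eG by (auto simp: L_def)
  obtain a b where ab: "a \<in> L" "b \<in> L" "wedge a b \<noteq> 0" "\<And>z. z \<in> L \<Longrightarrow> \<exists>i j. z = sm i a + sm j b"
    using plane_lattice_basis[OF L es(3) mL] by blast
  obtain x y where xy: "x \<in> carrier G" "x [^] m = P a" "y \<in> carrier G" "y [^] m = P b"
    using ab(1,2) by (auto simp: L_def)
  have pw: "(x [^] i \<otimes> y [^] j) [^] m = P (sm i a + sm j b)" for i j :: int
  proof -
    have "(x [^] i \<otimes> y [^] j) [^] m = (x [^] i) [^] m \<otimes> (y [^] j) [^] m"
      using xy by (intro int_pow_mult_distrib m_comm) auto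
    also have "\<dots> = (x [^] m) [^] i \<otimes> (y [^] m) [^] j" using xy(1,3) by (simp add: int_pow_pow mult.commute)
    finally show ?thesis by (simp add: xy Ps Pp)
  qed
  have "is_Z_basis G x y" unfolding is_Z_basis_def
  proof (intro conjI ballI)
    show "x \<in> carrier G" "y \<in> carrier G" using xy by auto
    fix z assume z: "z \<in> carrier G"
    obtain t where t: "z [^] m = P t" using 1[OF z] by blast
    then have "t \<in> L" using z by (auto simp: L_def)
    then obtain i j where ij: "t = sm i a + sm j b" using ab(4) by blast
    define w where "w = x [^] i \<otimes> y [^] j"
    have wG: "w \<in> carrier G" using xy by (simp add: w_def)
    have "(z \<otimes> inv w) [^] m = z [^] m \<otimes> (inv w) [^] m" using z wG by (intro int_pow_mult_distrib m_comm) auto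
    also have "\<dots> = \<one>" using wG PG by (simp add: int_pow_inv t ij w_def pw)
    finally have "z \<otimes> inv w = \<one>" using torsion_free_int[OF tf _ _ es(3)] z wG by simp
    then have zw: "z = w" using z wG by (metis inv_closed inv_equality inv_inv)
    show "\<exists>!ab::int \<times> int. z = x [^] fst ab \<otimes> y [^] snd ab"
    proof (rule ex1I[of _ "(i, j)"])
      show "z = x [^] fst (i, j) \<otimes> y [^] snd (i, j)" using zw by (simp add: w_def)
      fix ab' :: "int \<times> int" assume "z = x [^] fst ab' \<otimes> y [^] snd ab'"
      then have "P (sm i a + sm j b) = P (sm (fst ab') a + sm (snd ab') b)"
        using pw[of i j] pw[of "fst ab'" "snd ab'"] zw by (simp add: w_def)
      then have "P ((sm i a + sm j b) - (sm (fst ab') a + sm (snd ab') b)) = \<one>"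
        unfolding Pd using PG by simp
      then have eq: "sm i a + sm j b = sm (fst ab') a + sm (snd ab') b" using 2 by fastforce
      have "wedge a (sm i a + sm j b) = wedge a (sm (fst ab') a + sm (snd ab') b)"
        "wedge (sm i a + sm j b) b = wedge (sm (fst ab') a + sm (snd ab') b) b" unfolding eq by auto
      then have "snd ab' = j" "fst ab' = i" using ab(3) by auto
      then show "ab' = (i, j)" by (simp add: prod_eq_iff)
    qed
  qed
  then show thesis by (rule that)
qed

end

text \<open>A finite factor is killed by its order. An infinite one is recorded as a degree map to
  the integers with kernel \<open>A\<close>, which turns membership in \<open>A\<close> into
  arithmetic.\<close>

lemma (in group) cyclic_quotient_cases:
  assumes H: "subgroup H G" and A: "A \<lhd> (G\<lparr>carrier := H\<rparr>)" and cyc: "cyclic_group ((G\<lparr>carrier := H\<rparr>) Mod A)"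
  shows "finite (carrier ((G\<lparr>carrier := H\<rparr>) Mod A)) \<Longrightarrow> \<exists>j::int. j \<noteq> 0 \<and> (\<forall>x\<in>H. x [^] j \<in> A)"
    and "infinite (carrier ((G\<lparr>carrier := H\<rparr>) Mod A)) \<Longrightarrow>
      \<exists>deg. (\<forall>x\<in>H. \<forall>y\<in>H. deg (x \<otimes> y) = deg x + deg y) \<and> (\<forall>x\<in>H. deg x = (0::int) \<longleftrightarrow> x \<in> A) \<and> (\<exists>x\<in>H. deg x = 1)"
proof -
  define GH where "GH = G\<lparr>carrier := H\<rparr>"
  define Q where "Q = GH Mod A"
  have gH: "group GH" unfolding GH_def using H by (rule subgroup_imp_group)
  have nA: "A \<lhd> GH" using A by (simp add: GH_def)
  have gQ: "group Q" unfolding Q_def using nA by (rule normal.factorgroup_is_group)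
  have sA: "subgroup A GH" using nA by (rule normal_imp_subgroup)
  have cH: "carrier GH = H" by (simp add: GH_def)
  have pw: "x [^]\<^bsub>GH\<^esub> (k::int) = x [^] k" if "x \<in> H" for x k
    unfolding GH_def using int_pow_consistent[OF H that] by simp
  have cls: "A #>\<^bsub>GH\<^esub> x = A \<longleftrightarrow> x \<in> A" if "x \<in> H" for x
    using that group.coset_join1[OF gH _ _ sA] group.coset_join2[OF gH _ sA] cH by auto
  have clsQ: "A #>\<^bsub>GH\<^esub> x \<in> carrier Q" if "x \<in> H" for x using that cH by (auto simp: Q_def carrier_FactGroup)
  have pwQ: "(A #>\<^bsub>GH\<^esub> x) [^]\<^bsub>Q\<^esub> (k::int) = A #>\<^bsub>GH\<^esub> (x [^] k)" if "x \<in> H" for x k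
    unfolding Q_def using normal.FactGroup_int_pow[OF nA, of x k] that cH pw by simp
  have multQ: "(A #>\<^bsub>GH\<^esub> x) \<otimes>\<^bsub>Q\<^esub> (A #>\<^bsub>GH\<^esub> y) = A #>\<^bsub>GH\<^esub> (x \<otimes> y)" if "x \<in> H" "y \<in> H" for x y
    using normal.rcos_sum[OF nA, of x y] that cH by (simp add: Q_def GH_def)
  have oneQ: "\<one>\<^bsub>Q\<^esub> = A" by (simp add: Q_def)
  {
    assume fin: "finite (carrier ((G\<lparr>carrier := H\<rparr>) Mod A))"
    then have pos: "order Q > 0" using monoid.order_gt_0_iff_finite[OF group.is_monoid[OF gQ]] by (simp add: Q_def GH_def)
    have "x [^] int (order Q) \<in> A" if x: "x \<in> H" for x
    proof -
      have "(A #>\<^bsub>GH\<^esub> x) [^]\<^bsub>Q\<^esub> int (order Q) = A"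
        using group.pow_order_eq_1[OF gQ clsQ[OF x]] by (simp add: int_pow_int oneQ)
      then have "A #>\<^bsub>GH\<^esub> (x [^] int (order Q)) = A" by (simp add: pwQ[OF x])
      then show ?thesis using cls subgroup_int_pow_closed[OF H x] by blast
    qed
    then show "\<exists>j::int. j \<noteq> 0 \<and> (\<forall>x\<in>H. x [^] j \<in> A)" using pos by (intro exI[of _ "int (order Q)"]) auto
  }
  {
    assume inf: "infinite (carrier ((G\<lparr>carrier := H\<rparr>) Mod A))"
    obtain U where U: "U \<in> carrier Q" "carrier Q = range (\<lambda>n::int. U [^]\<^bsub>Q\<^esub> n)"
      using cyc group.cyclic_group[OF gQ] unfolding Q_def GH_def by blast
    \<comment> \<open>A coincidence of two powers would reduce all exponents modulo \<open>d\<close>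
      and leave only finitely many elements.\<close>
    have inj: "k = l" if eq: "U [^]\<^bsub>Q\<^esub> k = U [^]\<^bsub>Q\<^esub> l" for k l :: int
    proof (rule ccontr)
      assume "k \<noteq> l"
      define d where "d = k - l"
      have d: "d \<noteq> 0" "U [^]\<^bsub>Q\<^esub> d = \<one>\<^bsub>Q\<^esub>"
        using \<open>k \<noteq> l\<close> eq U(1) group.int_pow_closed[OF gQ U(1)] by (auto simp: d_def group.int_pow_diff[OF gQ] group.r_inv[OF gQ])
      have "U [^]\<^bsub>Q\<^esub> n = U [^]\<^bsub>Q\<^esub> (n mod d)" for n
      proof -
        have "U [^]\<^bsub>Q\<^esub> (d * (n div d)) = \<one>\<^bsub>Q\<^esub>"
          using group.int_pow_pow[OF gQ U(1), of d "n div d"] d(2) group.int_pow_one[OF gQ] by simp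
        then show ?thesis
          using group.int_pow_mult[OF gQ U(1), of "d * (n div d)" "n mod d"] group.int_pow_closed[OF gQ U(1)] group.is_monoid[OF gQ]
          by (simp add: monoid.l_one)
      qed
      moreover have "n mod d \<in> {- \<bar>d\<bar>..\<bar>d\<bar>}" for n
        using abs_mod_less[OF d(1), of n] by auto
      ultimately have "carrier Q \<subseteq> (\<lambda>n. U [^]\<^bsub>Q\<^esub> n) ` {- \<bar>d\<bar>..\<bar>d\<bar>}" unfolding U(2) by (metis image_subset_iff imageI)
      then have "finite (carrier Q)" using finite_subset by blast
      then show False using inf by (simp add: Q_def GH_def)
    qed
    define deg where "deg = (\<lambda>x. THE k::int. A #>\<^bsub>GH\<^esub> x = U [^]\<^bsub>Q\<^esub> k)"
    have deg: "A #>\<^bsub>GH\<^esub> x = U [^]\<^bsub>Q\<^esub> k \<longleftrightarrow> deg x = k" if x: "x \<in> H" for x k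
    proof -
      have "\<exists>k::int. A #>\<^bsub>GH\<^esub> x = U [^]\<^bsub>Q\<^esub> k" using clsQ[OF x] unfolding U(2) by blast
      then obtain k0 :: int where k0: "A #>\<^bsub>GH\<^esub> x = U [^]\<^bsub>Q\<^esub> k0" by blast
      have "deg x = k0" unfolding deg_def using k0 inj by (intro the_equality) auto
      then show ?thesis using k0 inj by auto
    qed
    have "deg (x \<otimes> y) = deg x + deg y" if xy: "x \<in> H" "y \<in> H" for x y
    proof -
      have "A #>\<^bsub>GH\<^esub> (x \<otimes> y) = U [^]\<^bsub>Q\<^esub> deg x \<otimes>\<^bsub>Q\<^esub> U [^]\<^bsub>Q\<^esub> deg y"
        using multQ[OF xy] deg[OF xy(1), of "deg x"] deg[OF xy(2), of "deg y"] by simp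
      then show ?thesis
        using group.int_pow_mult[OF gQ U(1)] deg subgroup.m_closed[OF H xy] by metis
    qed
    moreover have "deg x = 0 \<longleftrightarrow> x \<in> A" if x: "x \<in> H" for x
      using deg[OF x, of 0] cls[OF x] by (simp add: oneQ)
    moreover have "\<exists>x\<in>H. deg x = 1"
    proof -
      obtain x where "x \<in> H" "U = A #>\<^bsub>GH\<^esub> x" using U(1) cH by (auto simp: Q_def carrier_FactGroup)
      then show ?thesis using deg[of x 1] U(1) group.int_pow_1[OF gQ] by auto
    qed
    ultimately show "\<exists>deg. (\<forall>x\<in>H. \<forall>y\<in>H. deg (x \<otimes> y) = deg x + deg y) \<and> (\<forall>x\<in>H. deg x = (0::int) \<longleftrightarrow> x \<in> A) \<and> (\<exists>x\<in>H. deg x = 1)"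
      by blast
  }
qed

section \<open>Groups of nilpotency class two\<close>

context group
begin

definition cm :: "'a \<Rightarrow> 'a \<Rightarrow> 'a" where "cm x y = x \<otimes> y \<otimes> inv x \<otimes> inv y"

lemma cm_closed [simp]: "x \<in> carrier G \<Longrightarrow> y \<in> carrier G \<Longrightarrow> cm x y \<in> carrier G"
  by (simp add: cm_def)

lemma inv_cancel:
  "x \<in> carrier G \<Longrightarrow> y \<in> carrier G \<Longrightarrow> inv y \<otimes> (y \<otimes> x) = x"
  "x \<in> carrier G \<Longrightarrow> y \<in> carrier G \<Longrightarrow> y \<otimes> (inv y \<otimes> x) = x"
  by (simp_all add: m_assoc[symmetric])

lemma cm_swap: "x \<in> carrier G \<Longrightarrow> y \<in> carrier G \<Longrightarrow> x \<otimes> y = cm x y \<otimes> (y \<otimes> x)"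
  by (simp add: cm_def m_assoc inv_cancel)

lemma cm_inv: "x \<in> carrier G \<Longrightarrow> y \<in> carrier G \<Longrightarrow> cm y x = inv (cm x y)"
  by (simp add: cm_def inv_mult_group m_assoc)

lemma center_subgroup: "subgroup (center_of G) G"
proof (rule subgroupI)
  show "center_of G \<subseteq> carrier G" "center_of G \<noteq> {}" by (auto simp: center_of_def)
  fix a assume a: "a \<in> center_of G"
  then have aG: "a \<in> carrier G" by (simp add: center_of_def)
  show "inv a \<in> center_of G" unfolding center_of_def
  proof (intro CollectI conjI ballI)
    show "inv a \<in> carrier G" using aG by simp
    fix x assume x: "x \<in> carrier G"
    have "a \<otimes> inv x = inv x \<otimes> a" using a x by (simp add: center_of_def)
    then have "inv (a \<otimes> inv x) = inv (inv x \<otimes> a)" by simp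
    then show "inv a \<otimes> x = x \<otimes> inv a" using aG x by (simp add: inv_mult_group)
  qed
  fix b assume b: "b \<in> center_of G"
  show "a \<otimes> b \<in> center_of G" unfolding center_of_def
  proof (intro CollectI conjI ballI)
    have ab: "a \<in> carrier G" "b \<in> carrier G" using a b by (auto simp: center_of_def)
    then show "a \<otimes> b \<in> carrier G" by simp
    fix x assume x: "x \<in> carrier G"
    have "a \<otimes> b \<otimes> x = a \<otimes> (x \<otimes> b)" using b x ab by (simp add: m_assoc center_of_def)
    also have "\<dots> = x \<otimes> a \<otimes> b" using a x ab by (simp add: m_assoc[symmetric] center_of_def)
    finally show "a \<otimes> b \<otimes> x = x \<otimes> (a \<otimes> b)" using ab x by (simp add: m_assoc)
  qed
qed

lemma center_normal: "center_of G \<lhd> G"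
  unfolding normal_inv_iff
proof (intro conjI ballI)
  show "subgroup (center_of G) G" by (rule center_subgroup)
  fix x h assume x: "x \<in> carrier G" and h: "h \<in> center_of G"
  have hG: "h \<in> carrier G" using h by (simp add: center_of_def)
  have "x \<otimes> h = h \<otimes> x" using h x by (simp add: center_of_def)
  then have "x \<otimes> h \<otimes> inv x = h" using x hG by (simp add: m_assoc)
  then show "x \<otimes> h \<otimes> inv x \<in> center_of G" using h by simp
qed

lemma cm_one_iff: "x \<in> carrier G \<Longrightarrow> y \<in> carrier G \<Longrightarrow> cm x y = \<one> \<longleftrightarrow> x \<otimes> y = y \<otimes> x"
  using cm_swap[of x y] by (metis cm_closed l_cancel_one' l_one m_closed r_cancel_one)

text \<open>In the shifted numbering the term of index 1 is generated by the commutators. Triviality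
  at index 2 makes them central, and nontriviality at index 1 supplies a nontrivial one.\<close>

lemma class_two:
  assumes "has_nilpotency_class G 2"
  shows "\<And>x y. x \<in> carrier G \<Longrightarrow> y \<in> carrier G \<Longrightarrow> cm x y \<in> center_of G"
    and "\<exists>x\<in>carrier G. \<exists>y\<in>carrier G. cm x y \<noteq> \<one>"
proof -
  have l1: "cm x y \<in> lower_central G 1" if "x \<in> carrier G" "y \<in> carrier G" for x y
    using that by (auto simp: cm_def intro!: generate.incl)
  have l2: "cm x y \<in> lower_central G 2" if "x \<in> lower_central G 1" "y \<in> carrier G" for x y
    using that by (auto simp: cm_def numeral_2_eq_2 intro!: generate.incl)
  have two: "lower_central G 2 = {\<one>}" using assms by (simp add: has_nilpotency_class_def)
  show cen: "cm x y \<in> center_of G" if xy: "x \<in> carrier G" "y \<in> carrier G" for x y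
    unfolding center_of_def
  proof (intro CollectI conjI ballI)
    show "cm x y \<in> carrier G" using xy by simp
    fix z assume z: "z \<in> carrier G"
    have "cm (cm x y) z = \<one>" using l2[OF l1[OF xy] z] two by simp
    then show "cm x y \<otimes> z = z \<otimes> cm x y" using cm_one_iff xy z by simp
  qed
  show "\<exists>x\<in>carrier G. \<exists>y\<in>carrier G. cm x y \<noteq> \<one>"
  proof (rule ccontr)
    assume "\<not> ?thesis"
    then have "(\<Union>x\<in>carrier G. \<Union>y\<in>carrier G. {x \<otimes> y \<otimes> inv x \<otimes> inv y}) \<subseteq> {\<one>}"
      by (auto simp: cm_def)
    then have "lower_central G 1 \<subseteq> {\<one>}"
      using generate_subgroup_incl[OF _ triv_subgroup] by simp
    moreover have "\<one> \<in> lower_central G 1" by (simp add: generate.one)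
    ultimately have "lower_central G 1 = {\<one>}" by blast
    moreover have "(1::nat) < 2" by simp
    ultimately show False using assms unfolding has_nilpotency_class_def by blast
  qed
qed

text \<open>The commutator of \<open>y\<close> and \<open>z\<close> is central and can be moved out
  of the product.\<close>

lemma cm_mult:
  assumes cen: "\<And>x y. x \<in> carrier G \<Longrightarrow> y \<in> carrier G \<Longrightarrow> cm x y \<in> center_of G"
    and "x \<in> carrier G" "y \<in> carrier G" "z \<in> carrier G"
  shows "cm (x \<otimes> y) z = cm x z \<otimes> cm y z"
proof -
  have c: "cm y z \<otimes> t = t \<otimes> cm y z" if "t \<in> carrier G" for t
    using cen[of y z] assms that by (simp add: center_of_def)
  have "y \<otimes> z = cm y z \<otimes> (z \<otimes> y)" using assms cm_swap by blast
  have "cm (x \<otimes> y) z = x \<otimes> (y \<otimes> z) \<otimes> inv (x \<otimes> y) \<otimes> inv z" using assms by (simp add: cm_def m_assoc)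
  also have "\<dots> = x \<otimes> (cm y z \<otimes> (z \<otimes> y)) \<otimes> inv (x \<otimes> y) \<otimes> inv z" using \<open>y \<otimes> z = _\<close> by simp
  also have "\<dots> = (x \<otimes> cm y z) \<otimes> (z \<otimes> (y \<otimes> (inv y \<otimes> (inv x \<otimes> inv z))))"
    using assms by (simp add: inv_mult_group m_assoc)
  also have "y \<otimes> (inv y \<otimes> (inv x \<otimes> inv z)) = inv x \<otimes> inv z" using assms by (simp add: m_assoc[symmetric])
  also have "(x \<otimes> cm y z) \<otimes> (z \<otimes> (inv x \<otimes> inv z)) = cm y z \<otimes> cm x z"
  proof -
    have "(x \<otimes> cm y z) \<otimes> (z \<otimes> (inv x \<otimes> inv z)) = (cm y z \<otimes> x) \<otimes> (z \<otimes> (inv x \<otimes> inv z))"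
      using c[OF assms(2)] by simp
    also have "\<dots> = cm y z \<otimes> (x \<otimes> (z \<otimes> (inv x \<otimes> inv z)))" using assms by (intro m_assoc) auto
    also have "x \<otimes> (z \<otimes> (inv x \<otimes> inv z)) = cm x z" using assms by (simp add: cm_def m_assoc)
    finally show ?thesis .
  qed
  also have "\<dots> = cm x z \<otimes> cm y z" using assms c by simp
  finally show ?thesis .
qed

lemma cm_int_pow:
  assumes cen: "\<And>x y. x \<in> carrier G \<Longrightarrow> y \<in> carrier G \<Longrightarrow> cm x y \<in> center_of G"
    and xy: "x \<in> carrier G" "y \<in> carrier G"
  shows "cm (x [^] (i::int)) y = cm x y [^] i" "cm x (y [^] i) = cm x y [^] i"
proof -
  have 1: "cm (x [^] i) y = cm x y [^] i" if "x \<in> carrier G" "y \<in> carrier G" for x y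
  proof -
    have "group_hom G G (\<lambda>x. cm x y)"
      using that cm_mult[OF cen] group_axioms by (auto simp: group_hom_def group_hom_axioms_def hom_def)
    then show ?thesis using group_hom.hom_int_pow that(1) by metis
  qed
  show "cm (x [^] i) y = cm x y [^] i" using 1 xy .
  have "cm x (y [^] i) = inv (cm (y [^] i) x)" using xy by (intro cm_inv) auto
  also have "\<dots> = inv (cm y x [^] i)" using 1 xy by simp
  also have "\<dots> = cm x y [^] i" using xy by (simp add: cm_inv[of x y] int_pow_inv)
  finally show "cm x (y [^] i) = cm x y [^] i" .
qed

text \<open>Along the series each infinite factor raises exactly one of two ranks, that of the
  intersection with the centre or that of the image modulo the centre, so the final ranks add up to
  3. The centre contains a nontrivial commutator, and the quotient by the centre of a nonabelian
  group is neither trivial nor cyclic; this leaves ranks 1 and 2.\<close>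

lemma hirsch3_center:
  assumes tf: "torsion_free G" and cl: "has_nilpotency_class G 2" and h3: "has_hirsch_length G 3"
  obtains z where "z \<in> center_of G" "\<And>t. t \<in> center_of G \<Longrightarrow> \<exists>!i::int. t = z [^] i"
    "\<exists>X Y. is_Z_basis (G Mod center_of G) X Y"
proof -
  define Z where "Z = center_of G"
  note cen = class_two(1)[OF cl, folded Z_def]
  have nZ: "Z \<lhd> G" and sZ: "subgroup Z G" unfolding Z_def by (rule center_normal, rule center_subgroup)
  have Zc: "t \<otimes> x = x \<otimes> t" if "t \<in> Z" "x \<in> carrier G" for t x using that by (auto simp: Z_def center_of_def)
  have ZG: "Z \<subseteq> carrier G" by (auto simp: Z_def center_of_def)
  define GZ where "GZ = G\<lparr>carrier := Z\<rparr>"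
  define T where "T = G Mod Z"
  interpret Z: comm_group GZ
    using subgroup_imp_group[OF sZ] Zc ZG unfolding GZ_def by (intro group.group_comm_groupI) auto
  have cZ: "carrier GZ = Z" by (simp add: GZ_def)
  have powZ: "x [^]\<^bsub>GZ\<^esub> (k::int) = x [^] k" if "x \<in> Z" for x k
    unfolding GZ_def using int_pow_consistent[OF sZ that] by simp
  have gT: "group T" unfolding T_def using nZ by (rule normal.factorgroup_is_group)
  interpret \<pi>: group_hom G T "\<lambda>x. Z #> x"
    using normal.r_coset_hom_Mod[OF nZ] gT group_axioms by (simp add: group_hom_def group_hom_axioms_def T_def)
  have cT: "carrier T = (\<lambda>x. Z #> x) ` carrier G" by (simp add: T_def carrier_FactGroup)
  have eqT: "Z #> x = Z #> y \<longleftrightarrow> x \<otimes> inv y \<in> Z" if "x \<in> carrier G" "y \<in> carrier G" for x y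
    using that repr_independence[OF _ that(2) sZ, of x] rcos_self[OF that(1) sZ]
      subgroup.rcos_module[OF sZ group_axioms that(2,1)] by metis
  interpret T: comm_group T
  proof (rule group.group_comm_groupI[OF gT])
    fix X Y assume "X \<in> carrier T" "Y \<in> carrier T"
    then obtain x y where xy: "x \<in> carrier G" "y \<in> carrier G" "X = Z #> x" "Y = Z #> y" by (auto simp: cT)
    have "(x \<otimes> y) \<otimes> inv (y \<otimes> x) = cm x y" using xy by (simp add: cm_def inv_mult_group m_assoc)
    then have "Z #> (x \<otimes> y) = Z #> (y \<otimes> x)" using eqT[of "x \<otimes> y" "y \<otimes> x"] xy cen by simp
    then show "X \<otimes>\<^bsub>T\<^esub> Y = Y \<otimes>\<^bsub>T\<^esub> X" using xy \<pi>.hom_mult by metis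
  qed
  have oneT: "\<one>\<^bsub>T\<^esub> = Z" by (simp add: T_def)
  have ZT: "Z #> x = \<one>\<^bsub>T\<^esub> \<longleftrightarrow> x \<in> Z" if "x \<in> carrier G" for x
    using that coset_join1[OF _ that sZ] coset_join2[OF that sZ] by (auto simp: oneT)
  have tfZ: "torsion_free GZ"
    using tf ZG unfolding torsion_free_def GZ_def by (auto simp: nat_pow_consistent[symmetric])
  have tfT: "torsion_free T" unfolding torsion_free_def
  proof (intro ballI allI impI)
    fix X and n :: nat assume X: "X \<in> carrier T" and n: "n > 0" "X [^]\<^bsub>T\<^esub> n = \<one>\<^bsub>T\<^esub>"
    then obtain x where x: "x \<in> carrier G" "X = Z #> x" by (auto simp: cT)
    have "Z #> (x [^] n) = \<one>\<^bsub>T\<^esub>" using n x \<pi>.hom_nat_pow by metis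
    then have xn: "x [^] n \<in> Z" using ZT x by simp
    \<comment> \<open>Commutators are bilinear in class two, so a central power of \<open>x\<close>
      gives a trivial power of \<open>cm x y\<close>, and \<open>G\<close> is torsion-free.\<close>
    have "x \<in> Z" unfolding Z_def center_of_def
    proof (intro CollectI conjI ballI)
      show "x \<in> carrier G" by fact
      fix y assume y: "y \<in> carrier G"
      have "cm (x [^] n) y = \<one>" using xn Zc cm_one_iff x y by simp
      then have "cm x y [^] n = \<one>" using cm_int_pow(1)[OF class_two(1)[OF cl] x(1) y, of "int n"] by (simp add: int_pow_int)
      then have "cm x y = \<one>" using tf n x y unfolding torsion_free_def by simp
      then show "x \<otimes> y = y \<otimes> x" using cm_one_iff x y by simp
    qed
    then show "X = \<one>\<^bsub>T\<^esub>" using ZT x by simp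
  qed
  obtain n H where H: "H 0 = {\<one>}" "H n = carrier G"
    "\<And>i. i < n \<Longrightarrow> H i \<lhd> (G\<lparr>carrier := H (Suc i)\<rparr>)"
    "\<And>i. i < n \<Longrightarrow> cyclic_group ((G\<lparr>carrier := H (Suc i)\<rparr>) Mod H i)"
    "card {i. i < n \<and> infinite (carrier ((G\<lparr>carrier := H (Suc i)\<rparr>) Mod H i))} = 3"
    using h3 unfolding has_hirsch_length_def by blast
  have sub: "subgroup (H i) G" if "i \<le> n" for i
    using that
  proof (induction i rule: inc_induct)
    case base show ?case using H(2) subgroup_self by simp
  next
    case (step m)
    then show ?case using incl_subgroup[OF step(3) normal_imp_subgroup[OF H(3)]] by simp
  qed
  define I where "I = {i. i < n \<and> infinite (carrier ((G\<lparr>carrier := H (Suc i)\<rparr>) Mod H i))}"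
  have step: "\<exists>rz rt. rz + rt = card {j \<in> I. j < i} \<and> Z.rank (Z \<inter> H i) rz \<and> T.rank ((\<lambda>x. Z #> x) ` H i) rt"
    if "i \<le> n" for i
    using that
  proof (induction i)
    case 0
    have "Z \<inter> H 0 = {\<one>\<^bsub>GZ\<^esub>}" "(\<lambda>x. Z #> x) ` H 0 = {\<one>\<^bsub>T\<^esub>}"
      using H(1) sZ subgroup.one_closed[OF sZ] ZG by (auto simp: GZ_def oneT)
    then show ?case using Z.rank_one T.rank_one by (intro exI[of _ 0]) simp
  next
    case (Suc i)
    then have i: "i < n" by simp
    obtain rz rt where IH: "rz + rt = card {j \<in> I. j < i}" "Z.rank (Z \<inter> H i) rz" "T.rank ((\<lambda>x. Z #> x) ` H i) rt"
      using Suc by auto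
    define A B where "A = H i" and "B = H (Suc i)"
    have sA: "subgroup A G" and sB: "subgroup B G" using sub Suc(2) by (auto simp: A_def B_def)
    have nA: "A \<lhd> (G\<lparr>carrier := B\<rparr>)" using H(3)[OF i] by (simp add: A_def B_def)
    have AB: "A \<subseteq> B" using subgroup.subset[OF normal_imp_subgroup[OF nA]] by simp
    have BG: "B \<subseteq> carrier G" using subgroup.subset[OF sB] .
    have sub1: "Z \<inter> A \<subseteq> Z \<inter> B" "Z \<inter> B \<subseteq> carrier GZ" "(\<lambda>x. Z #> x) ` A \<subseteq> (\<lambda>x. Z #> x) ` B"
      "(\<lambda>x. Z #> x) ` B \<subseteq> carrier T" using AB BG by (auto simp: cZ cT)
    have sZA: "subgroup (Z \<inter> A) GZ"
      unfolding GZ_def using subgroups_Inter_pair[OF sZ sA] sZ subgroup_incl by blast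
    have sTA: "subgroup ((\<lambda>x. Z #> x) ` A) T" using \<pi>.subgroup_img_is_subgroup[OF sA] .
    have cyc: "cyclic_group ((G\<lparr>carrier := B\<rparr>) Mod A)" using H(4)[OF i] by (simp add: A_def B_def)
    note cases = cyclic_quotient_cases[OF sB nA cyc]
    have IH': "Z.rank (Z \<inter> A) rz" "T.rank ((\<lambda>x. Z #> x) ` A) rt" using IH by (auto simp: A_def)
    show ?case
    proof (cases "i \<in> I")
      case False
      then have "{j \<in> I. j < Suc i} = {j \<in> I. j < i}" by (auto simp: less_Suc_eq)
      moreover have "finite (carrier ((G\<lparr>carrier := B\<rparr>) Mod A))" using False i by (simp add: I_def A_def B_def)
      then obtain j :: int where j: "j \<noteq> 0" "\<And>x. x \<in> B \<Longrightarrow> x [^] j \<in> A" using cases(1) by blast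
      have "Z.rank (Z \<inter> B) rz"
      proof (rule Z.rank_finite_step[OF IH'(1) sub1(1,2) j(1)])
        fix x assume "x \<in> Z \<inter> B"
        then show "x [^]\<^bsub>GZ\<^esub> j \<in> Z \<inter> A" using j powZ subgroup_int_pow_closed[OF sZ] by auto
      qed
      moreover have "T.rank ((\<lambda>x. Z #> x) ` B) rt"
      proof (rule T.rank_finite_step[OF IH'(2) sub1(3,4) j(1)])
        fix X assume "X \<in> (\<lambda>x. Z #> x) ` B"
        then obtain x where x: "x \<in> B" "X = Z #> x" by blast
        then have "X [^]\<^bsub>T\<^esub> j = Z #> (x [^] j)" using \<pi>.hom_int_pow[of x j] BG by auto
        then show "X [^]\<^bsub>T\<^esub> j \<in> (\<lambda>x. Z #> x) ` A" using j(2)[OF x(1)] by blast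
      qed
      ultimately show ?thesis using IH(1) by (auto simp: B_def)
    next
      case True
      then have "{j \<in> I. j < Suc i} = insert i {j \<in> I. j < i}" by (auto simp: less_Suc_eq)
      then have card: "card {j \<in> I. j < Suc i} = Suc (card {j \<in> I. j < i})" by simp
      have "infinite (carrier ((G\<lparr>carrier := B\<rparr>) Mod A))" using True by (simp add: I_def A_def B_def)
      then obtain deg where deg: "\<And>x y. x \<in> B \<Longrightarrow> y \<in> B \<Longrightarrow> deg (x \<otimes> y) = deg x + deg y"
        "\<And>x. x \<in> B \<Longrightarrow> deg x = (0::int) \<longleftrightarrow> x \<in> A" "\<exists>x\<in>B. deg x = 1"
        using cases(2) by blast
      have Bpow: "x [^] (k::int) \<in> B" if "x \<in> B" for x k using subgroup_int_pow_closed[OF sB that] .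
      have Binv: "inv x \<in> B" if "x \<in> B" for x using subgroup.m_inv_closed[OF sB that] .
      have Bmult: "x \<otimes> y \<in> B" if "x \<in> B" "y \<in> B" for x y using subgroup.m_closed[OF sB that] .
      have degpow: "deg (x [^] k) = k * deg x" if x: "x \<in> B" for x and k :: int
      proof -
        have "(\<lambda>k. deg (x [^] k)) k = k * (\<lambda>k. deg (x [^] k)) (1::int)"
        proof (rule int_additive_linear)
          fix a b :: int
          have "x [^] (a + b) = x [^] a \<otimes> x [^] b" using x BG by (auto simp: int_pow_mult)
          then show "deg (x [^] (a + b)) = deg (x [^] a) + deg (x [^] b)" using deg(1) Bpow[OF x] by simp
        qed
        then show ?thesis using x BG by auto
      qed
      have deginv: "deg (inv x) = - deg x" if x: "x \<in> B" for x
        using degpow[OF x, of "- 1"] x BG int_pow_neg[of x 1] by auto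
      show ?thesis
      \<comment> \<open>The rank of the centre grows if a central element has nonzero degree;
        otherwise the rank of the image does.\<close>
      proof (cases "\<exists>w\<in>Z \<inter> B. deg w \<noteq> 0")
        case True
        then obtain w where w: "w \<in> Z" "w \<in> B" "deg w \<noteq> 0" by blast
        \<comment> \<open>The exponents balance the degrees, so the product has degree 0. Modulo the
          centre it is just a power of \<open>x\<close>, which is why the image gains no rank in
          this case.\<close>
        have key: "x [^] deg w \<otimes> inv (w [^] deg x) \<in> A" if x: "x \<in> B" for x
          using deg(2)[of "x [^] deg w \<otimes> inv (w [^] deg x)"] deg(1) Bmult Bpow Binv x w
          by (simp add: degpow deginv)
        have "Z.rank (Z \<inter> B) (Suc rz)"
        proof (rule Z.rank_infinite_step[OF IH'(1) sub1(1,2) sZA _ w(3)])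
          show "w \<in> Z \<inter> B" using w by simp
          fix x assume x: "x \<in> Z \<inter> B"
          have "x [^] deg w \<otimes> inv (w [^] deg x) \<in> Z"
            using x w subgroup_int_pow_closed[OF sZ] by (simp add: subgroup.m_closed[OF sZ] subgroup.m_inv_closed[OF sZ])
          moreover have "inv\<^bsub>GZ\<^esub> (w [^] deg x) = inv (w [^] deg x)"
            unfolding GZ_def using w subgroup_int_pow_closed[OF sZ] by (intro m_inv_consistent[OF sZ]) simp
          ultimately show "\<exists>k::int. x [^]\<^bsub>GZ\<^esub> deg w \<otimes>\<^bsub>GZ\<^esub> inv\<^bsub>GZ\<^esub> (w [^]\<^bsub>GZ\<^esub> k) \<in> Z \<inter> A"
            using key[of x] x w powZ[of x "deg w"] powZ[of w "deg x"]
            by (intro exI[of _ "deg x"]) (simp add: GZ_def)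
        next
          fix a :: int assume "w [^]\<^bsub>GZ\<^esub> a \<in> Z \<inter> A"
          then have "w [^] a \<in> A" using powZ w by simp
          then have "a * deg w = 0" using deg(2)[OF Bpow[OF w(2)]] degpow[OF w(2)] by simp
          then show "a = 0" using w(3) by simp
        qed
        moreover have "T.rank ((\<lambda>x. Z #> x) ` B) rt"
        proof (rule T.rank_finite_step[OF IH'(2) sub1(3,4) w(3)])
          fix X assume "X \<in> (\<lambda>x. Z #> x) ` B"
          then obtain x where x: "x \<in> B" "X = Z #> x" by blast
          have xG: "x \<in> carrier G" "w \<in> carrier G" using x w BG by auto
          have "X [^]\<^bsub>T\<^esub> deg w = Z #> (x [^] deg w)" using \<pi>.hom_int_pow[of x "deg w"] xG x by simp
          also have "\<dots> = Z #> (x [^] deg w \<otimes> inv (w [^] deg x))"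
          proof -
            have "inv (w [^] deg x) \<in> Z" using w subgroup_int_pow_closed[OF sZ] by (simp add: subgroup.m_inv_closed[OF sZ])
            moreover have "(x [^] deg w \<otimes> inv (w [^] deg x)) \<otimes> inv (x [^] deg w) = inv (w [^] deg x)"
              using Zc[OF calculation, of "x [^] deg w", symmetric] xG by (simp add: m_assoc)
            ultimately show ?thesis using eqT[of "x [^] deg w \<otimes> inv (w [^] deg x)" "x [^] deg w"] xG by simp
          qed
          finally show "X [^]\<^bsub>T\<^esub> deg w \<in> (\<lambda>x. Z #> x) ` A" using key[OF x(1)] by blast
        qed
        ultimately show ?thesis using IH(1) card by (intro exI[of _ "Suc rz"] exI[of _ rt]) (simp add: B_def)
      next
        case False
        then have "Z \<inter> B = Z \<inter> A" using deg(2) AB by blast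
        then have "Z.rank (Z \<inter> B) rz" using IH'(1) by simp
        moreover have "T.rank ((\<lambda>x. Z #> x) ` B) (Suc rt)"
        proof -
          obtain w where w: "w \<in> B" "deg w = 1" using deg(3) by blast
          have wG: "w \<in> carrier G" using w BG by blast
          show ?thesis
          proof (rule T.rank_infinite_step[OF IH'(2) sub1(3,4) sTA, of "Z #> w" 1])
            show "Z #> w \<in> (\<lambda>x. Z #> x) ` B" using w by blast
            show "(1::int) \<noteq> 0" by simp
            fix X assume "X \<in> (\<lambda>x. Z #> x) ` B"
            then obtain x where x: "x \<in> B" "X = Z #> x" by blast
            have xG: "x \<in> carrier G" using x BG by blast
            have "x \<otimes> inv (w [^] deg x) \<in> A"
              using deg(2)[of "x \<otimes> inv (w [^] deg x)"] deg(1) Bmult Bpow Binv x w by (simp add: degpow deginv)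
            moreover have "X [^]\<^bsub>T\<^esub> (1::int) \<otimes>\<^bsub>T\<^esub> inv\<^bsub>T\<^esub> ((Z #> w) [^]\<^bsub>T\<^esub> deg x) = Z #> (x \<otimes> inv (w [^] deg x))"
              using xG wG x(2) \<pi>.hom_int_pow[OF wG, of "deg x"] by (simp del: \<pi>.hom_int_pow)
            ultimately show "\<exists>i. X [^]\<^bsub>T\<^esub> (1::int) \<otimes>\<^bsub>T\<^esub> inv\<^bsub>T\<^esub> ((Z #> w) [^]\<^bsub>T\<^esub> (i::int)) \<in> (\<lambda>x. Z #> x) ` A"
              by (metis imageI)
          next
            fix a :: int assume "(Z #> w) [^]\<^bsub>T\<^esub> a \<in> (\<lambda>x. Z #> x) ` A"
            then obtain h where h: "h \<in> A" "Z #> (w [^] a) = Z #> h" using \<pi>.hom_int_pow[OF wG, of a] by auto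
            have hB: "h \<in> B" "h \<in> carrier G" using h AB BG by auto
            have wh: "w [^] a \<otimes> inv h \<in> Z" using eqT[of "w [^] a" h] h wG hB by simp
            moreover have "w [^] a \<otimes> inv h \<in> B" using Bmult Bpow Binv w hB by simp
            ultimately have "deg (w [^] a \<otimes> inv h) = 0" using False by blast
            moreover have "deg h = 0" using deg(2)[OF hB(1)] h by simp
            ultimately show "a = 0" using deg(1)[OF Bpow[OF w(1)] Binv[OF hB(1)]] degpow[OF w(1)] deginv[OF hB(1)] w by simp
          qed
        qed
        ultimately show ?thesis using IH(1) card by (intro exI[of _ rz] exI[of _ "Suc rt"]) (simp add: B_def)
      qed
    qed
  qed
  have "{j \<in> I. j < n} = I" by (auto simp: I_def)
  then have cardI: "card {j \<in> I. j < n} = 3" using H(5) by (simp add: I_def)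
  obtain rz rt where r: "rz + rt = 3" "Z.rank (Z \<inter> H n) rz" "T.rank ((\<lambda>x. Z #> x) ` H n) rt"
    using step[of n] unfolding cardI by auto
  have "Z \<inter> H n = carrier GZ" "(\<lambda>x. Z #> x) ` H n = carrier T" using H(2) ZG by (auto simp: cZ cT)
  then have rZ: "Z.rank (carrier GZ) rz" and rT: "T.rank (carrier T) rt" using r by auto
  obtain x0 y0 where x0: "x0 \<in> carrier G" "y0 \<in> carrier G" "cm x0 y0 \<noteq> \<one>" using class_two(2)[OF cl] by blast
  have "rz \<noteq> 0"
  proof
    assume "rz = 0"
    then have "Z = {\<one>}" using Z.rank_0_trivial rZ tfZ cZ by (simp add: GZ_def)
    then show False using cen[OF x0(1,2)] x0(3) by simp
  qed
  moreover have "rt \<noteq> 0"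
  proof
    assume "rt = 0"
    then have "carrier T = {\<one>\<^bsub>T\<^esub>}" using T.rank_0_trivial rT tfT by simp
    moreover have "Z #> x0 \<in> carrier T" using x0(1) unfolding cT by blast
    ultimately have "x0 \<in> Z" using ZT[OF x0(1)] by simp
    then show False using Zc[OF _ x0(2)] cm_one_iff[OF x0(1,2)] x0(3) by simp
  qed
  \<comment> \<open>With a cyclic quotient by the centre, any two elements are central multiples of
    powers of one \<open>x\<close> and commute.\<close>
  moreover have "rt \<noteq> 1"
  proof
    assume "rt = 1"
    then obtain X where X: "X \<in> carrier T" "\<And>Y. Y \<in> carrier T \<Longrightarrow> \<exists>!i::int. Y = X [^]\<^bsub>T\<^esub> i"
      using T.rank_1_cyclic rT tfT by auto
    obtain x where x: "x \<in> carrier G" "X = Z #> x" using X(1) by (auto simp: cT)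
    have "\<exists>t\<in>Z. \<exists>i::int. y = t \<otimes> x [^] i" if y: "y \<in> carrier G" for y
    proof -
      have "Z #> y \<in> carrier T" using y by (auto simp: cT)
      then obtain i :: int where "Z #> y = X [^]\<^bsub>T\<^esub> i" using X(2) by blast
      then have "Z #> y = Z #> (x [^] i)" using \<pi>.hom_int_pow[OF x(1), of i] x(2) by simp
      then have "y \<in> Z #> (x [^] i)" using rcos_self[OF y sZ] by simp
      then show ?thesis by (auto simp: r_coset_def)
    qed
    then obtain t i t' i' where ti: "t \<in> Z" "x0 = t \<otimes> x [^] (i::int)" "t' \<in> Z" "y0 = t' \<otimes> x [^] (i'::int)"
      using x0 by metis
    have tG: "t \<in> carrier G" "t' \<in> carrier G" using ti ZG by auto
    define a b where "a = x [^] i" and "b = x [^] i'"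
    have abG: "a \<in> carrier G" "b \<in> carrier G" using x by (auto simp: a_def b_def)
    have ab: "a \<otimes> b = b \<otimes> a" unfolding a_def b_def using x(1) by (metis int_pow_mult add.commute)
    have "x0 \<otimes> y0 = t \<otimes> ((a \<otimes> t') \<otimes> b)" unfolding ti a_def[symmetric] b_def[symmetric]
      using tG abG by (simp add: m_assoc)
    also have "\<dots> = (t \<otimes> t') \<otimes> (a \<otimes> b)" using Zc[OF ti(3) abG(1), symmetric] tG abG by (simp add: m_assoc)
    also have "\<dots> = (t' \<otimes> t) \<otimes> (b \<otimes> a)" using Zc[OF ti(1) tG(2)] ab by simp
    also have "\<dots> = t' \<otimes> ((t \<otimes> b) \<otimes> a)" using tG abG by (simp add: m_assoc)
    also have "\<dots> = y0 \<otimes> x0" unfolding ti a_def[symmetric] b_def[symmetric] Zc[OF ti(1) abG(2)]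
      using tG abG by (simp add: m_assoc)
    finally show False using x0 cm_one_iff by simp
  qed
  ultimately have rr: "rz = 1" "rt = 2" using r(1) by auto
  obtain z where z: "z \<in> carrier GZ" "\<And>t. t \<in> carrier GZ \<Longrightarrow> \<exists>!i::int. t = z [^]\<^bsub>GZ\<^esub> i"
    using Z.rank_1_cyclic[OF _ tfZ] rZ rr by auto
  have "\<exists>X Y. is_Z_basis T X Y" using T.rank_2_basis[OF _ tfT] rT rr by blast
  then show thesis
    using that[of z] z powZ[of z] unfolding cZ Z_def T_def by auto
qed

text \<open>Lifts \<open>x\<close>, \<open>y\<close> of a basis of the quotient and a generator
  \<open>z\<close> of the centre give the normal form. The constant \<kappa> is the exponent of
  \<open>cm y x\<close> as a power of \<open>z\<close>, and reordering \<open>y^j x^i\<close> costs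
  its multiple by \<open>j * i\<close>.\<close>

lemma heisenberg_coordinates:
  assumes tf: "torsion_free G" and cl: "has_nilpotency_class G 2" and h3: "has_hirsch_length G 3"
  obtains u v c :: "'a \<Rightarrow> int" and \<kappa> :: int where
    "\<And>n m. \<lbrakk>n \<in> carrier G; m \<in> carrier G; u n = u m; v n = v m; c n = c m\<rbrakk> \<Longrightarrow> n = m"
    "\<And>i j l. \<exists>n\<in>carrier G. u n = i \<and> v n = j \<and> c n = l"
    "\<And>n m. \<lbrakk>n \<in> carrier G; m \<in> carrier G\<rbrakk> \<Longrightarrow> u (n \<otimes> m) = u n + u m"
    "\<And>n m. \<lbrakk>n \<in> carrier G; m \<in> carrier G\<rbrakk> \<Longrightarrow> v (n \<otimes> m) = v n + v m"
    "\<And>n m. \<lbrakk>n \<in> carrier G; m \<in> carrier G\<rbrakk> \<Longrightarrow> c (n \<otimes> m) = c n + c m + \<kappa> * v n * u m"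
    "\<kappa> \<noteq> 0"
proof -
  define Z where "Z = center_of G"
  define T where "T = G Mod Z"
  note cen = class_two(1)[OF cl]
  have nZ: "Z \<lhd> G" and sZ: "subgroup Z G" unfolding Z_def by (rule center_normal, rule center_subgroup)
  have Zc: "t \<otimes> x = x \<otimes> t" if "t \<in> Z" "x \<in> carrier G" for t x using that by (auto simp: Z_def center_of_def)
  have ZG: "Z \<subseteq> carrier G" by (auto simp: Z_def center_of_def)
  obtain z X Y where z: "z \<in> Z" "\<And>t. t \<in> Z \<Longrightarrow> \<exists>!i::int. t = z [^] i" and XY: "is_Z_basis T X Y"
    using hirsch3_center[OF tf cl h3] unfolding Z_def T_def by metis
  have zG: "z \<in> carrier G" using z ZG by blast
  have gT: "group T" unfolding T_def using nZ by (rule normal.factorgroup_is_group)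
  interpret \<pi>: group_hom G T "\<lambda>x. Z #> x"
    using normal.r_coset_hom_Mod[OF nZ] gT group_axioms by (simp add: group_hom_def group_hom_axioms_def T_def)
  have cT: "carrier T = (\<lambda>x. Z #> x) ` carrier G" by (simp add: T_def carrier_FactGroup)
  obtain x y where x: "x \<in> carrier G" "X = Z #> x" and y: "y \<in> carrier G" "Y = Z #> y"
    using XY unfolding is_Z_basis_def cT by blast
  define E where "E = (\<lambda>(i::int) (j::int) (l::int). x [^] i \<otimes> y [^] j \<otimes> z [^] l)"
  have EG: "E i j l \<in> carrier G" for i j l using x y zG by (simp add: E_def)
  have zpZ: "z [^] (l::int) \<in> Z" for l using subgroup_int_pow_closed[OF sZ z(1)] .
  have Epi: "Z #> E i j l = X [^]\<^bsub>T\<^esub> i \<otimes>\<^bsub>T\<^esub> Y [^]\<^bsub>T\<^esub> j" for i j l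
  proof -
    have "Z #> (z [^] l) = \<one>\<^bsub>T\<^esub>" using coset_join2[OF _ sZ zpZ[of l]] zG by (simp add: T_def)
    moreover have "Z #> E i j l = (Z #> x [^] i) \<otimes>\<^bsub>T\<^esub> (Z #> y [^] j) \<otimes>\<^bsub>T\<^esub> (Z #> z [^] l)"
      unfolding E_def using x y zG by simp
    ultimately show ?thesis using x y \<pi>.hom_int_pow by simp
  qed
  have ex: "\<exists>i j l. n = E i j l" if n: "n \<in> carrier G" for n
  proof -
    have "Z #> n \<in> carrier T" using n by (auto simp: cT)
    then obtain i j where "Z #> n = X [^]\<^bsub>T\<^esub> (i::int) \<otimes>\<^bsub>T\<^esub> Y [^]\<^bsub>T\<^esub> (j::int)"
      using XY unfolding is_Z_basis_def by metis
    then have "Z #> n = Z #> E i j 0" using Epi by simp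
    then have "n \<in> Z #> E i j 0" using rcos_self[OF n sZ] by simp
    then obtain t where t: "t \<in> Z" "n = t \<otimes> E i j 0" by (auto simp: r_coset_def)
    then obtain l :: int where "t = z [^] l" using z(2) by blast
    then have "n = E i j l" using t Zc[OF t(1) EG[of i j 0]] x y zG by (simp add: E_def)
    then show ?thesis by blast
  qed
  have uniq: "i = i' \<and> j = j' \<and> l = l'" if eq: "E i j l = E i' j' l'" for i j l i' j' l'
  proof -
    have "X [^]\<^bsub>T\<^esub> i \<otimes>\<^bsub>T\<^esub> Y [^]\<^bsub>T\<^esub> j = X [^]\<^bsub>T\<^esub> i' \<otimes>\<^bsub>T\<^esub> Y [^]\<^bsub>T\<^esub> j'" using Epi eq by metis
    moreover have "X [^]\<^bsub>T\<^esub> i \<otimes>\<^bsub>T\<^esub> Y [^]\<^bsub>T\<^esub> j \<in> carrier T" using Epi[of i j 0] EG[of i j 0] by (auto simp: cT)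
    ultimately have "(i, j) = (i', j')"
      using XY unfolding is_Z_basis_def by (metis fst_conv snd_conv)
    then have ij: "i = i'" "j = j'" by auto
    then have "z [^] l = z [^] l'" using eq x y zG by (simp add: E_def)
    then have "l = l'" using z(2)[OF zpZ[of l]] by metis
    then show ?thesis using ij by simp
  qed
  obtain \<kappa> :: int where k: "cm y x = z [^] \<kappa>" using z(2) cen[OF y(1) x(1)] unfolding Z_def by blast
  have swap: "y [^] j \<otimes> x [^] i = x [^] i \<otimes> y [^] j \<otimes> z [^] (\<kappa> * j * i)" for i j :: int
  proof -
    have "cm (y [^] j) (x [^] i) = (cm y x [^] j) [^] i"
      using cm_int_pow[OF cen] x y by simp
    also have "\<dots> = z [^] (\<kappa> * j * i)" using zG by (simp add: k int_pow_pow)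
    finally have "y [^] j \<otimes> x [^] i = z [^] (\<kappa> * j * i) \<otimes> (x [^] i \<otimes> y [^] j)"
      using cm_swap[of "y [^] j" "x [^] i"] x y by simp
    then show ?thesis using Zc[OF zpZ] x y by simp
  qed
  have mult: "E i j l \<otimes> E i' j' l' = E (i + i') (j + j') (l + l' + \<kappa> * j * i')" for i j l i' j' l'
  proof -
    note [simp] = x(1) y(1) zG
    have zz: "z [^] k \<otimes> t = t \<otimes> z [^] k" if "t \<in> carrier G" for t and k :: int using Zc[OF zpZ that] .
    have "E i j l \<otimes> E i' j' l' = x [^] i \<otimes> y [^] j \<otimes> (z [^] l \<otimes> (x [^] i' \<otimes> y [^] j')) \<otimes> z [^] l'"
      by (simp add: E_def m_assoc)
    also have "\<dots> = x [^] i \<otimes> (y [^] j \<otimes> x [^] i') \<otimes> y [^] j' \<otimes> (z [^] l \<otimes> z [^] l')"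
      by (subst zz) (simp_all add: m_assoc)
    also have "\<dots> = (x [^] i \<otimes> x [^] i') \<otimes> (y [^] j \<otimes> (z [^] (\<kappa> * j * i') \<otimes> y [^] j')) \<otimes> (z [^] l \<otimes> z [^] l')"
      unfolding swap by (simp add: m_assoc)
    also have "\<dots> = (x [^] i \<otimes> x [^] i') \<otimes> (y [^] j \<otimes> y [^] j') \<otimes> (z [^] (\<kappa> * j * i') \<otimes> (z [^] l \<otimes> z [^] l'))"
      by (subst zz) (simp_all add: m_assoc)
    also have "\<dots> = E (i + i') (j + j') (\<kappa> * j * i' + (l + l'))"
      by (simp add: E_def int_pow_mult)
    finally show ?thesis by (simp add: add.commute)
  qed
  define co where "co = (\<lambda>n. SOME t. n = E (fst t) (fst (snd t)) (snd (snd t)))"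
  have co: "co (E i j l) = (i, j, l)" for i j l
  proof -
    have "\<exists>t. E i j l = E (fst t) (fst (snd t)) (snd (snd t))" by (intro exI[of _ "(i, j, l)"]) simp
    from someI_ex[OF this] have "E i j l = E (fst (co (E i j l))) (fst (snd (co (E i j l)))) (snd (snd (co (E i j l))))"
      unfolding co_def .
    from uniq[OF this] show ?thesis by (simp add: prod_eq_iff)
  qed
  show thesis
  proof (rule that[of "\<lambda>n. fst (co n)" "\<lambda>n. fst (snd (co n))" "\<lambda>n. snd (snd (co n))" \<kappa>])
    show "n = m" if "n \<in> carrier G" "m \<in> carrier G" "fst (co n) = fst (co m)" "fst (snd (co n)) = fst (snd (co m))"
      "snd (snd (co n)) = snd (snd (co m))" for n m
      using ex[OF that(1)] ex[OF that(2)] that(3-5) co by auto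
    show "\<exists>n\<in>carrier G. fst (co n) = i \<and> fst (snd (co n)) = j \<and> snd (snd (co n)) = l" for i j l
      using EG[of i j l] co[of i j l] by (intro bexI[of _ "E i j l"]) auto
    fix n m assume "n \<in> carrier G" "m \<in> carrier G"
    then obtain i j l i' j' l' where "n = E i j l" "m = E i' j' l'" using ex by metis
    then show "fst (co (n \<otimes> m)) = fst (co n) + fst (co m)" "fst (snd (co (n \<otimes> m))) = fst (snd (co n)) + fst (snd (co m))"
      "snd (snd (co (n \<otimes> m))) = snd (snd (co n)) + snd (snd (co m)) + \<kappa> * fst (snd (co n)) * fst (co m)"
      by (simp_all add: mult co)
  next
    show "\<kappa> \<noteq> 0"
    proof
      assume "\<kappa> = 0"
      then have com: "E i j l \<otimes> E i' j' l' = E i' j' l' \<otimes> E i j l" for i j l i' j' l'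
        by (simp add: mult add.commute)
      obtain a b where ab: "a \<in> carrier G" "b \<in> carrier G" "cm a b \<noteq> \<one>" using class_two(2)[OF cl] by blast
      then have "a \<otimes> b = b \<otimes> a" using ex com by metis
      then show False using cm_one_iff ab by simp
    qed
  qed
qed

end

section \<open>The plane as the quotient by the centre\<close>

context heis_ext
begin

text \<open>The fibres of \<open>uv\<close> are the cosets of the centre of \<open>N\<close>, which
  identifies the plane with the group \<open>T\<close>.\<close>

definition K :: "int \<times> int \<Rightarrow> 'a set" where "K x = {n \<in> N. uv n = x}"

lemma center_eq: "center_of GN = K 0"
  unfolding K_def center_of_def using central_iff by auto

lemma K_nonempty: "el (fst x) (snd x) 0 \<in> K x"
  by (simp add: K_def)

lemma K_inject: "K x = K y \<longleftrightarrow> x = y"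
proof
  assume "K x = K y"
  then have "el (fst x) (snd x) 0 \<in> K y" using K_nonempty[of x] by simp
  then show "x = y" by (simp add: K_def)
qed simp

lemma K_coset: "n \<in> N \<Longrightarrow> K 0 #>\<^bsub>GN\<^esub> n = K (uv n)"
proof -
  assume n: "n \<in> N"
  have "K 0 #> n = K (uv n)"
  proof (intro subset_antisym subsetI)
    fix m assume "m \<in> K 0 #> n"
    then show "m \<in> K (uv n)" using n by (auto simp: r_coset_def K_def)
  next
    fix m assume m: "m \<in> K (uv n)"
    then have "m \<otimes> inv n \<in> K 0" "m = (m \<otimes> inv n) \<otimes> n" using n by (auto simp: K_def m_assoc)
    then show "m \<in> K 0 #> n" unfolding r_coset_def by blast
  qed
  then show ?thesis by simp
qed

abbreviation T where "T \<equiv> quot_by_center G N"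

lemma group_GN': "group GN" using subgroup_N subgroup_imp_group by blast

lemma group_T: "group T"
  unfolding quot_by_center_def using group.center_normal[OF group_GN'] by (rule normal.factorgroup_is_group)

lemma carrier_T: "carrier T = range K"
proof -
  have "carrier T = (\<lambda>n. K (uv n)) ` N"
    unfolding quot_by_center_def center_eq carrier_FactGroup using K_coset by auto
  also have "\<dots> = range K"
  proof (intro subset_antisym subsetI)
    fix X assume "X \<in> range K"
    then obtain x where "X = K x" by blast
    then have "X = K (uv (el (fst x) (snd x) 0))" by simp
    then show "X \<in> (\<lambda>n. K (uv n)) ` N" using el(1) by blast
  qed auto
  finally show ?thesis .
qed

lemma mult_T: "K x \<otimes>\<^bsub>T\<^esub> K y = K (x + y)"
proof -
  define n m where "n = el (fst x) (snd x) 0" and "m = el (fst y) (snd y) 0"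
  have nm: "n \<in> N" "m \<in> N" "uv n = x" "uv m = y" by (auto simp: n_def m_def)
  have "(K 0 #>\<^bsub>GN\<^esub> n) <#>\<^bsub>GN\<^esub> (K 0 #>\<^bsub>GN\<^esub> m) = K 0 #>\<^bsub>GN\<^esub> (n \<otimes>\<^bsub>GN\<^esub> m)"
    using normal.rcos_sum[OF group.center_normal[OF group_GN'], of n m] nm by (simp add: center_eq)
  then have "K x <#>\<^bsub>GN\<^esub> K y = K (x + y)"
    using K_coset[OF nm(1)] K_coset[OF nm(2)] K_coset[of "n \<otimes> m"] nm by simp
  then show ?thesis by (simp add: quot_by_center_def)
qed

lemma one_T: "\<one>\<^bsub>T\<^esub> = K 0"
  by (simp add: quot_by_center_def center_eq)

lemma pow_T: "K x [^]\<^bsub>T\<^esub> (i::int) = K (sm i x)"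
proof -
  have nat: "K x [^]\<^bsub>T\<^esub> (n::nat) = K (sm (int n) x)" for n
  proof (induction n)
    case 0
    have "sm 0 x = 0" by (simp add: sm_def zero_prod_def)
    then show ?case using one_T by (simp add: nat_pow_def)
  next
    case (Suc n)
    have "sm (int (Suc n)) x = sm (int n) x + x" by (simp add: sm_def prod_eq_iff algebra_simps)
    then show ?case using Suc monoid.nat_pow_Suc[OF group.is_monoid[OF group_T]] by (simp add: mult_T)
  qed
  show ?thesis
  proof (cases "i < 0")
    case True
    have "inv\<^bsub>T\<^esub> (K (sm (int (nat (- i))) x)) = K (sm i x)"
    proof (rule group.inv_equality[OF group_T])
      show "K (sm i x) \<otimes>\<^bsub>T\<^esub> K (sm (int (nat (- i))) x) = \<one>\<^bsub>T\<^esub>"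
        using True by (simp add: mult_T one_T K_inject sm_def zero_prod_def)
    qed (auto simp: carrier_T)
    then show ?thesis using True nat by (simp add: int_pow_def2)
  qed (simp add: int_pow_def2 nat)
qed

text \<open>Restriction to the carrier matches the convention that automorphisms and
  \<open>conj_action\<close> are extensional functions; injectivity of \<open>K\<close> makes the
  description unique.\<close>

definition Act :: "mat2 \<Rightarrow> 'a set \<Rightarrow> 'a set" where
  "Act A = (\<lambda>X\<in>carrier T. K (mv A (THE x. K x = X)))"

lemma Act_K: "Act A (K x) = K (mv A x)"
proof -
  have "(THE y. K y = K x) = x" by (rule the_equality) (auto simp: K_inject)
  then show ?thesis by (simp add: Act_def carrier_T)
qed

lemma Act_extensional: "Act A \<in> extensional (carrier T)"
  by (simp add: Act_def)

lemma Act_inject: "Act A = Act B \<longleftrightarrow> A = B"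
proof
  assume "Act A = Act B"
  then have "K (mv A x) = K (mv B x)" for x by (metis Act_K)
  then show "A = B" by (intro mv_inject) (simp add: K_inject)
qed simp

lemma conj_action_eq:
  assumes g: "g \<in> carrier G" shows "conj_action G N (N #> g) = Act (Mat g)"
proof (rule extensionalityI[of _ "carrier T"])
  show "conj_action G N (N #> g) \<in> extensional (carrier T)" by (simp add: conj_action_def)
  show "Act (Mat g) \<in> extensional (carrier T)" by (rule Act_extensional)
  fix X assume X: "X \<in> carrier T"
  then obtain x where x: "X = K x" by (auto simp: carrier_T)
  have "(\<Union>h\<in>N #> g. \<Union>n\<in>K x. {h \<otimes> n \<otimes> inv h}) = K (mv (Mat g) x)"
  proof (intro subset_antisym subsetI)
    fix m assume "m \<in> (\<Union>h\<in>N #> g. \<Union>n\<in>K x. {h \<otimes> n \<otimes> inv h})"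
    then obtain k n where k: "k \<in> N" and n: "n \<in> K x" and m: "m = cj (k \<otimes> g) n"
      by (auto simp: r_coset_def cj_def)
    have nN: "n \<in> N" "uv n = x" using n by (auto simp: K_def)
    have "uv m = mv (Mat (k \<otimes> g)) x" unfolding m using k g nN by (simp add: uv_cj)
    also have "Mat (k \<otimes> g) = Mat g" using k g by (simp add: Mat_mult Mat_N)
    finally show "m \<in> K (mv (Mat g) x)" using k g nN m by (simp add: K_def)
  next
    fix m assume "m \<in> K (mv (Mat g) x)"
    then have m: "m \<in> N" "uv m = mv (Mat g) x" by (auto simp: K_def)
    define n where "n = cj (inv g) m"
    have "uv n = mv (mm (Mat (inv g)) (Mat g)) x" using g m by (simp add: n_def uv_cj mv_mm)
    then have n: "n \<in> K x" using g m Mat_inv(2)[OF g] by (simp add: K_def n_def)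
    have "cj g n = m" using g m by (simp add: n_def cj_comp[symmetric] cj_one)
    then have "m = g \<otimes> n \<otimes> inv g" by (simp add: cj_def)
    moreover have "g \<in> N #> g" using rcos_self[OF g subgroup_N] .
    ultimately show "m \<in> (\<Union>h\<in>N #> g. \<Union>n\<in>K x. {h \<otimes> n \<otimes> inv h})" using n by blast
  qed
  then show "conj_action G N (N #> g) X = Act (Mat g) X"
    using X by (simp add: conj_action_def x Act_K)
qed

lemma action_image_eq: "action_image G N = Act ` Mat ` carrier G"
  unfolding action_image_def carrier_FactGroup image_image
  by (rule image_cong[OF refl]) (rule conj_action_eq)

lemma Act_auto:
  assumes A: "A \<in> Mat ` carrier G" shows "Act A \<in> carrier (AutoGroup T)" "Act A \<in> Bij (carrier T)"
proof -
  obtain g where g: "g \<in> carrier G" "A = Mat g" using A by blast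
  have "bij_betw (Act A) (carrier T) (carrier T)"
  proof (rule bij_betwI[where g = "Act (Mat (inv g))"])
    show "Act A \<in> carrier T \<rightarrow> carrier T" "Act (Mat (inv g)) \<in> carrier T \<rightarrow> carrier T"
      by (auto simp: carrier_T Act_K)
    show "Act (Mat (inv g)) (Act A X) = X" if "X \<in> carrier T" for X
      using that Mat_inv(2)[OF g(1)] by (auto simp: carrier_T Act_K g(2) mv_mm[symmetric])
    show "Act A (Act (Mat (inv g)) X) = X" if "X \<in> carrier T" for X
      using that Mat_inv(1)[OF g(1)] by (auto simp: carrier_T Act_K g(2) mv_mm[symmetric])
  qed
  then show "Act A \<in> Bij (carrier T)" using Act_extensional by (simp add: Bij_def)
  moreover have "Act A \<in> hom T T"
  proof (rule homI)
    show "Act A X \<in> carrier T" if "X \<in> carrier T" for X using that by (auto simp: carrier_T Act_K)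
    fix X Y assume "X \<in> carrier T" "Y \<in> carrier T"
    then obtain x y where "X = K x" "Y = K y" unfolding carrier_T by blast
    then show "Act A (X \<otimes>\<^bsub>T\<^esub> Y) = Act A X \<otimes>\<^bsub>T\<^esub> Act A Y" by (simp only: Act_K mult_T mv_linear)
  qed
  ultimately show "Act A \<in> carrier (AutoGroup T)" by (simp add: AutoGroup_def auto_def)
qed

lemma mult_Act:
  assumes "A \<in> Mat ` carrier G" "B \<in> Mat ` carrier G"
  shows "Act A \<otimes>\<^bsub>AutoGroup T\<^esub> Act B = Act (mm A B)"
proof -
  have "Act A \<otimes>\<^bsub>AutoGroup T\<^esub> Act B = compose (carrier T) (Act A) (Act B)"
    using Act_auto(2)[OF assms(1)] Act_auto(2)[OF assms(2)] by (simp add: AutoGroup_def BijGroup_def)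
  also have "\<dots> = Act (mm A B)"
  proof (rule extensionalityI[OF _ Act_extensional])
    fix X assume "X \<in> carrier T"
    then show "compose (carrier T) (Act A) (Act B) X = Act (mm A B) X"
      by (auto simp: carrier_T compose_def Act_K mv_mm)
  qed (simp add: compose_def)
  finally show ?thesis .
qed

text \<open>Since \<open>Act\<close> is faithful, the isomorphism can be inverted and read on
  matrices, where the abstract group becomes visible through explicit generators.\<close>

lemma iso_mats:
  assumes "(AutoGroup T)\<lparr>carrier := action_image G N\<rparr> \<cong> H"
  obtains \<theta> where "bij_betw \<theta> (carrier H) (Mat ` carrier G)"
    "\<And>x y. x \<in> carrier H \<Longrightarrow> y \<in> carrier H \<Longrightarrow> \<theta> (x \<otimes>\<^bsub>H\<^esub> y) = mm (\<theta> x) (\<theta> y)"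
proof -
  obtain h where "h \<in> iso ((AutoGroup T)\<lparr>carrier := action_image G N\<rparr>) H"
    using assms by (auto simp: is_iso_def)
  then have h: "bij_betw h (Act ` Mat ` carrier G) (carrier H)"
    and hm: "\<And>x y. x \<in> Act ` Mat ` carrier G \<Longrightarrow> y \<in> Act ` Mat ` carrier G \<Longrightarrow> h (x \<otimes>\<^bsub>AutoGroup T\<^esub> y) = h x \<otimes>\<^bsub>H\<^esub> h y"
    by (auto simp: iso_def hom_def action_image_eq)
  have "bij_betw Act (Mat ` carrier G) (Act ` Mat ` carrier G)"
    by (rule bij_betw_imageI) (auto simp: inj_on_def Act_inject)
  then have b: "bij_betw (h \<circ> Act) (Mat ` carrier G) (carrier H)" using h by (rule bij_betw_trans)
  define \<theta> where "\<theta> = inv_into (Mat ` carrier G) (h \<circ> Act)"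
  have \<theta>: "bij_betw \<theta> (carrier H) (Mat ` carrier G)" unfolding \<theta>_def using b by (rule bij_betw_inv_into)
  have \<theta>h: "\<theta> (h (Act A)) = A" if "A \<in> Mat ` carrier G" for A
    using bij_betw_inv_into_left[OF b that] by (simp add: \<theta>_def)
  show thesis
  proof (rule that[OF \<theta>])
    fix x y assume xy: "x \<in> carrier H" "y \<in> carrier H"
    have img: "carrier H = (h \<circ> Act) ` (Mat ` carrier G)" using b by (simp add: bij_betw_def)
    obtain A where A: "A \<in> Mat ` carrier G" "x = h (Act A)" using xy(1) unfolding img comp_def by blast
    obtain B where B: "B \<in> Mat ` carrier G" "y = h (Act B)" using xy(2) unfolding img comp_def by blast
    note AB = A(1) B(1) A(2) B(2)
    have "mm A B \<in> Mat ` carrier G"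
      using AB(1,2) by (auto simp: Mat_mult[symmetric])
    moreover have "x \<otimes>\<^bsub>H\<^esub> y = h (Act (mm A B))" using hm AB mult_Act[OF AB(1,2)] by (metis imageI)
    ultimately show "\<theta> (x \<otimes>\<^bsub>H\<^esub> y) = mm (\<theta> x) (\<theta> y)" using \<theta>h AB by simp
  qed
qed

text \<open>Computed in any basis, the determinant is the factor by which the determinant form on
  that basis is multiplied.\<close>

lemma SL_of_iff: "action_image G N \<subseteq> SL_of T \<longleftrightarrow> (\<forall>A\<in>Mat ` carrier G. det2 A = 1)"
proof
  assume L: "action_image G N \<subseteq> SL_of T"
  show "\<forall>A\<in>Mat ` carrier G. det2 A = 1"
  proof
    fix A assume A: "A \<in> Mat ` carrier G"
    then have "Act A \<in> SL_of T" using L by (auto simp: action_image_eq)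
    then obtain e1 e2 and a b c d :: int where e: "is_Z_basis T e1 e2"
      "Act A e1 = e1 [^]\<^bsub>T\<^esub> a \<otimes>\<^bsub>T\<^esub> e2 [^]\<^bsub>T\<^esub> b" "Act A e2 = e1 [^]\<^bsub>T\<^esub> c \<otimes>\<^bsub>T\<^esub> e2 [^]\<^bsub>T\<^esub> d" "a * d - b * c = 1"
      by (auto simp: SL_of_def)
    obtain x y where xy: "e1 = K x" "e2 = K y" using e(1) by (auto simp: is_Z_basis_def carrier_T)
    have span: "\<exists>i j. z = sm i x + sm j y" for z
    proof -
      have "K z \<in> carrier T" by (simp add: carrier_T)
      then obtain ij :: "int \<times> int" where "K z = e1 [^]\<^bsub>T\<^esub> fst ij \<otimes>\<^bsub>T\<^esub> e2 [^]\<^bsub>T\<^esub> snd ij"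
        using e(1) unfolding is_Z_basis_def by blast
      then have "z = sm (fst ij) x + sm (snd ij) y" by (simp add: xy pow_T mult_T K_inject)
      then show ?thesis by blast
    qed
    \<comment> \<open>The unit vectors are combinations of the basis and have determinant 1, so the
      form cannot vanish on the basis.\<close>
    obtain i j where "(1, 0) = sm i x + sm j y" using span[of "(1, 0)"] by blast
    moreover obtain i' j' where "(0, 1) = sm i' x + sm j' y" using span[of "(0, 1)"] by blast
    moreover have "wedge (1, 0) (0, 1) = 1" by (simp add: wedge_def)
    ultimately have "wedge (sm i x + sm j y) (sm i' x + sm j' y) = 1" by simp
    then have w0: "wedge x y \<noteq> 0" using wedge_anticommute[of y x] by auto
    have "mv A x = sm a x + sm b y" "mv A y = sm c x + sm d y"
      using e(2,3) by (simp_all add: xy Act_K pow_T mult_T K_inject)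
    then have "wedge (mv A x) (mv A y) = (a * d - b * c) * wedge x y"
      using wedge_anticommute[of y x] by (simp add: algebra_simps)
    then have "det2 A * wedge x y = 1 * wedge x y" using e(4) by (simp add: wedge_mv)
    then show "det2 A = 1" using w0 by simp
  qed
next
  assume R: "\<forall>A\<in>Mat ` carrier G. det2 A = 1"
  have basis: "is_Z_basis T (K (1, 0)) (K (0, 1))" unfolding is_Z_basis_def
  proof (intro conjI ballI)
    fix X assume "X \<in> carrier T"
    then obtain x where X: "X = K x" by (auto simp: carrier_T)
    show "\<exists>!ab::int \<times> int. X = K (1, 0) [^]\<^bsub>T\<^esub> fst ab \<otimes>\<^bsub>T\<^esub> K (0, 1) [^]\<^bsub>T\<^esub> snd ab"
      by (rule ex1I[of _ x]) (auto simp: X pow_T mult_T K_inject sm_def prod_eq_iff)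
  qed (auto simp: carrier_T)
  show "action_image G N \<subseteq> SL_of T"
  proof
    fix f assume "f \<in> action_image G N"
    then obtain A where A: "A \<in> Mat ` carrier G" "f = Act A" unfolding action_image_eq by blast
    obtain a b c d where abcd: "A = (a, b, c, d)" by (cases A)
    \<comment> \<open>\<open>SL_of\<close> lists the image of each basis vector as a row, whereas
      the matrix stores images as columns; \<open>b\<close> and \<open>c\<close> trade
      places.\<close>
    have "f (K (1, 0)) = K (1, 0) [^]\<^bsub>T\<^esub> a \<otimes>\<^bsub>T\<^esub> K (0, 1) [^]\<^bsub>T\<^esub> c"
      "f (K (0, 1)) = K (1, 0) [^]\<^bsub>T\<^esub> b \<otimes>\<^bsub>T\<^esub> K (0, 1) [^]\<^bsub>T\<^esub> d"
      by (auto simp: A(2) Act_K pow_T mult_T K_inject sm_def mv_def abcd)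
    moreover have "a * d - c * b = 1" using bspec[OF R A(1)] by (simp add: abcd det2_def mult.commute)
    ultimately show "f \<in> SL_of T" using Act_auto(1)[OF A(1)] basis A(2) unfolding SL_of_def by blast
  qed
qed

lemma derived_eq: "derived G N = {el 0 0 (\<kappa> * j) |j. True}"
proof -
  define D where "D = {el 0 0 (\<kappa> * j) |j. True}"
  have DN: "D \<subseteq> N" by (auto simp: D_def)
  have sD: "subgroup D G"
  proof (rule subgroupI)
    show "D \<subseteq> carrier G" "D \<noteq> {}" using DN by (auto simp: D_def)
    fix a b assume "a \<in> D" "b \<in> D"
    then obtain i j where ij: "a = el 0 0 (\<kappa> * i)" "b = el 0 0 (\<kappa> * j)" by (auto simp: D_def)
    have "inv a = el 0 0 (\<kappa> * (- i))" unfolding ij by (rule coord_inj) (auto simp: inv_coords)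
    then show "inv a \<in> D" unfolding D_def by blast
    have "a \<otimes> b = el 0 0 (\<kappa> * (i + j))" by (simp add: ij el0_mult distrib_left)
    then show "a \<otimes> b \<in> D" unfolding D_def by blast
  qed
  have comm: "(\<Union>x\<in>N. \<Union>y\<in>N. {x \<otimes> y \<otimes> inv x \<otimes> inv y}) \<subseteq> D"
    using c_commutator by (auto simp: D_def)
  have "derived G N \<subseteq> D" unfolding derived_def using generate_subgroup_incl[OF comm sD] .
  moreover have "D \<subseteq> derived G N"
  proof
    fix n assume "n \<in> D"
    then obtain j where j: "n = el 0 0 (\<kappa> * j)" by (auto simp: D_def)
    have "el 0 1 0 \<otimes> el j 0 0 \<otimes> inv (el 0 1 0) \<otimes> inv (el j 0 0) = n"
      using c_commutator[of "el 0 1 0" "el j 0 0"] by (simp add: j)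
    then show "n \<in> derived G N" unfolding derived_def by (intro generate.incl) (use el(1) in blast)
  qed
  ultimately show ?thesis by (auto simp: D_def)
qed

lemma card_center_mod_derived:
  "card (rcosets\<^bsub>G\<lparr>carrier := center_of GN\<rparr>\<^esub> (derived G N)) = nat \<bar>\<kappa>\<bar>"
proof -
  define ZG where "ZG = G\<lparr>carrier := center_of GN\<rparr>"
  have Zel: "center_of GN = {el 0 0 l |l. True}"
  proof (intro subset_antisym subsetI)
    fix n assume "n \<in> center_of GN"
    then have n: "n \<in> N" "u n = 0" "v n = 0" by (auto simp: center_eq K_def uv_def zero_prod_def)
    then have "n = el 0 0 (c n)" using el_coords[OF n(1)] by simp
    then show "n \<in> {el 0 0 l |l. True}" by blast
  qed (auto simp: center_eq K_def zero_prod_def)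
  have sZ: "subgroup (center_of GN) G"
    using incl_subgroup[OF subgroup_N group.center_subgroup[OF group_GN']] .
  have gZ: "group ZG" unfolding ZG_def using sZ by (rule subgroup_imp_group)
  have sub: "derived G N \<subseteq> center_of GN" by (auto simp: derived_eq Zel)
  have "subgroup (derived G N) G"
    unfolding derived_def using subgroup.subset[OF subgroup_N]
    by (intro generate_is_subgroup) auto
  then have sD: "subgroup (derived G N) ZG" unfolding ZG_def using subgroup_incl[OF _ sZ sub] by blast
  have "card (rcosets\<^bsub>ZG\<^esub> (derived G N)) = card ((\<lambda>n. c n mod \<kappa>) ` carrier ZG)"
  proof (rule group.card_rcosets_detect[OF gZ sD])
    fix n m assume nm: "n \<in> carrier ZG" "m \<in> carrier ZG"
    then obtain i j where ij: "n = el 0 0 i" "m = el 0 0 j" by (auto simp: ZG_def Zel)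
    have "inv\<^bsub>ZG\<^esub> m = inv m" unfolding ZG_def using nm by (intro m_inv_consistent[OF sZ]) (simp add: ZG_def)
    then have "n \<otimes>\<^bsub>ZG\<^esub> inv\<^bsub>ZG\<^esub> m = el 0 0 (i - j)" using same_uv_inv[of n m] by (simp add: ZG_def ij)
    moreover have "el 0 0 (i - j) \<in> derived G N \<longleftrightarrow> \<kappa> dvd i - j"
    proof
      assume "el 0 0 (i - j) \<in> derived G N"
      then obtain t where "el 0 0 (i - j) = el 0 0 (\<kappa> * t)" by (auto simp: derived_eq)
      then have "i - j = \<kappa> * t" by (metis el(4))
      then show "\<kappa> dvd i - j" by simp
    qed (auto simp: derived_eq elim!: dvdE)
    ultimately show "(c n mod \<kappa> = c m mod \<kappa>) = (n \<otimes>\<^bsub>ZG\<^esub> inv\<^bsub>ZG\<^esub> m \<in> derived G N)"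
      by (simp add: ij mod_eq_dvd_iff)
  qed
  also have "(\<lambda>n. c n mod \<kappa>) ` carrier ZG = range (\<lambda>i. i mod \<kappa>)"
    by (force simp: ZG_def Zel)
  \<comment> \<open>For negative \<kappa> the remainders are nonpositive, so the two signs need
    different intervals.\<close>
  also have "card (range (\<lambda>i. i mod \<kappa>)) = nat \<bar>\<kappa>\<bar>"
  proof (cases "\<kappa> > 0")
    case True
    have "range (\<lambda>i. i mod \<kappa>) = {0..<\<kappa>}"
    proof (intro subset_antisym subsetI)
      fix x assume "x \<in> {0..<\<kappa>}"
      then have "x = x mod \<kappa>" by simp
      then show "x \<in> range (\<lambda>i. i mod \<kappa>)" by blast
    qed (use True in auto)
    then show ?thesis using True by simp
  next
    case False
    then have neg: "\<kappa> < 0" using kappa_nonzero by simp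
    have "range (\<lambda>i. i mod \<kappa>) = {\<kappa><..0}"
    proof (intro subset_antisym subsetI)
      fix x assume "x \<in> {\<kappa><..0}"
      then have "x = x mod \<kappa>" by (simp add: mod_neg_neg_trivial)
      then show "x \<in> range (\<lambda>i. i mod \<kappa>)" by blast
    qed (use neg in auto)
    then show ?thesis using neg by simp
  qed
  finally show ?thesis by (simp add: ZG_def)
qed

end

section \<open>The possible actions on the plane\<close>

context heis_ext_p
begin

lemma mats_order_coprime:
  assumes A: "A \<in> mats" and d: "mpow A d = id2" "\<And>i. 0 < i \<Longrightarrow> i < d \<Longrightarrow> mpow A i \<noteq> id2" "d > 0"
  shows "coprime p d"
proof -
  have "mpow A (order (G Mod N)) = id2" using A order_Mat_dvd by blast
  then have "d dvd order (G Mod N)" using order_dvd[OF d] by blast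
  then have "\<not> p dvd d" using p_index dvd_trans by blast
  then show ?thesis using prime_p prime_imp_coprime by blast
qed

lemma involution_p_odd:
  assumes "A \<in> mats" "mm A A = id2" "A \<noteq> id2" shows "p \<noteq> 2"
proof -
  have "coprime p 2"
    using assms by (intro mats_order_coprime) (auto simp: mpow_2 less_2_cases_iff)
  then show ?thesis by auto
qed

lemma inv_lats_Psi_conditions:
  assumes "L \<in> inv_lats q mats e a"
  shows "add_subgroup L" "\<And>A x. A \<in> mats \<Longrightarrow> x \<in> L \<Longrightarrow> mv A x \<in> L" "\<exists>w. primitive q w \<and> L = lat q e a w"
proof -
  obtain w where w: "primitive q w" "\<forall>A\<in>mats. q ^ a dvd wedge w (mv A w)" "L = lat q e a w"
    using assms by (auto simp: inv_lats_def)
  show "add_subgroup L" unfolding w(3) by (rule lat_add_subgroup)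
  show "\<exists>w. primitive q w \<and> L = lat q e a w" using w by blast
  fix A x assume "A \<in> mats" "x \<in> L"
  then show "mv A x \<in> L" using lat_invariant_iff[OF prime_q w(1), of e a A] w(2,3) by blast
qed

text \<open>The weight \<open>r\<close> is the multiplicity of the determinant character in the plane, and \<open>\<nu> a\<close>
  counts the invariant lattices of index \<open>p ^ a\<close> that are not contained in \<open>p\<close> times the plane.\<close>

definition lattice_data :: "nat \<Rightarrow> (nat \<Rightarrow> nat) \<Rightarrow> bool" where
  "lattice_data r \<nu> \<longleftrightarrow>
     (\<forall>e a b. \<forall>L\<in>inv_lats q mats e a. card (Psi (q ^ b) mats L) = p ^ (r * b)) \<and>
     (\<forall>e a. finite (inv_lats q mats e a) \<and> card (inv_lats q mats e a) = \<nu> a)"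

text \<open>Infinite sets also have \<open>card\<close> equal to 0. A zero count is therefore
  demanded as emptiness, while a positive count yields finiteness.\<close>

lemma lattice_dataI:
  assumes Psi: "\<And>e a b L. L \<in> inv_lats q mats e a \<Longrightarrow> card (Psi (q ^ b) mats L) = p ^ (r * b)"
    and pos: "\<And>e a. a > 0 \<Longrightarrow> inv_lats q mats e a = {} \<and> \<nu> a = 0 \<or> card (inv_lats q mats e a) = \<nu> a \<and> \<nu> a > 0"
    and zero: "\<nu> 0 = 1"
  shows "lattice_data r \<nu>"
proof -
  have "finite (inv_lats q mats e a) \<and> card (inv_lats q mats e a) = \<nu> a" for e a
  proof (cases "a = 0")
    case True
    then show ?thesis using card_inv_lats_0[OF prime_q] zero by (metis card.infinite zero_neq_one)
  next
    case False
    then show ?thesis using pos[of a e] by (metis card.empty card.infinite finite.emptyI less_irrefl neq0_conv)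
  qed
  then show ?thesis using Psi by (simp add: lattice_data_def)
qed

text \<open>Either -1 or an element of order 3 acts. Its order divides that of the quotient, so 2 or
  3 respectively is a unit modulo \<open>q ^ b\<close>.\<close>

lemma card_Psi_0:
  assumes "neg2 \<in> mats \<or> (\<exists>A\<in>mats. A \<noteq> id2 \<and> mpow A 3 = id2)" and L: "L \<in> inv_lats q mats e a"
  shows "card (Psi (q ^ b) mats L) = p ^ (0 * b)"
proof -
  note cond = inv_lats_Psi_conditions[OF L]
  have "card (Psi (q ^ b) mats L) = 1"
    using assms(1)
  proof
    assume neg: "neg2 \<in> mats"
    have "p \<noteq> 2" by (rule involution_p_odd[OF neg]) (auto simp: mm_def)
    then have "\<not> p dvd 2" using prime_p primes_dvd_imp_eq two_is_prime_nat by blast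
    then have "coprime p 2" using prime_p prime_imp_coprime by blast
    then have "coprime 2 q" by (metis coprime_commute coprime_int_iff of_nat_numeral)
    then show ?thesis using card_Psi_neg[OF q_pos _ cond(1,2) neg] by simp
  next
    assume "\<exists>A\<in>mats. A \<noteq> id2 \<and> mpow A 3 = id2"
    then obtain A where A: "A \<in> mats" "A \<noteq> id2" "mpow A 3 = id2" by blast
    have ord: "mpow A i \<noteq> id2" if i: "0 < i" "i < 3" for i
    proof
      assume *: "mpow A i = id2"
      have "i = 1 \<or> i = 2" using i by auto
      then show False
      proof
        assume "i = 2"
        then have "mpow A 3 = mm A (mpow A 2)" "mpow A 2 = id2" using * by (auto simp: mpow_2 mpow_3)
        then show False using A by simp
      qed (use * A in simp)
    qed
    have "coprime p 3" using mats_order_coprime[OF A(1,3) ord] by simp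
    then have "coprime 3 q" by (metis coprime_commute coprime_int_iff of_nat_numeral)
    then show ?thesis
      using card_Psi_order3[OF q_pos _ cond(1,2) A(1) order3_trace[OF A(3,2)]] by simp
  qed
  then show ?thesis by simp
qed

abbreviation \<nu>_all :: "nat \<Rightarrow> nat" where "\<nu>_all \<equiv> \<lambda>a. if a = 0 then 1 else p ^ a + p ^ (a - 1)"
abbreviation \<nu>_two :: "nat \<Rightarrow> nat" where "\<nu>_two \<equiv> \<lambda>a. if a = 0 then 1 else 2"
abbreviation \<nu>_none :: "nat \<Rightarrow> nat" where "\<nu>_none \<equiv> \<lambda>a. if a = 0 then 1 else 0"

lemma wedge_uminus_right: "wedge x (- y) = - wedge x y"
  by (simp add: wedge_def)

lemma data_trivial: assumes "mats = {id2}" shows "lattice_data 2 \<nu>_all"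
proof (rule lattice_dataI)
  fix e a b L assume "L \<in> inv_lats q mats e a"
  then show "card (Psi (q ^ b) mats L) = p ^ (2 * b)"
    using inv_lats_Psi_conditions(3) card_Psi_id[OF prime_p] unfolding assms by metis
next
  fix e a :: nat assume "a > 0"
  moreover have "card (inv_lats q mats e a) = p ^ a + p ^ (a - 1)"
    by (rule card_inv_lats_scalar[OF prime_p _ \<open>a > 0\<close>]) (auto simp: assms)
  ultimately show "inv_lats q mats e a = {} \<and> \<nu>_all a = 0 \<or> card (inv_lats q mats e a) = \<nu>_all a \<and> \<nu>_all a > 0"
    using prime_p by (simp add: prime_gt_0_nat)
qed simp

lemma data_neg: assumes "mats = {id2, neg2}" shows "lattice_data 0 \<nu>_all"
proof (rule lattice_dataI)
  fix e a b L assume "L \<in> inv_lats q mats e a"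
  then show "card (Psi (q ^ b) mats L) = p ^ (0 * b)"
    using card_Psi_0[of L e a b] assms by blast
next
  fix e a :: nat assume "a > 0"
  have wz: "wedge w (mv A w) = 0" if "A \<in> mats" for A w
  proof -
    have "A = id2 \<or> A = neg2" using that unfolding assms by blast
    then show ?thesis by (elim disjE) (simp_all add: wedge_uminus_right)
  qed
  have c: "card (inv_lats q mats e a) = p ^ a + p ^ (a - 1)"
    by (rule card_inv_lats_scalar[OF prime_p _ \<open>a > 0\<close>]) (rule wz)
  show "inv_lats q mats e a = {} \<and> \<nu>_all a = 0 \<or> card (inv_lats q mats e a) = \<nu>_all a \<and> \<nu>_all a > 0"
    using prime_p c \<open>a > 0\<close> by (simp add: prime_gt_0_nat)
qed simp

text \<open>The eigenvalues are 1 and -1, with discriminant 4; the existence of an involution forces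
  \<open>p\<close> to be odd.\<close>

lemma card_inv_lats_reflection:
  assumes R: "R \<in> mats" "det2 R = - 1" "mm R R = id2" and lin: "\<And>B. B \<in> mats \<Longrightarrow> \<exists>i j. B = lin i j R"
    and a: "a > 0"
  shows "card (inv_lats q mats e a) = 2"
proof -
  have tr: "tr2 R = 0" using det_minus1_square R by blast
  have "R \<noteq> id2" using R(2) by auto
  then have "p \<noteq> 2" using involution_p_odd R by blast
  then have "\<not> p dvd 2 ^ 2" using prime_p prime_dvd_power primes_dvd_imp_eq two_is_prime_nat by blast
  then have "\<not> p dvd 4" by simp
  then have "\<not> q dvd 4" by (metis of_nat_dvd_iff of_nat_numeral)
  then have "\<not> q dvd (tr2 R)\<^sup>2 - 4 * det2 R" by (simp add: tr R)
  moreover have "q ^ a dvd 1 ^ 2 - tr2 R * 1 + det2 R" by (simp add: tr R)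
  ultimately show ?thesis using card_inv_lats_split[OF prime_q _ _ a R(1) lin] by blast
qed

lemma data_reflection:
  assumes "mats = {id2, R}" "det2 R = - 1" "mm R R = id2" shows "lattice_data 1 \<nu>_two"
proof (rule lattice_dataI)
  have "R \<noteq> id2" using assms by auto
  then have p2: "p \<noteq> 2" using involution_p_odd assms by blast
  fix e a b L assume L: "L \<in> inv_lats q mats e a"
  then obtain w where w: "primitive q w" "L = lat q e a w" using inv_lats_Psi_conditions(3) by blast
  have "card (Psi (q ^ b) {id2, R} (lat q e a w)) = p ^ b"
    using det_minus1_square[OF assms(3,2)] inv_lats_Psi_conditions(2)[OF L] assms w
    by (intro card_Psi_reflection[OF prime_p p2 w(1) assms(2)]) auto
  then show "card (Psi (q ^ b) mats L) = p ^ (1 * b)" by (simp add: assms(1) w)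
next
  fix e a :: nat assume a: "a > 0"
  have "id2 = lin 1 0 R" "R = lin 0 1 R" by (cases R; simp add: lin_def)+
  then have "\<exists>i j. B = lin i j R" if "B \<in> mats" for B using that unfolding assms(1) by blast
  then have "card (inv_lats q mats e a) = 2" using card_inv_lats_reflection[OF _ assms(2,3) _ a] assms(1) by blast
  then show "inv_lats q mats e a = {} \<and> \<nu>_two a = 0 \<or> card (inv_lats q mats e a) = \<nu>_two a \<and> \<nu>_two a > 0"
    using a by simp
qed simp

lemma data_klein:
  assumes "mats = {id2, neg2, R, mm neg2 R}" "det2 R = - 1" "mm R R = id2" shows "lattice_data 0 \<nu>_two"
proof (rule lattice_dataI)
  fix e a b L assume "L \<in> inv_lats q mats e a"
  then show "card (Psi (q ^ b) mats L) = p ^ (0 * b)"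
    using card_Psi_0[of L e a b] assms(1) by blast
next
  fix e a :: nat assume a: "a > 0"
  have "id2 = lin 1 0 R" "neg2 = lin (- 1) 0 R" "R = lin 0 1 R" "mm neg2 R = lin 0 (- 1) R"
    by (cases R; simp add: lin_def mm_def)+
  then have "\<exists>i j. B = lin i j R" if "B \<in> mats" for B using that unfolding assms(1) by blast
  then have "card (inv_lats q mats e a) = 2" using card_inv_lats_reflection[OF _ assms(2,3) _ a] assms(1) by blast
  then show "inv_lats q mats e a = {} \<and> \<nu>_two a = 0 \<or> card (inv_lats q mats e a) = \<nu>_two a \<and> \<nu>_two a > 0"
    using a by simp
qed simp

lemma cyclic_order_facts:
  assumes d: "d \<in> {3, 4, 6}" and A: "A \<in> mats" "mpow A d = id2" "\<And>i. 0 < i \<Longrightarrow> i < d \<Longrightarrow> mpow A i \<noteq> id2"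
  shows "det2 A = 1" "tr2 A = cyc_tr d" "coprime p d"
    "neg2 \<in> mats \<or> (\<exists>B\<in>mats. B \<noteq> id2 \<and> mpow B 3 = id2)"
proof -
  have d0: "d > 0" using d by auto
  show "coprime p d" using mats_order_coprime[OF A d0] .
  show "det2 A = 1" "tr2 A = cyc_tr d" using finite_order_trace(1,2)[OF d A(2,3)] by (auto simp: cyc_tr_def)
  obtain g where g: "g \<in> carrier G" "A = Mat g" using A(1) by blast
  then have "mpow A n = Mat (g [^] n)" for n using Mat_pow by simp
  then have "mpow A n \<in> mats" for n using g by simp
  then show "neg2 \<in> mats \<or> (\<exists>B\<in>mats. B \<noteq> id2 \<and> mpow B 3 = id2)"
    using finite_order_trace(3,4)[OF d A(2,3)] d by (metis insert_iff)
qed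

text \<open>The character value decides whether the characteristic polynomial, which is cyclotomic,
  splits modulo \<open>p\<close>. A root lifts to all powers of \<open>p\<close>; without a root
  there is no eigenline even modulo \<open>p\<close>.\<close>

lemma data_cyclic:
  assumes d: "d \<in> {3, 4, 6}" and A: "A \<in> mats" "mpow A d = id2" "\<And>i. 0 < i \<Longrightarrow> i < d \<Longrightarrow> mpow A i \<noteq> id2"
    and gen: "\<And>B. B \<in> mats \<Longrightarrow> \<exists>n. B = mpow A n"
  shows "lattice_data 0 (if chi d p = 1 then \<nu>_two else \<nu>_none)"
proof (rule lattice_dataI)
  note f = cyclic_order_facts[OF d A]
  fix e a b L assume "L \<in> inv_lats q mats e a"
  then show "card (Psi (q ^ b) mats L) = p ^ (0 * b)" using card_Psi_0[OF f(4)] by blast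
next
  note f = cyclic_order_facts[OF d A]
  fix e a :: nat assume a: "a > 0"
  have disc: "\<not> q dvd (tr2 A)\<^sup>2 - 4 * det2 A" using disc_unit[OF prime_p d f(3)] by (simp add: f)
  show "inv_lats q mats e a = {} \<and> (if chi d p = 1 then \<nu>_two else \<nu>_none) a = 0 \<or>
     card (inv_lats q mats e a) = (if chi d p = 1 then \<nu>_two else \<nu>_none) a \<and> (if chi d p = 1 then \<nu>_two else \<nu>_none) a > 0"
  proof (cases "chi d p = 1")
    case True
    then obtain r where "q dvd r ^ 2 - cyc_tr d * r + 1" using cyclotomic_root_iff[OF prime_p d f(3)] by blast
    \<comment> \<open>Hensel lifting is stated for successor exponents, hence \<open>a - 1\<close>
      together with \<open>a > 0\<close>.\<close>
    then obtain s where s: "q ^ a dvd s ^ 2 - cyc_tr d * s + 1"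
      using hensel_quadratic[OF prime_q, of "cyc_tr d" 1 r "a - 1"] disc_unit[OF prime_p d f(3)] a by auto
    have "\<exists>i j. B = lin i j A" if "B \<in> mats" for B using gen[OF that] mpow_lin by metis
    then have "card (inv_lats q mats e a) = 2"
      using card_inv_lats_split[OF prime_q disc _ a A(1)] s by (simp add: f)
    then show ?thesis using True a by simp
  next
    case False
    then have none: "\<not> q dvd r ^ 2 - cyc_tr d * r + 1" for r using cyclotomic_root_iff[OF prime_p d f(3)] by blast
    have "inv_lats q mats e a = {}"
    proof (rule inv_lats_empty[OF _ a])
      fix w assume w: "primitive q w"
      have "\<not> q dvd wedge w (mv A w)"
      proof
        assume "q dvd wedge w (mv A w)"
        then obtain r where "eigen q 1 A r w" using wedge_eigen[OF prime_q w, of 1 A] by auto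
        from eigen_root[OF prime_q w this] show False using none[of r] by (simp add: f)
      qed
      then show "\<exists>A\<in>mats. \<not> q dvd wedge w (mv A w)" using A(1) by blast
    qed
    then show ?thesis using False a by simp
  qed
qed simp

text \<open>The rotation and the reflection have no common eigenline modulo
  \<open>p\<close>.\<close>

lemma data_dihedral:
  assumes d: "d \<in> {3, 4, 6}" and A: "A \<in> mats" "mpow A d = id2" "\<And>i. 0 < i \<Longrightarrow> i < d \<Longrightarrow> mpow A i \<noteq> id2"
    and Q: "Q \<in> mats" "mm Q Q = id2" "mm A (mm Q A) = Q"
  shows "lattice_data 0 \<nu>_none"
proof (rule lattice_dataI)
  note f = cyclic_order_facts[OF d A]
  fix e a b L assume "L \<in> inv_lats q mats e a"
  then show "card (Psi (q ^ b) mats L) = p ^ (0 * b)" using card_Psi_0[OF f(4)] by blast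
next
  note f = cyclic_order_facts[OF d A]
  fix e a :: nat assume a: "a > 0"
  have disc: "\<not> q dvd (tr2 A)\<^sup>2 - 4" using disc_unit[OF prime_p d f(3)] by (simp add: f)
  have "inv_lats q mats e a = {}"
    using dihedral_no_eigenvector[OF prime_q f(1) disc Q(3,2)] A(1) Q(1)
    by (intro inv_lats_empty[OF _ a]) blast
  then show "inv_lats q mats e a = {} \<and> \<nu>_none a = 0 \<or> card (inv_lats q mats e a) = \<nu>_none a \<and> \<nu>_none a > 0"
    using a by simp
qed simp

end

section \<open>Matrix groups isomorphic to cyclic and dihedral groups\<close>

text \<open>Only multiplicativity of \<theta> is assumed. The identity of \<open>H\<close> still
  goes to \<open>id2\<close>, because an idempotent matrix with a right inverse is the
  identity.\<close>

locale mat_group =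
  fixes H :: "'b monoid" and \<theta> :: "'b \<Rightarrow> mat2" and S :: "mat2 set"
  assumes bij: "bij_betw \<theta> (carrier H) S"
    and hom: "\<And>x y. x \<in> carrier H \<Longrightarrow> y \<in> carrier H \<Longrightarrow> \<theta> (x \<otimes>\<^bsub>H\<^esub> y) = mm (\<theta> x) (\<theta> y)"
    and inv: "\<And>A. A \<in> S \<Longrightarrow> \<exists>B. mm A B = id2"
begin

lemma idem: "x \<in> carrier H \<Longrightarrow> x \<otimes>\<^bsub>H\<^esub> x = x \<Longrightarrow> \<theta> x = id2"
proof -
  assume x: "x \<in> carrier H" "x \<otimes>\<^bsub>H\<^esub> x = x"
  then have e: "mm (\<theta> x) (\<theta> x) = \<theta> x" using hom by metis
  obtain B where "mm (\<theta> x) B = id2" using inv bij x(1) by (metis bij_betwE)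
  then show ?thesis using e mm_assoc[of "\<theta> x" "\<theta> x" B] by simp
qed

lemma mem: "x \<in> carrier H \<Longrightarrow> \<theta> x \<in> S"
  using bij bij_betwE by metis

lemma inj: "x \<in> carrier H \<Longrightarrow> y \<in> carrier H \<Longrightarrow> \<theta> x = \<theta> y \<Longrightarrow> x = y"
  using bij by (meson bij_betw_imp_inj_on inj_onD)

lemma surj: "A \<in> S \<Longrightarrow> \<exists>x\<in>carrier H. A = \<theta> x"
  using bij by (metis bij_betw_imp_surj_on imageE)

end

lemma cyclic_mat_group:
  assumes "mat_group (integer_mod_group d) \<theta> S" and d: "d > 0"
  obtains A where "A \<in> S" "mpow A d = id2" "\<And>i. 0 < i \<Longrightarrow> i < d \<Longrightarrow> mpow A i \<noteq> id2" "S = mpow A ` {..<d}"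
proof -
  interpret mat_group "integer_mod_group d" \<theta> S by fact
  have car: "carrier (integer_mod_group d) = {0..<int d}" using d by (simp add: carrier_integer_mod_group)
  \<comment> \<open>The reduction \<open>1 mod int d\<close> keeps the generator in the carrier for
    \<open>d = 1\<close> as well.\<close>
  define A where "A = \<theta> (1 mod int d)"
  have 0: "\<theta> 0 = id2" using d by (intro idem) (auto simp: car)
  have pw: "mpow A n = \<theta> (int n mod int d)" for n
  proof (induction n)
    case (Suc n)
    have "\<theta> (int (Suc n) mod int d) = \<theta> ((1 mod int d) \<otimes>\<^bsub>integer_mod_group d\<^esub> (int n mod int d))"
      by (simp add: mod_simps add.commute)
    also have "\<dots> = mm A (mpow A n)" using d Suc by (subst hom) (auto simp: car A_def)
    finally show ?case by simp
  qed (simp add: 0)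
  show thesis
  proof (rule that[of A])
    show "A \<in> S" unfolding A_def using d by (intro mem) (simp add: car)
    show "mpow A d = id2" by (simp add: pw 0)
    show "mpow A i \<noteq> id2" if i: "0 < i" "i < d" for i
    proof
      assume "mpow A i = id2"
      then have "\<theta> (int i) = \<theta> 0" using pw[of i] i 0 by simp
      then have "int i = 0" using i by (intro inj) (auto simp: car)
      then show False using i by simp
    qed
    show "S = mpow A ` {..<d}"
    proof (intro subset_antisym subsetI)
      fix B assume "B \<in> S"
      then obtain x where "x \<in> carrier (integer_mod_group d)" "B = \<theta> x" using surj by blast
      then have x: "0 \<le> x" "x < int d" "B = \<theta> x" by (auto simp: car)
      then have "B = mpow A (nat x)" by (simp add: pw)
      moreover have "nat x < d" using x by linarith
      ultimately show "B \<in> mpow A ` {..<d}" by blast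
    next
      fix B assume "B \<in> mpow A ` {..<d}"
      then show "B \<in> S" using d by (auto simp: pw car intro!: mem)
    qed
  qed
qed

text \<open>\<open>A Q A = Q\<close> is the dihedral relation written without inverses. The cases of
  order 2 and 4 also rest on \<open>Q\<close> not being a power of \<open>A\<close>.\<close>

lemma dihedral_mat_group:
  assumes "mat_group (dihedral_group d) \<theta> S" and d: "d > 0"
  obtains A Q where "A \<in> S" "Q \<in> S" "mpow A d = id2" "\<And>i. 0 < i \<Longrightarrow> i < d \<Longrightarrow> mpow A i \<noteq> id2"
    "mm Q Q = id2" "mm A (mm Q A) = Q" "\<And>i. Q \<noteq> mpow A i" "S = mpow A ` {..<d} \<union> (\<lambda>i. mm (mpow A i) Q) ` {..<d}"
proof -
  interpret mat_group "dihedral_group d" \<theta> S by fact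
  have car: "carrier (dihedral_group d) = {0..<int d} \<times> UNIV" by (simp add: dihedral_group_def)
  have mult: "(i, e) \<otimes>\<^bsub>dihedral_group d\<^esub> (j, f) = ((if e then i - j else i + j) mod int d, e \<noteq> f)" for i e j f
    by (simp add: dihedral_group_def)
  define A where "A = \<theta> (1 mod int d, False)"
  define Q where "Q = \<theta> (0, True)"
  have memc: "(x mod int d, e) \<in> carrier (dihedral_group d)" "(0, e) \<in> carrier (dihedral_group d)" for x e
    using d by (auto simp: car)
  have 0: "\<theta> (0, False) = id2" using memc by (intro idem) (auto simp: mult)
  have pw: "mpow A n = \<theta> (int n mod int d, False)" for n
  proof (induction n)
    case (Suc n)
    have "\<theta> (int (Suc n) mod int d, False) = \<theta> ((1 mod int d, False) \<otimes>\<^bsub>dihedral_group d\<^esub> (int n mod int d, False))"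
      by (simp add: mult mod_simps add.commute)
    also have "\<dots> = mm A (mpow A n)" using Suc memc by (subst hom) (auto simp: A_def)
    finally show ?case by simp
  qed (simp add: 0)
  have pwQ: "mm (mpow A n) Q = \<theta> (int n mod int d, True)" for n
  proof -
    have "mm (mpow A n) Q = \<theta> ((int n mod int d, False) \<otimes>\<^bsub>dihedral_group d\<^esub> (0, True))"
      unfolding pw Q_def using memc by (subst hom) auto
    then show ?thesis by (simp add: mult)
  qed
  show thesis
  proof (rule that[of A Q])
    show "A \<in> S" "Q \<in> S" unfolding A_def Q_def using memc mem by auto
    show "mpow A d = id2" by (simp add: pw 0)
    show "mpow A i \<noteq> id2" if i: "0 < i" "i < d" for i
    proof
      assume "mpow A i = id2"
      then have "\<theta> (int i, False) = \<theta> (0, False)" using pw[of i] i 0 by simp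
      then have "(int i, False) = (0, False)" using i by (intro inj) (auto simp: car)
      then show False using i by simp
    qed
    have "mm Q Q = \<theta> ((0, True) \<otimes>\<^bsub>dihedral_group d\<^esub> (0, True))" unfolding Q_def using memc by (subst hom) auto
    then show "mm Q Q = id2" using 0 by (simp add: mult)
    have "mm Q A = \<theta> ((0, True) \<otimes>\<^bsub>dihedral_group d\<^esub> (1 mod int d, False))" unfolding Q_def A_def using memc by (subst hom) auto
    also have "\<dots> = \<theta> ((- 1) mod int d, True)" by (simp add: mult mod_simps)
    finally have "mm A (mm Q A) = \<theta> ((1 mod int d, False) \<otimes>\<^bsub>dihedral_group d\<^esub> ((- 1) mod int d, True))"
      unfolding A_def using memc by (subst hom) auto
    then show "mm A (mm Q A) = Q" by (simp add: mult mod_simps Q_def)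
    show "Q \<noteq> mpow A i" for i
      unfolding pw Q_def using inj[OF memc(2) memc(1)] by blast
    show "S = mpow A ` {..<d} \<union> (\<lambda>i. mm (mpow A i) Q) ` {..<d}"
    proof (intro subset_antisym subsetI)
      fix B assume "B \<in> S"
      then obtain y where "y \<in> carrier (dihedral_group d)" "B = \<theta> y" using surj by blast
      then obtain x e where x: "0 \<le> x" "x < int d" "B = \<theta> (x, e)" by (cases y) (auto simp: car)
      then have "B = (if e then mm (mpow A (nat x)) Q else mpow A (nat x))"
        using pw[of "nat x"] pwQ[of "nat x"] by simp
      moreover have "nat x < d" using x by linarith
      ultimately show "B \<in> mpow A ` {..<d} \<union> (\<lambda>i. mm (mpow A i) Q) ` {..<d}" by (cases e) auto
    next
      fix B assume "B \<in> mpow A ` {..<d} \<union> (\<lambda>i. mm (mpow A i) Q) ` {..<d}"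
      then show "B \<in> S" unfolding pwQ unfolding pw using mem memc(1) by blast
    qed
  qed
qed

section \<open>Lattice data by isomorphism type of the action\<close>

context heis_ext_p
begin

abbreviation FG where "FG \<equiv> (AutoGroup (quot_by_center G N))\<lparr>carrier := action_image G N\<rparr>"

lemma mat_group_mats:
  assumes "FG \<cong> H" obtains \<theta> where "mat_group H \<theta> mats"
proof -
  obtain \<theta> where "bij_betw \<theta> (carrier H) mats"
    "\<And>x y. x \<in> carrier H \<Longrightarrow> y \<in> carrier H \<Longrightarrow> \<theta> (x \<otimes>\<^bsub>H\<^esub> y) = mm (\<theta> x) (\<theta> y)"
    using iso_mats[OF assms] by blast
  moreover have "\<exists>B. mm A B = id2" if "A \<in> mats" for A
  proof -
    obtain g where "g \<in> carrier G" "A = Mat g" using \<open>A \<in> mats\<close> by blast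
    then show ?thesis using Mat_inv(1) by blast
  qed
  ultimately have "mat_group H \<theta> mats" by unfold_locales
  then show thesis by (rule that)
qed

lemma less_2_image: "f ` {..<2::nat} = {f 0, f 1}"
  by (auto simp: less_2_cases_iff)

lemma type_C1: assumes "FG \<cong> integer_mod_group 1" shows "lattice_data 2 \<nu>_all" "action_image G N \<subseteq> SL_of T"
proof -
  obtain \<theta> where \<theta>: "mat_group (integer_mod_group 1) \<theta> mats" using mat_group_mats[OF assms] .
  obtain A where "mats = mpow A ` {..<1}" by (rule cyclic_mat_group[OF \<theta>]) auto
  then have m: "mats = {id2}" by (simp add: lessThan_Suc)
  then show "lattice_data 2 \<nu>_all" by (rule data_trivial)
  show "action_image G N \<subseteq> SL_of T" unfolding SL_of_iff m by simp
qed

lemma order2_group: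
  assumes "FG \<cong> integer_mod_group 2 \<or> FG \<cong> dihedral_group 1"
  obtains A where "mats = {id2, A}" "mm A A = id2" "A \<noteq> id2"
  using assms
proof
  assume "FG \<cong> integer_mod_group 2"
  then obtain \<theta> where \<theta>: "mat_group (integer_mod_group 2) \<theta> mats" using mat_group_mats by blast
  obtain A where A: "mpow A 2 = id2" "\<And>i. 0 < i \<Longrightarrow> i < 2 \<Longrightarrow> mpow A i \<noteq> id2" "mats = mpow A ` {..<2}"
    by (rule cyclic_mat_group[OF \<theta>]) auto
  then show thesis using A(2)[of 1] by (intro that[of A]) (auto simp: less_2_image mpow_2)
next
  assume "FG \<cong> dihedral_group 1"
  then obtain \<theta> where \<theta>: "mat_group (dihedral_group 1) \<theta> mats" using mat_group_mats by blast
  obtain A Q where Q: "mm Q Q = id2" "\<And>i. Q \<noteq> mpow A i" "mats = mpow A ` {..<1} \<union> (\<lambda>i. mm (mpow A i) Q) ` {..<1}"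
    by (rule dihedral_mat_group[OF \<theta>]) (simp, blast)
  then show thesis using Q(2)[of 0] by (intro that[of Q]) (auto simp: lessThan_Suc)
qed

lemma type_order2:
  assumes "FG \<cong> integer_mod_group 2 \<or> FG \<cong> dihedral_group 1"
  shows "action_image G N \<subseteq> SL_of T \<Longrightarrow> lattice_data 0 \<nu>_all"
    and "\<not> action_image G N \<subseteq> SL_of T \<Longrightarrow> lattice_data 1 \<nu>_two"
proof -
  obtain A where A: "mats = {id2, A}" "mm A A = id2" "A \<noteq> id2" using order2_group[OF assms] .
  {
    assume "action_image G N \<subseteq> SL_of T"
    then have "det2 A = 1" using A(1) SL_of_iff by auto
    then have "A = neg2" using involution_SL A by blast
    then show "lattice_data 0 \<nu>_all" using data_neg A(1) by simp
  }
  {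
    assume "\<not> action_image G N \<subseteq> SL_of T"
    then have "det2 A \<noteq> 1" using A(1) SL_of_iff by auto
    moreover have "A \<in> mats" using A(1) by simp
    ultimately have "det2 A = - 1" using det_Mat(1) by blast
    then show "lattice_data 1 \<nu>_two" using data_reflection A by blast
  }
qed

lemma type_cyclic:
  assumes d: "d \<in> {3, 4, 6}" and "FG \<cong> integer_mod_group d"
  shows "lattice_data 0 (if chi d p = 1 then \<nu>_two else \<nu>_none)" "coprime p d"
proof -
  obtain \<theta> where \<theta>: "mat_group (integer_mod_group d) \<theta> mats" using mat_group_mats[OF assms(2)] .
  obtain A where A: "A \<in> mats" "mpow A d = id2" "\<And>i. 0 < i \<Longrightarrow> i < d \<Longrightarrow> mpow A i \<noteq> id2" "mats = mpow A ` {..<d}"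
    by (rule cyclic_mat_group[OF \<theta>]) (use d in auto)
  show "lattice_data 0 (if chi d p = 1 then \<nu>_two else \<nu>_none)"
    using data_cyclic[OF d A(1-3)] A(4) by blast
  show "coprime p d" using cyclic_order_facts(3)[OF d A(1-3)] .
qed

lemma type_dihedral:
  assumes d: "d \<in> {3, 4, 6}" and "FG \<cong> dihedral_group d"
  shows "lattice_data 0 \<nu>_none"
proof -
  obtain \<theta> where \<theta>: "mat_group (dihedral_group d) \<theta> mats" using mat_group_mats[OF assms(2)] .
  obtain A Q where "A \<in> mats" "Q \<in> mats" "mpow A d = id2" "\<And>i. 0 < i \<Longrightarrow> i < d \<Longrightarrow> mpow A i \<noteq> id2"
    "mm Q Q = id2" "mm A (mm Q A) = Q"
    by (rule dihedral_mat_group[OF \<theta>]) (use d in auto)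
  then show ?thesis using data_dihedral[OF d] by blast
qed

text \<open>The determinants of \<open>A\<close>, \<open>Q\<close> and their product multiply to 1,
  so one of these involutions has determinant 1 and is -1. The other two are reflections that differ
  by the sign, which is the form expected by \<open>data_klein\<close>.\<close>

lemma type_klein:
  assumes "FG \<cong> dihedral_group 2" shows "lattice_data 0 \<nu>_two"
proof -
  obtain \<theta> where \<theta>: "mat_group (dihedral_group 2) \<theta> mats" using mat_group_mats[OF assms] .
  obtain A Q where AQ: "A \<in> mats" "Q \<in> mats" "mpow A 2 = id2" "\<And>i. 0 < i \<Longrightarrow> i < 2 \<Longrightarrow> mpow A i \<noteq> id2"
    "mm Q Q = id2" "mm A (mm Q A) = Q" "\<And>i. Q \<noteq> mpow A i"
    "mats = mpow A ` {..<2} \<union> (\<lambda>i. mm (mpow A i) Q) ` {..<2}"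
    by (rule dihedral_mat_group[OF \<theta>]) auto
  have AA: "mm A A = id2" "A \<noteq> id2" using AQ(3) AQ(4)[of 1] by (auto simp: mpow_2)
  have QA: "Q \<noteq> id2" "Q \<noteq> A" using AQ(7)[of 0] AQ(7)[of 1] by auto
  have mats: "mats = {id2, A, Q, mm A Q}" using AQ(8) by (auto simp: less_2_image)
  define R where "R = mm A Q"
  have "mm A R = Q" using AA by (simp add: R_def mm_assoc[symmetric])
  have QR: "mm Q A = R" using AQ(6) AA by (metis R_def mm_assoc mm_id2(1))
  have "mm R Q = A" using AQ(5) by (simp add: R_def mm_assoc)
  have "mm Q R = A" using AQ(5) QR by (metis mm_assoc mm_id2(1))
  have RR: "mm R R = id2" using \<open>mm Q R = A\<close> AA by (simp add: R_def mm_assoc)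
  have "R \<noteq> id2" using \<open>mm R Q = A\<close> QA by auto
  have det: "det2 A = 1 \<or> det2 A = - 1" "det2 Q = 1 \<or> det2 Q = - 1"
    using det_Mat(1) AQ(1,2) by blast+
  have "det2 R = det2 A * det2 Q" by (simp add: R_def det2_mm)
  note invol = involution_SL[OF AA(1) _ AA(2)] involution_SL[OF AQ(5) _ QA(1)] involution_SL[OF RR _ \<open>R \<noteq> id2\<close>]
  have comm: "mm neg2 B = mm B neg2" for B by (cases B) (simp add: mm_def)
  show ?thesis
  proof (cases "det2 A = 1")
    case True
    then have A: "A = neg2" using invol by blast
    have "det2 Q \<noteq> 1" using invol(2) QA A by auto
    then have "det2 Q = - 1" using det by blast
    then show ?thesis using data_klein[of Q] mats A AQ(5) by (simp add: R_def)
  next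
    case False
    then have dA: "det2 A = - 1" using det by blast
    show ?thesis
    proof (cases "det2 Q = 1")
      case True
      then have Q: "Q = neg2" using invol by blast
      have "mats = {id2, neg2, A, mm neg2 A}" unfolding mats using Q comm by auto
      then show ?thesis using data_klein[OF _ dA AA(1)] by blast
    next
      case False
      then have "det2 R = 1" using det dA \<open>det2 R = _\<close> by simp
      then have R: "R = neg2" using invol by blast
      have "mats = {id2, neg2, A, mm neg2 A}" unfolding mats using R \<open>mm A R = Q\<close> comm R_def by auto
      then show ?thesis using data_klein[OF _ dA AA(1)] by blast
    qed
  qed
qed

end

section \<open>Summation of the zeta function\<close>

lemma has_sum_times:
  fixes f :: "'i \<Rightarrow> complex" and g :: "'j \<Rightarrow> complex"
  assumes f: "(\<lambda>i. norm (f i)) summable_on A" "(f has_sum x) A"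
    and g: "(\<lambda>j. norm (g j)) summable_on B" "(g has_sum y) B"
  shows "(\<lambda>z. norm (f (fst z) * g (snd z))) summable_on A \<times> B"
    "((\<lambda>z. f (fst z) * g (snd z)) has_sum x * y) (A \<times> B)"
proof -
  have 1: "(\<lambda>j. norm (f i * g j)) summable_on B" for i
    using summable_on_cmult_right[OF g(1), of "norm (f i)"] by (simp add: norm_mult)
  have 2: "infsum (\<lambda>j. norm (f i * g j)) B = norm (f i) * infsum (\<lambda>j. norm (g j)) B" for i
    using infsum_cmult_right[of "norm (f i)" "\<lambda>j. norm (g j)" B] g(1) by (simp add: norm_mult)
  have 3: "(\<lambda>i. norm (infsum (\<lambda>j. norm (f i * g j)) B)) summable_on A"
    unfolding 2 using summable_on_cmult_left[OF f(1), of "infsum (\<lambda>j. norm (g j)) B"]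
    by (simp add: abs_mult infsum_nonneg)
  show abs: "(\<lambda>z. norm (f (fst z) * g (snd z))) summable_on A \<times> B"
    unfolding Infinite_Sum.abs_summable_on_Sigma_iff fst_conv snd_conv using 1 3 by blast
  show "((\<lambda>z. f (fst z) * g (snd z)) has_sum x * y) (A \<times> B)"
    by (rule has_sum_SigmaI[where g = "\<lambda>i. f i * y"])
      (use has_sum_cmult_right[OF g(2)] has_sum_cmult_left[OF f(2)] abs_summable_summable[OF abs] in auto)
qed

lemma has_sum_geometric:
  fixes z :: complex
  assumes "norm z < 1"
  shows "(\<lambda>n. norm (z ^ n)) summable_on UNIV" "((\<lambda>n. z ^ n) has_sum inverse (1 - z)) UNIV"
proof -
  have s: "summable (\<lambda>n. norm (z ^ n))" using assms by (simp add: norm_power summable_geometric)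
  show "((\<lambda>n. z ^ n) has_sum inverse (1 - z)) UNIV"
    using norm_summable_imp_has_sum[OF s] geometric_sums[OF assms] by (simp add: inverse_eq_divide)
  show "(\<lambda>n. norm (z ^ n)) summable_on UNIV"
    by (rule summable_nonneg_imp_summable_on[OF s]) simp
qed

text \<open>The lattice counts are geometric from index 1 on; index 0, with a single lattice, does
  not fit the pattern and is split off.\<close>

lemma has_sum_geometric_tail:
  fixes z C :: complex
  assumes z: "norm z < 1" and f: "f 0 = 1" "\<And>n. n > 0 \<Longrightarrow> f n = C * z ^ n"
  shows "(\<lambda>n. norm (f n)) summable_on UNIV" "(f has_sum 1 + C * z / (1 - z)) UNIV"
proof -
  have s: "((\<lambda>n. C * z ^ n) has_sum C * (z / (1 - z))) {1..}"
    by (rule has_sum_cmult_right[OF has_sum_geometric_from_1[OF z]])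
  have "(f has_sum C * (z / (1 - z))) {1..}"
    using s by (subst has_sum_cong[of _ _ "\<lambda>n. C * z ^ n"]) (use f in auto)
  moreover have "(f has_sum 1) {0}" using has_sum_finite[of "{0}" f] f by simp
  ultimately have "(f has_sum 1 + C * (z / (1 - z))) ({0} \<union> {1..})"
    by (intro has_sum_Un_disjoint) auto
  moreover have U: "{0} \<union> {1..} = (UNIV :: nat set)" by auto
  ultimately show "(f has_sum 1 + C * z / (1 - z)) UNIV" by simp
  have "(\<lambda>n. norm C * norm (z ^ n)) summable_on {1..}"
    by (rule summable_on_cmult_right) (rule summable_on_subset[OF has_sum_geometric(1)[OF z]], simp)
  then have "(\<lambda>n. norm (f n)) summable_on {1..}"
    by (subst summable_on_cong[of _ _ "\<lambda>n. norm C * norm (z ^ n)"]) (use f in \<open>auto simp: norm_mult\<close>)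
  then have "(\<lambda>n. norm (f n)) summable_on {0} \<union> {1..}"
    by (intro summable_on_Un_disjoint) auto
  then show "(\<lambda>n. norm (f n)) summable_on UNIV" unfolding U .
qed

text \<open>The region \<open>b \<le> K + e\<close> splits into \<open>b < K\<close> with \<open>e\<close> free, and the pairs
  \<open>(i + j, K + j)\<close> with \<open>i\<close> and \<open>j\<close> free.\<close>

lemma has_sum_staircase:
  fixes x y :: complex and K :: nat
  assumes x: "norm x < 1" and xy: "norm (x * y) < 1"
  defines "h \<equiv> \<lambda>(e, b). if b \<le> K + e then x ^ e * y ^ b else 0"
  shows "(\<lambda>z. norm (h z)) summable_on UNIV"
    "(h has_sum inverse (1 - x) * ((\<Sum>b<K. y ^ b) + y ^ K * inverse (1 - x * y))) UNIV"
proof -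
  let ?A = "(UNIV :: nat set) \<times> {..<K}" and ?\<phi> = "\<lambda>(i, j). (i + j, K + j) :: nat \<times> nat"
  note gx = has_sum_geometric[OF x] and gxy = has_sum_geometric[OF xy]
  have fin: "(\<lambda>b. norm (y ^ b)) summable_on {..<K}" "((\<lambda>b. y ^ b) has_sum (\<Sum>b<K. y ^ b)) {..<K}" by simp_all
  have tail: "(\<lambda>j. norm (y ^ K * (x * y) ^ j)) summable_on UNIV"
    "((\<lambda>j. y ^ K * (x * y) ^ j) has_sum y ^ K * inverse (1 - x * y)) UNIV"
    using summable_on_cmult_right[OF gxy(1), of "norm (y ^ K)"] has_sum_cmult_right[OF gxy(2)]
    by (simp_all add: norm_mult)
  have hA: "h z = x ^ fst z * y ^ snd z" if "z \<in> ?A" for z using that by (auto simp: h_def)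
  have h\<phi>: "h (?\<phi> z) = x ^ fst z * (y ^ K * (x * y) ^ snd z)" for z
    by (simp add: h_def split_beta power_add power_mult_distrib)
  have inj: "inj ?\<phi>" by (auto simp: inj_def)
  note p1 = has_sum_times[OF gx fin] and p2 = has_sum_times[OF gx tail]
  have A: "(\<lambda>z. norm (h z)) summable_on ?A" "(h has_sum inverse (1 - x) * (\<Sum>b<K. y ^ b)) ?A"
    using p1 hA by (auto cong: summable_on_cong has_sum_cong)
  have B: "(\<lambda>z. norm (h z)) summable_on range ?\<phi>" "(h has_sum inverse (1 - x) * (y ^ K * inverse (1 - x * y))) (range ?\<phi>)"
    unfolding summable_on_reindex[OF inj] has_sum_reindex[OF inj] comp_def h\<phi> using p2 by simp_all
  have disj: "?A \<inter> range ?\<phi> = {}" by auto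
  have zero: "h z = 0" if "z \<notin> ?A \<union> range ?\<phi>" for z
  proof (rule ccontr)
    obtain e b where z: "z = (e, b)" by (cases z)
    assume "h z \<noteq> 0"
    then have le: "b \<le> K + e" by (auto simp: h_def z split: if_splits)
    have "K \<le> b" using that z by auto
    then have "z = ?\<phi> (e - (b - K), b - K)" using le z by simp
    then show False using that by blast
  qed
  have "(h has_sum inverse (1 - x) * (\<Sum>b<K. y ^ b) + inverse (1 - x) * (y ^ K * inverse (1 - x * y)))
      (?A \<union> range ?\<phi>)"
    by (rule has_sum_Un_disjoint[OF A(2) B(2) disj])
  then show "(h has_sum inverse (1 - x) * ((\<Sum>b<K. y ^ b) + y ^ K * inverse (1 - x * y))) UNIV"
    unfolding distrib_left by (subst has_sum_cong_neutral[where g = h and T = "?A \<union> range ?\<phi>"]) (use zero in auto)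
  have "(\<lambda>z. norm (h z)) summable_on ?A \<union> range ?\<phi>"
    by (rule summable_on_Un_disjoint[OF A(1) B(1) disj])
  then show "(\<lambda>z. norm (h z)) summable_on UNIV"
    by (subst summable_on_cong_neutral[where g = "\<lambda>z. norm (h z)" and T = "?A \<union> range ?\<phi>"]) (use zero in auto)
qed

text \<open>All terms of a class agree, so the norms in a class sum to \<open>norm (W i)\<close>.
  Absolute summability over the classes then permits summation class by class.\<close>

lemma has_sum_disjoint_classes:
  fixes \<tau> :: "'b \<Rightarrow> complex" and w :: "'i \<Rightarrow> complex" and W :: "'i \<Rightarrow> complex"
  assumes disj: "\<And>i j B. B \<in> \<C> i \<Longrightarrow> B \<in> \<C> j \<Longrightarrow> i = j"
    and fin: "\<And>i. finite (\<C> i)" and \<tau>: "\<And>i B. B \<in> \<C> i \<Longrightarrow> \<tau> B = w i"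
    and W: "\<And>i. W i = of_nat (card (\<C> i)) * w i" and sum: "(\<lambda>i. norm (W i)) summable_on UNIV" "(W has_sum S) UNIV"
  shows "(\<tau> has_sum S) (\<Union>i. \<C> i)"
proof -
  have im: "(\<Union>i. \<C> i) = snd ` Sigma UNIV \<C>" by force
  have inj: "inj_on snd (Sigma UNIV \<C>)" using disj by (auto simp: inj_on_def)
  have s: "sum \<tau> (\<C> i) = W i" for i using \<tau> by (simp add: W)
  have n: "infsum (\<lambda>B. norm (\<tau> B)) (\<C> i) = norm (W i)" for i
    using \<tau> fin by (simp add: W norm_mult)
  have "(\<lambda>z. norm ((\<tau> \<circ> snd) z)) summable_on Sigma UNIV \<C>"
    unfolding Infinite_Sum.abs_summable_on_Sigma_iff
    using n sum(1) fin summable_on_cong[of UNIV "\<lambda>i. infsum (\<lambda>B. norm (\<tau> B)) (\<C> i)" "\<lambda>i. norm (W i)"]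
    by (simp del: infsum_finite)
  moreover have fs: "((\<lambda>B. (\<tau> \<circ> snd) (i, B)) has_sum W i) (\<C> i)" for i
    using has_sum_finiteI[OF fin s[symmetric]] by simp
  ultimately have "((\<tau> \<circ> snd) has_sum S) (Sigma UNIV \<C>)"
    using has_sum_SigmaI[OF fs sum(2)] abs_summable_summable by blast
  then show ?thesis unfolding im has_sum_reindex[OF inj] .
qed

context heis_ext_p
begin

text \<open>The class with exponents \<open>e\<close>, \<open>a\<close>, \<open>b\<close>
  contributes \<open>\<nu> a * p ^ (r * b) * X ^ (2 * e + a + b)\<close>. This separates into the
  series in \<open>a\<close> and a staircase sum in \<open>X ^ 2\<close> and
  \<open>Y\<close>.\<close>

lemma zeta_has_sum:
  fixes s :: complex
  assumes data: "lattice_data r \<nu>"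
  defines "X \<equiv> of_nat p powr - s" and "\<mu> \<equiv> multiplicity p (nat \<bar>\<kappa>\<bar>)"
  defines "Y \<equiv> of_nat p ^ r * X"
  assumes V: "(\<lambda>a. norm (of_nat (\<nu> a) * X ^ a)) summable_on UNIV" "((\<lambda>a. of_nat (\<nu> a) * X ^ a) has_sum V) UNIV"
    and X: "norm X < 1" and XY: "norm (X\<^sup>2 * Y) < 1"
  shows "((\<lambda>B. of_nat (card (rcosets\<^bsub>GN\<^esub> B)) powr - s) has_sum
    V * (inverse (1 - X\<^sup>2) * ((\<Sum>b<\<mu>. Y ^ b) + Y ^ \<mu> * inverse (1 - X\<^sup>2 * Y)))) fam"
proof -
  let ?h = "\<lambda>(e, b). if b \<le> \<mu> + e then (X\<^sup>2) ^ e * Y ^ b else 0"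
  let ?W = "\<lambda>z. of_nat (\<nu> (fst z)) * X ^ fst z * ?h (snd z)"
  have X2: "norm (X\<^sup>2) < 1" using X by (simp add: norm_power power_less_one_iff)
  note h = has_sum_staircase[OF X2 XY, of \<mu>]
  have W: "(\<lambda>i. norm (?W i)) summable_on UNIV"
    "(?W has_sum V * (inverse (1 - X\<^sup>2) * ((\<Sum>b<\<mu>. Y ^ b) + Y ^ \<mu> * inverse (1 - X\<^sup>2 * Y)))) UNIV"
    using has_sum_times[OF V h] by simp_all
  let ?c = "\<lambda>(a, e, b). cls e a b" and ?w = "\<lambda>(a, e, b). X ^ (2 * e + a + b)"
  have c: "finite (cls e a b)" "card (cls e a b) = (if b \<le> \<mu> + e then \<nu> a * p ^ (r * b) else 0)" for e a b
    using card_cls[of e a b r] data unfolding lattice_data_def \<mu>_def by simp_all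
  have p0: "of_nat p \<noteq> (0 :: complex)" using prime_p by auto
  have pow: "of_nat (p ^ m) powr - s = X ^ m" for m
  proof -
    show ?thesis
    proof (induction m)
      case (Suc m)
      have "(of_real (real p) * of_real (real p ^ m)) powr - s = of_real (real p) powr - s * of_real (real p ^ m) powr (- s)"
        by (rule powr_times_real) auto
      then show ?case using Suc by (simp add: X_def)
    qed simp
  qed
  have "((\<lambda>B. of_nat (card (rcosets\<^bsub>GN\<^esub> B)) powr - s) has_sum
    V * (inverse (1 - X\<^sup>2) * ((\<Sum>b<\<mu>. Y ^ b) + Y ^ \<mu> * inverse (1 - X\<^sup>2 * Y)))) (\<Union>i. ?c i)"
  proof (rule has_sum_disjoint_classes[OF _ _ _ _ W, where w = ?w])
    show "i = j" if "B \<in> ?c i" "B \<in> ?c j" for i j B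
      using that cls_disjoint[of B] by (auto split: prod.splits)
    show "finite (?c i)" for i using c(1) by (auto split: prod.splits)
    show "of_nat (card (rcosets\<^bsub>GN\<^esub> B)) powr - s = ?w i" if "B \<in> ?c i" for i B
      using that cls_index pow by (auto split: prod.splits)
    show "?W i = of_nat (card (?c i)) * ?w i" for i
      by (auto simp: c(2) Y_def power_add power_mult power_mult_distrib split: prod.splits)
  qed
  moreover have "(\<Union>i. ?c i) = fam" unfolding family_eq by auto
  ultimately show ?thesis by simp
qed

end

section \<open>Local factors\<close>

lemma of_real_powr_eq_exp: "q > 0 \<Longrightarrow> of_real q powr w = exp (w * of_real (ln q))" for w :: complex
  by (simp add: powr_def Ln_of_real)

lemma of_real_powr_linear:
  fixes s :: complex
  assumes "q > 0"
  shows "of_real q powr (of_nat m - of_nat n * s) = of_real q ^ m * (of_real q powr - s) ^ n"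
proof -
  have "exp (of_real (ln q)) = (of_real q :: complex)" using assms by (metis exp_ln exp_of_real)
  then show ?thesis using assms
    by (simp add: of_real_powr_eq_exp left_diff_distrib exp_diff exp_minus exp_of_nat_mult power_inverse
        divide_inverse mult.assoc)
qed

lemma zeta_loc_linear:
  assumes "q > 0"
  shows "zeta_loc q (of_nat n * s - of_nat m) = inverse (1 - of_real q ^ m * (of_real q powr - s) ^ n)"
  using of_real_powr_linear[OF assms, of m n s] by (simp add: zeta_loc_def)

lemma recip_powr: "q > 0 \<Longrightarrow> of_real (1 / q) powr w = inverse (of_real q powr w)" for w :: complex
  by (subst (1 2) of_real_powr_eq_exp) (simp_all add: ln_div exp_minus)

text \<open>Since \<open>c * c = 1\<close>, replacing \<open>y\<close> by its inverse turns
  \<open>1 - c * y\<close> into itself times \<open>- c / y\<close>. At a pole both sides are 0 by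
  the convention for \<open>inverse 0\<close>, so the identity holds for every
  \<open>s\<close>.\<close>

lemma L_loc_recip:
  assumes "q > 0" and c: "c = 1 \<or> c = - 1"
  shows "L_loc c (1 / q) s = - c * of_real q powr (- s) * L_loc c q s"
proof -
  define y where "y = of_real q powr (- s)"
  have y: "y \<noteq> 0" using assms by (simp add: y_def)
  have "1 - c * inverse y = - c * (1 - c * y) / y" using y c by (auto simp: field_simps)
  then show ?thesis unfolding L_loc_def recip_powr[OF assms(1)] y_def[symmetric]
    using c by (auto simp: divide_inverse)
qed

lemma zeta_loc_recip: "q > 0 \<Longrightarrow> zeta_loc (1 / q) s = - (of_real q powr (- s)) * zeta_loc q s"
  using L_loc_recip[of q 1 s] by (simp add: L_loc_def zeta_loc_def)

lemma norm_nat_powr: "p > 0 \<Longrightarrow> norm (of_nat p powr - s) = real p powr - Re s" for s :: complex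
  using norm_powr_real_powr[of "of_nat p" "- s"] by simp

lemma powr_padic_norm:
  fixes w :: complex
  assumes "p > 0" "k \<noteq> 0"
  shows "of_real (padic_norm p k) powr w = (of_nat p powr - w) ^ multiplicity p k"
proof -
  have "of_real (padic_norm p k) powr w = exp (w * of_real (ln (padic_norm p k)))"
    using assms by (intro of_real_powr_eq_exp) (simp add: padic_norm_def)
  also have "ln (padic_norm p k) = - real (multiplicity p k) * ln (real p)"
    using assms by (simp add: padic_norm_def ln_inverse ln_realpow)
  also have "exp (w * of_real (- real (multiplicity p k) * ln (real p))) = exp (- w * of_real (ln (real p))) ^ multiplicity p k"
    by (simp add: exp_of_nat_mult[symmetric] mult_ac)
  also have "exp (- w * of_real (ln (real p))) = of_nat p powr - w"
    using of_real_powr_eq_exp[of "real p" "- w"] assms by simp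
  finally show ?thesis .
qed

context heis_ext_p
begin

abbreviation k where "k \<equiv> nat \<bar>\<kappa>\<bar>"

text \<open>The condition \<open>3 * Re s > r\<close> is convergence of the diagonal part of the
  staircase, with ratio \<open>p ^ r * X ^ 3\<close>. The powers of \<open>Y\<close> below the
  valuation of \<open>k\<close> form a finite sum, and their closed form divides by
  \<open>1 - Y\<close>.\<close>

lemma zeta_value:
  fixes s :: complex
  assumes data: "lattice_data r \<nu>"
  defines "X \<equiv> of_nat p powr - s"
  assumes V: "(\<lambda>a. norm (of_nat (\<nu> a) * X ^ a)) summable_on UNIV" "((\<lambda>a. of_nat (\<nu> a) * X ^ a) has_sum V) UNIV"
    and s: "Re s > 0" "3 * Re s > real r"
  shows "partial_zeta_converges Gp Np s"
    "of_nat p powr (- s + of_nat r) \<noteq> 1 \<Longrightarrow>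
      partial_zeta Gp Np s = V * inverse (1 - X\<^sup>2) * center_factor p k (of_nat r) s"
    "\<not> p dvd k \<Longrightarrow> partial_zeta Gp Np s = V * inverse (1 - X\<^sup>2) * zeta_loc p (3 * s - of_nat r)"
proof -
  define Y where "Y = of_nat p ^ r * X"
  define \<mu> where "\<mu> = multiplicity p k"
  have p1: "real p > 1" using prime_gt_1_nat[OF prime_p] by simp
  then have p0: "p > 0" by simp
  have nX: "norm X = real p powr - Re s" unfolding X_def by (rule norm_nat_powr[OF p0])
  have X: "norm X < 1" unfolding nX using s(1) p1 powr_less_cancel_iff[of "real p" "- Re s" 0] by simp
  have "norm (X\<^sup>2 * Y) = real p ^ r * norm X ^ 3" by (simp add: Y_def norm_mult norm_power power2_eq_square power3_eq_cube)
  also have "\<dots> = real p powr (real r - 3 * Re s)"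
    using p1 by (simp add: nX powr_realpow[symmetric] powr_powr powr_add[symmetric] mult.commute)
  also have "\<dots> < 1" using s(2) p1 powr_less_cancel_iff[of "real p" "real r - 3 * Re s" 0] by simp
  finally have XY: "norm (X\<^sup>2 * Y) < 1" .
  define S where "S = (\<Sum>b<\<mu>. Y ^ b) + Y ^ \<mu> * inverse (1 - X\<^sup>2 * Y)"
  have sum: "((\<lambda>B. of_nat (card (rcosets\<^bsub>GN\<^esub> B)) powr - s) has_sum V * (inverse (1 - X\<^sup>2) * S)) fam"
    unfolding S_def \<mu>_def Y_def X_def
    by (rule zeta_has_sum[OF data V[unfolded X_def] X[unfolded X_def] XY[unfolded X_def Y_def]])
  show "partial_zeta_converges Gp Np s"
    unfolding zeta_family(1) using sum by (rule has_sum_imp_summable)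
  have z: "partial_zeta Gp Np s = V * inverse (1 - X\<^sup>2) * S"
    unfolding zeta_family(2) using infsumI[OF sum] by (simp add: mult.assoc)
  have Y: "of_nat p powr (of_nat r - s) = Y"
    using of_real_powr_linear[of "real p" r 1 s] p0 by (simp add: Y_def X_def)
  have z3: "zeta_loc p (3 * s - of_nat r) = inverse (1 - X\<^sup>2 * Y)"
    using zeta_loc_linear[of "real p" 3 s r] p0
    by (simp add: Y_def X_def power2_eq_square power3_eq_cube mult_ac)
  show "partial_zeta Gp Np s = V * inverse (1 - X\<^sup>2) * center_factor p k (of_nat r) s"
    if "of_nat p powr (- s + of_nat r) \<noteq> 1"
  proof -
    have Y1: "of_nat p powr (- s + of_nat r) = Y" using Y by (simp add: add.commute)
    have "of_real (padic_norm p k) powr (s - of_nat r) = Y ^ \<mu>"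
      using powr_padic_norm[OF p0, of k "s - of_nat r"] kappa_nonzero Y by (simp add: \<mu>_def)
    then have "center_factor p k (of_nat r) s = S"
      unfolding center_factor_def z3 Y1 S_def using that Y1 by (simp add: sum_gp_strict)
    then show ?thesis using z by simp
  qed
  show "partial_zeta Gp Np s = V * inverse (1 - X\<^sup>2) * zeta_loc p (3 * s - of_nat r)" if "\<not> p dvd k"
  proof -
    \<comment> \<open>The finite sum is empty, so the denominator \<open>1 - Y\<close> does not
      arise and no value of \<open>s\<close> is excluded.\<close>
    have "\<mu> = 0" using that by (simp add: \<mu>_def not_dvd_imp_multiplicity_0)
    then show ?thesis unfolding z z3 S_def by simp
  qed
qed

lemma norm_powr_less_one: "Re s > 0 \<Longrightarrow> norm (of_nat p powr - s) < 1" for s :: complex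
  using prime_gt_1_nat[OF prime_p] powr_less_cancel_iff[of "real p" "- Re s" 0] by (simp add: norm_nat_powr)

text \<open>The points of the projective lines sum to \<open>(1 + X) / (1 - p * X)\<close>, and
  \<open>1 + X\<close> cancels against \<open>1 - X ^ 2\<close>. The ratio \<open>p * X\<close> is
  the reason for \<open>Re s > 1\<close>.\<close>

lemma zeta_all:
  assumes data: "lattice_data r \<nu>_all" and s: "Re s > 1" "r < 3"
  shows "partial_zeta_converges Gp Np s"
    "of_nat p powr (- s + of_nat r) \<noteq> 1 \<Longrightarrow>
      partial_zeta Gp Np s = zeta_loc p s * zeta_loc p (s - 1) * center_factor p k (of_nat r) s"
    "\<not> p dvd k \<Longrightarrow> partial_zeta Gp Np s = zeta_loc p s * zeta_loc p (s - 1) * zeta_loc p (3 * s - of_nat r)"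
proof -
  define X where "X = of_nat p powr - s"
  have p0: "p > 0" using prime_gt_0_nat[OF prime_p] .
  have X: "norm X < 1" unfolding X_def using s by (intro norm_powr_less_one) simp
  have pX: "of_nat p powr - (s - 1) = of_nat p * X"
    using of_real_powr_linear[of "real p" 1 1 s] p0 by (simp add: X_def)
  have pX1: "norm (of_nat p * X) < 1" unfolding pX[symmetric] using s by (intro norm_powr_less_one) simp
  have "of_nat (\<nu>_all a) * X ^ a = (1 + 1 / of_nat p) * (of_nat p * X) ^ a" if "a > 0" for a
    using that p0 by (cases a) (simp_all add: field_simps)
  then have V: "(\<lambda>a. norm (of_nat (\<nu>_all a) * X ^ a)) summable_on UNIV"
    "((\<lambda>a. of_nat (\<nu>_all a) * X ^ a) has_sum 1 + (1 + 1 / of_nat p) * (of_nat p * X) / (1 - of_nat p * X)) UNIV"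
    using has_sum_geometric_tail[OF pX1, of "\<lambda>a. of_nat (\<nu>_all a) * X ^ a" "1 + 1 / of_nat p"] by auto
  have nz: "1 - X \<noteq> 0" "1 + X \<noteq> 0" "1 - of_nat p * X \<noteq> 0"
    using X pX1 by (auto simp: add_eq_0_iff)
  have sq: "1 - X\<^sup>2 = (1 - X) * (1 + X)" by (simp add: power2_eq_square algebra_simps)
  have V': "(1 + (1 + 1 / of_nat p) * (of_nat p * X) / (1 - of_nat p * X)) * inverse (1 - X\<^sup>2) = zeta_loc p s * zeta_loc p (s - 1)"
  proof -
    have "1 + (1 + 1 / of_nat p) * (of_nat p * X) / (1 - of_nat p * X) = (1 + X) / (1 - of_nat p * X)"
      using nz p0 by (simp add: field_simps)
    then show ?thesis using nz pX unfolding sq zeta_loc_def by (simp add: X_def[symmetric] divide_inverse)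
  qed
  have "3 * Re s > real r" using s by linarith
  moreover have "Re s > 0" using s by simp
  ultimately show "partial_zeta_converges Gp Np s"
    "of_nat p powr (- s + of_nat r) \<noteq> 1 \<Longrightarrow>
      partial_zeta Gp Np s = zeta_loc p s * zeta_loc p (s - 1) * center_factor p k (of_nat r) s"
    "\<not> p dvd k \<Longrightarrow> partial_zeta Gp Np s = zeta_loc p s * zeta_loc p (s - 1) * zeta_loc p (3 * s - of_nat r)"
    using zeta_value[OF data V[unfolded X_def]] V'[unfolded X_def] by auto
qed

text \<open>Two lattices for each positive exponent sum to \<open>(1 + X) / (1 - X)\<close>; with
  \<open>1 - X ^ 2\<close> this leaves \<open>1 / (1 - X) ^ 2\<close>.\<close>

lemma zeta_two:
  assumes data: "lattice_data r \<nu>_two" and s: "Re s > 0" "3 * Re s > real r"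
  shows "partial_zeta_converges Gp Np s"
    "of_nat p powr (- s + of_nat r) \<noteq> 1 \<Longrightarrow>
      partial_zeta Gp Np s = (zeta_loc p s)\<^sup>2 * center_factor p k (of_nat r) s"
    "\<not> p dvd k \<Longrightarrow> partial_zeta Gp Np s = (zeta_loc p s)\<^sup>2 * zeta_loc p (3 * s - of_nat r)"
proof -
  define X where "X = of_nat p powr - s"
  have X: "norm X < 1" unfolding X_def using s by (intro norm_powr_less_one) simp
  have V: "(\<lambda>a. norm (of_nat (\<nu>_two a) * X ^ a)) summable_on UNIV"
    "((\<lambda>a. of_nat (\<nu>_two a) * X ^ a) has_sum 1 + 2 * X / (1 - X)) UNIV"
    using has_sum_geometric_tail[OF X, of "\<lambda>a. of_nat (\<nu>_two a) * X ^ a" 2] by auto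
  have nz: "1 - X \<noteq> 0" "1 + X \<noteq> 0" using X by (auto simp: add_eq_0_iff)
  have sq: "1 - X\<^sup>2 = (1 - X) * (1 + X)" by (simp add: power2_eq_square algebra_simps)
  have "1 + 2 * X / (1 - X) = (1 + X) / (1 - X)" using nz by (simp add: field_simps)
  then have V': "(1 + 2 * X / (1 - X)) * inverse (1 - X\<^sup>2) = (zeta_loc p s)\<^sup>2"
    using nz unfolding sq zeta_loc_def by (simp add: X_def[symmetric] divide_inverse power2_eq_square)
  show "partial_zeta_converges Gp Np s"
    "of_nat p powr (- s + of_nat r) \<noteq> 1 \<Longrightarrow>
      partial_zeta Gp Np s = (zeta_loc p s)\<^sup>2 * center_factor p k (of_nat r) s"
    "\<not> p dvd k \<Longrightarrow> partial_zeta Gp Np s = (zeta_loc p s)\<^sup>2 * zeta_loc p (3 * s - of_nat r)"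
    using zeta_value[OF data V[unfolded X_def] s] V'[unfolded X_def] by auto
qed

lemma zeta_none:
  assumes data: "lattice_data 0 \<nu>_none" and s: "Re s > 0"
  shows "partial_zeta_converges Gp Np s"
    "partial_zeta Gp Np s = zeta_loc p (2 * s) * center_factor p k 0 s"
    "\<not> p dvd k \<Longrightarrow> partial_zeta Gp Np s = zeta_loc p (2 * s) * zeta_loc p (3 * s)"
proof -
  define X where "X = of_nat p powr - s"
  have X: "norm X < 1" unfolding X_def using s by (intro norm_powr_less_one) simp
  have V: "(\<lambda>a. norm (of_nat (\<nu>_none a) * X ^ a)) summable_on UNIV"
    "((\<lambda>a. of_nat (\<nu>_none a) * X ^ a) has_sum 1) UNIV"
    using has_sum_geometric_tail[OF X, of "\<lambda>a. of_nat (\<nu>_none a) * X ^ a" 0] by auto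
  have V': "inverse (1 - X\<^sup>2) = zeta_loc p (2 * s)"
    using zeta_loc_linear[of "real p" 2 s 0] prime_gt_0_nat[OF prime_p] by (simp add: X_def)
  have ne: "of_nat p powr (- s + of_nat 0) \<noteq> (1 :: complex)" using X by (auto simp: X_def)
  have "real 0 < 3 * Re s" using s by simp
  note zeta_value[OF data V[unfolded X_def] s this]
  then show "partial_zeta_converges Gp Np s"
    "partial_zeta Gp Np s = zeta_loc p (2 * s) * center_factor p k 0 s"
    "\<not> p dvd k \<Longrightarrow> partial_zeta Gp Np s = zeta_loc p (2 * s) * zeta_loc p (3 * s)"
    using V'[unfolded X_def] ne by auto
qed

lemma powr_ne_one: "Re s > 0 \<Longrightarrow> of_nat p powr - s \<noteq> (1 :: complex)" for s :: complex
  using norm_powr_less_one[of s] by auto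

text \<open>In the split case the L-factor is a second zeta factor. In the inert case
  \<open>(1 - X) * (1 + X) = 1 - X ^ 2\<close>, so the product is
  \<open>zeta_loc p (2 * s)\<close>.\<close>

lemma zeta_cyclic:
  assumes d: "d \<in> {3, 4, 6}" "FG \<cong> integer_mod_group d" and s: "Re s > 0"
  shows "partial_zeta_converges Gp Np s"
    "partial_zeta Gp Np s = zeta_loc p s * L_loc (chi d p) p s * center_factor p k 0 s"
    "\<not> p dvd k \<Longrightarrow> partial_zeta Gp Np s = zeta_loc p s * L_loc (chi d p) p s * zeta_loc p (3 * s)"
proof -
  note ty = type_cyclic[OF d]
  have chi: "chi d p = 1 \<or> chi d p = - 1" using chi_cases[OF prime_p d(1) ty(2)] by blast
  have "partial_zeta_converges Gp Np s \<and>
    partial_zeta Gp Np s = zeta_loc p s * L_loc (chi d p) p s * center_factor p k 0 s \<and>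
    (\<not> p dvd k \<longrightarrow> partial_zeta Gp Np s = zeta_loc p s * L_loc (chi d p) p s * zeta_loc p (3 * s))"
  proof (cases "chi d p = 1")
    case True
    then have L: "L_loc (chi d p) p s = zeta_loc p s" by (simp add: L_loc_def zeta_loc_def)
    have data: "lattice_data 0 \<nu>_two" using ty(1) True by simp
    have "real 0 < 3 * Re s" using s by simp
    from zeta_two[OF data s this] show ?thesis unfolding L using powr_ne_one[OF s] by (auto simp: power2_eq_square)
  next
    case False
    have data: "lattice_data 0 \<nu>_none" using ty(1) False by simp
    have c: "chi d p = - 1" using chi False by blast
    define X where "X = of_nat p powr - s"
    have sq: "1 - X\<^sup>2 = (1 - X) * (1 + X)" by (simp add: power2_eq_square algebra_simps)
    have "zeta_loc p (2 * s) = inverse (1 - X\<^sup>2)"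
      using zeta_loc_linear[of "real p" 2 s 0] prime_gt_0_nat[OF prime_p] by (simp add: X_def)
    then have L: "zeta_loc p s * L_loc (chi d p) p s = zeta_loc p (2 * s)"
      unfolding c sq by (simp add: L_loc_def zeta_loc_def X_def)
    show ?thesis unfolding L using zeta_none[OF data s] by blast
  qed
  then show "partial_zeta_converges Gp Np s"
    "partial_zeta Gp Np s = zeta_loc p s * L_loc (chi d p) p s * center_factor p k 0 s"
    "\<not> p dvd k \<Longrightarrow> partial_zeta Gp Np s = zeta_loc p s * L_loc (chi d p) p s * zeta_loc p (3 * s)"
    by blast+
qed

end

section \<open>Functional equations and the final assembly\<close>

lemma of_real_powr_add:
  fixes v w :: complex
  assumes "q > 0"
  shows "of_real q powr v * of_real q powr w = of_real q powr (v + w)"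
  using assms by (simp add: of_real_powr_eq_exp distrib_right exp_add)

lemma local_functional_equationI:
  assumes "\<And>s. Re s > \<sigma> \<Longrightarrow> f s = E (real p) s" "\<And>s. E (1 / real p) s = c s * E (real p) s"
  shows "local_functional_equation p f \<sigma> E c"
  using assms by (simp add: local_functional_equation_def)

text \<open>Each of the three factors contributes a sign and \<open>q powr - s\<close> at its own
  argument, and the middle one also the character value; in all applications the arguments add up to
  \<open>5 * s\<close> minus a constant.\<close>

lemma zeta_product_recip:
  fixes s1 s2 s3 :: complex
  assumes q: "q > 0" and c: "c = 1 \<or> c = - 1" and w: "w = - (s1 + s2 + s3)"
  shows "zeta_loc (1 / q) s1 * L_loc c (1 / q) s2 * zeta_loc (1 / q) s3 =
    (- 1)^3 * c * of_real q powr w * (zeta_loc q s1 * L_loc c q s2 * zeta_loc q s3)"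
proof -
  have "of_real q powr w = of_real q powr - s1 * of_real q powr - s2 * of_real q powr - s3"
    using q by (simp add: w of_real_powr_add)
  then show ?thesis unfolding zeta_loc_recip[OF q] L_loc_recip[OF q c] by (simp add: mult_ac)
qed

lemma zeta_loc_eq_L_loc: "zeta_loc q s = L_loc 1 q s"
  by (simp add: zeta_loc_def L_loc_def)

theorem corollary2p18:
  fixes G :: "('a, 'm) monoid_scheme" and N :: "'a set" and p k :: nat
    and T :: "'a set monoid" and F :: "('a set \<Rightarrow> 'a set) set"
    and FG :: "('a set \<Rightarrow> 'a set) monoid"
    and Gp :: "('a set \<Rightarrow> 'a set) monoid" and Np :: "('a set \<Rightarrow> 'a set) set"
    and \<zeta> :: "complex \<Rightarrow> complex" and conv :: "complex \<Rightarrow> bool"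
  assumes "group G" and "finitely_generated G" and "virtually_nilpotent G"
    and "N \<lhd> G" and "finite (rcosets\<^bsub>G\<^esub> N)"
    and "finitely_generated (G\<lparr>carrier := N\<rparr>)"
    and "torsion_free (G\<lparr>carrier := N\<rparr>)"
    and "has_nilpotency_class (G\<lparr>carrier := N\<rparr>) 2"
    and "has_hirsch_length (G\<lparr>carrier := N\<rparr>) 3"
    and "T = quot_by_center G N"
    and "F = action_image G N"
    and "FG = (AutoGroup T)\<lparr>carrier := F\<rparr>"
    and "k = card (rcosets\<^bsub>G\<lparr>carrier := center_of (G\<lparr>carrier := N\<rparr>)\<rparr>\<^esub> (derived G N))"
    and "prime p" and "\<not> p dvd order (G Mod N)"
    and "Gp = rel_completion G N p"
    and "Np = completion_closure G N p"
    and "\<zeta> = partial_zeta Gp Np"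
    and "conv = partial_zeta_converges Gp Np"
  shows
    "(F \<subseteq> SL_of T \<longrightarrow>
      (FG \<cong> integer_mod_group 1 \<longrightarrow>
        (\<forall>s. Re s > 1 \<longrightarrow> conv s \<and>
          (of_nat p powr (- s + 2) \<noteq> 1 \<longrightarrow>
            \<zeta> s = zeta_loc p s * zeta_loc p (s - 1) * center_factor p k 2 s) \<and>
          (\<not> p dvd k \<longrightarrow> \<zeta> s = zeta_loc p s * zeta_loc p (s - 1) * zeta_loc p (3 * s - 2)))) \<and>
      (FG \<cong> integer_mod_group 2 \<longrightarrow>
        (\<forall>s. Re s > 1 \<longrightarrow> conv s \<and>
          \<zeta> s = zeta_loc p s * zeta_loc p (s - 1) * center_factor p k 0 s \<and>
          (\<not> p dvd k \<longrightarrow> \<zeta> s = zeta_loc p s * zeta_loc p (s - 1) * zeta_loc p (3 * s)))) \<and>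
      (\<forall>d\<in>{3, 4, 6}. FG \<cong> integer_mod_group d \<longrightarrow>
        (\<forall>s. Re s > 0 \<longrightarrow> conv s \<and>
          \<zeta> s = zeta_loc p s * L_loc (chi d p) p s * center_factor p k 0 s \<and>
          (\<not> p dvd k \<longrightarrow> \<zeta> s = zeta_loc p s * L_loc (chi d p) p s * zeta_loc p (3 * s))))) \<and>
    (\<not> F \<subseteq> SL_of T \<longrightarrow>
      (FG \<cong> dihedral_group 1 \<longrightarrow>
        (\<forall>s. Re s > 1 / 3 \<longrightarrow> conv s \<and>
          (of_nat p powr (- s + 1) \<noteq> 1 \<longrightarrow>
            \<zeta> s = (zeta_loc p s)^2 * center_factor p k 1 s) \<and>
          (\<not> p dvd k \<longrightarrow> \<zeta> s = (zeta_loc p s)^2 * zeta_loc p (3 * s - 1)))) \<and>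
      (FG \<cong> dihedral_group 2 \<longrightarrow>
        (\<forall>s. Re s > 0 \<longrightarrow> conv s \<and>
          \<zeta> s = (zeta_loc p s)^2 * center_factor p k 0 s \<and>
          (\<not> p dvd k \<longrightarrow> \<zeta> s = (zeta_loc p s)^2 * zeta_loc p (3 * s)))) \<and>
      (\<forall>d\<in>{3, 4, 6}. FG \<cong> dihedral_group d \<longrightarrow>
        (\<forall>s. Re s > 0 \<longrightarrow> conv s \<and>
          \<zeta> s = zeta_loc p (2 * s) * center_factor p k 0 s \<and>
          (\<not> p dvd k \<longrightarrow> \<zeta> s = zeta_loc p (2 * s) * zeta_loc p (3 * s))))) \<and>
    (\<not> p dvd order (G Mod N) * k \<longrightarrow>
      (FG \<cong> integer_mod_group 1 \<longrightarrow>
        local_functional_equation p \<zeta> 1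
          (\<lambda>q s. zeta_loc q s * zeta_loc q (s - 1) * zeta_loc q (3 * s - 2))
          (\<lambda>s. (- 1)^3 * of_nat p powr (- 5 * s + 3))) \<and>
      (FG \<cong> integer_mod_group 2 \<and> F \<subseteq> SL_of T \<longrightarrow>
        local_functional_equation p \<zeta> 1
          (\<lambda>q s. zeta_loc q s * zeta_loc q (s - 1) * zeta_loc q (3 * s))
          (\<lambda>s. (- 1)^3 * of_nat p powr (- 5 * s + 1))) \<and>
      (FG \<cong> integer_mod_group 2 \<and> \<not> F \<subseteq> SL_of T \<longrightarrow>
        local_functional_equation p \<zeta> (1 / 3)
          (\<lambda>q s. (zeta_loc q s)^2 * zeta_loc q (3 * s - 1))
          (\<lambda>s. (- 1)^3 * of_nat p powr (- 5 * s + 1))) \<and>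
      (\<forall>d\<in>{3, 4, 6}. FG \<cong> integer_mod_group d \<longrightarrow>
        local_functional_equation p \<zeta> 0
          (\<lambda>q s. zeta_loc q s * L_loc (chi d p) q s * zeta_loc q (3 * s))
          (\<lambda>s. (- 1)^3 * chi d p * of_nat p powr (- 5 * s))) \<and>
      (FG \<cong> dihedral_group 2 \<longrightarrow>
        local_functional_equation p \<zeta> 0
          (\<lambda>q s. (zeta_loc q s)^2 * zeta_loc q (3 * s))
          (\<lambda>s. (- 1)^3 * of_nat p powr (- 5 * s))) \<and>
      (\<forall>d\<in>{3, 4, 6}. FG \<cong> dihedral_group d \<longrightarrow>
        local_functional_equation p \<zeta> 0
          (\<lambda>q s. zeta_loc q (2 * s) * zeta_loc q (3 * s))
          (\<lambda>s. of_nat p powr (- 5 * s))))"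
proof -
  interpret G: group G by fact
  have sN: "subgroup N G" using \<open>N \<lhd> G\<close> by (rule normal_imp_subgroup)
  interpret GN: group "G\<lparr>carrier := N\<rparr>" using G.subgroup_imp_group[OF sN] .
  let ?M = "G\<lparr>carrier := N\<rparr>"
  obtain u v c :: "'a \<Rightarrow> int" and \<kappa> :: int where
    "\<And>n m. \<lbrakk>n \<in> carrier ?M; m \<in> carrier ?M; u n = u m; v n = v m; c n = c m\<rbrakk> \<Longrightarrow> n = m"
    "\<And>i j l. \<exists>n\<in>carrier ?M. u n = i \<and> v n = j \<and> c n = l"
    "\<And>n m. \<lbrakk>n \<in> carrier ?M; m \<in> carrier ?M\<rbrakk> \<Longrightarrow> u (n \<otimes>\<^bsub>?M\<^esub> m) = u n + u m"
    "\<And>n m. \<lbrakk>n \<in> carrier ?M; m \<in> carrier ?M\<rbrakk> \<Longrightarrow> v (n \<otimes>\<^bsub>?M\<^esub> m) = v n + v m"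
    "\<And>n m. \<lbrakk>n \<in> carrier ?M; m \<in> carrier ?M\<rbrakk> \<Longrightarrow> c (n \<otimes>\<^bsub>?M\<^esub> m) = c n + c m + \<kappa> * v n * u m"
    "\<kappa> \<noteq> 0"
    by (rule GN.heisenberg_coordinates[OF assms(7-9)]) blast
  note co = this[simplified]
  interpret H: heis_ext_p G N u v c \<kappa> p
    by (intro heis_ext_p.intro heis_ext.intro heis_ext_axioms.intro heis_ext_p_axioms.intro)
      (fact assms co)+
  note T = \<open>T = _\<close> and F = \<open>F = _\<close> and FG = \<open>FG = _\<close>[unfolded T F]
  have k: "k = H.k" using H.card_center_mod_derived assms(13) by simp
  note zc = \<open>\<zeta> = _\<close>[unfolded \<open>Gp = _\<close> \<open>Np = _\<close>] \<open>conv = _\<close>[unfolded \<open>Gp = _\<close> \<open>Np = _\<close>]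
  have p0: "real p > 0" using prime_gt_0_nat[OF \<open>prime p\<close>] by simp
  \<comment> \<open>For \<open>r = 0\<close> the zeros of the denominator of
    \<open>center_factor\<close> lie on \<open>Re s = 0\<close>, outside the region of
    convergence.\<close>
  note ne = H.powr_ne_one
  have C1: "conv s \<and>
      (of_nat p powr (- s + 2) \<noteq> 1 \<longrightarrow> \<zeta> s = zeta_loc p s * zeta_loc p (s - 1) * center_factor p k 2 s) \<and>
      (\<not> p dvd k \<longrightarrow> \<zeta> s = zeta_loc p s * zeta_loc p (s - 1) * zeta_loc p (3 * s - 2))"
    if "FG \<cong> integer_mod_group 1" "Re s > 1" for s
    using H.zeta_all[of 2 s] H.type_C1(1) that unfolding FG k zc by simp
  have C2: "conv s \<and>
      \<zeta> s = zeta_loc p s * zeta_loc p (s - 1) * center_factor p k 0 s \<and>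
      (\<not> p dvd k \<longrightarrow> \<zeta> s = zeta_loc p s * zeta_loc p (s - 1) * zeta_loc p (3 * s))"
    if "F \<subseteq> SL_of T" "FG \<cong> integer_mod_group 2" "Re s > 1" for s
    using H.zeta_all[of 0 s] H.type_order2(1) ne[of s] that unfolding T F FG k zc by simp
  have Cd: "conv s \<and>
      \<zeta> s = zeta_loc p s * L_loc (chi d p) p s * center_factor p k 0 s \<and>
      (\<not> p dvd k \<longrightarrow> \<zeta> s = zeta_loc p s * L_loc (chi d p) p s * zeta_loc p (3 * s))"
    if "d \<in> {3, 4, 6}" "FG \<cong> integer_mod_group d" "Re s > 0" for d s
    using H.zeta_cyclic[of d s] that unfolding FG k zc by blast
  have D1: "conv s \<and>
      (of_nat p powr (- s + 1) \<noteq> 1 \<longrightarrow> \<zeta> s = (zeta_loc p s)^2 * center_factor p k 1 s) \<and>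
      (\<not> p dvd k \<longrightarrow> \<zeta> s = (zeta_loc p s)^2 * zeta_loc p (3 * s - 1))"
    if "\<not> F \<subseteq> SL_of T" "FG \<cong> integer_mod_group 2 \<or> FG \<cong> dihedral_group 1" "Re s > 1 / 3" for s
    using H.zeta_two[of 1 s] H.type_order2(2) that unfolding T F FG k zc by simp
  have D2: "conv s \<and>
      \<zeta> s = (zeta_loc p s)^2 * center_factor p k 0 s \<and>
      (\<not> p dvd k \<longrightarrow> \<zeta> s = (zeta_loc p s)^2 * zeta_loc p (3 * s))"
    if "FG \<cong> dihedral_group 2" "Re s > 0" for s
    using H.zeta_two[of 0 s] H.type_klein ne[of s] that unfolding FG k zc by simp
  have Dd: "conv s \<and>
      \<zeta> s = zeta_loc p (2 * s) * center_factor p k 0 s \<and>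
      (\<not> p dvd k \<longrightarrow> \<zeta> s = zeta_loc p (2 * s) * zeta_loc p (3 * s))"
    if "d \<in> {3, 4, 6}" "FG \<cong> dihedral_group d" "Re s > 0" for d s
    using H.zeta_none[of s] H.type_dihedral[of d] that unfolding FG k zc by blast
  have fC1: "local_functional_equation p \<zeta> 1
      (\<lambda>q s. zeta_loc q s * zeta_loc q (s - 1) * zeta_loc q (3 * s - 2))
      (\<lambda>s. (- 1)^3 * of_nat p powr (- 5 * s + 3))"
    if "FG \<cong> integer_mod_group 1" "\<not> p dvd k"
    by (rule local_functional_equationI, use C1 that in blast)
      (use zeta_product_recip[OF p0, of 1 "- 5 * s + 3" s "s - 1" "3 * s - 2" for s]
        in \<open>simp_all flip: zeta_loc_eq_L_loc\<close>)
  have fC2: "local_functional_equation p \<zeta> 1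
      (\<lambda>q s. zeta_loc q s * zeta_loc q (s - 1) * zeta_loc q (3 * s))
      (\<lambda>s. (- 1)^3 * of_nat p powr (- 5 * s + 1))"
    if "FG \<cong> integer_mod_group 2 \<and> F \<subseteq> SL_of T" "\<not> p dvd k"
    by (rule local_functional_equationI, use C2 that in blast)
      (use zeta_product_recip[OF p0, of 1 "- 5 * s + 1" s "s - 1" "3 * s" for s]
        in \<open>simp_all flip: zeta_loc_eq_L_loc\<close>)
  have fD1: "local_functional_equation p \<zeta> (1 / 3)
      (\<lambda>q s. (zeta_loc q s)^2 * zeta_loc q (3 * s - 1))
      (\<lambda>s. (- 1)^3 * of_nat p powr (- 5 * s + 1))"
    if "FG \<cong> integer_mod_group 2 \<and> \<not> F \<subseteq> SL_of T" "\<not> p dvd k"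
    by (rule local_functional_equationI, use D1 that in blast)
      (use zeta_product_recip[OF p0, of 1 "- 5 * s + 1" s s "3 * s - 1" for s]
        in \<open>simp_all add: power2_eq_square flip: zeta_loc_eq_L_loc\<close>)
  have fCd: "local_functional_equation p \<zeta> 0
      (\<lambda>q s. zeta_loc q s * L_loc (chi d p) q s * zeta_loc q (3 * s))
      (\<lambda>s. (- 1)^3 * chi d p * of_nat p powr (- 5 * s))"
    if d: "d \<in> {3, 4, 6}" "FG \<cong> integer_mod_group d" and "\<not> p dvd k" for d
  proof -
    have "coprime p d" using H.type_cyclic(2)[OF d(1)] d(2) unfolding FG by blast
    then have "chi d p = 1 \<or> chi d p = - 1" using chi_cases[OF \<open>prime p\<close> d(1)] by blast
    from zeta_product_recip[OF p0 this, of "- 5 * s" s s "3 * s" for s] show ?thesis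
      by (intro local_functional_equationI, use Cd[OF d] that(3) in blast) simp
  qed
  have fD2: "local_functional_equation p \<zeta> 0
      (\<lambda>q s. (zeta_loc q s)^2 * zeta_loc q (3 * s))
      (\<lambda>s. (- 1)^3 * of_nat p powr (- 5 * s))"
    if "FG \<cong> dihedral_group 2" "\<not> p dvd k"
    by (rule local_functional_equationI, use D2 that in blast)
      (use zeta_product_recip[OF p0, of 1 "- 5 * s" s s "3 * s" for s]
        in \<open>simp_all add: power2_eq_square flip: zeta_loc_eq_L_loc\<close>)
  have fDd: "local_functional_equation p \<zeta> 0
      (\<lambda>q s. zeta_loc q (2 * s) * zeta_loc q (3 * s))
      (\<lambda>s. of_nat p powr (- 5 * s))"
    if d: "d \<in> {3, 4, 6}" "FG \<cong> dihedral_group d" and "\<not> p dvd k" for d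
  proof -
    \<comment> \<open>Two factors give two signs, which cancel.\<close>
    have "zeta_loc (1 / p) (2 * s) * zeta_loc (1 / p) (3 * s)
      = of_nat p powr (- 5 * s) * (zeta_loc p (2 * s) * zeta_loc p (3 * s))" for s
      using of_real_powr_add[OF p0, of "- (2 * s)" "- (3 * s)"] by (simp add: zeta_loc_recip[OF p0] mult_ac)
    then show ?thesis
      by (intro local_functional_equationI, use Dd[OF d] that(3) in blast) simp
  qed
  have dvd: "\<not> p dvd k" if "\<not> p dvd order (G Mod N) * k" using that by auto
  note cases = C1[THEN conjunct1] C2[THEN conjunct1] Cd[THEN conjunct1]
    D1[THEN conjunct1] D2[THEN conjunct1] Dd[THEN conjunct1]
    C1[THEN conjunct2, THEN conjunct1, THEN mp] D1[THEN conjunct2, THEN conjunct1, THEN mp] C2[THEN conjunct2, THEN conjunct1]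
    Cd[THEN conjunct2, THEN conjunct1] D2[THEN conjunct2, THEN conjunct1] Dd[THEN conjunct2, THEN conjunct1]
    C1[THEN conjunct2, THEN conjunct2, THEN mp] C2[THEN conjunct2, THEN conjunct2, THEN mp] Cd[THEN conjunct2, THEN conjunct2, THEN mp]
    D1[THEN conjunct2, THEN conjunct2, THEN mp] D2[THEN conjunct2, THEN conjunct2, THEN mp] Dd[THEN conjunct2, THEN conjunct2, THEN mp]
    fC1 fC2 fD1 fCd fD2 fDd
  show ?thesis
    by (intro conjI impI allI ballI) (rule cases; (assumption | rule disjI2, assumption | rule dvd, assumption))+
qed

end
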